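(* The set $\Psi^{2D}$ normalized with respect to the $H^1$-seminorm, i.e. the set $\left\{ g/|g|_{H^1} : g\in\Psi^{2D}\right\}$ with $|g|_{H^1}=\left(\int_{(0,1)^2}|\nabla g|^2\right)^{1/2}$, is a Riesz basis of $H_0^1\left((0,1)^2\right)$.
   Context: Scaling functions: $\phi(x)=\frac{x^2}{2}$ on $[0,1]$, $-x^2+3x-\frac32$ on $[1,2]$, $\frac{x^2}{2}-3x+\frac92$ on $[2,3]$, and $0$ otherwise. $\phi_b(x)=-\frac{9x^2}{4}+3x$ on $[0,1]$, $\frac{3x^2}{4}-3x+3$ on $[1,2]$, and $0$ otherwise. Wavelets: $\psi(x)=-\frac12\phi(2x-1)+\frac12\phi(2x-2)$ and $\psi_b(x)=-\frac12\phi_b(2x)+\frac12\phi(2x)$. For $j\ge 2$ let $\mathcal I_j=\{k\in\mathbb Z: 1\le k\le 2^j\}$, and for $x\in[0,1]$ put $\phi_{j,k}(x)=2^{j/2}\phi(2^jx-k+2)$ for $k=2,\dots,2^j-1$, $\phi_{j,1}(x)=2^{j/2}\phi_b(2^jx)$, $\phi_{j,2^j}(x)=2^{j/2}\phi_b(2^j(1-x))$; $\psi_{j,k}(x)=2^{j/2}\psi(2^jx-k+2)$ for $k=2,\dots,2^j-1$, $\psi_{j,1}(x)=2^{j/2}\psi_b(2^jx)$, $\psi_{j,2^j}(x)=-2^{j/2}\psi_b(2^j(1-x))$. Two-dimensional system: for $\mathbf k=(k_1,k_2)\in\mathcal I_j\times\mathcal I_j$ let $\phi^2_{j,\mathbf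 k}(x_1,x_2)=\phi_{j,k_1}(x_1)\phi_{j,k_2}(x_2)$. For $\mathbf e=(e_1,e_2)\in E^2=\{0,1\}^2\setminus\{(0,0)\}$ let $\psi^2_{j,\mathbf e,\mathbf k}(x_1,x_2)=\psi_{j,e_1,k_1}(x_1)\psi_{j,e_2,k_2}(x_2)$, where $\psi_{j,1,k}=\psi_{j,k}$ and $\psi_{j,0,k}=\phi_{j,k}$. Then $$\Psi^{2D}=\{\phi^2_{2,\mathbf k}:\mathbf k\in\mathcal I_2\times\mathcal I_2\}\cup\{\psi^2_{j,\mathbf e,\mathbf k}: j\ge2,\ \mathbf e\in E^2,\ \mathbf k\in\mathcal I_j\times\mathcal I_j\}.$$ A countable family $\{\psi_\lambda\}_{\lambda\in\mathcal J}$ in a Hilbert space $H$ is a Riesz basis of $H$ if the closure of its span is $H$ and there are constants $c,C\in(0,\infty)$ such that $c\|\mathbf b\|_2\le\left\|\sum_{\lambda}b_\lambda\psi_\lambda\right\|_H\le C\|\mathbf b\|_2$ for all $\mathbf b=\{b_\lambda\}\in l^2(\mathcal J)$, where $\|\mathbf b\|_2=\left(\sum_\lambda b_\lambda^2\right)^{1/2}$. All function spaces are real. *)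

theory Defs
  imports "HOL-Analysis.Analysis"
begin

section \<open>The Sobolev spaces \<open>H\<^sup>1(\<Omega>)\<close> and \<open>H\<^sub>0\<^sup>1(\<Omega>)\<close>\<close>

text \<open>
  Elements of function spaces over \<open>\<Omega>\<close> are represented by total functions on the ambient
  Euclidean space. Only their restrictions to \<open>\<Omega>\<close>, up to Lebesgue-null sets, matter: the
  (semi)norms below integrate over \<open>\<Omega>\<close>.
\<close>

primrec C_n :: "nat \<Rightarrow> ('a::euclidean_space \<Rightarrow> real) \<Rightarrow> bool" where
  "C_n 0 f \<longleftrightarrow> continuous_on UNIV f"
| "C_n (Suc n) f \<longleftrightarrow>
     (\<exists>G. (\<forall>x. GDERIV f x :> G x) \<and> (\<forall>i\<in>Basis. C_n n (\<lambda>x. G x \<bullet> i)))"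

definition test_functions :: "'a::euclidean_space set \<Rightarrow> ('a \<Rightarrow> real) set" where
  "test_functions \<Omega> = {\<phi>. (\<forall>n. C_n n \<phi>) \<and>
     compact (closure {x. \<phi> x \<noteq> 0}) \<and> closure {x. \<phi> x \<noteq> 0} \<subseteq> \<Omega>}"

definition square_integrable ::
    "'a::euclidean_space set \<Rightarrow> ('a \<Rightarrow> 'b::euclidean_space) \<Rightarrow> bool" where
  "square_integrable \<Omega> f \<longleftrightarrow> f \<in> borel_measurable (lebesgue_on \<Omega>) \<and>
     integrable (lebesgue_on \<Omega>) (\<lambda>x. (norm (f x))\<^sup>2)"

definition has_weak_gradient ::
    "'a::euclidean_space set \<Rightarrow> ('a \<Rightarrow> real) \<Rightarrow> ('a \<Rightarrow> 'a) \<Rightarrow> bool" where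
  "has_weak_gradient \<Omega> u G \<longleftrightarrow> square_integrable \<Omega> G \<and>
     (\<forall>\<phi>\<in>test_functions \<Omega>. \<forall>D. (\<forall>x. GDERIV \<phi> x :> D x) \<longrightarrow>
        (LINT x|lebesgue_on \<Omega>. u x *\<^sub>R D x) = - (LINT x|lebesgue_on \<Omega>. \<phi> x *\<^sub>R G x))"

definition H1 :: "'a::euclidean_space set \<Rightarrow> ('a \<Rightarrow> real) set" where
  "H1 \<Omega> = {u. square_integrable \<Omega> u \<and> (\<exists>G. has_weak_gradient \<Omega> u G)}"

text \<open>For open \<open>\<Omega>\<close> and \<open>u\<close> in \<open>H1 \<Omega>\<close> the weak gradient is unique up to null sets, so the
  choice below does not affect integrals over \<open>\<Omega>\<close>.\<close>

definition weak_gradient :: "'a::euclidean_space set \<Rightarrow> ('a \<Rightarrow> real) \<Rightarrow> 'a \<Rightarrow> 'a" where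
  "weak_gradient \<Omega> u = (SOME G. has_weak_gradient \<Omega> u G)"

definition H1_seminorm :: "'a::euclidean_space set \<Rightarrow> ('a \<Rightarrow> real) \<Rightarrow> real" where
  "H1_seminorm \<Omega> u = sqrt (LINT x|lebesgue_on \<Omega>. (norm (weak_gradient \<Omega> u x))\<^sup>2)"

definition H1_norm :: "'a::euclidean_space set \<Rightarrow> ('a \<Rightarrow> real) \<Rightarrow> real" where
  "H1_norm \<Omega> u = sqrt ((LINT x|lebesgue_on \<Omega>. (u x)\<^sup>2) + (H1_seminorm \<Omega> u)\<^sup>2)"

definition H1_0 :: "'a::euclidean_space set \<Rightarrow> ('a \<Rightarrow> real) set" where
  "H1_0 \<Omega> = {u \<in> H1 \<Omega>. \<forall>\<epsilon>>0. \<exists>\<phi>\<in>test_functions \<Omega>. H1_norm \<Omega> (\<lambda>x. u x - \<phi> x) < \<epsilon>}"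


section \<open>Riesz bases\<close>

text \<open>
  \<open>riesz_basis H N J \<psi>\<close>: the family \<open>(\<psi> l)\<close>, \<open>l \<in> J\<close>, is a Riesz basis of the Hilbert space of
  (classes of) functions \<open>H\<close> with norm \<open>N\<close>. The second conjunct says that the span is dense.
  A series over \<open>J\<close> converges in \<open>H\<close> along the net of finite subsets of \<open>J\<close>, and
  \<open>s\<close> is its sum.
\<close>

definition riesz_basis ::
    "('x \<Rightarrow> real) set \<Rightarrow> (('x \<Rightarrow> real) \<Rightarrow> real) \<Rightarrow> 'i set \<Rightarrow> ('i \<Rightarrow> 'x \<Rightarrow> real) \<Rightarrow> bool" where
  "riesz_basis H N J \<psi> \<longleftrightarrow>
     countable J \<and> \<psi> ` J \<subseteq> H \<and>
     (\<forall>h\<in>H. \<forall>\<epsilon>>0. \<exists>F a. finite F \<and> F \<subseteq> J \<and> N (\<lambda>x. h x - (\<Sum>l\<in>F. a l * \<psi> l x)) < \<epsilon>) \<and>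
     (\<exists>c>0. \<exists>C>0. \<forall>b. (\<lambda>l. (b l)\<^sup>2) summable_on J \<longrightarrow>
        (\<exists>s\<in>H. ((\<lambda>F. N (\<lambda>x. s x - (\<Sum>l\<in>F. b l * \<psi> l x))) \<longlongrightarrow> 0) (finite_subsets_at_top J) \<and>
               c * sqrt (\<Sum>\<^sub>\<infinity>l\<in>J. (b l)\<^sup>2) \<le> N s \<and>
               N s \<le> C * sqrt (\<Sum>\<^sub>\<infinity>l\<in>J. (b l)\<^sup>2)))"


section \<open>The wavelet system\<close>

definition phi :: "real \<Rightarrow> real" where
  "phi x =
     (if 0 \<le> x \<and> x \<le> 1 then x\<^sup>2 / 2
      else if 1 \<le> x \<and> x \<le> 2 then - x\<^sup>2 + 3 * x - 3 / 2
      else if 2 \<le> x \<and> x \<le> 3 then x\<^sup>2 / 2 - 3 * x + 9 / 2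
      else 0)"

definition phi_b :: "real \<Rightarrow> real" where
  "phi_b x =
     (if 0 \<le> x \<and> x \<le> 1 then - (9 * x\<^sup>2 / 4) + 3 * x
      else if 1 \<le> x \<and> x \<le> 2 then 3 * x\<^sup>2 / 4 - 3 * x + 3
      else 0)"

definition psi :: "real \<Rightarrow> real" where
  "psi x = - (1 / 2) * phi (2 * x - 1) + (1 / 2) * phi (2 * x - 2)"

definition psi_b :: "real \<Rightarrow> real" where
  "psi_b x = - (1 / 2) * phi_b (2 * x) + (1 / 2) * phi (2 * x)"

definition I_set :: "nat \<Rightarrow> int set" where
  "I_set j = {1..2 ^ j}"

definition phi1 :: "nat \<Rightarrow> int \<Rightarrow> real \<Rightarrow> real" where
  "phi1 j k x =
     (if k = 1 then 2 powr (real j / 2) * phi_b (2 ^ j * x)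
      else if k = 2 ^ j then 2 powr (real j / 2) * phi_b (2 ^ j * (1 - x))
      else 2 powr (real j / 2) * phi (2 ^ j * x - real_of_int k + 2))"

definition psi1 :: "nat \<Rightarrow> int \<Rightarrow> real \<Rightarrow> real" where
  "psi1 j k x =
     (if k = 1 then 2 powr (real j / 2) * psi_b (2 ^ j * x)
      else if k = 2 ^ j then - (2 powr (real j / 2)) * psi_b (2 ^ j * (1 - x))
      else 2 powr (real j / 2) * psi (2 ^ j * x - real_of_int k + 2))"

definition psi1_type :: "nat \<Rightarrow> nat \<Rightarrow> int \<Rightarrow> real \<Rightarrow> real" where
  "psi1_type j e k = (if e = 1 then psi1 j k else phi1 j k)"

definition phi2 :: "nat \<Rightarrow> int \<times> int \<Rightarrow> real \<times> real \<Rightarrow> real" where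
  "phi2 j k x = phi1 j (fst k) (fst x) * phi1 j (snd k) (snd x)"

definition psi2 :: "nat \<Rightarrow> nat \<times> nat \<Rightarrow> int \<times> int \<Rightarrow> real \<times> real \<Rightarrow> real" where
  "psi2 j e k x = psi1_type j (fst e) (fst k) (fst x) * psi1_type j (snd e) (snd k) (snd x)"

definition E2 :: "(nat \<times> nat) set" where
  "E2 = {0, 1} \<times> {0, 1} - {(0, 0)}"

definition Psi_2D :: "(real \<times> real \<Rightarrow> real) set" where
  "Psi_2D = {phi2 2 k |k. k \<in> I_set 2 \<times> I_set 2} \<union>
     {psi2 j e k |j e k. 2 \<le> j \<and> e \<in> E2 \<and> k \<in> I_set j \<times> I_set j}"

definition unit_square :: "(real \<times> real) set" where
  "unit_square = {0<..<1} \<times> {0<..<1}"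

end

theory Submission
  imports Defs
begin

text \<open>
  A quadratic spline on the grid of width \<open>2\<^sup>-\<^sup>J\<close> that vanishes on the boundary is given by
  coefficients that are odd under reflection at the boundary, and its \<open>H\<^sup>1\<close> seminorm is equivalent,
  uniformly in \<open>J\<close>, to the sum of the squared first differences of these coefficients (in two
  dimensions no power of \<open>2\<^sup>J\<close> appears). The Riesz inequalities for finite sums thus become
  inequalities between these energies and the wavelet coefficients. The upper one is an induction on
  \<open>J\<close> with the second differences as an additional potential. For the lower one, a weighted pair
  average annihilates the wavelets and is a strict contraction in a suitable norm; hence, for an
  arbitrary competitor \<open>x\<close>, the energy of \<open>x\<close> plus a small multiple of the dual norm of \<open>X J - x\<close>
  drops at least by the wavelet coefficients of a level when \<open>x\<close> is replaced by its pair averages.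
  Quasi-interpolation of test functions by splines gives density, since splines are combinations of
  wavelets: the coarse part solves a diagonally dominant tridiagonal system. Quasi-interpolation with
  a smooth kernel instead approximates the splines by test functions, so that they lie in \<open>H\<^sub>0\<^sup>1\<close>.
\<close>

section \<open>Odd periodic coefficient sequences\<close>

text \<open>The splitting of level \<open>2 * n\<close> into coarse part and wavelets is oblique, so
  energies of different levels do not decouple, and a one-level estimate with a constant above one
  would compound over the levels. Two mechanisms are combined instead. Pair averaging does not
  increase the energy and even pays back half of the squared defect
  \<open>x - refine (refine y)\<close>, but it does not return the true coarse part. The true coarse
  part solves a \<open>tri\<close> equation with right-hand side \<open>dual_avg\<close>, a
  contraction by 19/20 in each variable. The weight 1/10^6 on the dual norm is so small that the
  defect gained by averaging pays for the mismatch between the two coarse arrays; the surplus of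
  both pays for the wavelet coefficients with weight 1/10^9. Essential is only that 361/400,
  enlarged by the Young factor 21/20, stays below one. In the upper inequality the borderline is the
  same: in two dimensions the energy bound for refinement is exactly neutral, so cross terms between
  distant levels do not decay by themselves. Second differences do shrink, and absorb them.\<close>

text \<open>The reflection about \<open>1/2\<close>, and with it the one about \<open>n + 1/2\<close>, encodes the zero boundary values.\<close>

definition oddper :: "int \<Rightarrow> (int \<Rightarrow> real) \<Rightarrow> bool" where
  "oddper n c \<longleftrightarrow> (\<forall>k. c (k + 2 * n) = c k) \<and> (\<forall>k. c (1 - k) = - c k)"

text \<open>Only \<open>f 1\<close>, ..., \<open>f n\<close> enter. With \<open>m = r + 1\<close> in
  \<open>{1..2 * n}\<close> the second branch is \<open>- f (2 * n + 1 - m)\<close>, the reflection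
  about \<open>n + 1/2\<close>.\<close>

definition oddext :: "int \<Rightarrow> (int \<Rightarrow> real) \<Rightarrow> int \<Rightarrow> real" where
  "oddext n f m = (let r = (m - 1) mod (2 * n) in if r < n then f (r + 1) else - f (2 * n - r))"

text \<open>The two-scale relation of \<^const>\<open>phi\<close> has the mask \<open>(1, 3, 3, 1) / 4\<close>.\<close>

definition refine :: "(int \<Rightarrow> real) \<Rightarrow> int \<Rightarrow> real" where
  "refine c m = (if even m then (3 * c (m div 2) + c (m div 2 + 1)) / 4
                 else (3 * c ((m + 1) div 2) + c ((m - 1) div 2)) / 4)"

definition pair_avg :: "(int \<Rightarrow> real) \<Rightarrow> int \<Rightarrow> real" where
  "pair_avg x k = (x (2 * k - 1) + x (2 * k)) / 2"

text \<open>The functional \<open>dual_avg n\<close> vanishes on wavelets and maps the refinement of a sequence \<open>c\<close> to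
  \<open>tri n c\<close>; its weights \<open>2/3\<close> cancel the boundary factors \<open>3/2\<close> of \<open>bdry\<close>.\<close>

definition tri :: "int \<Rightarrow> (int \<Rightarrow> real) \<Rightarrow> int \<Rightarrow> real" where
  "tri n c k = c (k - 1) + 6 * c k + c (k + 1) - (if k = 1 \<or> k = n then 2 / 3 * c k else 0)"

definition dual_avg :: "int \<Rightarrow> (int \<Rightarrow> real) \<Rightarrow> int \<Rightarrow> real" where
  "dual_avg n x k = 4 * ((if k = 1 then 2 / 3 else 1) * x (2 * k - 1) +
                         (if k = n then 2 / 3 else 1) * x (2 * k))"

text \<open>On the half-line, \<open>phi_b x = 3/2 * (phi (x + 1) - phi (x + 2))\<close>, whence the factor \<open>3/2\<close>.\<close>

definition bdry :: "int \<Rightarrow> (int \<Rightarrow> real) \<Rightarrow> int \<Rightarrow> real" where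
  "bdry n = (\<lambda>f. oddext n (\<lambda>m. (if m = 1 \<or> m = n then 3 / 2 else 1) * f m))"

text \<open>A wavelet is half a difference of two neighbouring fine scaling functions, which gives
  the signs at \<open>2 * k - 1\<close> and \<open>2 * k\<close>. The factor 1/2 is left to the
  weights.\<close>

definition detail :: "int \<Rightarrow> (int \<Rightarrow> real) \<Rightarrow> int \<Rightarrow> real" where
  "detail n d = bdry (2 * n) (\<lambda>m. if even m then d (m div 2) else - d ((m + 1) div 2))"

lemma refine_even [simp]: "refine c (2 * k) = (3 * c k + c (k + 1)) / 4"
  by (simp add: refine_def)

lemma refine_odd [simp]: "refine c (2 * k - 1) = (3 * c k + c (k - 1)) / 4"
proof -
  have "(2 * k - 1 + 1) div 2 = k" "(2 * k - 1 - 1) div 2 = k - 1" by auto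
  then show ?thesis by (simp add: refine_def)
qed

lemma refine_odd' [simp]: "refine c (2 * k + 1) = (3 * c (k + 1) + c k) / 4"
  using refine_odd[of c "k + 1"] by (simp add: algebra_simps)

lemma oddperD:
  assumes "oddper n c"
  shows "c (k + 2 * n) = c k" "c (1 - k) = - c k" "c 0 = - c 1" "c (n + 1) = - c n" 
    "c (2 * n + 1 - k) = - c k"
proof -
  show a: "c (k + 2 * n) = c k" for k using assms by (simp add: oddper_def)
  show b: "c (1 - k) = - c k" for k using assms by (simp add: oddper_def)
  show "c 0 = - c 1" using b[of 1] by simp
  show c: "c (2 * n + 1 - k) = - c k" for k using a[of "1 - k"] b[of k] by (simp add: algebra_simps)
  show "c (n + 1) = - c n" using c[of n] by (simp add: algebra_simps)
qed

lemma oddext_eq: "k \<in> {1..n} \<Longrightarrow> oddext n f k = f k"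
  by (auto simp: oddext_def Let_def mod_pos_pos_trivial)

lemma oddper_oddext:
  assumes "n > 0" shows "oddper n (oddext n f)"
  unfolding oddper_def
proof (intro conjI allI)
  fix k
  have "(k + 2 * n - 1) mod (2 * n) = (k - 1) mod (2 * n)"
    by (metis add_diff_eq diff_add_eq mod_add_self2)
  then show "oddext n f (k + 2 * n) = oddext n f k" by (simp add: oddext_def)
  define r where "r = (k - 1) mod (2 * n)"
  have r: "0 \<le> r" "r < 2 * n" using assms by (auto simp: r_def)
  have "(1 - k - 1) mod (2 * n) = (2 * n - 1 - r) mod (2 * n)"
    unfolding r_def by (simp add: mod_simps)
  also have "\<dots> = 2 * n - 1 - r" using r by (intro mod_pos_pos_trivial) auto
  finally have "(1 - k - 1) mod (2 * n) = 2 * n - 1 - r" .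
  then show "oddext n f (1 - k) = - oddext n f k"
    using r by (auto simp: oddext_def Let_def r_def[symmetric] add.commute)
qed

lemma oddper_refine:
  assumes "oddper n c" shows "oddper (2 * n) (refine c)"
  unfolding oddper_def
proof (intro conjI allI)
  note o = oddperD[OF assms]
  fix m :: int
  show "refine c (m + 2 * (2 * n)) = refine c m"
  proof (cases "even m")
    case True
    then obtain k where "m = 2 * k" by blast
    moreover have "2 * k + 2 * (2 * n) = 2 * (k + 2 * n)" by simp
    ultimately show ?thesis using o(1)[of k] o(1)[of "k + 1"] by (simp only: refine_even) (simp add: algebra_simps)
  next
    case False
    then obtain k where "m = 2 * k + 1" by (auto elim: oddE)
    moreover have "2 * k + 1 + 2 * (2 * n) = 2 * (k + 2 * n) + 1" by simp
    ultimately show ?thesis using o(1)[of k] o(1)[of "k + 1"] by (simp only: refine_odd') (simp add: algebra_simps)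
  qed
  show "refine c (1 - m) = - refine c m"
  proof (cases "even m")
    case True
    then obtain k where "m = 2 * k" by blast
    moreover have "1 - 2 * k = 2 * (1 - k) - 1" by simp
    ultimately show ?thesis using o(2)[of k] o(2)[of "k + 1"] by (simp only: refine_even refine_odd) (simp add: algebra_simps)
  next
    case False
    then obtain k where "m = 2 * k + 1" by (auto elim: oddE)
    moreover have "1 - (2 * k + 1) = 2 * (- k)" by simp
    ultimately show ?thesis using o(2)[of "k+1"] o(2)[of "k"] by (simp only: refine_even refine_odd') (simp add: algebra_simps)
  qed
qed

lemma oddper_pair_avg:
  assumes "oddper (2 * n) x" shows "oddper n (pair_avg x)"
  unfolding oddper_def pair_avg_def
proof (intro conjI allI)
  note o = oddperD[OF assms]
  fix k :: int
  show "(x (2 * (k + 2 * n) - 1) + x (2 * (k + 2 * n))) / 2 = (x (2 * k - 1) + x (2 * k)) / 2"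
    using o(1)[of "2 * k - 1"] o(1)[of "2 * k"] by (simp add: algebra_simps)
  show "(x (2 * (1 - k) - 1) + x (2 * (1 - k))) / 2 = - ((x (2 * k - 1) + x (2 * k)) / 2)"
    using o(2)[of "2 * k"] o(2)[of "2 * k - 1"] by (simp add: algebra_simps)
qed

lemma oddper_add: "oddper n c \<Longrightarrow> oddper n d \<Longrightarrow> oddper n (\<lambda>k. c k + d k)"
  and oddper_diff: "oddper n c \<Longrightarrow> oddper n d \<Longrightarrow> oddper n (\<lambda>k. c k - d k)"
  and oddper_cmult: "oddper n c \<Longrightarrow> oddper n (\<lambda>k. a * c k)"
  and oddper_sum: "(\<And>i. i \<in> I \<Longrightarrow> oddper n (f i)) \<Longrightarrow> oddper n (\<lambda>k. \<Sum>i\<in>I. f i k)"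
  by (auto simp: oddper_def sum_negf)

lemma oddper_zero: "oddper n (\<lambda>k. 0)"
  by (simp add: oddper_def)

lemma oddper_detail: "n > 0 \<Longrightarrow> oddper (2 * n) (detail n d)"
  by (simp add: detail_def bdry_def oddper_oddext)

lemma oddper_eqI:
  assumes "oddper n c" "oddper n d" "n > 0" "\<And>k. k \<in> {1..n} \<Longrightarrow> c k = d k"
  shows "c k = d k"
proof -
  define r where "r = (k - 1) mod (2 * n)"
  define q where "q = (k - 1) div (2 * n)"
  have r: "0 \<le> r" "r < 2 * n" using assms by (auto simp: r_def)
  have per: "f (m + 2 * n * int j) = f m" if "oddper n f" for f m j
  proof (induction j)
    case (Suc j)
    then show ?case using oddperD(1)[OF that, of "m + 2 * n * int j"] by (simp add: algebra_simps)
  qed auto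
  have per': "f (m + 2 * n * i) = f m" if "oddper n f" for f m i
  proof (cases "i \<ge> 0")
    case True then show ?thesis using per[OF that, of m "nat i"] by simp
  next
    case False then show ?thesis using per[OF that, of "m + 2 * n * i" "nat (- i)"] by simp
  qed
  have k: "k = r + 1 + 2 * n * q" unfolding r_def q_def by (metis add.commute add.assoc diff_add_cancel mod_mult_div_eq)
  have "c (r + 1) = d (r + 1)"
  proof (cases "r < n")
    case True then show ?thesis using r assms(4)[of "r + 1"] by auto
  next
    case False
    then have "c (2 * n - r) = d (2 * n - r)" using r assms(4)[of "2 * n - r"] by auto
    then show ?thesis using oddperD(5)[OF assms(1), of "r + 1"] oddperD(5)[OF assms(2), of "r + 1"] by simp
  qed
  then show ?thesis using per'[OF assms(1)] per'[OF assms(2)] k by simp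
qed

section \<open>Telescoping, shifting and reflecting sums over integer intervals\<close>

lemma sum_int_Suc:
  fixes f :: "int \<Rightarrow> 'a::comm_monoid_add"
  assumes "n \<ge> 0" shows "(\<Sum>k\<in>{1..n + 1}. f k) = (\<Sum>k\<in>{1..n}. f k) + f (n + 1)"
proof -
  have "{1..n + 1} = insert (n + 1) {1..n}" using assms by auto
  then show ?thesis by (simp add: add.commute)
qed

lemma sum_pairs:
  fixes f :: "int \<Rightarrow> real"
  assumes "n \<ge> 0" shows "(\<Sum>m\<in>{1..2 * n}. f m) = (\<Sum>k\<in>{1..n}. f (2 * k - 1) + f (2 * k))"
  using assms
proof (induction n rule: int_ge_induct)
  case (step i)
  have "{1..2 * (i + 1)} = insert (2 * i + 2) (insert (2 * i + 1) {1..2 * i})" using step(1) by auto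
  then have "(\<Sum>m\<in>{1..2 * (i + 1)}. f m) = (\<Sum>m\<in>{1..2 * i}. f m) + f (2 * i + 1) + f (2 * i + 2)" by simp
  also have "\<dots> = (\<Sum>k\<in>{1..i + 1}. f (2 * k - 1) + f (2 * k))"
    using step sum_int_Suc[of i "\<lambda>k. f (2 * k - 1) + f (2 * k)"] by (simp add: algebra_simps)
  finally show ?case .
qed auto

lemma sum_telescope_int:
  fixes f :: "int \<Rightarrow> real"
  assumes "n \<ge> 0" shows "(\<Sum>k\<in>{1..n}. f (k + 1) - f k) = f (n + 1) - f 1"
  using assms by (induction n rule: int_ge_induct) (auto simp: sum_int_Suc)

lemma sum_periodic_shift:
  fixes f :: "int \<Rightarrow> real"
  assumes "n \<ge> 0" "\<And>k. f (k + n) = f k"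
  shows "(\<Sum>k\<in>{1..n}. f (k + 1)) = (\<Sum>k\<in>{1..n}. f k)"
  using sum_telescope_int[of n f] assms(1) assms(2)[of 1] by (simp add: sum_subtractf add.commute)

lemma sum_periodic_shift':
  fixes f :: "int \<Rightarrow> real"
  assumes "n \<ge> 0" "\<And>k. f (k + n) = f k"
  shows "(\<Sum>k\<in>{1..n}. f (k - 1)) = (\<Sum>k\<in>{1..n}. f k)"
  using sum_periodic_shift[of n "\<lambda>k. f (k - 1)"] assms(1) assms(2)[of "_ - 1"] by (simp add: algebra_simps)

lemma sum_reflect:
  fixes f :: "int \<Rightarrow> real"
  assumes "n \<ge> 0" "\<And>k. f (2 * n + 1 - k) = f k"
  shows "(\<Sum>k\<in>{1..2 * n}. f k) = 2 * (\<Sum>k\<in>{1..n}. f k)"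
proof -
  have "{1..2 * n} = {1..n} \<union> {n + 1..2 * n}" using assms(1) by auto
  then have "(\<Sum>k\<in>{1..2 * n}. f k) = (\<Sum>k\<in>{1..n}. f k) + (\<Sum>k\<in>{n + 1..2 * n}. f k)"
    by (simp add: sum.union_disjoint)
  also have "(\<Sum>k\<in>{n + 1..2 * n}. f k) = (\<Sum>k\<in>{1..n}. f k)"
    by (rule sum.reindex_bij_witness[of _ "\<lambda>k. 2 * n + 1 - k" "\<lambda>k. 2 * n + 1 - k"]) (auto simp: assms(2))
  finally show ?thesis by simp
qed

section \<open>One-dimensional discrete estimates\<close>

definition sq :: "int \<Rightarrow> (int \<Rightarrow> real) \<Rightarrow> real" where
  "sq N f = (\<Sum>k\<in>{1..N}. (f k)\<^sup>2)"

definition dif :: "(int \<Rightarrow> real) \<Rightarrow> int \<Rightarrow> real" where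
  "dif c k = c (k + 1) - c k"

definition ddif :: "(int \<Rightarrow> real) \<Rightarrow> int \<Rightarrow> real" where
  "ddif c k = c (k + 1) - 2 * c k + c (k - 1)"

lemma sq_nonneg [simp]: "sq N f \<ge> 0"
  by (simp add: sq_def sum_nonneg)

lemma sq_pairs: "N \<ge> 0 \<Longrightarrow> sq (2 * N) f = (\<Sum>k\<in>{1..N}. (f (2 * k - 1))\<^sup>2 + (f (2 * k))\<^sup>2)"
  by (simp add: sq_def sum_pairs)

lemma sq_add_le: "sq N (\<lambda>k. f k + g k) \<le> 2 * sq N f + 2 * sq N g"
proof -
  have "(a + b)\<^sup>2 \<le> 2 * a\<^sup>2 + 2 * b\<^sup>2" for a b :: real
    using sum_squares_bound[of a b] by (simp add: power2_sum)
  then show ?thesis unfolding sq_def sum_distrib_left sum.distrib[symmetric] by (intro sum_mono) auto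
qed

lemma sq_diff_le: "sq N (\<lambda>k. f k - g k) \<le> 2 * sq N f + 2 * sq N g"
  using sq_add_le[of N f "\<lambda>k. - g k"] by (simp add: sq_def)

lemma sq_pair_avg: "N \<ge> 0 \<Longrightarrow> sq N (pair_avg x) \<le> 1 / 2 * sq (2 * N) x"
proof -
  assume N: "N \<ge> 0"
  have "((a + b) / 2)\<^sup>2 \<le> 1 / 2 * (a\<^sup>2 + b\<^sup>2)" for a b :: real
    using sum_squares_bound[of a b] by (simp add: power2_sum power_divide field_simps)
  then show ?thesis
    unfolding sq_pairs[OF N] sum_distrib_left unfolding sq_def pair_avg_def by (intro sum_mono) auto
qed

text \<open>Each fine value is a convex combination with weights 3/4 and 1/4, so convexity of the
  square applies; the factor 2 counts fine indices per coarse index.\<close>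

lemma sq_refine:
  assumes N: "N \<ge> 0" and p: "\<And>k. c (k + N) = c k"
  shows "sq (2 * N) (refine c) \<le> 2 * sq N c"
proof -
  have cell: "((3 * a + b) / 4)\<^sup>2 \<le> 3 / 4 * a\<^sup>2 + 1 / 4 * b\<^sup>2" for a b :: real
    using zero_le_power2[of "a - b"] by (simp add: power2_eq_square field_simps)
  have "sq (2 * N) (refine c) \<le> (\<Sum>k\<in>{1..N}. 3 / 2 * (c k)\<^sup>2 + 1 / 4 * (c (k - 1))\<^sup>2 + 1 / 4 * (c (k + 1))\<^sup>2)"
    unfolding sq_pairs[OF N]
  proof (intro sum_mono)
    fix k
    show "(refine c (2 * k - 1))\<^sup>2 + (refine c (2 * k))\<^sup>2
        \<le> 3 / 2 * (c k)\<^sup>2 + 1 / 4 * (c (k - 1))\<^sup>2 + 1 / 4 * (c (k + 1))\<^sup>2"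
      using cell[of "c k" "c (k - 1)"] cell[of "c k" "c (k + 1)"] by simp
  qed
  also have "\<dots> = 2 * sq N c"
    using sum_periodic_shift[OF N, of "\<lambda>k. (c k)\<^sup>2"] sum_periodic_shift'[OF N, of "\<lambda>k. (c k)\<^sup>2"] p
    by (simp add: sum.distrib sq_def sum_distrib_left[symmetric] sum_divide_distrib[symmetric])
  finally show ?thesis .
qed

text \<open>Fine differences are half as large, and there are twice as many. Together with the
  factor 2 of \<open>sq_refine\<close> in the other variable this makes refinement energy neutral in
  two dimensions.\<close>

lemma sq_dif_refine:
  assumes N: "N \<ge> 0" and p: "\<And>k. c (k + N) = c k"
  shows "sq (2 * N) (dif (refine c)) \<le> 1 / 2 * sq N (dif c)"
proof -
  have cell: "((a + b) / 4)\<^sup>2 + (a / 2)\<^sup>2 \<le> 3 / 8 * a\<^sup>2 + 1 / 8 * b\<^sup>2" for a b :: real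
    using zero_le_power2[of "a - b"] by (simp add: power2_eq_square field_simps)
  have pd: "dif c (k + N) = dif c k" for k using p[of k] p[of "k + 1"] by (simp add: dif_def algebra_simps)
  have e: "dif (refine c) (2 * k - 1) = (dif c k + dif c (k - 1)) / 4" 
    "dif (refine c) (2 * k) = dif c k / 2" for k
    by (simp_all add: dif_def add_divide_distrib diff_divide_distrib)
  have "sq (2 * N) (dif (refine c)) \<le> (\<Sum>k\<in>{1..N}. 3 / 8 * (dif c k)\<^sup>2 + 1 / 8 * (dif c (k - 1))\<^sup>2)"
    unfolding sq_pairs[OF N] e using cell by (intro sum_mono) 
  also have "\<dots> = 1 / 2 * sq N (dif c)"
    using sum_periodic_shift'[OF N, of "\<lambda>k. (dif c k)\<^sup>2"] pd
    by (simp add: sum.distrib sq_def sum_distrib_left[symmetric] sum_divide_distrib[symmetric])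
  finally show ?thesis .
qed

text \<open>Every second difference occurs twice, divided by 4. The factor 1/8 remains small after
  the factor 2 from the other variable.\<close>

lemma sq_ddif_refine:
  assumes N: "N \<ge> 0"
  shows "sq (2 * N) (ddif (refine c)) \<le> 1 / 8 * sq N (ddif c)"
proof -
  have e: "ddif (refine c) (2 * k) = ddif c k / 4" for k
    by (simp add: ddif_def add_divide_distrib diff_divide_distrib)
  have e': "ddif (refine c) (2 * k - 1) = ddif c k / 4" for k
    using refine_even[of c "k - 1"] by (simp add: ddif_def add_divide_distrib diff_divide_distrib right_diff_distrib)
  show ?thesis unfolding sq_pairs[OF N] e e' 
    by (simp add: sq_def sum_distrib_left power_divide)
qed

lemma sum_dif_dif:
  assumes N: "N \<ge> 0" and "\<And>k. a (k + N) = a k" "\<And>k. b (k + N) = b k"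
  shows "(\<Sum>k\<in>{1..N}. dif a k * dif b k) = - (\<Sum>k\<in>{1..N}. ddif a k * b k)"
proof -
  have p: "dif a (k + N) = dif a k" for k 
    using assms(2)[of k] assms(2)[of "k + 1"] by (simp add: dif_def algebra_simps)
  have "(\<Sum>k\<in>{1..N}. dif a (k - 1) * b k) = (\<Sum>k\<in>{1..N}. dif a k * b (k + 1))"
    using sum_periodic_shift'[OF N, of "\<lambda>k. dif a k * b (k + 1)"] p assms(3)[of "_ + 1"]
    by (simp add: algebra_simps)
  moreover have "dif a k * dif b k = dif a k * b (k + 1) - dif a k * b k" for k
    by (simp add: dif_def algebra_simps)
  moreover have "ddif a k * b k = dif a k * b k - dif a (k - 1) * b k" for k
    by (simp add: dif_def ddif_def algebra_simps)
  ultimately show ?thesis by (simp add: sum_subtractf)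
qed

lemma sq_dif_le:
  assumes N: "N \<ge> 0" and p: "\<And>k. c (k + N) = c k"
  shows "sq N (dif c) \<le> 4 * sq N c"
proof -
  have "sq N (dif c) \<le> 2 * sq N (\<lambda>k. c (k + 1)) + 2 * sq N c"
    using sq_diff_le[of N "\<lambda>k. c (k + 1)" c] by (simp add: dif_def[abs_def])
  also have "sq N (\<lambda>k. c (k + 1)) = sq N c" 
    unfolding sq_def using sum_periodic_shift[OF N, of "\<lambda>k. (c k)\<^sup>2"] p by simp
  finally show ?thesis by simp
qed

lemma sq_ddif_le:
  assumes N: "N \<ge> 0" and p: "\<And>k. c (k + N) = c k"
  shows "sq N (ddif c) \<le> 16 * sq N c"
proof -
  have pd: "dif c (k + N) = dif c k" for k using p[of k] p[of "k + 1"] by (simp add: dif_def algebra_simps)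
  have pdd: "dif (dif c) (k + N) = dif (dif c) k" for k
    using pd[of k] pd[of "k + 1"] unfolding dif_def[of "dif c"] by (simp add: algebra_simps)
  have "ddif c k = dif (dif c) (k - 1)" for k by (simp add: dif_def ddif_def)
  then have "sq N (ddif c) = sq N (dif (dif c))"
    using sum_periodic_shift'[OF N, of "\<lambda>k. (dif (dif c) k)\<^sup>2"] pdd by (simp add: sq_def)
  then show ?thesis using sq_dif_le[of N c] sq_dif_le[of N "dif c"] N p pd by simp
qed

text \<open>Everything is a quadratic form in three consecutive differences \<open>p\<close>,
  \<open>b\<close>, \<open>q\<close> of \<open>x\<close>. For \<open>p = b = q\<close> the residuals
  vanish and equality holds, so the slack is a form in \<open>p - b\<close> and
  \<open>q - b\<close>, which turns out positive. The factor 2 on the right is compensated later by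
  the pair average in the other variable.\<close>

lemma pair_avg_energy:
  assumes N: "N \<ge> 0" and p: "\<And>k. x (k + 2 * N) = x k"
  shows "sq N (dif (pair_avg x)) + 2 * sq (2 * N) (\<lambda>m. x m - refine (pair_avg x) m) \<le> 2 * sq (2 * N) (dif x)"
proof -
  let ?r = "\<lambda>m. x m - refine (pair_avg x) m"
  have px: "x (2 * (k + N) - 1) = x (2 * k - 1)" "x (2 * (k + N)) = x (2 * k)" 
     "x (2 * (k + N) + 1) = x (2 * k + 1)" for k
  proof -
    have "2 * (k + N) - 1 = 2 * k - 1 + 2 * N" "2 * (k + N) = 2 * k + 2 * N" "2 * (k + N) + 1 = 2 * k + 1 + 2 * N"
      by simp_all
    then show "x (2 * (k + N) - 1) = x (2 * k - 1)" "x (2 * (k + N)) = x (2 * k)" 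
     "x (2 * (k + N) + 1) = x (2 * k + 1)" by (simp_all only: p)
  qed
  have pa: "pair_avg x (k + N) = pair_avg x k" for k
    using px[of k] by (simp add: pair_avg_def)
  have pr: "?r (2 * (k + N) - 1) = ?r (2 * k - 1)" for k
    proof -
    have "pair_avg x (k + N - 1) = pair_avg x (k - 1)" using pa[of "k - 1"] by (simp add: algebra_simps)
    then show ?thesis unfolding refine_odd px(1) pa by simp
  qed
  have pdx: "dif x (2 * (k + N) - 1) = dif x (2 * k - 1)" for k
    using px[of k] by (simp add: dif_def)
  \<comment> \<open>The fine indices are regrouped as \<open>2 * k\<close>,
    \<open>2 * k + 1\<close>: both residuals then involve the same two averages, those at
    \<open>k\<close> and \<open>k + 1\<close>.\<close>
  have A: "sq (2 * N) ?r = (\<Sum>k\<in>{1..N}. (?r (2 * k + 1))\<^sup>2 + (?r (2 * k))\<^sup>2)"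
  proof -
    have "2 * (k + 1) - 1 = 2 * k + 1" for k :: int by simp
    then show ?thesis
      using sum_periodic_shift[OF N, of "\<lambda>k. (?r (2 * k - 1))\<^sup>2", unfolded pr] unfolding sq_pairs[OF N] sum.distrib
      by (simp del: refine_odd refine_even refine_odd' add: add.commute)
  qed
  \<comment> \<open>Each odd difference is shared by two neighbouring cells, hence the weights 1, 2,
    1.\<close>
  have B: "2 * sq (2 * N) (dif x) = (\<Sum>k\<in>{1..N}. (dif x (2 * k - 1))\<^sup>2 + 2 * (dif x (2 * k))\<^sup>2 + (dif x (2 * k + 1))\<^sup>2)"
    using sum_periodic_shift[OF N, of "\<lambda>k. (dif x (2 * k - 1))\<^sup>2"] pdx
    unfolding sq_pairs[OF N] sum.distrib sum_distrib_left[symmetric]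
    by (simp add: algebra_simps)
  have cell: "((p + 2 * b + q) / 2)\<^sup>2 + 2 * (((p - 2 * b * (- 1) - 3 * q) / 8)\<^sup>2 + ((3 * p - 2 * b - q) / 8)\<^sup>2)
      \<le> p\<^sup>2 + 2 * b\<^sup>2 + q\<^sup>2" for p b q :: real
  proof -
    have "p\<^sup>2 + 2 * b\<^sup>2 + q\<^sup>2 - ((p + 2 * b + q) / 2)\<^sup>2 - 2 * (((p - 2 * b * (- 1) - 3 * q) / 8)\<^sup>2 + ((3 * p - 2 * b - q) / 8)\<^sup>2)
      = 7 / 16 * ((p - b)\<^sup>2 + (q - b)\<^sup>2) - 1 / 8 * ((p - b) * (q - b))"
      by (simp add: power2_eq_square field_simps)
    moreover have "2 * ((p - b) * (q - b)) \<le> (p - b)\<^sup>2 + (q - b)\<^sup>2"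
      using sum_squares_bound[of "p - b" "q - b"] by (simp only: mult.assoc)
    moreover have "U \<le> T" if "T - A - B = 7 / 16 * (P + Q) - 1 / 8 * R" "2 * R \<le> P + Q" "0 \<le> P" "0 \<le> Q" "U = A + B" 
      for U T A B P Q R :: real
    proof -
      have "16 * (T - U) = 7 * (P + Q) - 2 * R" using that(1,5) by (simp add: field_simps)
      then show ?thesis using that(2-4) by argo
    qed
    ultimately show ?thesis using zero_le_power2[of "p - b"] zero_le_power2[of "q - b"] by blast
  qed
  have C: "(dif (pair_avg x) k)\<^sup>2 + 2 * ((?r (2 * k + 1))\<^sup>2 + (?r (2 * k))\<^sup>2)
     \<le> (dif x (2 * k - 1))\<^sup>2 + 2 * (dif x (2 * k))\<^sup>2 + (dif x (2 * k + 1))\<^sup>2" for k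
  proof -
    let ?p = "dif x (2 * k - 1)" and ?b = "dif x (2 * k)" and ?q = "dif x (2 * k + 1)"
    have i: "2 * (k + 1) - 1 = 2 * k + 1" "2 * (k + 1) = 2 * k + 2" by auto
    have "dif (pair_avg x) k = (?p + 2 * ?b + ?q) / 2"
      unfolding dif_def pair_avg_def i by (simp add: field_simps)
    moreover have "?r (2 * k + 1) = (?p - 2 * ?b * (- 1) - 3 * ?q) / 8"
      unfolding refine_odd' pair_avg_def i by (simp add: field_simps dif_def)
    moreover have "?r (2 * k) = (3 * ?p - 2 * ?b - ?q) / 8"
      unfolding refine_even pair_avg_def i by (simp add: field_simps dif_def)
    ultimately show ?thesis using cell[of ?p ?b ?q] by (simp only:)
  qed
  show ?thesis unfolding A B unfolding sq_def sum_distrib_left sum.distrib[symmetric]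
    using C by (intro sum_mono)
qed

section \<open>The tridiagonal operator, the dual functional and the stability of the one-level
  splitting\<close>

lemma tri_ge:
  assumes n: "n \<ge> 2" and c: "c 0 = - c 1" "c (n + 1) = - c n"
  shows "9 * sq n c \<le> sq n (tri n c)"
proof -
  have n0: "n \<ge> 0" using n by simp
  \<comment> \<open>Products of neighbours are bounded by squares. What this moves between
    neighbours telescopes and cancels by the boundary conditions; the diagonal keeps 6 - 2 - 2/3,
    rounded down to 3.\<close>
  have "3 * (c k)\<^sup>2 - 1 / 2 * (((c (k - 1))\<^sup>2 - (c k)\<^sup>2) + ((c (k + 1))\<^sup>2 - (c k)\<^sup>2)) \<le> c k * tri n c k" 
    for k
  proof -
    have "- (2 * (a * b)) \<le> a\<^sup>2 + b\<^sup>2" for a b :: real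
      using zero_le_power2[of "a + b"] unfolding power2_sum by simp
    from this[of "c k" "c (k - 1)"] this[of "c k" "c (k + 1)"] have "- (1 / 2 * ((c (k - 1))\<^sup>2 + (c k)\<^sup>2) + 1 / 2 * ((c (k + 1))\<^sup>2 + (c k)\<^sup>2)) \<le> c k * c (k - 1) + c k * c (k + 1)"
      by (simp add: algebra_simps)
    moreover have "c k * tri n c k = 6 * (c k)\<^sup>2 + (c k * c (k - 1) + c k * c (k + 1)) - (if k = 1 \<or> k = n then 2 / 3 * (c k)\<^sup>2 else 0)"
      by (simp add: tri_def power2_eq_square algebra_simps)
    moreover have "(if k = 1 \<or> k = n then 2 / 3 * (c k)\<^sup>2 else 0) \<le> 2 / 3 * (c k)\<^sup>2" by simp
    ultimately show ?thesis using zero_le_power2[of "c k"] by (simp only: right_diff_distrib distrib_left)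
  qed
  then have "3 * sq n c - 1 / 2 * ((\<Sum>k\<in>{1..n}. (c (k - 1))\<^sup>2 - (c k)\<^sup>2) + (\<Sum>k\<in>{1..n}. (c (k + 1))\<^sup>2 - (c k)\<^sup>2))
      \<le> (\<Sum>k\<in>{1..n}. c k * tri n c k)"
    unfolding sq_def sum.distrib[symmetric] sum_distrib_left sum_subtractf[symmetric] by (intro sum_mono)
  moreover have "(\<Sum>k\<in>{1..n}. (c (k - 1))\<^sup>2 - (c k)\<^sup>2) + (\<Sum>k\<in>{1..n}. (c (k + 1))\<^sup>2 - (c k)\<^sup>2) = 0"
    using sum_telescope_int[OF n0, of "\<lambda>k. (c k)\<^sup>2"] sum_telescope_int[OF n0, of "\<lambda>k. (c (k - 1))\<^sup>2"] c 
    by (simp add: sum_subtractf)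
  ultimately have "3 * sq n c \<le> (\<Sum>k\<in>{1..n}. c k * tri n c k)"
    by simp
  \<comment> \<open>Young's inequality, weighted so that half of the left-hand side is
    absorbed.\<close>
  also have "\<dots> \<le> (\<Sum>k\<in>{1..n}. 3 / 2 * (c k)\<^sup>2 + 1 / 6 * (tri n c k)\<^sup>2)"
  proof (intro sum_mono)
    fix k
    show "c k * tri n c k \<le> 3 / 2 * (c k)\<^sup>2 + 1 / 6 * (tri n c k)\<^sup>2"
      using zero_le_power2[of "3 * c k - tri n c k"] by (simp add: power2_eq_square field_simps)
  qed
  also have "\<dots> = 3 / 2 * sq n c + 1 / 6 * sq n (tri n c)"
    by (simp only: sum.distrib sum_distrib_left sq_def)
  finally show ?thesis by simp
qed

text \<open>Row sums are at most 8, and Cauchy-Schwarz with the entries as weights bounds the square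
  of a row. Summation over the rows telescopes as in the lower bound.\<close>

lemma tri_le:
  assumes n: "n \<ge> 2" and c: "c 0 = - c 1" "c (n + 1) = - c n"
  shows "sq n (tri n c) \<le> 64 * sq n c"
proof -
  have n0: "n \<ge> 0" using n by simp
  have cell: "(a + 6 * b + d - 2 / 3 * b * e)\<^sup>2 \<le> 8 * (a\<^sup>2 + d\<^sup>2 + 6 * b\<^sup>2)" if "e = 0 \<or> e = 1" for a b d e :: real
  proof -
    define t where "t = 6 - 2 / 3 * e"
    have t: "0 \<le> t" "t \<le> 6" using that by (auto simp: t_def)
    have "(2 + t) * (a\<^sup>2 + d\<^sup>2 + t * b\<^sup>2) - (a + t * b + d)\<^sup>2 = (a - d)\<^sup>2 + t * (a - b)\<^sup>2 + t * (d - b)\<^sup>2"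
      by (simp add: power2_eq_square algebra_simps)
    then have "(a + t * b + d)\<^sup>2 \<le> (2 + t) * (a\<^sup>2 + d\<^sup>2 + t * b\<^sup>2)"
      using t by (smt (verit) mult_nonneg_nonneg zero_le_power2)
    also have "\<dots> \<le> 8 * (a\<^sup>2 + d\<^sup>2 + 6 * b\<^sup>2)"
      using t by (intro mult_mono add_mono mult_right_mono) auto
    finally show ?thesis by (simp add: t_def algebra_simps)
  qed
  have "(tri n c k)\<^sup>2 \<le> 8 * ((c (k - 1))\<^sup>2 + (c (k + 1))\<^sup>2 + 6 * (c k)\<^sup>2)" for k
    using cell[of 1 "c (k - 1)" "c k" "c (k + 1)"] cell[of 0 "c (k - 1)" "c k" "c (k + 1)"]
    by (auto simp: tri_def)
  then have "sq n (tri n c) \<le> (\<Sum>k\<in>{1..n}. 8 * ((c (k - 1))\<^sup>2 + (c (k + 1))\<^sup>2 + 6 * (c k)\<^sup>2))"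
    unfolding sq_def by (intro sum_mono)
  also have "\<dots> = (\<Sum>k\<in>{1..n}. 64 * (c k)\<^sup>2 + 8 * ((c (k - 1))\<^sup>2 - (c k)\<^sup>2) + 8 * ((c (k + 1))\<^sup>2 - (c k)\<^sup>2))"
    by (intro sum.cong) auto
  also have "\<dots> = 64 * sq n c"
    using sum_telescope_int[OF n0, of "\<lambda>k. (c k)\<^sup>2"] sum_telescope_int[OF n0, of "\<lambda>k. (c (k - 1))\<^sup>2"] c 
    by (simp add: sq_def sum.distrib sum_subtractf sum_distrib_left[symmetric])
  finally show ?thesis .
qed

text \<open>The rows of \<open>tri\<close> couple a pair to its outer neighbours. That coupling is
  estimated by \<open>12 * b * c >= - 6 * b^2 - 6 * c^2\<close>; the exchanged squares, with factor
  57/10 = 19/20 * 6, telescope over the pairs and vanish by the boundary conditions. A form in the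
  two entries of one pair remains, and it is positive for the factor 19/20.\<close>

lemma dual_avg_contraction:
  assumes n: "n \<ge> 2" and x: "x 0 = - x 1" "x (2 * n + 1) = - x (2 * n)"
  shows "sq n (dual_avg n x) \<le> 19 / 20 * sq (2 * n) (tri (2 * n) x)"
proof -
  have n0: "n \<ge> 0" using n by simp
  have odd: "- (2 * (a * b)) \<le> a\<^sup>2 + b\<^sup>2" for a b :: real
    using zero_le_power2[of "a + b"] unfolding power2_sum by simp
  have term_ge: "30 * b\<^sup>2 + 12 * a * b - 6 * c\<^sup>2 \<le> (a + 6 * b + c)\<^sup>2" for a b c :: real
    using zero_le_power2[of "a + c"] odd[of b c] by (simp add: power2_eq_square algebra_simps)
  have bulk: "(4 * (a + b))\<^sup>2 + 57 / 10 * (a\<^sup>2 + b\<^sup>2 - p\<^sup>2 - q\<^sup>2) \<le> 19 / 20 * ((p + 6 * a + b)\<^sup>2 + (a + 6 * b + q)\<^sup>2)"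
    for a b p q :: real
  proof -
    have f1: "30 * a\<^sup>2 + 12 * b * a - 6 * p\<^sup>2 \<le> (p + 6 * a + b)\<^sup>2"
      using term_ge[of a b p] term_ge[of b a p] by (simp add: algebra_simps)
    have f2: "30 * b\<^sup>2 + 12 * a * b - 6 * q\<^sup>2 \<le> (a + 6 * b + q)\<^sup>2" using term_ge[of b a q] by simp
    have "19 / 20 * (30 * a\<^sup>2 + 12 * b * a - 6 * p\<^sup>2 + (30 * b\<^sup>2 + 12 * a * b - 6 * q\<^sup>2)) \<le> 19 / 20 * ((p + 6 * a + b)\<^sup>2 + (a + 6 * b + q)\<^sup>2)"
      by (intro mult_left_mono add_mono f1 f2) simp
    moreover have "19 / 20 * (30 * a\<^sup>2 + 12 * b * a - 6 * p\<^sup>2 + (30 * b\<^sup>2 + 12 * a * b - 6 * q\<^sup>2)) - (4 * (a + b))\<^sup>2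
        - 57 / 10 * (a\<^sup>2 + b\<^sup>2 - p\<^sup>2 - q\<^sup>2) = 23 / 5 * (a - b)\<^sup>2 + 11 / 5 * (a\<^sup>2 + b\<^sup>2)"
      by (simp add: power2_eq_square field_simps)
    moreover have "0 \<le> 23 / 5 * (a - b)\<^sup>2 + 11 / 5 * (a\<^sup>2 + b\<^sup>2)" by simp
    moreover have "A + B \<le> R" if "L \<le> R" "L - A - B = n" "0 \<le> n" for L A B R n :: real
      using that by linarith
    ultimately show ?thesis by blast
  qed
  \<comment> \<open>The pair at an end, \<open>a\<close> being the outermost entry: its row is
    \<open>13 / 3 * a + b\<close>, because 6 - 1 - 2/3 = 13/3 once the reflected value is inserted.
    The mirror image of the same inequality serves the other end.\<close>
  have bd: "(4 * (2 / 3 * a + b))\<^sup>2 + 57 / 10 * (b\<^sup>2 - q\<^sup>2) \<le> 19 / 20 * ((13 / 3 * a + b)\<^sup>2 + (a + 6 * b + q)\<^sup>2)"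
    for a b q :: real
  proof -
    have f: "30 * b\<^sup>2 + 12 * a * b - 6 * q\<^sup>2 \<le> (a + 6 * b + q)\<^sup>2" using term_ge[of b a q] by simp
    have "19 / 20 * ((13 / 3 * a + b)\<^sup>2 + (30 * b\<^sup>2 + 12 * a * b - 6 * q\<^sup>2)) \<le> 19 / 20 * ((13 / 3 * a + b)\<^sup>2 + (a + 6 * b + q)\<^sup>2)"
      by (intro mult_left_mono add_mono f) simp_all
    moreover have "19 / 20 * ((13 / 3 * a + b)\<^sup>2 + (30 * b\<^sup>2 + 12 * a * b - 6 * q\<^sup>2)) - (4 * (2 / 3 * a + b))\<^sup>2
        - 57 / 10 * (b\<^sup>2 - q\<^sup>2) = 17 / 20 * (a - b)\<^sup>2 + (889 / 90 * a\<^sup>2 + 69 / 10 * b\<^sup>2)"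
      by (simp add: power2_eq_square field_simps)
    moreover have "0 \<le> 17 / 20 * (a - b)\<^sup>2 + (889 / 90 * a\<^sup>2 + 69 / 10 * b\<^sup>2)" by simp
    moreover have "A + B \<le> R" if "L \<le> R" "L - A - B = n" "0 \<le> n" for L A B R n :: real
      using that by linarith
    ultimately show ?thesis by blast
  qed
  have cell: "(dual_avg n x k)\<^sup>2 + 57 / 10 * (((x (2 * k - 1))\<^sup>2 - (x (2 * k + 1))\<^sup>2) - ((x (2 * k - 2))\<^sup>2 - (x (2 * k))\<^sup>2))
     \<le> 19 / 20 * ((tri (2 * n) x (2 * k - 1))\<^sup>2 + (tri (2 * n) x (2 * k))\<^sup>2)" if k: "k \<in> {1..n}" for k
  proof -
    consider "k = 1" | "k = n" "k \<noteq> 1" | "k \<noteq> 1" "k \<noteq> n" by blast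
    then show ?thesis
    proof cases
      case 1
      have "tri (2 * n) x 1 = 13 / 3 * x 1 + x 2" "tri (2 * n) x 2 = x 1 + 6 * x 2 + x 3"
         "dual_avg n x 1 = 4 * (2 / 3 * x 1 + x 2)"
        using n x by (auto simp: tri_def dual_avg_def)
      then show ?thesis using bd[of "x 1" "x 2" "x 3"] x 1 by simp
    next
      case 2
      have "2 * n - 1 - 1 = 2 * n - 2" by simp
      then have "tri (2 * n) x (2 * n) = 13 / 3 * x (2 * n) + x (2 * n - 1)"
         "tri (2 * n) x (2 * n - 1) = x (2 * n) + 6 * x (2 * n - 1) + x (2 * n - 2)"
         "dual_avg n x n = 4 * (2 / 3 * x (2 * n) + x (2 * n - 1))"
        using n x by (auto simp: tri_def dual_avg_def)
      then show ?thesis using bd[of "x (2 * n)" "x (2 * n - 1)" "x (2 * n - 2)"] x 2 by (simp add: algebra_simps)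
    next
      case 3
      have i: "2 * k - 1 - 1 = 2 * k - 2" "2 * k - 1 + 1 = 2 * k" by simp_all
      have j: "2 * k - 1 \<noteq> 2 * n" "2 * k \<noteq> 1" "2 * k - 1 \<noteq> 1" "2 * k \<noteq> 2 * n" using 3 by presburger+
      have "tri (2 * n) x (2 * k - 1) = x (2 * k - 2) + 6 * x (2 * k - 1) + x (2 * k)"
         "tri (2 * n) x (2 * k) = x (2 * k - 1) + 6 * x (2 * k) + x (2 * k + 1)"
         "dual_avg n x k = 4 * (x (2 * k - 1) + x (2 * k))"
        using 3 j by (simp_all add: tri_def dual_avg_def i)
      then show ?thesis using bulk[of "x (2 * k - 1)" "x (2 * k)" "x (2 * k - 2)" "x (2 * k + 1)"]
        by (simp add: algebra_simps)
    qed
  qed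
  have "(\<Sum>k\<in>{1..n}. ((x (2 * k - 1))\<^sup>2 - (x (2 * k + 1))\<^sup>2) - ((x (2 * k - 2))\<^sup>2 - (x (2 * k))\<^sup>2)) = 0"
  proof -
    have "2 * (k + 1) - 1 = 2 * k + 1" "2 * (k + 1) - 2 = 2 * k" for k :: int by auto
    then have "(\<Sum>k\<in>{1..n}. (x (2 * k + 1))\<^sup>2 - (x (2 * k - 1))\<^sup>2) = (x (2 * n + 1))\<^sup>2 - (x 1)\<^sup>2"
      "(\<Sum>k\<in>{1..n}. (x (2 * k))\<^sup>2 - (x (2 * k - 2))\<^sup>2) = (x (2 * n))\<^sup>2 - (x 0)\<^sup>2"
      using sum_telescope_int[OF n0, of "\<lambda>k. (x (2 * k - 1))\<^sup>2"] sum_telescope_int[OF n0, of "\<lambda>k. (x (2 * k - 2))\<^sup>2"]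
      by (simp_all add: add.commute)
    then show ?thesis using x by (simp add: sum_subtractf)
  qed
  moreover have "(\<Sum>k\<in>{1..n}. (dual_avg n x k)\<^sup>2 + 57 / 10 * (((x (2 * k - 1))\<^sup>2 - (x (2 * k + 1))\<^sup>2) - ((x (2 * k - 2))\<^sup>2 - (x (2 * k))\<^sup>2)))
     \<le> 19 / 20 * sq (2 * n) (tri (2 * n) x)"
    unfolding sq_pairs[OF n0] sum_distrib_left by (intro sum_mono cell)
  ultimately show ?thesis by (simp only: sq_def[of n] sum.distrib sum_distrib_left[symmetric])
qed

text \<open>Biorthogonality. The weights 2/3 undo the factors 3/2, so the two entries of each
  wavelet cancel. On a refined sequence the missing third of the outermost entry,
  \<open>4 * 1/3 * x 1\<close> with \<open>x 1 = c 1 / 2\<close>, is the correction 2/3 in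
  \<open>tri\<close>.\<close>

lemma dual_avg_refine_detail:
  assumes n: "n \<ge> 2" and c: "oddper n c" and k: "k \<in> {1..n}"
  shows "dual_avg n (\<lambda>m. refine c m + detail n d m) k = tri n c k"
proof -
  have e: "detail n d m = (if m = 1 \<or> m = 2 * n then 3 / 2 else 1) * (if even m then d (m div 2) else - d ((m + 1) div 2))"
    if "m \<in> {1..2 * n}" for m using that by (simp add: detail_def bdry_def oddext_eq)
  have i: "2 * k - 1 \<in> {1..2 * n}" "2 * k \<in> {1..2 * n}" using k by auto
  have j: "2 * k - 1 \<noteq> 2 * n" "2 * k \<noteq> 1" "2 * k - 1 = 1 \<longleftrightarrow> k = 1" "2 * k = 2 * n \<longleftrightarrow> k = n" by presburger+
  have h: "detail n d (2 * k - 1) = - ((if k = 1 then 3 / 2 else 1) * d k)" 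
    "detail n d (2 * k) = (if k = n then 3 / 2 else 1) * d k"
    unfolding e[OF i(1)] e[OF i(2)] using j by (simp_all)
  show ?thesis unfolding dual_avg_def h refine_even refine_odd tri_def
    using oddperD(3,4)[OF c] n by (auto simp: field_simps)
qed

text \<open>Since \<open>dual_avg\<close> does not see the wavelets, the coarse part is bounded
  whatever \<open>d\<close> is; 19/20 * 64 / 9 is below 8.\<close>

lemma sq_coarse_le:
  assumes n: "n \<ge> 2" and c: "oddper n c"
  shows "sq n c \<le> 8 * sq (2 * n) (\<lambda>m. refine c m + detail n d m)"
proof -
  let ?x = "\<lambda>m. refine c m + detail n d m"
  have x: "oddper (2 * n) ?x" using oddper_add[OF oddper_refine[OF c] oddper_detail] n by simp
  have "9 * sq n c \<le> sq n (tri n c)" using tri_ge[OF n] oddperD(3,4)[OF c] by simp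
  also have "sq n (tri n c) = sq n (dual_avg n ?x)"
    unfolding sq_def by (intro sum.cong refl) (simp add: dual_avg_refine_detail[OF n c])
  also have "\<dots> \<le> 19 / 20 * sq (2 * n) (tri (2 * n) ?x)"
    using dual_avg_contraction[OF n, of ?x] oddperD(3,4)[OF x] by simp
  also have "sq (2 * n) (tri (2 * n) ?x) \<le> 64 * sq (2 * n) ?x"
    using tri_le[of "2 * n" ?x] n oddperD(3,4)[OF x] by simp
  finally show ?thesis using sq_nonneg[of "2 * n" ?x] by linarith
qed

lemma sq_oddper: "n \<ge> 0 \<Longrightarrow> oddper n c \<Longrightarrow> sq (2 * n) c = 2 * sq n c"
  unfolding sq_def by (intro sum_reflect) (auto simp: oddperD(5))

lemma sq_refine_half:
  assumes n: "n \<ge> 0" and c: "oddper n c"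
  shows "sq (2 * n) (refine c) \<le> 2 * sq n c"
  using sq_refine[of "2 * n" c] sq_oddper[OF n c] sq_oddper[OF _ oddper_refine[OF c]] n oddperD(1)[OF c]
  by simp

lemma detail_values:
  assumes "k \<in> {1..n}"
  shows "detail n d (2 * k - 1) = - ((if k = 1 then 3 / 2 else 1) * d k)" 
    "detail n d (2 * k) = (if k = n then 3 / 2 else 1) * d k"
proof -
  have i: "2 * k - 1 \<in> {1..2 * n}" "2 * k \<in> {1..2 * n}" using assms by auto
  have j: "2 * k - 1 \<noteq> 2 * n" "2 * k \<noteq> 1" "2 * k - 1 = 1 \<longleftrightarrow> k = 1" "2 * k = 2 * n \<longleftrightarrow> k = n" by presburger+
  show "detail n d (2 * k - 1) = - ((if k = 1 then 3 / 2 else 1) * d k)" 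
    "detail n d (2 * k) = (if k = n then 3 / 2 else 1) * d k"
    unfolding detail_def bdry_def oddext_eq[OF i(1)] oddext_eq[OF i(2)] using j by simp_all
qed

lemma sq_detail_ge: "n \<ge> 0 \<Longrightarrow> 2 * sq n d \<le> sq (2 * n) (detail n d)"
  and sq_detail_le: "n \<ge> 0 \<Longrightarrow> sq (2 * n) (detail n d) \<le> 5 * sq n d"
proof -
  assume n: "n \<ge> 0"
  have a: "1 * a\<^sup>2 \<le> ((if P then 3 / 2 else 1) * a)\<^sup>2" "((if P then 3 / 2 else 1) * a)\<^sup>2 \<le> 9 / 4 * a\<^sup>2"
    for P and a :: real by (auto simp: power_mult_distrib power2_eq_square[of "3/2::real"])
  have c: "2 * (d k)\<^sup>2 \<le> (detail n d (2 * k - 1))\<^sup>2 + (detail n d (2 * k))\<^sup>2 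
       \<and> (detail n d (2 * k - 1))\<^sup>2 + (detail n d (2 * k))\<^sup>2 \<le> 5 * (d k)\<^sup>2" if "k \<in> {1..n}" for k
    using a[where P = "k = 1" and a = "d k"] a[where P = "k = n" and a = "d k"] zero_le_power2[of "d k"]
    unfolding detail_values[OF that] power2_minus by linarith
  show "2 * sq n d \<le> sq (2 * n) (detail n d)"
    unfolding sq_pairs[OF n] unfolding sq_def sum_distrib_left using c by (intro sum_mono) auto
  show "sq (2 * n) (detail n d) \<le> 5 * sq n d"
    unfolding sq_pairs[OF n] unfolding sq_def sum_distrib_left using c by (intro sum_mono) auto
qed

text \<open>The wavelet part is what is left after subtracting the refined coarse part: 2 * 17 = 2 +
  2 * 2 * 8.\<close>

lemma sq_fine_le:
  assumes n: "n \<ge> 2" and c: "oddper n c"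
  shows "sq n d \<le> 17 * sq (2 * n) (\<lambda>m. refine c m + detail n d m)"
proof -
  let ?x = "\<lambda>m. refine c m + detail n d m"
  have "2 * sq n d \<le> sq (2 * n) (detail n d)" using sq_detail_ge n by simp
  also have "\<dots> \<le> 2 * sq (2 * n) ?x + 2 * sq (2 * n) (refine c)"
    using sq_diff_le[of "2 * n" ?x "refine c"] by simp
  also have "sq (2 * n) (refine c) \<le> 2 * sq n c" using sq_refine_half[OF _ c] n by simp
  also have "sq n c \<le> 8 * sq (2 * n) ?x" by (rule sq_coarse_le[OF n c])
  finally show ?thesis by simp
qed

section \<open>Arrays of coefficients\<close>

definition sq2 :: "int \<Rightarrow> int \<Rightarrow> (int \<Rightarrow> int \<Rightarrow> real) \<Rightarrow> real" where
  "sq2 M N X = (\<Sum>k\<in>{1..M}. sq N (X k))"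

definition op1 :: "((int \<Rightarrow> real) \<Rightarrow> int \<Rightarrow> real) \<Rightarrow> (int \<Rightarrow> int \<Rightarrow> real) \<Rightarrow> int \<Rightarrow> int \<Rightarrow> real" where
  "op1 f X k l = f (\<lambda>i. X i l) k"

definition op2 :: "((int \<Rightarrow> real) \<Rightarrow> int \<Rightarrow> real) \<Rightarrow> (int \<Rightarrow> int \<Rightarrow> real) \<Rightarrow> int \<Rightarrow> int \<Rightarrow> real" where
  "op2 f X k l = f (X k) l"

definition oddper2 :: "int \<Rightarrow> int \<Rightarrow> (int \<Rightarrow> int \<Rightarrow> real) \<Rightarrow> bool" where
  "oddper2 m n X \<longleftrightarrow> (\<forall>l. oddper m (\<lambda>k. X k l)) \<and> (\<forall>k. oddper n (X k))"

text \<open>For arrays in \<open>oddper2 n n\<close> one takes \<open>N = 2 * n\<close>, a full period.\<close>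

definition energy :: "int \<Rightarrow> (int \<Rightarrow> int \<Rightarrow> real) \<Rightarrow> real" where
  "energy N X = sq2 N N (op1 dif X) + sq2 N N (op2 dif X)"

text \<open>The tensor square of the one-level splitting: \<open>X\<close> goes with scaling
  functions in both variables, \<open>a\<close> with wavelets in the second variable only,
  \<open>b\<close> in the first only, \<open>c\<close> in both. \<open>bdry\<close> supplies the
  factors 3/2 in the variable in which \<open>a\<close> or \<open>b\<close> multiplies scaling
  functions; \<open>X\<close> already consists of plain B-spline coefficients.\<close>

definition synth :: "int \<Rightarrow> (int \<Rightarrow> int \<Rightarrow> real) \<Rightarrow> (int \<Rightarrow> int \<Rightarrow> real) \<Rightarrow> (int \<Rightarrow> int \<Rightarrow> real)
    \<Rightarrow> (int \<Rightarrow> int \<Rightarrow> real) \<Rightarrow> int \<Rightarrow> int \<Rightarrow> real" where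
  "synth n X a b c = (\<lambda>k l. op1 refine (\<lambda>k l. op2 refine X k l + op2 (detail n) (op1 (bdry n) a) k l) k l
     + op1 (detail n) (\<lambda>k l. op2 refine (op2 (bdry n) b) k l + op2 (detail n) c k l) k l)"

definition coef_norm :: "int \<Rightarrow> (int \<Rightarrow> int \<Rightarrow> real) \<Rightarrow> (int \<Rightarrow> int \<Rightarrow> real) \<Rightarrow> (int \<Rightarrow> int \<Rightarrow> real) \<Rightarrow> real" where
  "coef_norm n a b c = sq2 n n a + sq2 n n b + sq2 n n c"

lemma sq2_nonneg [simp]: "sq2 M N X \<ge> 0"
  by (simp add: sq2_def sum_nonneg)

lemma sq2_swap: "sq2 M N X = (\<Sum>l\<in>{1..N}. sq M (\<lambda>k. X k l))"
  unfolding sq2_def sq_def by (rule sum.swap)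

lemma sq2_add_le: "sq2 M N (\<lambda>k l. X k l + Y k l) \<le> 2 * sq2 M N X + 2 * sq2 M N Y"
  unfolding sq2_def sum_distrib_left sum.distrib[symmetric] by (intro sum_mono sq_add_le)

lemma sq2_op2:
  assumes "\<And>k. k \<in> {1..M} \<Longrightarrow> sq N (f (X k)) \<le> a * sq N' (X k)"
  shows "sq2 M N (op2 f X) \<le> a * sq2 M N' X"
  unfolding sq2_def sum_distrib_left op2_def[abs_def] using assms by (intro sum_mono) auto

lemma sq2_op1:
  assumes "\<And>l. l \<in> {1..N} \<Longrightarrow> sq M (f (\<lambda>k. X k l)) \<le> a * sq M' (\<lambda>k. X k l)"
  shows "sq2 M N (op1 f X) \<le> a * sq2 M' N X"
  unfolding sq2_swap sum_distrib_left op1_def[abs_def] using assms by (intro sum_mono) auto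

lemma oddper2D: "oddper2 m n X \<Longrightarrow> oddper m (\<lambda>k. X k l)" "oddper2 m n X \<Longrightarrow> oddper n (X k)"
  by (auto simp: oddper2_def)

lemma oddper2_add: "oddper2 m n X \<Longrightarrow> oddper2 m n Y \<Longrightarrow> oddper2 m n (\<lambda>k l. X k l + Y k l)"
  and oddper2_diff: "oddper2 m n X \<Longrightarrow> oddper2 m n Y \<Longrightarrow> oddper2 m n (\<lambda>k l. X k l - Y k l)"
  by (auto simp: oddper2_def oddper_add oddper_diff)

lemma op_commute:
  "op1 refine (op2 refine X) = op2 refine (op1 refine X)"
  "op1 pair_avg (op2 pair_avg X) = op2 pair_avg (op1 pair_avg X)"
  "op1 (dual_avg n) (op2 (dual_avg n) X) = op2 (dual_avg n) (op1 (dual_avg n) X)"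
  "op1 (dual_avg n) (op2 (tri m) X) = op2 (tri m) (op1 (dual_avg n) X)"
  "op1 (tri m) (op2 (dual_avg n) X) = op2 (dual_avg n) (op1 (tri m) X)"
  by (simp_all add: fun_eq_iff op1_def op2_def refine_def pair_avg_def dual_avg_def tri_def field_simps)

lemma op_commute_dif:
  "op1 dif (op2 pair_avg X) = op2 pair_avg (op1 dif X)"
  "op2 dif (op1 pair_avg X) = op1 pair_avg (op2 dif X)"
  "op1 dif (op2 refine X) = op2 refine (op1 dif X)"
  "op2 dif (op1 refine X) = op1 refine (op2 dif X)"
  "op1 ddif (op2 refine X) = op2 refine (op1 ddif X)"
  "op2 ddif (op1 refine X) = op1 refine (op2 ddif X)"
  by (simp_all add: fun_eq_iff op1_def op2_def refine_def pair_avg_def dif_def ddif_def field_simps)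

lemma oddper2_op1_refine: "oddper2 m n X \<Longrightarrow> oddper2 (2 * m) n (op1 refine X)"
  unfolding oddper2_def op1_def[abs_def]
  by (auto intro: oddper_refine) (auto simp: refine_def oddper_def field_simps)

lemma oddper2_op2_refine: "oddper2 m n X \<Longrightarrow> oddper2 m (2 * n) (op2 refine X)"
  unfolding oddper2_def op2_def[abs_def]
  by (auto intro: oddper_refine) (auto simp: refine_def oddper_def field_simps)

lemma oddper2_op1_pair_avg: "oddper2 (2 * m) n X \<Longrightarrow> oddper2 m n (op1 pair_avg X)"
  unfolding oddper2_def op1_def[abs_def]
  by (auto intro: oddper_pair_avg) (auto simp: pair_avg_def oddper_def field_simps)

lemma oddper2_op2_pair_avg: "oddper2 m (2 * n) X \<Longrightarrow> oddper2 m n (op2 pair_avg X)"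
  unfolding oddper2_def op2_def[abs_def]
  by (auto intro: oddper_pair_avg) (auto simp: pair_avg_def oddper_def field_simps)

lemma oddper_bdry: "n > 0 \<Longrightarrow> oddper n (bdry n f)"
  by (simp add: bdry_def oddper_oddext)

lemma bdry_ext: "n > 0 \<Longrightarrow> (\<And>k. oddper m (Z k)) \<Longrightarrow> oddper m (\<lambda>l. bdry n (\<lambda>i. Z i l) k)"
  by (auto simp: bdry_def oddext_def Let_def oddper_def)

lemma detail_ext: "n > 0 \<Longrightarrow> (\<And>k. oddper m (Z k)) \<Longrightarrow> oddper m (\<lambda>l. detail n (\<lambda>i. Z i l) k)"
  by (auto simp: detail_def bdry_def oddext_def Let_def oddper_def)

lemma detail_ext2: "n > 0 \<Longrightarrow> (\<And>l. oddper m (\<lambda>k. Z k l)) \<Longrightarrow> oddper m (\<lambda>k. detail n (Z k) l)"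
  using detail_ext[of n m "\<lambda>l k. Z k l" l] by simp

lemma oddper2_synth:
  assumes "n > 0" "oddper2 n n X" shows "oddper2 (2 * n) (2 * n) (synth n X a b c)"
proof -
  have 1: "oddper2 n (2 * n) (\<lambda>k l. op2 refine X k l + op2 (detail n) (op1 (bdry n) a) k l)"
  proof (rule oddper2_add)
    show "oddper2 n (2 * n) (op2 (detail n) (op1 (bdry n) a))"
      using assms(1) unfolding oddper2_def op2_def[abs_def] op1_def[abs_def]
      by (auto intro!: oddper_detail detail_ext2 oddper_bdry)
  qed (rule oddper2_op2_refine[OF assms(2)])
  have 2: "oddper (2 * n) (\<lambda>l. op2 refine (op2 (bdry n) b) k l + op2 (detail n) c k l)" for k
    unfolding op2_def using assms(1) by (intro oddper_add oddper_refine oddper_bdry oddper_detail)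
  have "oddper2 (2 * n) (2 * n) (op1 (detail n) (\<lambda>k l. op2 refine (op2 (bdry n) b) k l + op2 (detail n) c k l))"
    using assms(1) 2 unfolding oddper2_def op1_def[abs_def] by (auto intro!: oddper_detail detail_ext)
  with oddper2_op1_refine[OF 1] show ?thesis unfolding synth_def by (rule oddper2_add)
qed

lemma sq_bdry_ge: "sq n f \<le> sq n (bdry n f)"
  unfolding sq_def
proof (intro sum_mono)
  fix k assume k: "k \<in> {1..n}"
  have "1 * (f k)\<^sup>2 \<le> (if k = 1 \<or> k = n then 3 / 2 else 1)\<^sup>2 * (f k)\<^sup>2"
    by (intro mult_right_mono) (auto simp: power2_eq_square)
  then show "(f k)\<^sup>2 \<le> (bdry n f k)\<^sup>2" by (simp add: bdry_def oddext_eq[OF k] power_mult_distrib)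
qed

lemma sq_bdry_le: "sq n (bdry n f) \<le> 9 / 4 * sq n f"
  unfolding sq_def sum_distrib_left
proof (intro sum_mono)
  fix k assume k: "k \<in> {1..n}"
  have "(if k = 1 \<or> k = n then 3 / 2 else 1)\<^sup>2 * (f k)\<^sup>2 \<le> 9 / 4 * (f k)\<^sup>2"
    by (intro mult_right_mono) (auto simp: power2_eq_square)
  then show "(bdry n f k)\<^sup>2 \<le> 9 / 4 * (f k)\<^sup>2" by (simp add: bdry_def oddext_eq[OF k] power_mult_distrib)
qed

text \<open>The one-dimensional splitting is undone twice: along the first index it bounds
  \<open>U\<close> and \<open>V\<close>, along the second index of these it bounds \<open>a\<close>,
  \<open>b\<close>, \<open>c\<close>. The constant is 17 * 8 + 8 * 17 + 17 * 17.\<close>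

lemma synth_coeffs_le:
  assumes n: "n \<ge> 2" and X: "oddper2 n n X"
  shows "coef_norm n a b c \<le> 561 * sq2 (2 * n) (2 * n) (synth n X a b c)"
proof -
  let ?S = "synth n X a b c"
  define U where "U = (\<lambda>k l. op2 refine X k l + op2 (detail n) (op1 (bdry n) a) k l)"
  define V where "V = (\<lambda>k l. op2 refine (op2 (bdry n) b) k l + op2 (detail n) c k l)"
  have S: "?S k l = refine (\<lambda>i. U i l) k + detail n (\<lambda>i. V i l) k" for k l
    by (simp add: synth_def U_def V_def op1_def)
  have Uodd: "oddper n (\<lambda>i. U i l)" for l
  proof -
    have "oddper2 n (2 * n) (op2 (detail n) (op1 (bdry n) a))"
      using n unfolding oddper2_def op2_def[abs_def] op1_def[abs_def]
      by (auto intro!: oddper_detail detail_ext2 oddper_bdry)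
    from oddper2D(1)[OF this] oddper2D(1)[OF oddper2_op2_refine[OF X]] show ?thesis
      unfolding U_def by (rule oddper_add[rotated])
  qed
  have "sq2 n (2 * n) U \<le> 8 * sq2 (2 * n) (2 * n) ?S"
    unfolding sq2_swap sum_distrib_left S by (intro sum_mono sq_coarse_le n Uodd)
  moreover have "sq2 n (2 * n) V \<le> 17 * sq2 (2 * n) (2 * n) ?S"
    unfolding sq2_swap sum_distrib_left S by (intro sum_mono sq_fine_le n Uodd)
  moreover have "sq2 n n (op1 (bdry n) a) \<le> 17 * sq2 n (2 * n) U"
    unfolding sq2_def sum_distrib_left
  proof (intro sum_mono)
    fix k show "sq n (op1 (bdry n) a k) \<le> 17 * sq (2 * n) (U k)"
      using sq_fine_le[OF n oddper2D(2)[OF X], of "op1 (bdry n) a k" k] by (simp add: U_def op2_def)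
  qed
  moreover have "sq2 n n (op2 (bdry n) b) \<le> 8 * sq2 n (2 * n) V"
    unfolding sq2_def sum_distrib_left
  proof (intro sum_mono)
    fix k show "sq n (op2 (bdry n) b k) \<le> 8 * sq (2 * n) (V k)"
      using sq_coarse_le[OF n, of "op2 (bdry n) b k" "c k"] n by (simp add: V_def op2_def[abs_def] oddper_bdry)
  qed
  moreover have "sq2 n n c \<le> 17 * sq2 n (2 * n) V"
    unfolding sq2_def sum_distrib_left
  proof (intro sum_mono)
    fix k show "sq n (c k) \<le> 17 * sq (2 * n) (V k)"
      using sq_fine_le[OF n, of "op2 (bdry n) b k" "c k"] n by (simp add: V_def op2_def[abs_def] oddper_bdry)
  qed
  moreover have "sq2 n n a \<le> sq2 n n (op1 (bdry n) a)"
    unfolding sq2_swap op1_def[abs_def] by (intro sum_mono sq_bdry_ge)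
  moreover have "sq2 n n b \<le> sq2 n n (op2 (bdry n) b)"
    unfolding sq2_def op2_def[abs_def] by (intro sum_mono sq_bdry_ge)
  ultimately show ?thesis unfolding coef_norm_def by linarith
qed

text \<open>The dual norm: comparable with \<open>sq2 n n X\<close>, but taken after
  \<open>tri\<close> in both variables, because exactly this array is what \<open>dual_avg\<close>
  in both variables yields on the next finer level. Only so does coarsening become a contraction;
  comparability alone would lose a constant at every level.\<close>

definition dual_energy :: "int \<Rightarrow> (int \<Rightarrow> int \<Rightarrow> real) \<Rightarrow> real" where
  "dual_energy n X = sq2 n n (op1 (tri n) (op2 (tri n) X))"

lemma dual_energy_bounds:
  assumes n: "n \<ge> 2" and X: "oddper2 n n X"
  shows "81 * sq2 n n X \<le> dual_energy n X" "dual_energy n X \<le> 4096 * sq2 n n X"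
proof -
  note o = oddperD(3,4)[OF oddper2D(1)[OF X]] oddperD(3,4)[OF oddper2D(2)[OF X]]
  have 1: "op2 (tri n) X 0 l = - op2 (tri n) X 1 l" "op2 (tri n) X (n + 1) l = - op2 (tri n) X n l" for l
    using o(1,2) by (auto simp: op2_def tri_def)
  have a: "9 * sq2 n n (op2 (tri n) X) \<le> dual_energy n X"
    unfolding dual_energy_def sq2_swap sum_distrib_left op1_def[abs_def]
    by (intro sum_mono tri_ge n) (use 1 in auto)
  have b: "dual_energy n X \<le> 64 * sq2 n n (op2 (tri n) X)"
    unfolding dual_energy_def by (intro sq2_op1 tri_le n) (use 1 in auto)
  have c: "9 * sq2 n n X \<le> sq2 n n (op2 (tri n) X)"
    unfolding sq2_def sum_distrib_left op2_def[abs_def] by (intro sum_mono tri_ge n) (use o in auto)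
  have d: "sq2 n n (op2 (tri n) X) \<le> 64 * sq2 n n X"
    by (intro sq2_op2 tri_le n) (use o in auto)
  show "81 * sq2 n n X \<le> dual_energy n X" using a c by linarith
  show "dual_energy n X \<le> 4096 * sq2 n n X" using b d by linarith
qed

text \<open>Biorthogonality in both variables expresses the left-hand side by the fine array; then
  the one-dimensional contraction is applied once per variable, and 361/400 = (19/20)^2.\<close>

lemma dual_energy_contraction:
  assumes n: "n \<ge> 2" and X: "oddper2 n n X"
  shows "dual_energy n X \<le> 361 / 400 * dual_energy (2 * n) (synth n X a b c)"
proof -
  let ?S = "synth n X a b c"
  have So: "oddper2 (2 * n) (2 * n) ?S" using oddper2_synth[OF _ X] n by simp
  define U where "U = (\<lambda>k l. op2 refine X k l + op2 (detail n) (op1 (bdry n) a) k l)"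
  define V where "V = (\<lambda>k l. op2 refine (op2 (bdry n) b) k l + op2 (detail n) c k l)"
  have S: "?S k l = refine (\<lambda>i. U i l) k + detail n (\<lambda>i. V i l) k" for k l
    by (simp add: synth_def U_def V_def op1_def)
  have Uodd: "oddper n (\<lambda>i. U i l)" for l
  proof -
    have "oddper2 n (2 * n) (op2 (detail n) (op1 (bdry n) a))"
      using n unfolding oddper2_def op2_def[abs_def] op1_def[abs_def]
      by (auto intro!: oddper_detail detail_ext2 oddper_bdry)
    from oddper2D(1)[OF this] oddper2D(1)[OF oddper2_op2_refine[OF X]] show ?thesis
      unfolding U_def by (rule oddper_add[rotated])
  qed
  have e: "op1 (tri n) (op2 (tri n) X) k l = op2 (dual_avg n) (op1 (dual_avg n) ?S) k l"
    if k: "k \<in> {1..n}" and l: "l \<in> {1..n}" for k l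
  proof -
    have 1: "op1 (dual_avg n) ?S k l = op1 (tri n) U k l" for l
      unfolding op1_def S by (rule dual_avg_refine_detail[OF n Uodd k])
    have 2: "dual_avg n (U i) l = tri n (X i) l" for i
      unfolding U_def op2_def by (rule dual_avg_refine_detail[OF n oddper2D(2)[OF X] l])
    have "op2 (dual_avg n) (op1 (dual_avg n) ?S) k l = op2 (dual_avg n) (op1 (tri n) U) k l"
      unfolding op2_def using 1 by presburger
    also have "\<dots> = op1 (tri n) (op2 (tri n) X) k l"
      unfolding op_commute[symmetric] unfolding op1_def op2_def 2 ..
    finally show ?thesis by simp
  qed
  have "dual_energy n X = sq2 n n (op2 (dual_avg n) (op1 (dual_avg n) ?S))"
    unfolding dual_energy_def sq2_def sq_def using e by (intro sum.cong refl) auto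
  also have "\<dots> \<le> 19 / 20 * sq2 n (2 * n) (op2 (tri (2 * n)) (op1 (dual_avg n) ?S))"
    unfolding sq2_def sum_distrib_left op2_def[abs_def]
    by (intro sum_mono dual_avg_contraction n)
      (use oddperD(3,4)[OF oddper2D(2)[OF So]] in \<open>auto simp: op1_def dual_avg_def\<close>)
  also have "op2 (tri (2 * n)) (op1 (dual_avg n) ?S) = op1 (dual_avg n) (op2 (tri (2 * n)) ?S)"
    by (simp add: op_commute)
  also have "sq2 n (2 * n) \<dots> \<le> 19 / 20 * dual_energy (2 * n) ?S"
    unfolding sq2_swap dual_energy_def sum_distrib_left op1_def[abs_def]
    by (intro sum_mono dual_avg_contraction n)
      (use oddperD(3,4)[OF oddper2D(1)[OF So]] in \<open>auto simp: op2_def tri_def\<close>)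
  finally show ?thesis by simp
qed

text \<open>Averaging in the differentiated variable costs a factor 2, averaging in the other one
  gains 1/2. The two-dimensional defect is the defect in the first variable plus the refined average
  of the defect in the second, and both are paid for by \<open>pair_avg_energy\<close>.\<close>

lemma energy_pair_avg:
  assumes N: "N \<ge> 0" and p1: "\<And>k l. x (k + 2 * N) l = x k l" and p2: "\<And>k l. x k (l + 2 * N) = x k l"
  defines "y \<equiv> op1 pair_avg (op2 pair_avg x)"
  shows "energy N y \<le> energy (2 * N) x - 1 / 2 * sq2 (2 * N) (2 * N) (\<lambda>k l. x k l - op1 refine (op2 refine y) k l)"
proof -
  let ?r = "\<lambda>f m. f m - refine (pair_avg f) m"
  have N2: "2 * N \<ge> 0" using N by simp
  have 1: "sq2 N N (op1 dif y) \<le> sq2 (2 * N) (2 * N) (op1 dif x) - sq2 (2 * N) (2 * N) (op1 ?r x)"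
  proof -
    have "sq2 N N (op1 dif y) = sq2 N N (op2 pair_avg (op1 dif (op1 pair_avg x)))"
      unfolding y_def op_commute(2) op_commute_dif ..
    also have "\<dots> \<le> 1 / 2 * sq2 N (2 * N) (op1 dif (op1 pair_avg x))"
      by (intro sq2_op2 sq_pair_avg N)
    also have "sq2 N (2 * N) (op1 dif (op1 pair_avg x)) + 2 * sq2 (2 * N) (2 * N) (op1 ?r x) 
       \<le> 2 * sq2 (2 * N) (2 * N) (op1 dif x)"
      unfolding sq2_swap sum_distrib_left sum.distrib[symmetric] op1_def[abs_def]
      by (intro sum_mono pair_avg_energy N p1)
    then have "1 / 2 * sq2 N (2 * N) (op1 dif (op1 pair_avg x)) \<le> sq2 (2 * N) (2 * N) (op1 dif x) - sq2 (2 * N) (2 * N) (op1 ?r x)"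
      by simp
    finally show ?thesis .
  qed
  have 2: "sq2 N N (op2 dif y) \<le> sq2 (2 * N) (2 * N) (op2 dif x) - sq2 (2 * N) (2 * N) (op2 ?r x)"
  proof -
    have "sq2 N N (op2 dif y) = sq2 N N (op1 pair_avg (op2 dif (op2 pair_avg x)))"
      unfolding y_def op_commute_dif ..
    also have "\<dots> \<le> 1 / 2 * sq2 (2 * N) N (op2 dif (op2 pair_avg x))"
      by (intro sq2_op1 sq_pair_avg N)
    also have "sq2 (2 * N) N (op2 dif (op2 pair_avg x)) + 2 * sq2 (2 * N) (2 * N) (op2 ?r x) 
       \<le> 2 * sq2 (2 * N) (2 * N) (op2 dif x)"
      unfolding sq2_def sum_distrib_left sum.distrib[symmetric] op2_def[abs_def]
      by (intro sum_mono pair_avg_energy N p2)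
    then have "1 / 2 * sq2 (2 * N) N (op2 dif (op2 pair_avg x)) \<le> sq2 (2 * N) (2 * N) (op2 dif x) - sq2 (2 * N) (2 * N) (op2 ?r x)"
      by simp
    finally show ?thesis .
  qed
  have q: "(\<lambda>k l. x k l - op1 refine (op2 refine y) k l)
      = (\<lambda>k l. op1 ?r x k l + op1 refine (op1 pair_avg (op2 ?r x)) k l)"
    unfolding y_def
    by (simp add: fun_eq_iff op1_def op2_def refine_def pair_avg_def field_simps)
  have pr: "op2 ?r x (k + 2 * N) l = op2 ?r x k l" for k l
    by (simp add: op2_def refine_def pair_avg_def p1)
  have pp: "op1 pair_avg (op2 ?r x) (k + N) l = op1 pair_avg (op2 ?r x) k l" for k l
    using pr[of "2 * k" l] pr[of "2 * k - 1" l] by (simp add: op1_def pair_avg_def algebra_simps)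
  have "sq2 (2 * N) (2 * N) (op1 refine (op1 pair_avg (op2 ?r x))) \<le> 2 * sq2 N (2 * N) (op1 pair_avg (op2 ?r x))"
    by (intro sq2_op1 sq_refine N pp)
  also have "sq2 N (2 * N) (op1 pair_avg (op2 ?r x)) \<le> 1 / 2 * sq2 (2 * N) (2 * N) (op2 ?r x)"
    by (intro sq2_op1 sq_pair_avg N)
  finally have "sq2 (2 * N) (2 * N) (\<lambda>k l. x k l - op1 refine (op2 refine y) k l)
      \<le> 2 * sq2 (2 * N) (2 * N) (op1 ?r x) + 2 * sq2 (2 * N) (2 * N) (op2 ?r x)"
    using sq2_add_le[of "2 * N" "2 * N" "op1 ?r x" "op1 refine (op1 pair_avg (op2 ?r x))"] unfolding q by linarith
  then show ?thesis using 1 2 unfolding energy_def by linarith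
qed

section \<open>The discrete Riesz inequalities\<close>

lemma tri_add: "tri n (\<lambda>k. f k + g k) k = tri n f k + tri n g k"
  by (simp add: tri_def algebra_simps)

lemma tri_zero: "tri n (\<lambda>k. 0) k = 0"
  by (simp add: tri_def)

text \<open>Young's inequality with parameter 1/20, so close to one that 361/400 * 21/20 stays below
  95/100.\<close>

lemma dual_energy_triangle:
  "dual_energy n (\<lambda>k l. X k l + Y k l) \<le> 21 / 20 * dual_energy n X + 21 * dual_energy n Y"
proof -
  have e: "op1 (tri n) (op2 (tri n) (\<lambda>k l. X k l + Y k l)) k l
     = op1 (tri n) (op2 (tri n) X) k l + op1 (tri n) (op2 (tri n) Y) k l" for k l
    by (simp add: op1_def op2_def tri_add)
  have "(u + v)\<^sup>2 \<le> 21 / 20 * u\<^sup>2 + 21 * v\<^sup>2" for u v :: real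
    using zero_le_power2[of "u - 20 * v"] by (simp add: power2_eq_square algebra_simps)
  then show ?thesis unfolding dual_energy_def sq2_def sq_def e sum_distrib_left sum.distrib[symmetric]
    by (intro sum_mono)
qed

lemma sq2_mono:
  assumes "m \<le> n" shows "sq2 m m X \<le> sq2 n n X"
proof -
  have "sq2 m m X \<le> (\<Sum>k\<in>{1..m}. sq n (X k))" unfolding sq2_def sq_def
    using assms by (intro sum_mono sum_mono2) auto
  also have "\<dots> \<le> sq2 n n X" unfolding sq2_def using assms by (intro sum_mono2) auto
  finally show ?thesis .
qed

text \<open>With \<open>?d = X - y\<close> the old mismatch \<open>?D\<close> and the averaging
  defect \<open>q\<close> add up to \<open>synth n ?d a b c\<close>; hence both the new mismatch and
  the wavelet coefficients are controlled by \<open>?D\<close> and \<open>q\<close>. The energy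
  supplies half of \<open>?Q\<close>, against 78000 / 10^6 and 1122 / 10^9; the dual energy supplies
  5/100 of its weight 1/10^6, against 14 / 10^9.\<close>

lemma lower_step:
  assumes n: "n \<ge> 2" and X: "oddper2 n n X" and x: "oddper2 (2 * n) (2 * n) x"
  defines "y \<equiv> op1 pair_avg (op2 pair_avg x)"
  shows "energy (2 * n) y + 1 / 10 ^ 6 * dual_energy n (\<lambda>k l. X k l - y k l) + 1 / 10 ^ 9 * coef_norm n a b c
    \<le> energy (2 * (2 * n)) x + 1 / 10 ^ 6 * dual_energy (2 * n) (\<lambda>k l. synth n X a b c k l - x k l)"
proof -
  define q where "q = (\<lambda>k l. x k l - op1 refine (op2 refine y) k l)"
  let ?D = "\<lambda>k l. synth n X a b c k l - x k l"
  let ?d = "\<lambda>k l. X k l - y k l"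
  let ?Q = "sq2 (2 * (2 * n)) (2 * (2 * n)) q"
  have y: "oddper2 n n y" unfolding y_def by (intro oddper2_op1_pair_avg oddper2_op2_pair_avg x)
  have d: "oddper2 n n ?d" by (intro oddper2_diff X y)
  have qo: "oddper2 (2 * n) (2 * n) q" unfolding q_def
    by (intro oddper2_diff x oddper2_op1_refine oddper2_op2_refine y)
  have Do: "oddper2 (2 * n) (2 * n) ?D" using oddper2_synth[OF _ X] x n by (intro oddper2_diff) auto
  \<comment> \<open>Linearity: \<open>synth\<close> applied to \<open>y\<close> without wavelets is
    the refinement of \<open>y\<close> in both variables.\<close>
  have S: "synth n ?d a b c = (\<lambda>k l. ?D k l + q k l)"
    unfolding q_def synth_def by (simp add: fun_eq_iff op1_def[of refine] op2_def[of refine] refine_def field_simps)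
  have Q: "sq2 (2 * n) (2 * n) q \<le> ?Q" using n by (intro sq2_mono) auto
  have n2: "2 \<le> 2 * n" using n by simp
  have Db: "81 * sq2 (2 * n) (2 * n) ?D \<le> dual_energy (2 * n) ?D"
    by (rule dual_energy_bounds(1)[OF n2 Do])
  have p: "(10::real) ^ 6 = 1000000" "(10::real) ^ 9 = 1000000000" by simp_all
  have E: "energy (2 * n) y \<le> energy (2 * (2 * n)) x - 1 / 2 * ?Q"
    unfolding q_def y_def
  proof (rule energy_pair_avg)
    show "x (k + 2 * (2 * n)) l = x k l" for k l using oddperD(1)[OF oddper2D(1)[OF x]] by auto
    show "x k (l + 2 * (2 * n)) = x k l" for k l using oddperD(1)[OF oddper2D(2)[OF x]] by auto
  qed (use n in auto)
  have "dual_energy n ?d \<le> 361 / 400 * dual_energy (2 * n) (\<lambda>k l. ?D k l + q k l)"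
    using dual_energy_contraction[OF n d, of a b c] unfolding S .
  also have "dual_energy (2 * n) (\<lambda>k l. ?D k l + q k l) \<le> 21 / 20 * dual_energy (2 * n) ?D + 21 * dual_energy (2 * n) q"
    by (rule dual_energy_triangle)
  also have "dual_energy (2 * n) q \<le> 4096 * sq2 (2 * n) (2 * n) q"
    using dual_energy_bounds(2)[OF _ qo] n by simp
  finally have "dual_energy n ?d \<le> 361 / 400 * (21 / 20 * dual_energy (2 * n) ?D + 21 * (4096 * sq2 (2 * n) (2 * n) q))"
    by simp
  \<comment> \<open>361/400 * 21/20 and 361/400 * 21 * 4096, both rounded up. The defect is enlarged
    from a quarter of a period to the full period, where the energy estimate provides it.\<close>
  then have F: "dual_energy n ?d \<le> 95 / 100 * dual_energy (2 * n) ?D + 78000 * ?Q"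
    using Q sq2_nonneg[of "2 * n" "2 * n" q] Db sq2_nonneg[of "2 * n" "2 * n" ?D] by argo
  have "coef_norm n a b c \<le> 561 * sq2 (2 * n) (2 * n) (\<lambda>k l. ?D k l + q k l)"
    using synth_coeffs_le[OF n d, of a b c] unfolding S .
  also have "\<dots> \<le> 561 * (2 * sq2 (2 * n) (2 * n) ?D + 2 * sq2 (2 * n) (2 * n) q)"
    by (intro mult_left_mono sq2_add_le) simp
  \<comment> \<open>561 * 2 / 81 is below 14, and 561 * 2 = 1122.\<close>
  finally have "coef_norm n a b c \<le> 14 * dual_energy (2 * n) ?D + 1122 * ?Q"
    using Q Db sq2_nonneg[of "2 * n" "2 * n" ?D] by argo
  with E F show ?thesis
    unfolding p using sq2_nonneg[of "2 * n" "2 * n" ?D] Db sq2_nonneg[of "2 * (2 * n)" "2 * (2 * n)" q] by argo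
qed

text \<open>A crude Poincare inequality on the coarsest level: oddness gives
  \<open>dif c 8 = 2 * c 1\<close>, so \<open>c 1\<close> and, one after the other,
  \<open>c 2\<close>, \<open>c 3\<close>, \<open>c 4\<close> are bounded by differences.\<close>

lemma discrete_lower_base:
  assumes x: "oddper2 4 4 x"
  shows "sq2 4 4 x \<le> 100 * energy 8 x"
proof -
  have 1: "sq 4 c \<le> 100 * sq 8 (dif c)" if "oddper 4 c" for c
  proof -
    have I: "{1..4::int} = {1,2,3,4}" "{1..8::int} = {1,2,3,4,5,6,7,8}" by auto
    have d8: "dif c 8 = 2 * c 1" using oddperD(1)[OF that, of 1] oddperD(1)[OF that, of 0] oddperD(3)[OF that] by (simp add: dif_def)
    have s: "(u + v)\<^sup>2 \<le> 2 * u\<^sup>2 + 2 * v\<^sup>2" for u v :: real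
      using sum_squares_bound[of u v] by (simp add: power2_sum)
    have c2: "(c 2)\<^sup>2 \<le> 2 * (c 1)\<^sup>2 + 2 * (dif c 1)\<^sup>2" using s[of "c 1" "dif c 1"] by (simp add: dif_def)
    have c3: "(c 3)\<^sup>2 \<le> 2 * (c 2)\<^sup>2 + 2 * (dif c 2)\<^sup>2" using s[of "c 2" "dif c 2"] by (simp add: dif_def)
    have c4: "(c 4)\<^sup>2 \<le> 2 * (c 3)\<^sup>2 + 2 * (dif c 3)\<^sup>2" using s[of "c 3" "dif c 3"] by (simp add: dif_def)
    have "sq 8 (dif c) \<ge> (dif c 1)\<^sup>2 + (dif c 2)\<^sup>2 + (dif c 3)\<^sup>2 + 4 * (c 1)\<^sup>2"
      unfolding sq_def I by (simp add: d8)
    moreover have "sq 4 c = (c 1)\<^sup>2 + (c 2)\<^sup>2 + (c 3)\<^sup>2 + (c 4)\<^sup>2" unfolding sq_def I by simp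
    ultimately show ?thesis using c2 c3 c4 zero_le_power2[of "c 1"] zero_le_power2[of "dif c 1"] 
       zero_le_power2[of "dif c 2"] zero_le_power2[of "dif c 3"] by linarith
  qed
  have "sq2 4 4 x \<le> (\<Sum>k\<in>{1..4}. 100 * sq 8 (dif (x k)))"
    unfolding sq2_def by (intro sum_mono 1 oddper2D(2)[OF x])
  also have "\<dots> \<le> (\<Sum>k\<in>{1..8}. 100 * sq 8 (dif (x k)))"
    by (intro sum_mono2) auto
  also have "\<dots> = 100 * sq2 8 8 (op2 dif x)" by (simp add: sq2_def op2_def[abs_def] sum_distrib_left)
  finally show ?thesis using sq2_nonneg[of 8 8 "op1 dif x"] unfolding energy_def by argo
qed

definition chain :: "nat \<Rightarrow> (nat \<Rightarrow> int \<Rightarrow> int \<Rightarrow> real) \<Rightarrow> (nat \<Rightarrow> int \<Rightarrow> int \<Rightarrow> real) \<Rightarrow>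
    (nat \<Rightarrow> int \<Rightarrow> int \<Rightarrow> real) \<Rightarrow> (nat \<Rightarrow> int \<Rightarrow> int \<Rightarrow> real) \<Rightarrow> bool" where
  "chain J X a b c \<longleftrightarrow> oddper2 4 4 (X 2) \<and>
     (\<forall>j. 2 \<le> j \<and> j < J \<longrightarrow> X (Suc j) = synth (2 ^ j) (X j) (a j) (b j) (c j))"

definition total_norm :: "nat \<Rightarrow> (nat \<Rightarrow> int \<Rightarrow> int \<Rightarrow> real) \<Rightarrow> (nat \<Rightarrow> int \<Rightarrow> int \<Rightarrow> real) \<Rightarrow>
    (nat \<Rightarrow> int \<Rightarrow> int \<Rightarrow> real) \<Rightarrow> (nat \<Rightarrow> int \<Rightarrow> int \<Rightarrow> real) \<Rightarrow> real" where
  "total_norm J X a b c = sq2 4 4 (X 2) + (\<Sum>j=2..<J. coef_norm (2 ^ j) (a j) (b j) (c j))"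

lemma chain_oddper2:
  assumes "chain J X a b c" "2 \<le> j" "j \<le> J"
  shows "oddper2 (2 ^ j) (2 ^ j) (X j)"
  using assms(2,3)
proof (induction j rule: dec_induct)
  case base then show ?case using assms(1) by (simp add: chain_def)
next
  case (step j)
  then show ?case using assms(1) oddper2_synth[of "2 ^ j" "X j"] by (simp add: chain_def)
qed

text \<open>The competitor \<open>x\<close> is arbitrary so that the induction can pass to its pair averages; \<open>x = X J\<close> gives
  the estimate that is needed.\<close>

lemma discrete_lower_aux:
  assumes "chain J X a b c" "2 \<le> J" "oddper2 (2 ^ J) (2 ^ J) x"
  shows "1 / 10 ^ 9 * total_norm J X a b c \<le> energy (2 * 2 ^ J) x + 1 / 10 ^ 6 * dual_energy (2 ^ J) (\<lambda>k l. X J k l - x k l)"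
  using assms(2,1,3)
proof (induction J arbitrary: x rule: dec_induct)
  case base
  have X: "oddper2 4 4 (X 2)" and x: "oddper2 4 4 x" using base by (auto simp: chain_def)
  have "sq2 4 4 (X 2) = sq2 4 4 (\<lambda>k l. (X 2 k l - x k l) + x k l)" by simp
  also have "\<dots> \<le> 2 * sq2 4 4 (\<lambda>k l. X 2 k l - x k l) + 2 * sq2 4 4 x" by (rule sq2_add_le)
  finally have "sq2 4 4 (X 2) \<le> 2 * sq2 4 4 (\<lambda>k l. X 2 k l - x k l) + 200 * energy 8 x" 
    using discrete_lower_base[OF x] by linarith
  moreover have "81 * sq2 4 4 (\<lambda>k l. X 2 k l - x k l) \<le> dual_energy 4 (\<lambda>k l. X 2 k l - x k l)"
    by (intro dual_energy_bounds oddper2_diff X x) simp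
  moreover have "energy 8 x \<ge> 0" "sq2 4 4 (\<lambda>k l. X 2 k l - x k l) \<ge> 0" by (auto simp: energy_def)
  moreover have "total_norm 2 X a b c = sq2 4 4 (X 2)" by (simp add: total_norm_def)
  moreover have p: "(10::real) ^ 6 = 1000000" "(10::real) ^ 9 = 1000000000" "(2::int)\<^sup>2 = 4" by simp_all
  moreover have q: "(2::int) * 4 = 8" by simp
  ultimately show ?case unfolding p q by argo
next
  case (step J)
  define y where "y = op1 pair_avg (op2 pair_avg x)"
  have c: "chain J X a b c" using step.prems(1) by (simp add: chain_def)
  have X: "oddper2 (2 ^ J) (2 ^ J) (X J)" by (rule chain_oddper2[OF c step.hyps(1)]) simp
  have x: "oddper2 (2 * 2 ^ J) (2 * 2 ^ J) x" using step.prems(2) by simp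
  have y: "oddper2 (2 ^ J) (2 ^ J) y" unfolding y_def
    by (intro oddper2_op1_pair_avg oddper2_op2_pair_avg x)
  have J2: "(2::int) \<le> 2 ^ J" using step.hyps(1) power_increasing[of 1 J "2::int"] by simp
  have "X (Suc J) = synth (2 ^ J) (X J) (a J) (b J) (c J)"
    using step.prems(1) step.hyps(1) by (simp add: chain_def)
  then have "energy (2 * 2 ^ J) y + 1 / 10 ^ 6 * dual_energy (2 ^ J) (\<lambda>k l. X J k l - y k l) + 1 / 10 ^ 9 * coef_norm (2 ^ J) (a J) (b J) (c J)
    \<le> energy (2 * 2 ^ Suc J) x + 1 / 10 ^ 6 * dual_energy (2 ^ Suc J) (\<lambda>k l. X (Suc J) k l - x k l)"
    using lower_step[OF J2 X x, of "a J" "b J" "c J"] unfolding y_def by simp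
  moreover have "1 / 10 ^ 9 * total_norm J X a b c \<le> energy (2 * 2 ^ J) y + 1 / 10 ^ 6 * dual_energy (2 ^ J) (\<lambda>k l. X J k l - y k l)"
    by (rule step.IH[OF c y])
  moreover have "total_norm (Suc J) X a b c = total_norm J X a b c + coef_norm (2 ^ J) (a J) (b J) (c J)"
    using step.hyps(1) by (simp add: total_norm_def)
  moreover have p: "(10::real) ^ 6 = 1000000" "(10::real) ^ 9 = 1000000000" by simp_all
  ultimately show ?case unfolding p by argo
qed

theorem discrete_lower:
  assumes "chain J X a b c" "2 \<le> J"
  shows "total_norm J X a b c \<le> 10 ^ 9 * energy (2 * 2 ^ J) (X J)"
proof -
  have z: "dual_energy (2 ^ J) (\<lambda>k l. X J k l - X J k l) = 0"
    by (simp add: dual_energy_def op1_def[abs_def] op2_def[abs_def] tri_zero sq2_def sq_def)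
  show ?thesis
    using discrete_lower_aux[OF assms chain_oddper2[OF assms(1,2)]] unfolding z by (simp add: field_simps)
qed

section \<open>The upper inequality\<close>

definition curv :: "int \<Rightarrow> (int \<Rightarrow> int \<Rightarrow> real) \<Rightarrow> real" where
  "curv N X = sq2 N N (op1 ddif X) + sq2 N N (op2 ddif X)"

lemma sq2_detail_synth:
  assumes n: "n \<ge> 2"
  fixes a b c defines "W \<equiv> synth n (\<lambda>k l. 0) a b c"
  shows "sq2 (2 * (2 * n)) (2 * (2 * n)) W \<le> 1000 * coef_norm n a b c"
proof -
  have n0: "n \<ge> 0" "n > 0" using n by auto
  have W: "oddper2 (2 * n) (2 * n) W" unfolding W_def
    by (intro oddper2_synth n0) (simp add: oddper2_def oddper_zero)
  define U where "U = op2 (detail n) (op1 (bdry n) a)"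
  define V1 where "V1 = op2 refine (op2 (bdry n) b)" 
  define V2 where "V2 = op2 (detail n) c"
  have We: "W = (\<lambda>k l. op1 refine U k l + op1 (detail n) (\<lambda>k l. V1 k l + V2 k l) k l)"
    unfolding W_def synth_def U_def V1_def V2_def by (simp add: fun_eq_iff op1_def op2_def refine_def)
  \<comment> \<open>The square of a full period consists of four mirror images of the quarter that
    carries the free coefficients.\<close>
  have "sq2 (2 * (2 * n)) (2 * (2 * n)) W = 4 * sq2 (2 * n) (2 * n) W"
  proof -
    have "sq2 (2 * (2 * n)) (2 * (2 * n)) W = (\<Sum>k\<in>{1..2 * (2 * n)}. 2 * sq (2 * n) (W k))"
      unfolding sq2_def using n oddper2D(2)[OF W] by (intro sum.cong refl sq_oddper) auto
    also have "\<dots> = 2 * (\<Sum>k\<in>{1..2 * (2 * n)}. 2 * sq (2 * n) (W k)) / 2"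
      by simp
    also have "(\<Sum>k\<in>{1..2 * (2 * n)}. 2 * sq (2 * n) (W k)) = 2 * (2 * sq2 (2 * n) (2 * n) W)"
    proof -
      have "(\<Sum>k\<in>{1..2 * (2 * n)}. 2 * sq (2 * n) (W k)) = 2 * sq2 (2 * (2 * n)) (2 * n) W"
        by (simp add: sq2_def sum_distrib_left)
      also have "sq2 (2 * (2 * n)) (2 * n) W = (\<Sum>l\<in>{1..2 * n}. 2 * sq (2 * n) (\<lambda>k. W k l))"
        unfolding sq2_swap using n oddper2D(1)[OF W] by (intro sum.cong refl sq_oddper) auto
      also have "\<dots> = 2 * sq2 (2 * n) (2 * n) W" unfolding sq2_swap by (simp add: sum_distrib_left)
      finally show ?thesis .
    qed
    finally show ?thesis by simp
  qed
  also have "sq2 (2 * n) (2 * n) W \<le> 2 * sq2 (2 * n) (2 * n) (op1 refine U) + 2 * sq2 (2 * n) (2 * n) (op1 (detail n) (\<lambda>k l. V1 k l + V2 k l))"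
    unfolding We by (rule sq2_add_le)
  also have "sq2 (2 * n) (2 * n) (op1 refine U) \<le> 2 * sq2 n (2 * n) U"
  proof (intro sq2_op1 sq_refine_half n0)
    fix l show "oddper n (\<lambda>k. U k l)"
      unfolding U_def op2_def op1_def using n0 by (auto intro!: detail_ext2 oddper_bdry)
  qed
  also have "sq2 n (2 * n) U \<le> 5 * sq2 n n (op1 (bdry n) a)"
    unfolding U_def by (intro sq2_op2 sq_detail_le n0)
  also have "sq2 n n (op1 (bdry n) a) \<le> 9 / 4 * sq2 n n a" by (intro sq2_op1 sq_bdry_le)
  also have "sq2 (2 * n) (2 * n) (op1 (detail n) (\<lambda>k l. V1 k l + V2 k l)) \<le> 5 * sq2 n (2 * n) (\<lambda>k l. V1 k l + V2 k l)"
    by (intro sq2_op1 sq_detail_le n0)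
  also have "sq2 n (2 * n) (\<lambda>k l. V1 k l + V2 k l) \<le> 2 * sq2 n (2 * n) V1 + 2 * sq2 n (2 * n) V2"
    by (rule sq2_add_le)
  also have "sq2 n (2 * n) V1 \<le> 2 * sq2 n n (op2 (bdry n) b)"
    unfolding V1_def by (intro sq2_op2 sq_refine_half n0) (simp add: op2_def[abs_def] oddper_bdry n0)
  also have "sq2 n n (op2 (bdry n) b) \<le> 9 / 4 * sq2 n n b" by (intro sq2_op2 sq_bdry_le)
  also have "sq2 n (2 * n) V2 \<le> 5 * sq2 n n c" unfolding V2_def by (intro sq2_op2 sq_detail_le n0)
  finally have "sq2 (2 * (2 * n)) (2 * (2 * n)) W \<le> 180 * sq2 n n a + 360 * sq2 n n b + 400 * sq2 n n c"
    by (simp add: algebra_simps)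
  then show ?thesis using sq2_nonneg[of n n a] sq2_nonneg[of n n b] sq2_nonneg[of n n c] unfolding coef_norm_def by argo
qed

text \<open>Refinement does not increase the energy and reduces \<open>curv\<close> to a quarter.
  The cross term of the energies costs \<open>curv P\<close> once, the square of the sum inside
  \<open>curv\<close> costs it twice, so 3/4 of the old \<open>curv\<close> is consumed where one
  whole copy is available. The wavelet part enters only by its \<open>sq2\<close>, at most 80 times,
  and 80 * 1000 is below 10^6.\<close>

lemma upper_step:
  assumes n: "n \<ge> 2" and X: "oddper2 n n X"
  shows "energy (2 * (2 * n)) (synth n X a b c) + curv (2 * (2 * n)) (synth n X a b c)
    \<le> energy (2 * n) X + curv (2 * n) X + 10 ^ 6 * coef_norm n a b c"
proof -
  let ?N = "2 * n" and ?M = "2 * (2 * n)"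
  define P where "P = op1 refine (op2 refine X)"
  define W where "W = synth n (\<lambda>k l. 0) a b c"
  have n0: "n \<ge> 0" "n > 0" "?N \<ge> 0" "?M \<ge> 0" using n by auto
  have S: "synth n X a b c = (\<lambda>k l. P k l + W k l)"
    unfolding P_def W_def synth_def by (simp add: fun_eq_iff op1_def[of refine] op2_def[of refine] refine_def field_simps)
  have W: "oddper2 (2 * n) (2 * n) W" unfolding W_def
    by (intro oddper2_synth n0) (simp add: oddper2_def oddper_zero)
  have Po: "oddper2 (2 * n) (2 * n) P" unfolding P_def by (intro oddper2_op1_refine oddper2_op2_refine X)
  note pX = oddperD(1)[OF oddper2D(1)[OF X]] oddperD(1)[OF oddper2D(2)[OF X]]
  note pP = oddperD(1)[OF oddper2D(1)[OF Po]] oddperD(1)[OF oddper2D(2)[OF Po]]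
  note pW = oddperD(1)[OF oddper2D(1)[OF W]] oddperD(1)[OF oddper2D(2)[OF W]]
  let ?w = "sq2 ?M ?M W"
  have P1: "P = op1 refine (op2 refine X)" and P2: "P = op2 refine (op1 refine X)"
    by (simp_all add: P_def op_commute)
  have dX: "op1 dif X (k) (l + ?N) = op1 dif X k l" "op2 dif X (k + ?N) l = op2 dif X k l"
     "op1 ddif X (k) (l + ?N) = op1 ddif X k l" "op2 ddif X (k + ?N) l = op2 ddif X k l" for k l
    by (auto simp: op1_def op2_def dif_def ddif_def pX)
  have rX: "op2 refine X (k + ?N) l = op2 refine X k l" "op1 refine X k (l + ?N) = op1 refine X k l" for k l
    by (auto simp: op1_def op2_def refine_def pX)
  have e1: "sq2 ?M ?M (op1 dif P) \<le> sq2 ?N ?N (op1 dif X)"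
  proof -
    have "sq2 ?M ?M (op1 dif P) \<le> 2 * sq2 ?M ?N (op1 dif (op1 refine X))"
      unfolding P2 op_commute_dif using dX
      by (intro sq2_op2 sq_refine n0) (auto simp: op1_def dif_def rX[unfolded op1_def])
    also have "sq2 ?M ?N (op1 dif (op1 refine X)) \<le> 1 / 2 * sq2 ?N ?N (op1 dif X)"
      unfolding sq2_swap sum_distrib_left op1_def[abs_def] by (intro sum_mono sq_dif_refine n0 pX)
    finally show ?thesis by simp
  qed
  have e2: "sq2 ?M ?M (op2 dif P) \<le> sq2 ?N ?N (op2 dif X)"
  proof -
    have "sq2 ?M ?M (op2 dif P) \<le> 2 * sq2 ?N ?M (op2 dif (op2 refine X))"
      unfolding P1 op_commute_dif
      by (intro sq2_op1 sq_refine n0) (auto simp: op2_def dif_def rX[unfolded op2_def])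
    also have "sq2 ?N ?M (op2 dif (op2 refine X)) \<le> 1 / 2 * sq2 ?N ?N (op2 dif X)"
      unfolding sq2_def sum_distrib_left op2_def[abs_def] by (intro sum_mono sq_dif_refine n0 pX)
    finally show ?thesis by simp
  qed
  have c1: "sq2 ?M ?M (op1 ddif P) \<le> 1 / 4 * sq2 ?N ?N (op1 ddif X)"
  proof -
    have "sq2 ?M ?M (op1 ddif P) \<le> 2 * sq2 ?M ?N (op1 ddif (op1 refine X))"
      unfolding P2 op_commute_dif 
      by (intro sq2_op2 sq_refine n0) (auto simp: op1_def ddif_def rX[unfolded op1_def])
    also have "sq2 ?M ?N (op1 ddif (op1 refine X)) \<le> 1 / 8 * sq2 ?N ?N (op1 ddif X)"
      unfolding sq2_swap sum_distrib_left op1_def[abs_def] by (intro sum_mono sq_ddif_refine n0)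
    finally show ?thesis by simp
  qed
  have c2: "sq2 ?M ?M (op2 ddif P) \<le> 1 / 4 * sq2 ?N ?N (op2 ddif X)"
  proof -
    have "sq2 ?M ?M (op2 ddif P) \<le> 2 * sq2 ?N ?M (op2 ddif (op2 refine X))"
      unfolding P1 op_commute_dif
      by (intro sq2_op1 sq_refine n0) (auto simp: op2_def ddif_def rX[unfolded op2_def])
    also have "sq2 ?N ?M (op2 ddif (op2 refine X)) \<le> 1 / 8 * sq2 ?N ?N (op2 ddif X)"
      unfolding sq2_def sum_distrib_left op2_def[abs_def] by (intro sum_mono sq_ddif_refine n0)
    finally show ?thesis by simp
  qed
  have w1: "sq2 ?M ?M (op1 dif W) \<le> 4 * ?w" "sq2 ?M ?M (op1 ddif W) \<le> 16 * ?w"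
    by (intro sq2_op1 sq_dif_le sq_ddif_le n0 pW)+
  have w2: "sq2 ?M ?M (op2 dif W) \<le> 4 * ?w" "sq2 ?M ?M (op2 ddif W) \<le> 16 * ?w"
    by (intro sq2_op2 sq_dif_le sq_ddif_le n0 pW)+
  have cs: "- (2 * (d * w)) \<le> d\<^sup>2 + w\<^sup>2" for d w :: real
    using zero_le_power2[of "d + w"] unfolding power2_sum by simp
  \<comment> \<open>Summation by parts moves one difference from \<open>W\<close> to \<open>P\<close>: the cross term of the energies is
    controlled by the second differences of \<open>P\<close>, which lose the factor \<open>1/4\<close> under refinement.\<close>
  have x1: "sq2 ?M ?M (op1 dif (\<lambda>k l. P k l + W k l))
      \<le> sq2 ?M ?M (op1 dif P) + sq2 ?M ?M (op1 dif W) + sq2 ?M ?M (op1 ddif P) + ?w"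
  proof -
    have "sq ?M (dif (\<lambda>k. P k l + W k l)) \<le> sq ?M (dif (\<lambda>k. P k l)) + sq ?M (dif (\<lambda>k. W k l)) + sq ?M (ddif (\<lambda>k. P k l)) + sq ?M (\<lambda>k. W k l)" for l
    proof -
      have "sq ?M (dif (\<lambda>k. P k l + W k l)) = sq ?M (dif (\<lambda>k. P k l)) + sq ?M (dif (\<lambda>k. W k l)) + 2 * (\<Sum>k\<in>{1..?M}. dif (\<lambda>k. P k l) k * dif (\<lambda>k. W k l) k)"
        unfolding sq_def sum_distrib_left sum.distrib[symmetric]
        by (intro sum.cong refl) (simp add: dif_def power2_eq_square algebra_simps)
      also have "2 * (\<Sum>k\<in>{1..?M}. dif (\<lambda>k. P k l) k * dif (\<lambda>k. W k l) k) = (\<Sum>k\<in>{1..?M}. - (2 * (ddif (\<lambda>k. P k l) k * W k l)))"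
        using sum_dif_dif[of ?M "\<lambda>k. P k l" "\<lambda>k. W k l"] n0 pP pW by (simp add: sum_negf sum_distrib_left)
      also have "\<dots> \<le> sq ?M (ddif (\<lambda>k. P k l)) + sq ?M (\<lambda>k. W k l)"
        unfolding sq_def sum.distrib[symmetric] by (intro sum_mono cs)
      finally show ?thesis by simp
    qed
    then show ?thesis unfolding sq2_swap op1_def[abs_def] sum.distrib[symmetric] by (intro sum_mono)
  qed
  have x2: "sq2 ?M ?M (op2 dif (\<lambda>k l. P k l + W k l))
      \<le> sq2 ?M ?M (op2 dif P) + sq2 ?M ?M (op2 dif W) + sq2 ?M ?M (op2 ddif P) + ?w"
  proof -
    have "sq ?M (dif (\<lambda>l. P k l + W k l)) \<le> sq ?M (dif (P k)) + sq ?M (dif (W k)) + sq ?M (ddif (P k)) + sq ?M (W k)" for k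
    proof -
      have "sq ?M (dif (\<lambda>l. P k l + W k l)) = sq ?M (dif (P k)) + sq ?M (dif (W k)) + 2 * (\<Sum>l\<in>{1..?M}. dif (P k) l * dif (W k) l)"
        unfolding sq_def sum_distrib_left sum.distrib[symmetric]
        by (intro sum.cong refl) (simp add: dif_def power2_eq_square algebra_simps)
      also have "2 * (\<Sum>l\<in>{1..?M}. dif (P k) l * dif (W k) l) = (\<Sum>l\<in>{1..?M}. - (2 * (ddif (P k) l * W k l)))"
        using sum_dif_dif[of ?M "P k" "W k"] n0 pP pW by (simp add: sum_negf sum_distrib_left)
      also have "\<dots> \<le> sq ?M (ddif (P k)) + sq ?M (W k)"
        unfolding sq_def sum.distrib[symmetric] by (intro sum_mono cs)
      finally show ?thesis by simp
    qed
    then show ?thesis unfolding sq2_def op2_def[abs_def] sum.distrib[symmetric] by (intro sum_mono)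
  qed
  have y1: "sq2 ?M ?M (op1 ddif (\<lambda>k l. P k l + W k l)) \<le> 2 * sq2 ?M ?M (op1 ddif P) + 2 * sq2 ?M ?M (op1 ddif W)"
  proof -
    have "op1 ddif (\<lambda>k l. P k l + W k l) = (\<lambda>k l. op1 ddif P k l + op1 ddif W k l)"
      by (simp add: fun_eq_iff op1_def ddif_def algebra_simps)
    then show ?thesis using sq2_add_le by simp
  qed
  have y2: "sq2 ?M ?M (op2 ddif (\<lambda>k l. P k l + W k l)) \<le> 2 * sq2 ?M ?M (op2 ddif P) + 2 * sq2 ?M ?M (op2 ddif W)"
  proof -
    have "op2 ddif (\<lambda>k l. P k l + W k l) = (\<lambda>k l. op2 ddif P k l + op2 ddif W k l)"
      by (simp add: fun_eq_iff op2_def ddif_def algebra_simps)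
    then show ?thesis using sq2_add_le by simp
  qed
  have w: "?w \<le> 1000 * coef_norm n a b c" unfolding W_def by (rule sq2_detail_synth[OF n])
  have "energy ?M (synth n X a b c) + curv ?M (synth n X a b c) \<le> energy ?N X + curv ?N X + 80 * ?w"
    unfolding S energy_def curv_def using e1 e2 c1 c2 w1 w2 x1 x2 y1 y2 
      sq2_nonneg[of ?N ?N "op1 ddif X"] sq2_nonneg[of ?N ?N "op2 ddif X"] sq2_nonneg[of ?M ?M W] by argo
  moreover have p: "(10::real) ^ 6 = 1000000" by simp
  ultimately show ?thesis unfolding p using w sq2_nonneg[of ?M ?M W] by argo
qed

theorem discrete_upper:
  assumes "chain J X a b c" "2 \<le> J"
  shows "energy (2 * 2 ^ J) (X J) \<le> 10 ^ 6 * total_norm J X a b c"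
proof -
  have "energy (2 * 2 ^ J) (X J) + curv (2 * 2 ^ J) (X J) \<le> 10 ^ 6 * total_norm J X a b c"
    using assms(2,1)
  proof (induction J rule: dec_induct)
    case base
    have X: "oddper2 4 4 (X 2)" using base by (simp add: chain_def)
    note p = oddperD(1)[OF oddper2D(1)[OF X]] oddperD(1)[OF oddper2D(2)[OF X]]
    have "sq2 8 8 (op1 dif (X 2)) \<le> 4 * sq2 8 8 (X 2)" "sq2 8 8 (op1 ddif (X 2)) \<le> 16 * sq2 8 8 (X 2)"
      by (intro sq2_op1 sq_dif_le sq_ddif_le; use p in auto)+
    moreover have "sq2 8 8 (op2 dif (X 2)) \<le> 4 * sq2 8 8 (X 2)" "sq2 8 8 (op2 ddif (X 2)) \<le> 16 * sq2 8 8 (X 2)"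
      by (intro sq2_op2 sq_dif_le sq_ddif_le; use p in auto)+
    moreover have "sq2 8 8 (X 2) = 4 * sq2 4 4 (X 2)"
    proof -
      have "sq2 8 8 (X 2) = (\<Sum>k\<in>{1..8}. 2 * sq 4 (X 2 k))"
        unfolding sq2_def using oddper2D(2)[OF X] sq_oddper[of 4] by (intro sum.cong refl) auto
      also have "\<dots> = 2 * sq2 8 4 (X 2)" by (simp add: sq2_def sum_distrib_left)
      also have "sq2 8 4 (X 2) = (\<Sum>l\<in>{1..4}. 2 * sq 4 (\<lambda>k. X 2 k l))"
        unfolding sq2_swap using oddper2D(1)[OF X] sq_oddper[of 4] by (intro sum.cong refl) auto
      also have "\<dots> = 2 * sq2 4 4 (X 2)" unfolding sq2_swap by (simp add: sum_distrib_left)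
      finally show ?thesis by simp
    qed
    moreover have "total_norm 2 X a b c = sq2 4 4 (X 2)" by (simp add: total_norm_def)
    moreover have p: "(10::real) ^ 6 = 1000000" "(2::int) * 2\<^sup>2 = 8" by simp_all
    ultimately show ?case unfolding p using sq2_nonneg[of 4 4 "X 2"] unfolding energy_def curv_def by argo
  next
    case (step J)
    have c: "chain J X a b c" using step.prems(1) by (simp add: chain_def)
    have X: "oddper2 (2 ^ J) (2 ^ J) (X J)" by (rule chain_oddper2[OF c step.hyps(1)]) simp
    have J2: "(2::int) \<le> 2 ^ J" using step.hyps(1) power_increasing[of 1 J "2::int"] by simp
    have "X (Suc J) = synth (2 ^ J) (X J) (a J) (b J) (c J)"
      using step.prems(1) step.hyps(1) by (simp add: chain_def)
    then have "energy (2 * 2 ^ Suc J) (X (Suc J)) + curv (2 * 2 ^ Suc J) (X (Suc J))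
      \<le> energy (2 * 2 ^ J) (X J) + curv (2 * 2 ^ J) (X J) + 10 ^ 6 * coef_norm (2 ^ J) (a J) (b J) (c J)"
      using upper_step[OF J2 X, of "a J" "b J" "c J"] by simp
    moreover have "total_norm (Suc J) X a b c = total_norm J X a b c + coef_norm (2 ^ J) (a J) (b J) (c J)"
      using step.hyps(1) by (simp add: total_norm_def)
    moreover have p: "(10::real) ^ 6 = 1000000" by simp
    ultimately show ?case using step.IH[OF c] unfolding p by argo
  qed
  then show ?thesis using sq2_nonneg unfolding curv_def by (smt (verit))
qed

section \<open>Smooth test functions\<close>

text \<open>Order 0 imposes nothing: in \<open>smooth\<close> every derivative is differentiable
  once more, so continuity comes for free.\<close>

primrec smooth_n :: "nat \<Rightarrow> (real \<Rightarrow> real) \<Rightarrow> bool" where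
  "smooth_n 0 f \<longleftrightarrow> True"
| "smooth_n (Suc n) f \<longleftrightarrow> (\<exists>g. (\<forall>x. (f has_real_derivative g x) (at x)) \<and> smooth_n n g)"

definition smooth :: "(real \<Rightarrow> real) \<Rightarrow> bool" where
  "smooth f \<longleftrightarrow> (\<forall>n. smooth_n n f)"

lemma smooth_n_SucI: "(\<And>x. (f has_real_derivative g x) (at x)) \<Longrightarrow> smooth_n n g \<Longrightarrow> smooth_n (Suc n) f"
  by auto

lemma smooth_n_SucD: "smooth_n (Suc n) f \<Longrightarrow> smooth_n n f"
proof (induction n arbitrary: f)
  case (Suc n)
  then obtain g where g: "\<And>x. (f has_real_derivative g x) (at x)" "smooth_n (Suc n) g" by (auto simp del: smooth_n.simps(2) simp: smooth_n.simps(2)[of "Suc n"])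
  show ?case by (rule smooth_n_SucI[OF g(1) Suc.IH[OF g(2)]])
qed simp

lemma smooth_n_add: "smooth_n n f \<Longrightarrow> smooth_n n g \<Longrightarrow> smooth_n n (\<lambda>x. f x + g x)"
proof (induction n arbitrary: f g)
  case (Suc n)
  then obtain f' g' where "\<forall>x. (f has_real_derivative f' x) (at x)" "smooth_n n f'"
    "\<forall>x. (g has_real_derivative g' x) (at x)" "smooth_n n g'" by auto
  then show ?case using Suc.IH[of f' g']
    by (intro smooth_n_SucI[of _ "\<lambda>x. f' x + g' x"]) (auto intro!: derivative_intros)
qed simp

lemma smooth_n_mult: "smooth_n n f \<Longrightarrow> smooth_n n g \<Longrightarrow> smooth_n n (\<lambda>x. f x * g x)"
proof (induction n arbitrary: f g)
  case (Suc n)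
  then obtain f' g' where d: "\<forall>x. (f has_real_derivative f' x) (at x)" "smooth_n n f'"
    "\<forall>x. (g has_real_derivative g' x) (at x)" "smooth_n n g'" by auto
  have "smooth_n n (\<lambda>x. f' x * g x + g' x * f x)"
    using d smooth_n_SucD[OF Suc.prems(1)] smooth_n_SucD[OF Suc.prems(2)] by (intro smooth_n_add Suc.IH)
  moreover have "((\<lambda>x. f x * g x) has_real_derivative f' x * g x + g' x * f x) (at x)" for x
    using d by (intro DERIV_mult) auto
  ultimately show ?case by (intro smooth_n_SucI)
qed simp

lemma smooth_n_const: "smooth_n n (\<lambda>x. c)"
proof (induction n arbitrary: c)
  case (Suc n) show ?case by (rule smooth_n_SucI[of _ "\<lambda>x. 0"]) (auto intro: Suc)
qed simp

lemma smooth_n_affine: "smooth_n n f \<Longrightarrow> smooth_n n (\<lambda>x. f (a * x + b))"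
proof (induction n arbitrary: f)
  case (Suc n)
  then obtain f' where d: "\<forall>x. (f has_real_derivative f' x) (at x)" "smooth_n n f'" by auto
  have "((\<lambda>x. f (a * x + b)) has_real_derivative f' (a * x + b) * a) (at x)" for x
    using d(1) by (auto intro!: DERIV_chain2[of f] derivative_eq_intros)
  moreover have "smooth_n n (\<lambda>x. f' (a * x + b) * a)"
    using Suc.IH[OF d(2)] by (intro smooth_n_mult smooth_n_const)
  ultimately show ?case by (rule smooth_n_SucI)
qed simp

lemma smooth_add: "smooth f \<Longrightarrow> smooth g \<Longrightarrow> smooth (\<lambda>x. f x + g x)"
  and smooth_mult: "smooth f \<Longrightarrow> smooth g \<Longrightarrow> smooth (\<lambda>x. f x * g x)"
  and smooth_const: "smooth (\<lambda>x. c)"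
  and smooth_affine: "smooth f \<Longrightarrow> smooth (\<lambda>x. f (a * x + b))"
  by (simp_all add: smooth_def smooth_n_add smooth_n_mult smooth_n_const smooth_n_affine)

lemma smooth_diff: "smooth f \<Longrightarrow> smooth g \<Longrightarrow> smooth (\<lambda>x. f x - g x)"
  using smooth_add[of f "\<lambda>x. - 1 * g x"] smooth_mult[OF smooth_const, of g "- 1"] by simp

lemma smooth_antideriv:
  assumes "\<And>x. (f has_real_derivative g x) (at x)" "smooth g" shows "smooth f"
  unfolding smooth_def
proof
  fix n show "smooth_n n f"
    using assms unfolding smooth_def by (intro smooth_n_SucD[of n f] smooth_n_SucI[of f g]) auto
qed

lemma smooth_deriv:
  assumes "smooth f"
  shows "\<exists>g. (\<forall>x. (f has_real_derivative g x) (at x)) \<and> smooth g"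
proof -
  have "smooth_n (Suc 0) f" using assms unfolding smooth_def by blast
  then obtain g where g: "\<And>x. (f has_real_derivative g x) (at x)" by auto
  have "smooth_n n g" for n
  proof -
    have "smooth_n (Suc n) f" using assms unfolding smooth_def by blast
    then obtain h where h: "\<And>x. (f has_real_derivative h x) (at x)" "smooth_n n h" by auto
    \<comment> \<open>The derivative supplied by \<open>smooth_n (Suc n)\<close> depends on
      \<open>n\<close>; uniqueness identifies all of them with the one \<open>g\<close>.\<close>
    have "g = h" using g h(1) DERIV_unique by blast
    then show ?thesis using h by simp
  qed
  then show ?thesis using g by (auto simp: smooth_def)
qed

lemma smooth_continuous: "smooth f \<Longrightarrow> continuous_on A f"
  using smooth_deriv[of f] DERIV_continuous_on[of A f] has_field_derivative_at_within by blast

section \<open>Flat functions and the smooth step\<close>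

definition flat_exp :: "nat \<Rightarrow> real \<Rightarrow> real" where
  "flat_exp k x = (if x \<le> 0 then 0 else (1 / x) ^ k * exp (- (1 / x)))"

lemma flat_exp_lim: "(flat_exp k \<longlongrightarrow> 0) (at 0)"
proof -
  have "((\<lambda>y. y ^ k / exp y :: real) \<longlongrightarrow> 0) at_top" by (rule tendsto_power_div_exp_0)
  then have "((\<lambda>x. (1 / x) ^ k / exp (1 / x) :: real) \<longlongrightarrow> 0) (at_right 0)"
    using filterlim_compose[OF _ filterlim_inverse_at_top_right] by (simp add: inverse_eq_divide)
  then have "(flat_exp k \<longlongrightarrow> 0) (at_right 0)"
    by (rule Lim_transform_eventually)
      (auto simp: flat_exp_def exp_minus field_simps eventually_at_right_field intro!: exI[of _ 1])
  moreover have "(flat_exp k \<longlongrightarrow> 0) (at_left 0)"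
    by (rule Lim_transform_eventually[of "\<lambda>x. 0"])
      (auto simp: flat_exp_def eventually_at_left_field intro!: exI[of _ "-1"])
  ultimately show ?thesis by (simp add: filterlim_at_split)
qed

text \<open>The powers \<open>(1 / x) ^ k\<close> are carried along because the family is then
  closed under differentiation. At 0 the difference quotient of \<open>flat_exp k\<close> is
  \<open>flat_exp (k + 1)\<close>, which tends to 0.\<close>

lemma flat_exp_deriv:
  "(flat_exp k has_real_derivative flat_exp (k + 2) x - real k * flat_exp (k + 1) x) (at x)"
proof -
  consider "x > 0" | "x < 0" | "x = 0" by linarith
  then show ?thesis
  proof cases
    case 1
    have "((\<lambda>x. (1 / x) ^ k * exp (- (1 / x))) has_real_derivative
        flat_exp (k + 2) x - real k * flat_exp (k + 1) x) (at x)"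
    proof (cases k)
      case 0
      then show ?thesis using 1 by (auto intro!: derivative_eq_intros simp: flat_exp_def field_simps power2_eq_square)
    next
      case (Suc m)
      have "((\<lambda>x. 1 / x) has_real_derivative - ((1 / x) * (1 / x))) (at x)"
        using 1 by (auto intro!: derivative_eq_intros simp: field_simps power2_eq_square)
      from DERIV_power_Suc[OF this, of m]
      have "((\<lambda>x. (1 / x) ^ Suc m) has_real_derivative - (real (Suc m) * (1 / x) ^ (Suc m + 1))) (at x)"
        by (simp add: algebra_simps)
      moreover have "((\<lambda>x. exp (- (1 / x))) has_real_derivative exp (- (1 / x)) * (1 / x) ^ 2) (at x)"
        using 1 by (auto intro!: derivative_eq_intros simp: field_simps power2_eq_square)
      ultimately have "((\<lambda>x. (1 / x) ^ Suc m * exp (- (1 / x))) has_real_derivative 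
         - (real (Suc m) * (1 / x) ^ (Suc m + 1)) * exp (- (1 / x)) + exp (- (1 / x)) * (1 / x) ^ 2 * (1 / x) ^ Suc m) (at x)"
        by (rule DERIV_mult)
      then show ?thesis using 1 unfolding Suc flat_exp_def by (simp add: power_add power2_eq_square algebra_simps)
    qed
    then show ?thesis
      by (rule has_field_derivative_transform_within_open[of _ _ _ "{0<..}"]) (use 1 in \<open>auto simp: flat_exp_def\<close>)
  next
    case 2
    have "((\<lambda>x. 0) has_real_derivative 0) (at x)" by simp
    then have "(flat_exp k has_real_derivative 0) (at x)"
      by (rule has_field_derivative_transform_within_open[of _ _ _ "{..<0}"]) (use 2 in \<open>auto simp: flat_exp_def\<close>)
    then show ?thesis using 2 by (simp add: flat_exp_def)
  next
    case 3
    have "((\<lambda>h. (flat_exp k (0 + h) - flat_exp k 0) / h) \<longlongrightarrow> 0) (at 0)"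
    proof (rule Lim_transform_eventually[OF flat_exp_lim[of "k + 1"]])
      show "\<forall>\<^sub>F x in at 0. flat_exp (k + 1) x = (flat_exp k (0 + x) - flat_exp k 0) / x"
        by (auto simp: flat_exp_def eventually_at intro!: exI[of _ 1])
    qed
    then show ?thesis using 3 by (simp add: DERIV_def flat_exp_def)
  qed
qed

lemma smooth_flat_exp: "smooth (flat_exp k)"
proof -
  have "smooth_n n (flat_exp k)" for n
  proof (induction n arbitrary: k)
    case (Suc n)
    have "smooth_n n (\<lambda>x. flat_exp (k + 2) x + (- real k) * flat_exp (k + 1) x)"
      by (intro smooth_n_add smooth_n_mult smooth_n_const Suc.IH)
    then have "smooth_n n (\<lambda>x. flat_exp (k + 2) x - real k * flat_exp (k + 1) x)" by simp
    then show ?case by (rule smooth_n_SucI[OF flat_exp_deriv])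
  qed simp
  then show ?thesis by (simp add: smooth_def)
qed

lemma antiderivative_exists:
  fixes f :: "real \<Rightarrow> real"
  assumes "continuous_on UNIV f"
  shows "\<exists>F. (\<forall>x. (F has_real_derivative f x) (at x)) \<and> F 0 = 0"
proof -
  have "\<exists>F. \<forall>x. -\<infinity> < ereal x \<longrightarrow> ereal x < \<infinity> \<longrightarrow> (F has_vector_derivative f x) (at x)"
    using assms by (intro einterval_antiderivative) (auto simp: continuous_on_eq_continuous_at)
  then obtain F where F: "\<And>x. (F has_real_derivative f x) (at x)"
    by (auto simp: has_real_derivative_iff_has_vector_derivative)
  show ?thesis
    by (rule exI[of _ "\<lambda>x. F x - F 0"]) (auto intro!: derivative_eq_intros F)
qed

text \<open>The normalized integral of \<open>flat_exp 0 x * flat_exp 0 (1 - x)\<close>, a bump that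
  is positive exactly on the open unit interval.\<close>

lemma smooth_step_exists:
  obtains s where "smooth s" "\<And>x. x \<le> 0 \<Longrightarrow> s x = 0" "\<And>x. x \<ge> 1 \<Longrightarrow> s x = 1" "\<And>x. 0 \<le> s x \<and> s x \<le> 1"
proof -
  define b where "b = (\<lambda>x. flat_exp 0 x * flat_exp 0 (- 1 * x + 1))"
  have b: "smooth b" unfolding b_def by (intro smooth_mult smooth_affine smooth_flat_exp)
  have b0: "b x \<ge> 0" for x by (auto simp: b_def flat_exp_def)
  have bz: "b x = 0" if "x \<le> 0 \<or> x \<ge> 1" for x using that by (auto simp: b_def flat_exp_def)
  obtain F where "(\<forall>x. (F has_real_derivative b x) (at x)) \<and> F 0 = 0"
    using antiderivative_exists[OF smooth_continuous[OF b]] ..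
  then have F: "\<And>x. (F has_real_derivative b x) (at x)" "F 0 = 0" by simp_all
  have mono: "F x \<le> F y" if "x \<le> y" for x y
    by (rule DERIV_nonneg_imp_nondecreasing[OF that]) (intro exI conjI, rule F(1), rule b0)
  have F_eq: "F y = F x" if "x \<le> y" "\<And>z. x < z \<Longrightarrow> z < y \<Longrightarrow> b z = 0" for x y
  proof (cases "x = y")
    case False
    then have "x < y" using that(1) by simp
    then have "\<exists>z. x < z \<and> z < y \<and> F y - F x = (y - x) * b z"
      by (rule MVT2) (rule F(1))
    then obtain z where "x < z" "z < y" "F y - F x = (y - x) * b z" by blast
    then show ?thesis using that(2)[of z] by simp
  qed simp
  have F_le: "F x = 0" if "x \<le> 0" for x
    using F_eq[of x 0] bz that F(2) by simp
  have F_ge: "F x = F 1" if "x \<ge> 1" for x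
    using F_eq[of 1 x] bz that by simp
  have pos: "F 1 > 0"
  proof -
    have "\<exists>z. 0 < z \<and> z < 1 \<and> F 1 - F 0 = (1 - 0) * b z"
      by (rule MVT2) (simp, rule F(1))
    then obtain z where z: "0 < z" "z < 1" "F 1 - F 0 = b z" by auto
    then show ?thesis using F(2) b0[of z] by (simp add: b_def flat_exp_def)
  qed
  show ?thesis
  proof (rule that[of "\<lambda>x. 1 / F 1 * F x"])
    show "smooth (\<lambda>x. 1 / F 1 * F x)"
      by (rule smooth_mult[OF smooth_const smooth_antideriv[OF F(1) b]])
    show "0 \<le> 1 / F 1 * F x \<and> 1 / F 1 * F x \<le> 1" for x
    proof (cases "x \<le> 0")
      case True then show ?thesis using F_le[of x] by simp
    next
      case False
      then show ?thesis using mono[of 0 x] mono[of x 1] F_ge[of x] F(2) pos by (cases "x \<ge> 1") auto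
    qed
    show "1 / F 1 * F x = 0" if "x \<le> 0" for x using F_le[OF that] by simp
    show "1 / F 1 * F x = 1" if "x \<ge> 1" for x using F_ge[OF that] pos by simp
  qed
qed

section \<open>Tensor products and closure properties of test functions\<close>

lemma GDERIV_tensor:
  fixes f g :: "real \<Rightarrow> real"
  assumes "(f has_real_derivative f') (at (fst z))" "(g has_real_derivative g') (at (snd z))"
  shows "GDERIV (\<lambda>z. f (fst z) * g (snd z)) z :> (f' * g (snd z), f (fst z) * g')"
proof -
  have "((\<lambda>z. f (fst z)) has_derivative (\<lambda>h. f' * fst h)) (at z)"
    using has_derivative_compose[OF has_derivative_fst[OF has_derivative_ident], of f "\<lambda>h. f' * h"] assms(1)
    by (simp add: has_field_derivative_def)
  moreover have "((\<lambda>z. g (snd z)) has_derivative (\<lambda>h. g' * snd h)) (at z)"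
    using has_derivative_compose[OF has_derivative_snd[OF has_derivative_ident], of g "\<lambda>h. g' * h"] assms(2)
    by (simp add: has_field_derivative_def)
  ultimately show ?thesis
    unfolding gderiv_def by (auto intro!: derivative_eq_intros simp: inner_prod_def algebra_simps)
qed

lemma C_n_tensor: "smooth f \<Longrightarrow> smooth g \<Longrightarrow> C_n n (\<lambda>z. f (fst z) * g (snd z))"
proof (induction n arbitrary: f g)
  case 0
  have "continuous_on UNIV (\<lambda>z::real \<times> real. f (fst z))" "continuous_on UNIV (\<lambda>z::real \<times> real. g (snd z))"
    by (rule continuous_on_compose2[OF smooth_continuous, of _ UNIV]; use 0 in \<open>auto intro: continuous_intros\<close>)+
  then show ?case by (auto intro: continuous_intros)
next
  case (Suc n)
  obtain f' where f': "\<And>x. (f has_real_derivative f' x) (at x)" "smooth f'" using smooth_deriv[OF Suc.prems(1)] by blast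
  obtain g' where g': "\<And>x. (g has_real_derivative g' x) (at x)" "smooth g'" using smooth_deriv[OF Suc.prems(2)] by blast
  show ?case unfolding C_n.simps
  proof (intro exI[of _ "\<lambda>z. (f' (fst z) * g (snd z), f (fst z) * g' (snd z))"] conjI allI ballI)
    show "GDERIV (\<lambda>z. f (fst z) * g (snd z)) z :> (f' (fst z) * g (snd z), f (fst z) * g' (snd z))" for z
      by (intro GDERIV_tensor f' g')
    fix i :: "real \<times> real" assume "i \<in> Basis"
    then have "i = (1, 0) \<or> i = (0, 1)" by (auto simp: Basis_prod_def)
    then show "C_n n (\<lambda>z. (f' (fst z) * g (snd z), f (fst z) * g' (snd z)) \<bullet> i)"
      using Suc.IH[OF f'(2) Suc.prems(2)] Suc.IH[OF Suc.prems(1) g'(2)] by (auto simp: inner_prod_def)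
  qed
qed

lemma C_n_sum: "(\<And>i. i \<in> I \<Longrightarrow> C_n n (f i)) \<Longrightarrow> C_n n (\<lambda>z. \<Sum>i\<in>I. f i z)"
proof (induction n arbitrary: f)
  case 0 then show ?case by (auto intro: continuous_intros)
next
  case (Suc n)
  then have "\<forall>i\<in>I. \<exists>G. (\<forall>x. GDERIV (f i) x :> G x) \<and> (\<forall>j\<in>Basis. C_n n (\<lambda>x. G x \<bullet> j))" by simp
  then obtain G where G: "\<And>i x. i \<in> I \<Longrightarrow> GDERIV (f i) x :> G i x" 
     "\<And>i j. i \<in> I \<Longrightarrow> j \<in> Basis \<Longrightarrow> C_n n (\<lambda>x. G i x \<bullet> j)" by metis
  show ?case unfolding C_n.simps
  proof (intro exI[of _ "\<lambda>x. \<Sum>i\<in>I. G i x"] conjI allI ballI)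
    show "GDERIV (\<lambda>z. \<Sum>i\<in>I. f i z) x :> (\<Sum>i\<in>I. G i x)" for x
      using G(1) unfolding gderiv_def inner_sum_right by (intro has_derivative_sum) auto
    show "C_n n (\<lambda>x. (\<Sum>i\<in>I. G i x) \<bullet> j)" if "j \<in> Basis" for j
      unfolding inner_sum_left by (intro Suc.IH G(2) that)
  qed
qed

lemma C_n_cmult: "C_n n f \<Longrightarrow> C_n n (\<lambda>z. a * f z)"
proof (induction n arbitrary: f)
  case 0 then show ?case by (auto intro: continuous_intros)
next
  case (Suc n)
  then obtain G where G: "\<And>x. GDERIV f x :> G x" "\<And>j. j \<in> Basis \<Longrightarrow> C_n n (\<lambda>x. G x \<bullet> j)" by auto
  show ?case unfolding C_n.simps
  proof (intro exI[of _ "\<lambda>x. a *\<^sub>R G x"] conjI allI ballI)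
    show "GDERIV (\<lambda>z. a * f z) x :> a *\<^sub>R G x" for x
      using G(1)[of x] unfolding gderiv_def by (auto intro!: derivative_eq_intros)
    show "C_n n (\<lambda>x. (a *\<^sub>R G x) \<bullet> j)" if "j \<in> Basis" for j
      using Suc.IH[OF G(2)[OF that]] by simp
  qed
qed

lemma C_n_diff: "C_n n f \<Longrightarrow> C_n n g \<Longrightarrow> C_n n (\<lambda>z. f z - g z)"
  using C_n_sum[of "{True, False}" n "\<lambda>b. if b then f else (\<lambda>z. - 1 * g z)"] C_n_cmult[of n g "- 1"]
  by (simp split: if_splits)

lemma test_functionsI:
  assumes "\<And>n. C_n n \<phi>" "compact K" "K \<subseteq> \<Omega>" "\<And>x. x \<notin> K \<Longrightarrow> \<phi> x = 0"
  shows "\<phi> \<in> test_functions \<Omega>"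
proof -
  have "closure {x. \<phi> x \<noteq> 0} \<subseteq> K" using assms by (intro closure_minimal compact_imp_closed) auto
  moreover from this have "compact (closure {x. \<phi> x \<noteq> 0})"
    using compact_Int_closed[OF assms(2), of "closure {x. \<phi> x \<noteq> 0}"] by (simp add: Int_absorb1)
  ultimately show ?thesis using assms unfolding test_functions_def by blast
qed

lemma test_functionsD:
  assumes "f \<in> test_functions \<Omega>"
  shows "C_n n f" "compact (closure {x. f x \<noteq> 0})" "closure {x. f x \<noteq> 0} \<subseteq> \<Omega>"
  using assms by (simp_all add: test_functions_def)

lemma zero_outside_support: "x \<notin> closure {x. f x \<noteq> 0} \<Longrightarrow> f x = 0"
  using closure_subset[of "{x. f x \<noteq> 0}"] by auto

lemma test_functions_diff:
  assumes "f \<in> test_functions \<Omega>" "g \<in> test_functions \<Omega>"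
  shows "(\<lambda>x. f x - g x) \<in> test_functions \<Omega>"
proof (rule test_functionsI[where K = "closure {x. f x \<noteq> 0} \<union> closure {x. g x \<noteq> 0}"])
  fix x assume "x \<notin> closure {x. f x \<noteq> 0} \<union> closure {x. g x \<noteq> 0}"
  then show "f x - g x = 0" using zero_outside_support[of x f] zero_outside_support[of x g] by simp
next
  show "C_n n (\<lambda>x. f x - g x)" for n by (intro C_n_diff test_functionsD(1)[OF assms(1)] test_functionsD(1)[OF assms(2)])
  show "compact (closure {x. f x \<noteq> 0} \<union> closure {x. g x \<noteq> 0})"
    by (intro compact_Un test_functionsD(2)[OF assms(1)] test_functionsD(2)[OF assms(2)])
  show "closure {x. f x \<noteq> 0} \<union> closure {x. g x \<noteq> 0} \<subseteq> \<Omega>"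
    by (intro Un_least test_functionsD(3)[OF assms(1)] test_functionsD(3)[OF assms(2)])
qed

lemma test_functions_sum:
  assumes "finite I" "\<And>i. i \<in> I \<Longrightarrow> f i \<in> test_functions \<Omega>"
  shows "(\<lambda>x. \<Sum>i\<in>I. f i x) \<in> test_functions \<Omega>"
proof (rule test_functionsI[where K = "\<Union>i\<in>I. closure {x. f i x \<noteq> 0}"])
  fix x assume "x \<notin> (\<Union>i\<in>I. closure {x. f i x \<noteq> 0})"
  then show "(\<Sum>i\<in>I. f i x) = 0" using zero_outside_support[of x "f _"] by (intro sum.neutral) blast
next
  show "C_n n (\<lambda>x. \<Sum>i\<in>I. f i x)" for n by (intro C_n_sum test_functionsD(1)[OF assms(2)])
  show "compact (\<Union>i\<in>I. closure {x. f i x \<noteq> 0})" by (intro compact_UN assms(1) test_functionsD(2)[OF assms(2)])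
  show "(\<Union>i\<in>I. closure {x. f i x \<noteq> 0}) \<subseteq> \<Omega>" using test_functionsD(3)[OF assms(2)] by blast
qed

lemma test_functions_cmult:
  assumes "f \<in> test_functions \<Omega>"
  shows "(\<lambda>x. a * f x) \<in> test_functions \<Omega>"
proof (rule test_functionsI[where K = "closure {x. f x \<noteq> 0}"])
  fix x assume "x \<notin> closure {x. f x \<noteq> 0}"
  then show "a * f x = 0" using zero_outside_support[of x f] by simp
next
  show "C_n n (\<lambda>x. a * f x)" for n by (intro C_n_cmult test_functionsD(1)[OF assms])
qed (rule test_functionsD(2)[OF assms], rule test_functionsD(3)[OF assms])

lemma test_functions_tensor:
  assumes "smooth f" "smooth g" "0 < a" "b < 1" "\<And>x. x \<notin> {a..b} \<Longrightarrow> f x = 0" "\<And>x. x \<notin> {a..b} \<Longrightarrow> g x = 0"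
  shows "(\<lambda>z. f (fst z) * g (snd z)) \<in> test_functions unit_square"
proof (rule test_functionsI[where K = "{a..b} \<times> {a..b}"])
  show "compact ({a..b} \<times> {a..b})" by (intro compact_Times compact_Icc)
  show "{a..b} \<times> {a..b} \<subseteq> unit_square" using assms(3,4) by (auto simp: unit_square_def)
  show "C_n n (\<lambda>z. f (fst z) * g (snd z))" for n by (intro C_n_tensor assms)
  show "f (fst z) * g (snd z) = 0" if "z \<notin> {a..b} \<times> {a..b}" for z
    using that assms(5)[of "fst z"] assms(6)[of "snd z"] by (cases z) auto
qed

section \<open>Square-integrable functions\<close>

text \<open>Values in an arbitrary Euclidean space let one development cover functions, gradients
  and pairs of both; completeness of the Sobolev space is then completeness for pairs.\<close>

definition sqint :: "'a measure \<Rightarrow> ('a \<Rightarrow> 'b::euclidean_space) \<Rightarrow> bool" where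
  "sqint M f \<longleftrightarrow> f \<in> borel_measurable M \<and> integrable M (\<lambda>x. (norm (f x))\<^sup>2)"

definition l2 :: "'a measure \<Rightarrow> ('a \<Rightarrow> 'b::euclidean_space) \<Rightarrow> real" where
  "l2 M f = sqrt (LINT x|M. (norm (f x))\<^sup>2)"

lemma l2_nonneg [simp]: "l2 M f \<ge> 0"
  by (simp add: l2_def)

lemma l2_power2: "(l2 M f)\<^sup>2 = (LINT x|M. (norm (f x))\<^sup>2)"
  by (simp add: l2_def)

lemma sqintD: "sqint M f \<Longrightarrow> f \<in> borel_measurable M" "sqint M f \<Longrightarrow> integrable M (\<lambda>x. (norm (f x))\<^sup>2)"
  by (simp_all add: sqint_def)

lemma sum_power2_le: "(a + b)\<^sup>2 \<le> 2 * a\<^sup>2 + 2 * b\<^sup>2" for a b :: real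
  using sum_squares_bound[of a b] by (simp add: power2_sum)

lemma sqint_bound:
  assumes "sqint M f" "g \<in> borel_measurable M" "\<And>x. x \<in> space M \<Longrightarrow> norm (g x) \<le> norm (f x)"
  shows "sqint M g"
  unfolding sqint_def
proof
  show "integrable M (\<lambda>x. (norm (g x))\<^sup>2)"
    using assms(2,3) sqintD[OF assms(1)]
    by (intro Bochner_Integration.integrable_bound[OF sqintD(2)[OF assms(1)]] AE_I2) (auto intro: power_mono)
qed fact

lemma sqint_add: "sqint M f \<Longrightarrow> sqint M g \<Longrightarrow> sqint M (\<lambda>x. f x + g x)"
  unfolding sqint_def
proof (elim conjE, intro conjI)
  assume a: "f \<in> borel_measurable M" "integrable M (\<lambda>x. (norm (f x))\<^sup>2)" 
    "g \<in> borel_measurable M" "integrable M (\<lambda>x. (norm (g x))\<^sup>2)"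
  show "(\<lambda>x. f x + g x) \<in> borel_measurable M" using a by simp
  show "integrable M (\<lambda>x. (norm (f x + g x))\<^sup>2)"
  proof (rule Bochner_Integration.integrable_bound[of M "\<lambda>x. 2 * (norm (f x))\<^sup>2 + 2 * (norm (g x))\<^sup>2"])
    show "AE x in M. norm ((norm (f x + g x))\<^sup>2) \<le> norm (2 * (norm (f x))\<^sup>2 + 2 * (norm (g x))\<^sup>2)"
    proof (intro AE_I2)
      fix x
      have "(norm (f x + g x))\<^sup>2 \<le> (norm (f x) + norm (g x))\<^sup>2" by (intro power_mono norm_triangle_ineq) auto
      also have "\<dots> \<le> 2 * (norm (f x))\<^sup>2 + 2 * (norm (g x))\<^sup>2" by (rule sum_power2_le)
      finally show "norm ((norm (f x + g x))\<^sup>2) \<le> norm (2 * (norm (f x))\<^sup>2 + 2 * (norm (g x))\<^sup>2)" by simp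
    qed
  qed (use a in auto)
qed

lemma sqint_scaleR: "sqint M f \<Longrightarrow> sqint M (\<lambda>x. c *\<^sub>R f x)"
  by (auto simp: sqint_def power_mult_distrib)

lemma sqint_cmult: "sqint M f \<Longrightarrow> sqint M (\<lambda>x. c * f x)" for f :: "'a \<Rightarrow> real"
  using sqint_scaleR[of M f c] by simp

lemma sqint_diff: "sqint M f \<Longrightarrow> sqint M g \<Longrightarrow> sqint M (\<lambda>x. f x - g x)"
  using sqint_add[of M f "\<lambda>x. - 1 *\<^sub>R g x"] sqint_scaleR[of M g "- 1"] by simp

lemma integrable_norm_mult:
  assumes "sqint M f" "sqint M g"
  shows "integrable M (\<lambda>x. norm (f x) * norm (g x))"
proof (rule Bochner_Integration.integrable_bound[of M "\<lambda>x. (norm (f x))\<^sup>2 + (norm (g x))\<^sup>2"])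
  show "AE x in M. norm (norm (f x) * norm (g x)) \<le> norm ((norm (f x))\<^sup>2 + (norm (g x))\<^sup>2)"
  proof (intro AE_I2)
    fix x
    have "norm (f x) * norm (g x) \<le> (norm (f x))\<^sup>2 + (norm (g x))\<^sup>2"
      using sum_squares_bound[of "norm (f x)" "norm (g x)"] mult_nonneg_nonneg[OF norm_ge_zero[of "f x"] norm_ge_zero[of "g x"]] unfolding mult.assoc by argo
    then show "norm (norm (f x) * norm (g x)) \<le> norm ((norm (f x))\<^sup>2 + (norm (g x))\<^sup>2)" by simp
  qed
qed (use assms in \<open>auto simp: sqint_def\<close>)

lemma l2_Cauchy_Schwarz:
  assumes f: "sqint M f" and g: "sqint M g"
  shows "(LINT x|M. norm (f x) * norm (g x)) \<le> l2 M f * l2 M g"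
proof -
  let ?A = "(l2 M f)\<^sup>2" and ?B = "LINT x|M. norm (f x) * norm (g x)" and ?C = "(l2 M g)\<^sup>2"
  have B0: "?B \<ge> 0" by simp
  \<comment> \<open>The usual quadratic polynomial in \<open>t\<close>; its minimum over
    \<open>t\<close> is the claim unless the leading coefficient vanishes.\<close>
  have q: "0 \<le> ?A - 2 * t * ?B + t\<^sup>2 * ?C" for t
  proof -
    have "0 \<le> (LINT x|M. (norm (f x) - t * norm (g x))\<^sup>2)" by simp
    also have "(\<lambda>x. (norm (f x) - t * norm (g x))\<^sup>2)
       = (\<lambda>x. (norm (f x))\<^sup>2 - (2 * t) * (norm (f x) * norm (g x)) + t\<^sup>2 * (norm (g x))\<^sup>2)"
      by (simp add: fun_eq_iff power2_diff power_mult_distrib)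
    also have "(LINT x|M. (norm (f x))\<^sup>2 - (2 * t) * (norm (f x) * norm (g x)) + t\<^sup>2 * (norm (g x))\<^sup>2) = ?A - 2 * t * ?B + t\<^sup>2 * ?C"
      using sqintD(2)[OF f] sqintD(2)[OF g] integrable_norm_mult[OF f g] by (simp add: l2_power2)
    finally show ?thesis .
  qed
  show ?thesis
  proof (cases "?C = 0")
    case True
    have "?B = 0"
    proof (rule ccontr)
      assume "?B \<noteq> 0"
      \<comment> \<open>With vanishing leading coefficient the polynomial is affine in
        \<open>t\<close>, and this \<open>t\<close> makes it equal to -1.\<close>
      then show False using q[of "(?A + 1) / (2 * ?B)"] True by simp
    qed
    then show ?thesis by simp
  next
    case False
    then have C: "?C > 0" by simp
    have e: "a - 2 * (b / c) * b + (b / c)\<^sup>2 * c = a - b\<^sup>2 / c" if "c > 0" for a b c :: real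
      using that by (simp add: power2_eq_square field_simps)
    have "0 \<le> ?A - ?B\<^sup>2 / ?C" using q[of "?B / ?C"] unfolding e[OF C] .
    then have "?B\<^sup>2 \<le> (l2 M f * l2 M g)\<^sup>2" using C by (simp add: field_simps power_mult_distrib)
    then show ?thesis by (rule power2_le_imp_le) simp
  qed
qed

lemma l2_triangle:
  assumes f: "sqint M f" and g: "sqint M g"
  shows "l2 M (\<lambda>x. f x + g x) \<le> l2 M f + l2 M g"
proof -
  have "(l2 M (\<lambda>x. f x + g x))\<^sup>2 \<le> (LINT x|M. (norm (f x))\<^sup>2 + 2 * (norm (f x) * norm (g x)) + (norm (g x))\<^sup>2)"
    unfolding l2_power2
  proof (intro integral_mono)
    show "(norm (f x + g x))\<^sup>2 \<le> (norm (f x))\<^sup>2 + 2 * (norm (f x) * norm (g x)) + (norm (g x))\<^sup>2" for x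
      using power_mono[OF norm_triangle_ineq[of "f x" "g x"], of 2] by (simp add: power2_sum)
  qed (use sqintD(2)[OF f] sqintD(2)[OF g] integrable_norm_mult[OF f g] sqintD(2)[OF sqint_add[OF f g]] in auto)
  also have "\<dots> = (l2 M f)\<^sup>2 + 2 * (LINT x|M. norm (f x) * norm (g x)) + (l2 M g)\<^sup>2"
    using sqintD(2)[OF f] sqintD(2)[OF g] integrable_norm_mult[OF f g] by (simp add: l2_power2)
  also have "\<dots> \<le> (l2 M f + l2 M g)\<^sup>2"
    using l2_Cauchy_Schwarz[OF f g] by (simp add: power2_sum)
  finally show ?thesis by (rule power2_le_imp_le) simp
qed

lemma l2_scaleR: "l2 M (\<lambda>x. c *\<^sub>R f x) = \<bar>c\<bar> * l2 M f"
proof -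
  have "(LINT x|M. (norm (c *\<^sub>R f x))\<^sup>2) = c\<^sup>2 * (LINT x|M. (norm (f x))\<^sup>2)"
    by (simp add: power_mult_distrib)
  then show ?thesis by (simp add: l2_def real_sqrt_mult)
qed

lemma l2_minus_commute: "l2 M (\<lambda>x. f x - g x) = l2 M (\<lambda>x. g x - f x)"
  by (simp add: l2_def norm_minus_commute)

lemma l2_diff_triangle:
  assumes "sqint M f" "sqint M g" "sqint M h"
  shows "l2 M (\<lambda>x. f x - h x) \<le> l2 M (\<lambda>x. f x - g x) + l2 M (\<lambda>x. g x - h x)"
  using l2_triangle[OF sqint_diff[OF assms(1,2)] sqint_diff[OF assms(2,3)]] by simp

lemma nn_integral_sqint:
  assumes "sqint M f" shows "(\<integral>\<^sup>+x. ennreal ((norm (f x))\<^sup>2) \<partial>M) = ennreal ((l2 M f)\<^sup>2)"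
  unfolding l2_power2 using sqintD(2)[OF assms] by (intro nn_integral_eq_integral) auto

text \<open>Riesz-Fischer. For a rapidly Cauchy subsequence the increments are summable in mean,
  which uses that the measure is finite, so it converges almost everywhere; Fatou's lemma carries
  the Cauchy bounds over to the limit.\<close>

theorem l2_complete:
  fixes f :: "nat \<Rightarrow> 'a \<Rightarrow> 'b::euclidean_space"
  assumes fin: "finite_measure M" and f: "\<And>n. sqint M (f n)"
    and cauchy: "\<And>e. e > 0 \<Longrightarrow> \<exists>N. \<forall>m\<ge>N. \<forall>n\<ge>N. l2 M (\<lambda>x. f m x - f n x) < e"
  shows "\<exists>g. sqint M g \<and> (\<lambda>n. l2 M (\<lambda>x. f n x - g x)) \<longlonglongrightarrow> 0"
proof -
  interpret finite_measure M by fact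
  have "\<forall>k. \<exists>N. \<forall>m\<ge>N. \<forall>n\<ge>N. l2 M (\<lambda>x. f m x - f n x) < (1 / 2) ^ k" using cauchy by simp
  then obtain N where N: "\<And>k m n. m \<ge> N k \<Longrightarrow> n \<ge> N k \<Longrightarrow> l2 M (\<lambda>x. f m x - f n x) < (1 / 2) ^ k" by metis
  \<comment> \<open>Partial sums dominate \<open>N k\<close> and increase with \<open>k\<close>, so
    they index a subsequence.\<close>
  define r where "r k = (\<Sum>i\<le>k. N i)" for k
  have rN: "r k \<ge> N k" for k unfolding r_def by (intro member_le_sum) auto
  have rm: "r k \<le> r l" if "k \<le> l" for k l unfolding r_def using that by (intro sum_mono2) auto
  define h where "h k = f (r k)" for k
  have h: "sqint M (h k)" for k using f by (simp add: h_def)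
  have hm: "h k \<in> borel_measurable M" for k using sqintD(1)[OF h] .
  have hd: "l2 M (\<lambda>x. h l x - h k x) < (1 / 2) ^ k" if "k \<le> l" for k l
    unfolding h_def using rN[of k] rm[OF that] by (intro N) auto
  have AEc: "AE x in M. convergent (\<lambda>k. h k x)"
  proof -
    define d where "d k x = norm (h (Suc k) x - h k x)" for k x
    have dm: "(\<lambda>x. ennreal (d k x)) \<in> borel_measurable M" for k unfolding d_def using hm by measurable
    have di: "(\<integral>\<^sup>+x. ennreal (d k x) \<partial>M) \<le> ennreal ((1 / 2) ^ k * (measure M (space M) + 1))" for k
    proof -
      have s: "sqint M (\<lambda>x. h (Suc k) x - h k x)" by (intro sqint_diff h)
      have "(\<integral>\<^sup>+x. ennreal (d k x) \<partial>M) \<le> (\<integral>\<^sup>+x. ennreal ((1 / 2) ^ k + 2 ^ k * (d k x)\<^sup>2) \<partial>M)"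
      proof (intro nn_integral_mono ennreal_leI)
        fix x
        \<comment> \<open>The arithmetic-geometric mean inequality, weighted so that an
          \<open>l2\<close> bound of \<open>(1 / 2) ^ k\<close> turns into an integral of the same
          order.\<close>
        have "2 * (1 * (2 ^ k * d k x)) \<le> 1\<^sup>2 + (2 ^ k * d k x)\<^sup>2"
          using sum_squares_bound[of 1 "2 ^ k * d k x"] by (simp add: mult.assoc)
        then have "2 ^ k * d k x \<le> 2 ^ k * ((1 / 2) ^ k + 2 ^ k * (d k x)\<^sup>2)"
          by (simp add: d_def power_mult_distrib power2_eq_square distrib_left power_one_over algebra_simps)
             (smt (verit) mult_nonneg_nonneg norm_ge_zero zero_le_power)
        then show "d k x \<le> (1 / 2) ^ k + 2 ^ k * (d k x)\<^sup>2" by simp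
      qed
      also have "\<dots> = ennreal (LINT x|M. (1 / 2) ^ k + 2 ^ k * (d k x)\<^sup>2)"
        using sqintD(2)[OF s] by (intro nn_integral_eq_integral) (auto simp: d_def)
      also have "(LINT x|M. (1 / 2) ^ k + 2 ^ k * (d k x)\<^sup>2) = measure M (space M) * (1 / 2) ^ k + 2 ^ k * (l2 M (\<lambda>x. h (Suc k) x - h k x))\<^sup>2"
        using sqintD(2)[OF s] by (simp add: d_def l2_power2)
      also have "\<dots> \<le> measure M (space M) * (1 / 2) ^ k + 2 ^ k * ((1 / 2) ^ k)\<^sup>2"
        using hd[of k "Suc k"] by (intro add_left_mono mult_left_mono power_mono) auto
      also have "\<dots> = (1 / 2) ^ k * (measure M (space M) + 1)"
        by (simp add: power_one_over power2_eq_square field_simps)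
      finally show ?thesis by (simp add: ennreal_leI)
    qed
    have "(\<integral>\<^sup>+x. (\<Sum>k. ennreal (d k x)) \<partial>M) = (\<Sum>k. \<integral>\<^sup>+x. ennreal (d k x) \<partial>M)"
      by (intro nn_integral_suminf dm)
    also have "\<dots> \<le> (\<Sum>k. ennreal ((1 / 2) ^ k * (measure M (space M) + 1)))"
      by (intro suminf_le di) auto
    also have "\<dots> = ennreal (\<Sum>k. (1 / 2) ^ k * (measure M (space M) + 1))"
      by (intro suminf_ennreal2 summable_mult2 summable_geometric) auto
    also have "\<dots> < \<infinity>" by simp
    finally have "AE x in M. (\<Sum>k. ennreal (d k x)) \<noteq> \<infinity>"
      using dm by (intro nn_integral_noteq_infinite) auto
    then show ?thesis
    proof eventually_elim
      case (elim x)
      have "summable (\<lambda>k. d k x)" using elim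
        by (intro summable_suminf_not_top) (auto simp: d_def top_unique)
      then have "summable (\<lambda>k. h (Suc k) x - h k x)" unfolding d_def by (rule summable_norm_cancel)
      then have "convergent (\<lambda>n. \<Sum>k<n. h (Suc k) x - h k x)" by (simp add: summable_iff_convergent)
      then have "convergent (\<lambda>n. h n x - h 0 x)" unfolding sum_lessThan_telescope[of "\<lambda>k. h k x"] .
      then have "convergent (\<lambda>n. (h n x - h 0 x) + h 0 x)" by (intro convergent_add convergent_const)
      then show ?case by simp
    qed
  qed
  define g where "g x = lim (\<lambda>k. h k x)" for x
  have gm: "g \<in> borel_measurable M" unfolding g_def[abs_def] using hm by (rule borel_measurable_lim_metric)
  have AEl: "AE x in M. (\<lambda>k. h k x) \<longlonglongrightarrow> g x"
    using AEc by eventually_elim (simp add: g_def convergent_LIMSEQ_iff)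
  have fatou: "(\<integral>\<^sup>+x. ennreal ((norm (h k x - g x))\<^sup>2) \<partial>M) \<le> ennreal (((1 / 2) ^ k)\<^sup>2)" for k
  proof -
    have "(\<integral>\<^sup>+x. ennreal ((norm (h k x - g x))\<^sup>2) \<partial>M) = (\<integral>\<^sup>+x. liminf (\<lambda>l. ennreal ((norm (h l x - h k x))\<^sup>2)) \<partial>M)"
    proof (rule nn_integral_cong_AE)
      show "AE x in M. ennreal ((norm (h k x - g x))\<^sup>2) = liminf (\<lambda>l. ennreal ((norm (h l x - h k x))\<^sup>2))"
        using AEl
      proof eventually_elim
        case (elim x)
        have "(\<lambda>l. ennreal ((norm (h l x - h k x))\<^sup>2)) \<longlonglongrightarrow> ennreal ((norm (g x - h k x))\<^sup>2)"
          by (intro tendsto_ennrealI tendsto_intros elim)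
        from lim_imp_Liminf[OF trivial_limit_sequentially this] show ?case by (simp only: norm_minus_commute)
      qed
    qed
    also have "\<dots> \<le> liminf (\<lambda>l. \<integral>\<^sup>+x. ennreal ((norm (h l x - h k x))\<^sup>2) \<partial>M)"
      using hm by (intro nn_integral_liminf) measurable
    also have "\<dots> \<le> liminf (\<lambda>l. ennreal (((1 / 2) ^ k)\<^sup>2))"
    proof (rule Liminf_mono)
      show "\<forall>\<^sub>F l in sequentially. (\<integral>\<^sup>+x. ennreal ((norm (h l x - h k x))\<^sup>2) \<partial>M) \<le> ennreal (((1 / 2) ^ k)\<^sup>2)"
        using eventually_ge_at_top[of k]
      proof eventually_elim
        case (elim l)
        have "(\<integral>\<^sup>+x. ennreal ((norm (h l x - h k x))\<^sup>2) \<partial>M) = ennreal ((l2 M (\<lambda>x. h l x - h k x))\<^sup>2)"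
          by (intro nn_integral_sqint sqint_diff h)
        also have "\<dots> \<le> ennreal (((1 / 2) ^ k)\<^sup>2)"
          using hd[OF elim] by (intro ennreal_leI power_mono) auto
        finally show ?case .
      qed
    qed
    also have "\<dots> = ennreal (((1 / 2) ^ k)\<^sup>2)" by (simp add: Liminf_const)
    finally show ?thesis .
  qed
  have s: "sqint M (\<lambda>x. h k x - g x)" for k
    unfolding sqint_def
  proof
    show "(\<lambda>x. h k x - g x) \<in> borel_measurable M" using hm gm by simp
    then show "integrable M (\<lambda>x. (norm (h k x - g x))\<^sup>2)"
      using fatou[of k] by (intro integrableI_bounded) (auto simp: top_unique less_top[symmetric])
  qed
  have g: "sqint M g" using sqint_diff[OF h s, of 0 0] by simp
  have hb: "l2 M (\<lambda>x. h k x - g x) \<le> (1 / 2) ^ k" for k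
  proof -
    have "ennreal ((l2 M (\<lambda>x. h k x - g x))\<^sup>2) \<le> ennreal (((1 / 2) ^ k)\<^sup>2)"
      using fatou[of k] unfolding nn_integral_sqint[OF s] .
    then have "(l2 M (\<lambda>x. h k x - g x))\<^sup>2 \<le> ((1 / 2) ^ k)\<^sup>2" by (simp add: ennreal_le_iff)
    then show ?thesis by (rule power2_le_imp_le) simp
  qed
  have "(\<lambda>n. l2 M (\<lambda>x. f n x - g x)) \<longlonglongrightarrow> 0"
  proof (rule LIMSEQ_I)
    fix e :: real assume e: "e > 0"
    obtain k where k: "(1 / 2) ^ k < e / 2" using real_arch_pow_inv[of "e / 2" "1 / 2"] e by auto
    have "l2 M (\<lambda>x. f n x - g x) < e" if "n \<ge> N k" for n
    proof -
      have "l2 M (\<lambda>x. f n x - g x) \<le> l2 M (\<lambda>x. f n x - h k x) + l2 M (\<lambda>x. h k x - g x)"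
        by (intro l2_diff_triangle f h g)
      also have "l2 M (\<lambda>x. f n x - h k x) < (1 / 2) ^ k" unfolding h_def using that rN by (intro N)
      also have "l2 M (\<lambda>x. h k x - g x) \<le> (1 / 2) ^ k" by (rule hb)
      finally show ?thesis using k by simp
    qed
    then show "\<exists>no. \<forall>n\<ge>no. norm (l2 M (\<lambda>x. f n x - g x) - 0) < e" by auto
  qed
  then show ?thesis using g by blast
qed

section \<open>Weak gradients on the unit square\<close>

abbreviation Q :: "(real \<times> real) measure" where
  "Q \<equiv> lebesgue_on unit_square"

lemma unit_square_box: "unit_square = box (0, 0) (1, 1)"
  by (auto simp: unit_square_def box_def Basis_prod_def)

lemma unit_square_meas [measurable, simp]: "unit_square \<in> sets borel" "unit_square \<in> sets lebesgue"
  "unit_square \<inter> space lebesgue \<in> sets lebesgue"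
  by (simp_all add: unit_square_box)

lemma square_integrable_eq: "square_integrable unit_square f \<longleftrightarrow> sqint Q f"
  by (simp add: square_integrable_def sqint_def)

lemma emeasure_Q: "emeasure Q unit_square = 1"
proof -
  have "emeasure Q unit_square = emeasure lborel (box (0::real, 0::real) (1, 1))"
    by (simp add: emeasure_restrict_space unit_square_box)
  also have "\<dots> = 1" by (subst emeasure_lborel_box) (auto simp: Basis_prod_def prod.union_disjoint inner_prod_def)
  finally show ?thesis .
qed

lemma finite_measure_Q: "finite_measure Q"
  by (rule finite_measureI) (simp add: emeasure_Q)

lemma borel_measurable_Q: "f \<in> borel_measurable borel \<Longrightarrow> f \<in> borel_measurable Q"
  by (intro measurable_restrict_space1 measurable_completion) simp

lemma integral_Q_lborel:
  fixes f :: "real \<times> real \<Rightarrow> 'b::{banach, second_countable_topology}"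
  assumes "f \<in> borel_measurable borel"
  shows "integral\<^sup>L Q f = (\<integral>z. indicator unit_square z *\<^sub>R f z \<partial>lborel)"
  using assms by (subst integral_restrict_space) (auto intro!: integral_completion)

lemma sqint_Q_bounded:
  fixes f :: "real \<times> real \<Rightarrow> 'b::euclidean_space"
  assumes "f \<in> borel_measurable Q" "\<And>z. z \<in> unit_square \<Longrightarrow> norm (f z) \<le> B"
  shows "sqint Q f"
proof -
  interpret finite_measure Q by (rule finite_measure_Q)
  show ?thesis unfolding sqint_def
  proof
    show "integrable Q (\<lambda>x. (norm (f x))\<^sup>2)"
      using assms by (intro integrable_const_bound[where B = "B\<^sup>2"] AE_I2) (auto intro: power_mono)
  qed fact
qed

lemma sqint_Q_continuous:
  fixes f :: "real \<times> real \<Rightarrow> 'b::euclidean_space"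
  assumes "continuous_on UNIV f"
  shows "sqint Q f"
proof -
  have "compact (f ` cbox (0, 0) (1, 1))"
    by (intro compact_continuous_image continuous_on_subset[OF assms] compact_cbox) auto
  then obtain B where "\<And>z. z \<in> cbox (0, 0) (1, 1) \<Longrightarrow> norm (f z) \<le> B"
    using compact_imp_bounded bounded_iff by (metis imageI)
  then show ?thesis
    using assms box_subset_cbox[of "(0::real, 0::real)" "(1, 1)"]
    by (intro sqint_Q_bounded[where B = B] borel_measurable_Q borel_measurable_continuous_onI) (auto simp: unit_square_box)
qed

lemma sqint_const_Q: "sqint Q (\<lambda>z. c)"
  by (intro sqint_Q_continuous continuous_intros)

lemma integrable_scaleR_sqint:
  fixes f :: "'a \<Rightarrow> real" and g :: "'a \<Rightarrow> 'b::euclidean_space"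
  assumes "sqint M f" "sqint M g" shows "integrable M (\<lambda>x. f x *\<^sub>R g x)"
  using sqintD(1)[OF assms(1)] sqintD(1)[OF assms(2)]
  by (intro Bochner_Integration.integrable_bound[OF integrable_norm_mult[OF assms]]) auto

lemma integrable_sqint_Q: "sqint Q f \<Longrightarrow> integrable Q f"
  using integrable_scaleR_sqint[OF sqint_const_Q[of "1::real"], of f] by simp

lemma GDERIV_partials:
  assumes "GDERIV w (x, y) :> W"
  shows "((\<lambda>x. w (x, y)) has_real_derivative fst W) (at x)" "((\<lambda>y. w (x, y)) has_real_derivative snd W) (at y)"
proof -
  have w: "(w has_derivative (\<lambda>h. h \<bullet> W)) (at (x, y))" using assms by (simp add: gderiv_def)
  have 1: "((\<lambda>x. (x, y)) has_derivative (\<lambda>h. (h, 0))) (at x)" by (auto intro!: derivative_eq_intros)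
  have 2: "((\<lambda>y. (x, y)) has_derivative (\<lambda>h. (0, h))) (at y)" by (auto intro!: derivative_eq_intros)
  show "((\<lambda>x. w (x, y)) has_real_derivative fst W) (at x)"
    using has_derivative_compose[OF 1 w]
    by (simp add: has_field_derivative_def inner_prod_def mult_commute_abs)
  show "((\<lambda>y. w (x, y)) has_real_derivative snd W) (at y)"
    using has_derivative_compose[OF 2 w]
    by (simp add: has_field_derivative_def inner_prod_def mult_commute_abs)
qed

lemma GDERIV_continuous: "(\<And>z. GDERIV w z :> W z) \<Longrightarrow> continuous_on UNIV w"
  by (metis continuous_at_imp_continuous_on gderiv_def has_derivative_continuous)

lemma GDERIV_unique:
  assumes "GDERIV f z :> A" "GDERIV f z :> B" shows "A = B"
proof -
  have "(\<lambda>h. h \<bullet> A) = (\<lambda>h. h \<bullet> B)" using assms unfolding gderiv_def by (rule has_derivative_unique)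
  then have "\<forall>h. h \<bullet> A = h \<bullet> B" by metis
  then have "(A - B) \<bullet> (A - B) = 0" by (simp add: inner_diff_right)
  then show ?thesis by simp
qed

text \<open>Fubini and the fundamental theorem of calculus on every line: the end points lie outside
  the support. Applied to a product, this is integration by parts against a test function.\<close>

lemma integral_gradient_compact_support:
  assumes d: "\<And>z. GDERIV w z :> W z" and c: "continuous_on UNIV W"
    and K: "compact K" "K \<subseteq> unit_square" "\<And>z. z \<notin> K \<Longrightarrow> w z = 0"
  shows "integral\<^sup>L Q W = 0"
proof -
  let ?C = "cbox (0::real, 0::real) (1, 1)"
  have W0: "W z = 0" if "z \<notin> K" for z
  proof -
    have "open (- K)" using K(1) by (simp add: compact_imp_closed open_Compl)
    have "((\<lambda>z. 0) has_derivative (\<lambda>h. 0)) (at z)" by simp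
    then have "(w has_derivative (\<lambda>h. 0)) (at z)"
      by (rule has_derivative_transform_within_open[OF _ \<open>open (- K)\<close>]) (use that K(3) in auto)
    then have "GDERIV w z :> 0" by (simp add: gderiv_def)
    then show ?thesis using d GDERIV_unique by blast
  qed
  have sub: "K \<subseteq> ?C" using K(2) box_subset_cbox by (auto simp: unit_square_box)
  have Wm: "W \<in> borel_measurable borel" by (intro borel_measurable_continuous_onI c)
  have "integrable lborel (\<lambda>z. indicator ?C z *\<^sub>R W z)"
    by (intro borel_integrable_compact compact_cbox continuous_on_subset[OF c]) auto
  also have "(\<lambda>z. indicator ?C z *\<^sub>R W z) = W"
  proof
    fix z show "indicator ?C z *\<^sub>R W z = W z" using W0[of z] sub by (cases "z \<in> K") auto
  qed
  finally have Wi: "integrable lborel W" .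
  have "integral\<^sup>L Q W = (\<integral>z. indicator unit_square z *\<^sub>R W z \<partial>lborel)" by (rule integral_Q_lborel[OF Wm])
  also have "(\<lambda>z. indicator unit_square z *\<^sub>R W z) = W" using W0 K(2) by (auto simp: fun_eq_iff indicator_def)
  finally have e: "integral\<^sup>L Q W = integral\<^sup>L lborel W" .
  have i1: "integrable (lborel \<Otimes>\<^sub>M lborel) (case_prod (\<lambda>x y. fst (W (x, y))))"
    and i2: "integrable (lborel \<Otimes>\<^sub>M lborel) (\<lambda>z. snd (W z))"
    using Wi by (simp_all add: lborel_prod case_prod_beta')
  have wK: "w z = 0" if "\<not> (0 < fst z \<and> fst z < 1 \<and> 0 < snd z \<and> snd z < 1)" for z
    by (rule K(3)) (use that K(2) in \<open>auto simp: unit_square_def\<close>)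
  have W0': "W z = 0" if "\<not> (0 < fst z \<and> fst z < 1 \<and> 0 < snd z \<and> snd z < 1)" for z
    by (rule W0) (use that K(2) in \<open>auto simp: unit_square_def\<close>)
  have "fst (integral\<^sup>L lborel W) = (\<integral>z. fst (W z) \<partial>lborel)" using Wi by simp
  also have "\<dots> = (\<integral>y. (\<integral>x. fst (W (x, y)) \<partial>lborel) \<partial>lborel)"
    unfolding lborel_pair.integral_snd[OF i1] by (simp add: lborel_prod case_prod_beta')
  also have "(\<lambda>y. \<integral>x. fst (W (x, y)) \<partial>lborel) = (\<lambda>y. 0)"
  proof
    fix y
    have "(\<integral>x. fst (W (x, y)) \<partial>lborel) = (\<integral>x. fst (W (x, y)) * indicator {0..1} x \<partial>lborel)"
    proof (intro Bochner_Integration.integral_cong refl)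
      fix x show "fst (W (x, y)) = fst (W (x, y)) * indicator {0..1} x"
        using W0'[of "(x, y)"] by (cases "x \<in> {0..1}") auto
    qed
    also have "\<dots> = w (1, y) - w (0, y)"
    proof (rule integral_FTC_Icc_real)
      show "((\<lambda>x. w (x, y)) has_real_derivative fst (W (x, y))) (at x)" for x
        by (rule GDERIV_partials(1)[OF d])
      have "continuous_on UNIV (\<lambda>x. fst (W (x, y)))"
        by (intro continuous_intros continuous_on_compose2[OF c]) auto
      then show "isCont (\<lambda>x. fst (W (x, y))) x" for x by (simp add: continuous_on_eq_continuous_at)
    qed auto
    finally show "(\<integral>x. fst (W (x, y)) \<partial>lborel) = 0" using wK by simp
  qed
  finally have 1: "fst (integral\<^sup>L lborel W) = 0" by simp
  have "snd (integral\<^sup>L lborel W) = (\<integral>z. snd (W z) \<partial>lborel)" using Wi by simp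
  also have "\<dots> = (\<integral>x. (\<integral>y. snd (W (x, y)) \<partial>lborel) \<partial>lborel)"
    unfolding lborel_pair.integral_fst'[OF i2] by (simp add: lborel_prod)
  also have "(\<lambda>x. \<integral>y. snd (W (x, y)) \<partial>lborel) = (\<lambda>x. 0)"
  proof
    fix x
    have "(\<integral>y. snd (W (x, y)) \<partial>lborel) = (\<integral>y. snd (W (x, y)) * indicator {0..1} y \<partial>lborel)"
    proof (intro Bochner_Integration.integral_cong refl)
      fix y show "snd (W (x, y)) = snd (W (x, y)) * indicator {0..1} y"
        using W0'[of "(x, y)"] by (cases "y \<in> {0..1}") auto
    qed
    also have "\<dots> = w (x, 1) - w (x, 0)"
    proof (rule integral_FTC_Icc_real)
      show "((\<lambda>y. w (x, y)) has_real_derivative snd (W (x, y))) (at y)" for y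
        by (rule GDERIV_partials(2)[OF d])
      have "continuous_on UNIV (\<lambda>y. snd (W (x, y)))"
        by (intro continuous_intros continuous_on_compose2[OF c]) auto
      then show "isCont (\<lambda>y. snd (W (x, y))) y" for y by (simp add: continuous_on_eq_continuous_at)
    qed auto
    finally show "(\<integral>y. snd (W (x, y)) \<partial>lborel) = 0" using wK by simp
  qed
  finally have "snd (integral\<^sup>L lborel W) = 0" by simp
  then show ?thesis unfolding e using 1 by (simp add: prod_eq_iff)
qed

lemma test_function_gradient:
  assumes "\<phi> \<in> test_functions \<Omega>" "\<And>z. GDERIV \<phi> z :> D z"
  shows "continuous_on UNIV D" "continuous_on UNIV \<phi>"
proof -
  have "C_n (Suc 0) \<phi>" using test_functionsD(1)[OF assms(1)] .
  then obtain G where G: "\<And>z. GDERIV \<phi> z :> G z" "\<And>i. i \<in> Basis \<Longrightarrow> continuous_on UNIV (\<lambda>z. G z \<bullet> i)" by auto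
  have "D = G" using GDERIV_unique[OF assms(2) G(1)] by auto
  then show "continuous_on UNIV D" using G(2) by (simp add: continuous_on_componentwise[of UNIV G])
  show "continuous_on UNIV \<phi>" by (rule GDERIV_continuous[OF assms(2)])
qed

lemma has_weak_gradient_C1:
  assumes d: "\<And>z. GDERIV u z :> G z" and c: "continuous_on UNIV G"
  shows "has_weak_gradient unit_square u G"
  unfolding has_weak_gradient_def square_integrable_eq
proof (intro conjI ballI allI impI)
  show "sqint Q G" by (rule sqint_Q_continuous[OF c])
  fix \<phi> D assume \<phi>: "\<phi> \<in> test_functions unit_square" and D: "\<forall>z. GDERIV \<phi> z :> D z"
  note cD = test_function_gradient[OF \<phi> D[rule_format]]
  have cu: "continuous_on UNIV u" by (rule GDERIV_continuous[OF d])
  have "integral\<^sup>L Q (\<lambda>z. u z *\<^sub>R D z + \<phi> z *\<^sub>R G z) = 0"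
  proof (rule integral_gradient_compact_support)
    show "GDERIV (\<lambda>z. u z * \<phi> z) z :> u z *\<^sub>R D z + \<phi> z *\<^sub>R G z" for z
      by (rule GDERIV_mult[OF d D[rule_format]])
    show "continuous_on UNIV (\<lambda>z. u z *\<^sub>R D z + \<phi> z *\<^sub>R G z)"
      by (intro continuous_intros cu cD c)
    show "u z * \<phi> z = 0" if "z \<notin> closure {x. \<phi> x \<noteq> 0}" for z using zero_outside_support[OF that] by simp
  qed (rule test_functionsD[OF \<phi>])+
  moreover have "integrable Q (\<lambda>z. u z *\<^sub>R D z)" "integrable Q (\<lambda>z. \<phi> z *\<^sub>R G z)"
    by (intro integrable_scaleR_sqint sqint_Q_continuous cu cD c)+
  ultimately show "(LINT x|Q. u x *\<^sub>R D x) = - (LINT x|Q. \<phi> x *\<^sub>R G x)"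
    by (simp add: eq_neg_iff_add_eq_0)
qed

section \<open>The fundamental lemma of the calculus of variations\<close>

lemma continuous_sequentially_indicator:
  fixes s :: "real \<Rightarrow> real"
  assumes s: "\<And>x. x \<le> 0 \<Longrightarrow> s x = 0" "\<And>x. x \<ge> 1 \<Longrightarrow> s x = 1"
  shows "(\<lambda>m. s (real m * (x - a) - 1) * s (real m * (b - x) - 1)) \<longlonglongrightarrow> indicator {a<..<b} x"
proof (cases "x \<in> {a<..<b}")
  case True
  obtain m0 :: nat where m0: "2 / (x - a) < m0" using reals_Archimedean2 by blast
  obtain m1 :: nat where m1: "2 / (b - x) < m1" using reals_Archimedean2 by blast
  have "s (real m * (x - a) - 1) * s (real m * (b - x) - 1) = 1" if "m \<ge> max m0 m1" for m
  proof -
    have "2 \<le> real m0 * (x - a)" "2 \<le> real m1 * (b - x)" using m0 m1 True by (auto simp: field_simps)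
    moreover have "real m0 * (x - a) \<le> real m * (x - a)" "real m1 * (b - x) \<le> real m * (b - x)"
      using that True by (auto intro!: mult_right_mono)
    ultimately show ?thesis using s(2)[of "real m * (x - a) - 1"] s(2)[of "real m * (b - x) - 1"] by simp
  qed
  then have "\<forall>\<^sub>F m in sequentially. s (real m * (x - a) - 1) * s (real m * (b - x) - 1) = 1"
    by (intro eventually_sequentiallyI[of "max m0 m1"])
  then have "(\<lambda>m. s (real m * (x - a) - 1) * s (real m * (b - x) - 1)) \<longlonglongrightarrow> 1"
    by (rule tendsto_eventually)
  then show ?thesis using True by simp
next
  case False
  then have "x \<le> a \<or> x \<ge> b" by auto
  then have "s (real m * (x - a) - 1) = 0 \<or> s (real m * (b - x) - 1) = 0" for m
    using s(1)[of "real m * (x - a) - 1"] s(1)[of "real m * (b - x) - 1"]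
      mult_nonneg_nonpos[of "real m" "x - a"] mult_nonneg_nonpos[of "real m" "b - x"] by force
  then have "(\<lambda>m. s (real m * (x - a) - 1) * s (real m * (b - x) - 1)) = (\<lambda>m. 0)" by (simp add: fun_eq_iff)
  then show ?thesis unfolding \<open>(\<lambda>m. s (real m * (x - a) - 1) * s (real m * (b - x) - 1)) = (\<lambda>m. 0)\<close> using False by simp
qed

text \<open>Products of one-dimensional bumps are test functions and converge boundedly to
  indicators of boxes, so the integral of \<open>F\<close> over every box vanishes. Boxes are stable
  under intersection and generate the Borel sets, which forces the positive and the negative part of
  \<open>F\<close> to have the same integrals everywhere.\<close>

lemma AE_zero_of_test_functions:
  fixes F :: "real \<times> real \<Rightarrow> real"
  assumes F: "sqint Q F" and z: "\<And>\<phi>. \<phi> \<in> test_functions unit_square \<Longrightarrow> (LINT z|Q. \<phi> z * F z) = 0"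
  shows "AE z in Q. F z = 0"
proof -
  obtain s :: "real \<Rightarrow> real" where s: "smooth s" "\<And>x. x \<le> 0 \<Longrightarrow> s x = 0" "\<And>x. x \<ge> 1 \<Longrightarrow> s x = 1" "\<And>x. 0 \<le> s x \<and> s x \<le> 1"
    using smooth_step_exists by blast
  define bump where "bump a b m x = s (real m * (x - a) - 1) * s (real m * (b - x) - 1)" for a b m x
  have bump_smooth: "smooth (bump a b m)" for a b m
    using smooth_mult[OF smooth_affine[OF s(1), of "real m" "- real m * a - 1"] smooth_affine[OF s(1), of "- real m" "real m * b - 1"]]
    unfolding bump_def by (simp add: algebra_simps)
  have bump_le: "0 \<le> bump a b m x \<and> bump a b m x \<le> 1" for a b m x
    using s(4) by (auto simp: bump_def intro: mult_le_one)
  have bump_zero: "bump a b m x = 0" if "x \<notin> {a + 1 / real m..b - 1 / real m}" for a b m x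
  proof (cases "m = 0")
    case True then show ?thesis using s(2)[of "-1"] by (simp add: bump_def)
  next
    case False
    then have "real m * (x - a) - 1 \<le> 0 \<or> real m * (b - x) - 1 \<le> 0"
      using that by (auto simp: field_simps)
    then show ?thesis using s(2) by (auto simp: bump_def)
  qed
  have Fi: "integrable Q F" by (rule integrable_sqint_Q[OF F])
  have box0: "(LINT z|Q. indicator (box (a, c) (b, d)) z * F z) = 0" for a b c d :: real
  proof -
    \<comment> \<open>The box is clipped to the square, so that the bumps for positive
      \<open>m\<close> have compact support inside.\<close>
    let ?a = "max a 0" and ?b = "min b 1" and ?c = "max c 0" and ?d = "min d 1"
    have "(\<lambda>m. LINT z|Q. (bump ?a ?b m (fst z) * bump ?c ?d m (snd z)) * F z) \<longlonglongrightarrow> 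
      (LINT z|Q. indicator (box (a, c) (b, d)) z * F z)"
    proof (rule integral_dominated_convergence[where w = "\<lambda>z. norm (F z)"])
      show "AE z in Q. (\<lambda>m. (bump ?a ?b m (fst z) * bump ?c ?d m (snd z)) * F z) \<longlonglongrightarrow> indicator (box (a, c) (b, d)) z * F z"
      proof (rule AE_I2)
        fix z assume "z \<in> space Q"
        then have i: "indicator (box (a, c) (b, d)) z = (indicator {?a<..<?b} (fst z) * indicator {?c<..<?d} (snd z) :: real)"
          by (cases z) (auto simp: indicator_def box_def Basis_prod_def unit_square_def)
        show "(\<lambda>m. (bump ?a ?b m (fst z) * bump ?c ?d m (snd z)) * F z) \<longlonglongrightarrow> indicator (box (a, c) (b, d)) z * F z"
          unfolding i bump_def by (intro tendsto_mult tendsto_const continuous_sequentially_indicator s)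
      qed
      show "AE z in Q. norm ((bump ?a ?b m (fst z) * bump ?c ?d m (snd z)) * F z) \<le> norm (F z)" for m
      proof (rule AE_I2)
        fix z
        have "norm ((bump ?a ?b m (fst z) * bump ?c ?d m (snd z)) * F z) = (bump ?a ?b m (fst z) * bump ?c ?d m (snd z)) * norm (F z)"
          using bump_le by (simp add: abs_mult)
        also have "\<dots> \<le> 1 * norm (F z)" using bump_le by (intro mult_right_mono mult_le_one) auto
        finally show "norm ((bump ?a ?b m (fst z) * bump ?c ?d m (snd z)) * F z) \<le> norm (F z)" by simp
      qed
      have "continuous_on UNIV (\<lambda>z. bump ?a ?b m (fst z) * bump ?c ?d m (snd z))" for m
        by (intro continuous_intros continuous_on_compose2[OF smooth_continuous[OF bump_smooth], of UNIV]) auto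
      then show "(\<lambda>z. (bump ?a ?b m (fst z) * bump ?c ?d m (snd z)) * F z) \<in> borel_measurable Q" for m
        by (rule borel_measurable_times[OF borel_measurable_Q[OF borel_measurable_continuous_onI] sqintD(1)[OF F]])
      show "(\<lambda>z. indicator (box (a, c) (b, d)) z * F z) \<in> borel_measurable Q"
        by (rule borel_measurable_times[OF borel_measurable_Q[OF borel_measurable_indicator] sqintD(1)[OF F]]) simp
    qed (use Fi in auto)
    moreover have "(LINT z|Q. (bump ?a ?b m (fst z) * bump ?c ?d m (snd z)) * F z) = 0" for m
    proof (cases "m = 0")
      case True
      then show ?thesis using s(2)[of "-1"] by (simp add: bump_def)
    next
      case False
      have "(\<lambda>z. bump ?a ?b m (fst z) * bump ?c ?d m (snd z)) \<in> test_functions unit_square"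
        by (rule test_functions_tensor[where a = "1 / real m" and b = "1 - 1 / real m"])
          (use False in \<open>auto intro!: bump_smooth bump_zero\<close>)
      then show ?thesis by (rule z)
    qed
    ultimately show ?thesis by (simp add: LIMSEQ_const_iff)
  qed
  have Fm: "(\<lambda>z. indicator unit_square z *\<^sub>R F z) \<in> borel_measurable lebesgue"
    using sqintD(1)[OF F] by (subst borel_measurable_restrict_space_iff[symmetric]) auto
  \<comment> \<open>A Borel representative of the zero extension of \<open>F\<close>: the comparison
    of measures below takes place over \<open>lborel\<close>, while \<open>F\<close> is Lebesgue
    measurable.\<close>
  obtain g where g: "g \<in> borel_measurable lborel" "AE z in lborel. indicator unit_square z *\<^sub>R F z = g z"
    using completion_ex_borel_measurable_real[OF Fm] by blast
  have gL: "AE z in lebesgue. indicator unit_square z *\<^sub>R F z = g z" using g(2) by (rule AE_completion)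
  have Fil: "integrable lebesgue (\<lambda>z. indicator unit_square z *\<^sub>R F z)"
    using Fi by (subst integrable_restrict_space[symmetric]) auto
  have gi: "integrable lborel g"
  proof -
    have "integrable lebesgue g"
      using Fil gL g(1) by (subst integrable_cong_AE[symmetric, OF _ _ gL]) (auto intro: measurable_completion)
    then show ?thesis using g(1) by (simp add: integrable_completion)
  qed
  have gbox: "(\<integral>z. indicator B z * g z \<partial>lborel) = 0" if rB: "B \<in> range (\<lambda>(a, b). box a b)" for B :: "(real \<times> real) set"
  proof -
    obtain p q where "B = box p q" using rB by auto
    then have B: "B = box (fst p, snd p) (fst q, snd q)" by simp
    have Bm: "B \<in> sets borel" by (simp add: B)
    have "(\<integral>z. indicator B z * g z \<partial>lborel) = (\<integral>z. indicator B z * g z \<partial>lebesgue)"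
      using g(1) Bm by (intro integral_completion[symmetric]) auto
    also have "\<dots> = (\<integral>z. indicator B z * (indicator unit_square z *\<^sub>R F z) \<partial>lebesgue)"
    proof (rule integral_cong_AE)
      show "AE z in lebesgue. indicator B z * g z = indicator B z * (indicator unit_square z *\<^sub>R F z)"
        using gL by eventually_elim simp
      have iB: "(indicator B :: _ \<Rightarrow> real) \<in> borel_measurable lebesgue"
        using Bm by (intro measurable_completion borel_measurable_indicator) simp
      show "(\<lambda>z. indicator B z * g z) \<in> borel_measurable lebesgue"
        by (rule borel_measurable_times[OF iB measurable_completion[OF g(1)]])
      show "(\<lambda>z. indicator B z * (indicator unit_square z *\<^sub>R F z)) \<in> borel_measurable lebesgue"
        by (rule borel_measurable_times[OF iB Fm])
    qed
    also have "\<dots> = (LINT z|Q. indicator B z * F z)"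
      by (subst integral_restrict_space) (auto intro!: Bochner_Integration.integral_cong)
    also have "\<dots> = 0" unfolding B by (rule box0)
    finally show ?thesis .
  qed
  \<comment> \<open>Since \<open>ennreal\<close> truncates at 0, these are the measures whose
    densities are the positive and the negative part of \<open>g\<close>.\<close>
  have "density lborel (\<lambda>z. ennreal (g z)) = density lborel (\<lambda>z. ennreal (- g z))"
  proof (rule measure_eqI_generator_eq)
    let ?E = "range (\<lambda>(a, b). box a b::(real \<times> real) set)"
    show "Int_stable ?E" by (auto simp: Int_stable_def box_Int_box)
    show "?E \<subseteq> Pow UNIV" "sets (density lborel (\<lambda>z. ennreal (g z))) = sigma_sets UNIV ?E"
      "sets (density lborel (\<lambda>z. ennreal (- g z))) = sigma_sets UNIV ?E"
      by (simp_all add: borel_eq_box)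
    let ?A = "\<lambda>n::nat. box (- (real n *\<^sub>R One)) (real n *\<^sub>R One) :: (real \<times> real) set"
    show "range ?A \<subseteq> ?E" "(\<Union>i. ?A i) = UNIV" unfolding UN_box_eq_UNIV by auto
    show "emeasure (density lborel (\<lambda>z. ennreal (g z))) (?A i) \<noteq> \<infinity>" for i
    proof -
      have "emeasure (density lborel (\<lambda>z. ennreal (g z))) (?A i) = (\<integral>\<^sup>+z. ennreal (g z) * indicator (?A i) z \<partial>lborel)"
        using g(1) by (intro emeasure_density) auto
      also have "\<dots> \<le> (\<integral>\<^sup>+z. ennreal (norm (g z)) \<partial>lborel)"
        by (intro nn_integral_mono) (auto simp: indicator_def ennreal_leI)
      also have "\<dots> < \<infinity>" using gi by (simp add: integrable_iff_bounded)
      finally show ?thesis by simp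
    qed
    fix B assume B: "B \<in> ?E"
    then have Bm: "B \<in> sets borel" by auto
    have m: "(\<lambda>z. indicator B z * g z) \<in> borel_measurable lborel" using g(1) Bm by auto
    have i: "integrable lborel (\<lambda>z. indicator B z * g z)"
      using gi m by (rule Bochner_Integration.integrable_bound) (auto simp: indicator_def)
    have p: "integrable lborel (\<lambda>z. max 0 (indicator B z * g z))" "integrable lborel (\<lambda>z. max 0 (- (indicator B z * g z)))"
      using i by (auto intro: integrable_max)
    have "(\<integral>z. max 0 (indicator B z * g z) \<partial>lborel) - (\<integral>z. max 0 (- (indicator B z * g z)) \<partial>lborel)
       = (\<integral>z. max 0 (indicator B z * g z) - max 0 (- (indicator B z * g z)) \<partial>lborel)"
      using p by simp
    also have "\<dots> = (\<integral>z. indicator B z * g z \<partial>lborel)" by (intro Bochner_Integration.integral_cong refl) (auto simp: max_def)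
    also have "\<dots> = 0" by (rule gbox[OF B])
    finally have eq: "(\<integral>z. max 0 (indicator B z * g z) \<partial>lborel) = (\<integral>z. max 0 (- (indicator B z * g z)) \<partial>lborel)" by simp
    have "emeasure (density lborel (\<lambda>z. ennreal (g z))) B = (\<integral>\<^sup>+z. ennreal (max 0 (indicator B z * g z)) \<partial>lborel)"
      using g(1) Bm by (subst emeasure_density) (auto intro!: nn_integral_cong simp: indicator_def max_def ennreal_neg)
    also have "\<dots> = ennreal (\<integral>z. max 0 (indicator B z * g z) \<partial>lborel)"
      using p by (intro nn_integral_eq_integral) auto
    also have "\<dots> = (\<integral>\<^sup>+z. ennreal (max 0 (- (indicator B z * g z))) \<partial>lborel)"
      unfolding eq using p by (intro nn_integral_eq_integral[symmetric]) auto
    also have "\<dots> = emeasure (density lborel (\<lambda>z. ennreal (- g z))) B"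
      using g(1) Bm by (subst emeasure_density) (auto intro!: nn_integral_cong simp: indicator_def max_def ennreal_neg)
    finally show "emeasure (density lborel (\<lambda>z. ennreal (g z))) B = emeasure (density lborel (\<lambda>z. ennreal (- g z))) B" .
  qed
  then have "AE z in lborel. ennreal (g z) = ennreal (- g z)"
    using g(1) by (intro sigma_finite_measure.density_unique[OF sigma_finite_lborel]) auto
  then have "AE z in lborel. indicator unit_square z *\<^sub>R F z = 0"
    using g(2)
  proof eventually_elim
    case (elim z)
    have "g z = 0"
    proof (cases "g z \<ge> 0")
      case True
      then have "ennreal (g z) = 0" unfolding elim(1) by (simp add: ennreal_neg)
      then show ?thesis using True by (simp add: ennreal_eq_0_iff)
    next
      case False
      then have "ennreal (- g z) = 0" unfolding elim(1)[symmetric] by (simp add: ennreal_neg)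
      then show ?thesis using False by (simp add: ennreal_eq_0_iff)
    qed
    then show ?case using elim(2) by simp
  qed
  then have "AE z in lebesgue. indicator unit_square z *\<^sub>R F z = 0" by (rule AE_completion)
  then have "AE z in lebesgue. z \<in> unit_square \<longrightarrow> F z = 0" by eventually_elim (auto simp: indicator_def)
  then show ?thesis by (simp add: AE_restrict_space_iff)
qed

section \<open>The Sobolev space of the unit square\<close>

abbreviation hwg :: "(real \<times> real \<Rightarrow> real) \<Rightarrow> (real \<times> real \<Rightarrow> real \<times> real) \<Rightarrow> bool" where
  "hwg \<equiv> has_weak_gradient unit_square"

abbreviation H1Q :: "(real \<times> real \<Rightarrow> real) set" where "H1Q \<equiv> H1 unit_square"
abbreviation H10 :: "(real \<times> real \<Rightarrow> real) set" where "H10 \<equiv> H1_0 unit_square"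
abbreviation N1 :: "(real \<times> real \<Rightarrow> real) \<Rightarrow> real" where "N1 \<equiv> H1_norm unit_square"
abbreviation S1 :: "(real \<times> real \<Rightarrow> real) \<Rightarrow> real" where "S1 \<equiv> H1_seminorm unit_square"

lemma sqint_fst:
  fixes V :: "'a \<Rightarrow> 'b::euclidean_space \<times> 'c::euclidean_space"
  assumes V: "sqint M V" shows "sqint M (\<lambda>z. fst (V z))"
proof (rule sqint_bound[OF V])
  show "(\<lambda>z. fst (V z)) \<in> borel_measurable M"
    by (rule measurable_compose[OF sqintD(1)[OF V] borel_measurable_continuous_onI]) (intro continuous_intros)
  show "norm (fst (V z)) \<le> norm (V z)" for z using norm_fst_le[of "fst (V z)" "snd (V z)"] by simp
qed

lemma sqint_snd:
  fixes V :: "'a \<Rightarrow> 'b::euclidean_space \<times> 'c::euclidean_space"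
  assumes V: "sqint M V" shows "sqint M (\<lambda>z. snd (V z))"
proof (rule sqint_bound[OF V])
  show "(\<lambda>z. snd (V z)) \<in> borel_measurable M"
    by (rule measurable_compose[OF sqintD(1)[OF V] borel_measurable_continuous_onI]) (intro continuous_intros)
  show "norm (snd (V z)) \<le> norm (V z)" for z using norm_snd_le[of "snd (V z)" "fst (V z)"] by simp
qed

lemma hwg_sqint: "hwg u G \<Longrightarrow> sqint Q G"
  by (simp add: has_weak_gradient_def square_integrable_eq)

lemma hwgD:
  assumes "hwg u G" "\<phi> \<in> test_functions unit_square" "\<And>z. GDERIV \<phi> z :> D z"
  shows "(LINT x|Q. u x *\<^sub>R D x) = - (LINT x|Q. \<phi> x *\<^sub>R G x)"
  using assms unfolding has_weak_gradient_def by blast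

lemma test_function_gradient_exists:
  assumes "\<phi> \<in> test_functions \<Omega>"
  shows "\<exists>D. \<forall>z. GDERIV \<phi> z :> D z"
proof -
  have "C_n (Suc 0) \<phi>" using test_functionsD(1)[OF assms] .
  then show ?thesis unfolding C_n.simps by blast
qed

lemma hwg_unique:
  assumes G: "hwg u G" and G': "hwg u G'"
  shows "AE z in Q. G z = G' z"
proof -
  note s = hwg_sqint[OF G] hwg_sqint[OF G']
  let ?F = "\<lambda>z. G z - G' z"
  have F: "sqint Q ?F" by (intro sqint_diff s)
  have e: "(LINT z|Q. \<phi> z *\<^sub>R ?F z) = 0" if \<phi>: "\<phi> \<in> test_functions unit_square" for \<phi>
  proof -
    obtain D where D: "\<forall>z. GDERIV \<phi> z :> D z" using test_function_gradient_exists[OF \<phi>] ..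
    have p: "sqint Q \<phi>" by (rule sqint_Q_continuous[OF test_function_gradient(2)[OF \<phi> D[rule_format]]])
    have "(LINT z|Q. \<phi> z *\<^sub>R G z) = (LINT z|Q. \<phi> z *\<^sub>R G' z)"
      using hwgD[OF G \<phi> D[rule_format]] hwgD[OF G' \<phi> D[rule_format]] by simp
    then show ?thesis using integrable_scaleR_sqint[OF p s(1)] integrable_scaleR_sqint[OF p s(2)]
      by (simp add: scaleR_diff_right)
  qed
  have i: "integrable Q (\<lambda>z. \<phi> z *\<^sub>R ?F z)" if \<phi>: "\<phi> \<in> test_functions unit_square" for \<phi>
  proof -
    obtain D where D: "\<forall>z. GDERIV \<phi> z :> D z" using test_function_gradient_exists[OF \<phi>] ..
    show ?thesis
      by (rule integrable_scaleR_sqint[OF sqint_Q_continuous[OF test_function_gradient(2)[OF \<phi> D[rule_format]]] F])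
  qed
  have "AE z in Q. fst (?F z) = 0"
  proof (rule AE_zero_of_test_functions)
    show "sqint Q (\<lambda>z. fst (?F z))" by (rule sqint_fst[OF F])
    show "(LINT z|Q. \<phi> z * fst (?F z)) = 0" if "\<phi> \<in> test_functions unit_square" for \<phi>
      using integral_fst[OF i[OF that]] e[OF that] by simp
  qed
  moreover have "AE z in Q. snd (?F z) = 0"
  proof (rule AE_zero_of_test_functions)
    show "sqint Q (\<lambda>z. snd (?F z))" by (rule sqint_snd[OF F])
    show "(LINT z|Q. \<phi> z * snd (?F z)) = 0" if "\<phi> \<in> test_functions unit_square" for \<phi>
      using integral_snd[OF i[OF that]] e[OF that] by simp
  qed
  ultimately show ?thesis by eventually_elim (simp add: prod_eq_iff)
qed

text \<open>Uniqueness of weak gradients removes the choice inside \<open>weak_gradient\<close>: any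
  weak gradient at hand computes the seminorm.\<close>

lemma S1_eq:
  assumes "hwg u G" shows "S1 u = l2 Q G"
proof -
  have w: "hwg u (weak_gradient unit_square u)"
    unfolding weak_gradient_def using someI[of "hwg u" G] assms by simp
  have "(LINT z|Q. (norm (weak_gradient unit_square u z))\<^sup>2) = (LINT z|Q. (norm (G z))\<^sup>2)"
  proof (rule integral_cong_AE)
    show "AE z in Q. (norm (weak_gradient unit_square u z))\<^sup>2 = (norm (G z))\<^sup>2"
      using hwg_unique[OF w assms] by eventually_elim simp
  qed (use sqintD(1)[OF hwg_sqint[OF w]] sqintD(1)[OF hwg_sqint[OF assms]] in auto)
  then show ?thesis by (simp add: H1_seminorm_def l2_def)
qed

lemma norm_pair_power2: "(norm (a, b))\<^sup>2 = (norm a)\<^sup>2 + (norm b)\<^sup>2"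
  by (simp add: norm_Pair)

lemma sqint_pair:
  assumes "sqint M u" "sqint M G" shows "sqint M (\<lambda>z. (u z, G z))"
  using assms unfolding sqint_def norm_pair_power2 by (auto intro: borel_measurable_Pair)

text \<open>The Sobolev norm as a graph norm. Homogeneity, triangle inequality and completeness of
  \<open>N1\<close> are those of \<open>l2\<close> for pairs.\<close>

lemma N1_eq:
  assumes "sqint Q u" "hwg u G" shows "N1 u = l2 Q (\<lambda>z. (u z, G z))"
  using sqintD(2)[OF assms(1)] sqintD(2)[OF hwg_sqint[OF assms(2)]]
  by (simp add: H1_norm_def S1_eq[OF assms(2)] l2_power2 l2_def norm_pair_power2)

lemma N1_nonneg [simp]: "N1 u \<ge> 0"
  by (simp add: H1_norm_def)

lemma S1_le_N1: "S1 u \<le> N1 u"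
  unfolding H1_norm_def by (rule real_le_rsqrt) simp

lemma hwg_add:
  assumes "sqint Q u" "sqint Q v" "hwg u G" "hwg v H"
  shows "hwg (\<lambda>z. u z + v z) (\<lambda>z. G z + H z)"
  unfolding has_weak_gradient_def square_integrable_eq
proof (intro conjI ballI allI impI)
  show "sqint Q (\<lambda>z. G z + H z)" by (intro sqint_add hwg_sqint[OF assms(3)] hwg_sqint[OF assms(4)])
  fix \<phi> D assume \<phi>: "\<phi> \<in> test_functions unit_square" and D: "\<forall>z. GDERIV \<phi> z :> D z"
  note c = test_function_gradient[OF \<phi> D[rule_format]]
  have s: "sqint Q D" "sqint Q \<phi>" by (intro sqint_Q_continuous c)+
  show "(LINT x|Q. (u x + v x) *\<^sub>R D x) = - (LINT x|Q. \<phi> x *\<^sub>R (G x + H x))"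
    using hwgD[OF assms(3) \<phi> D[rule_format]] hwgD[OF assms(4) \<phi> D[rule_format]]
      integrable_scaleR_sqint[OF assms(1) s(1)] integrable_scaleR_sqint[OF assms(2) s(1)]
      integrable_scaleR_sqint[OF s(2) hwg_sqint[OF assms(3)]] integrable_scaleR_sqint[OF s(2) hwg_sqint[OF assms(4)]]
    by (simp add: scaleR_add_left scaleR_add_right)
qed

lemma hwg_cmult:
  assumes "hwg u G" shows "hwg (\<lambda>z. a * u z) (\<lambda>z. a *\<^sub>R G z)"
  unfolding has_weak_gradient_def square_integrable_eq
proof (intro conjI ballI allI impI)
  show "sqint Q (\<lambda>z. a *\<^sub>R G z)" by (intro sqint_scaleR hwg_sqint[OF assms])
  fix \<phi> D assume \<phi>: "\<phi> \<in> test_functions unit_square" and D: "\<forall>z. GDERIV \<phi> z :> D z"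
  have "(LINT x|Q. (a * u x) *\<^sub>R D x) = a *\<^sub>R (LINT x|Q. u x *\<^sub>R D x)"
    by (simp only: scaleR_scaleR[symmetric] integral_scaleR_right)
  also have "\<dots> = a *\<^sub>R - (LINT x|Q. \<phi> x *\<^sub>R G x)" by (simp only: hwgD[OF assms \<phi> D[rule_format]])
  also have "\<dots> = - (LINT x|Q. a *\<^sub>R (\<phi> x *\<^sub>R G x))" by (simp only: integral_scaleR_right scaleR_minus_right)
  finally show "(LINT x|Q. (a * u x) *\<^sub>R D x) = - (LINT x|Q. \<phi> x *\<^sub>R a *\<^sub>R G x)"
    by (simp add: mult.commute)
qed

text \<open>All integrals extend over the square. Together with the analogues below this allows
  splines, which are defined everywhere, to be exchanged with zero extensions and wavelet sums that
  agree with them only inside.\<close>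

lemma hwg_cong:
  assumes "\<And>z. z \<in> unit_square \<Longrightarrow> u z = v z" shows "hwg u G \<longleftrightarrow> hwg v G"
proof -
  have "(LINT x|Q. u x *\<^sub>R D x) = (LINT x|Q. v x *\<^sub>R D x)" for D :: "real \<times> real \<Rightarrow> real \<times> real"
    using assms by (intro Bochner_Integration.integral_cong) auto
  then show ?thesis unfolding has_weak_gradient_def by simp
qed

lemma sqint_cong:
  assumes "\<And>z. z \<in> space M \<Longrightarrow> u z = v z" shows "sqint M u \<longleftrightarrow> sqint M v"
  unfolding sqint_def using assms
  by (intro conj_cong measurable_cong Bochner_Integration.integrable_cong) auto

lemma S1_cong: "(\<And>z. z \<in> unit_square \<Longrightarrow> u z = v z) \<Longrightarrow> S1 u = S1 v"
  using hwg_cong[of u v] by (simp add: H1_seminorm_def weak_gradient_def)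

lemma N1_cong:
  assumes "\<And>z. z \<in> unit_square \<Longrightarrow> u z = v z" shows "N1 u = N1 v"
proof -
  have "(LINT x|Q. (u x)\<^sup>2) = (LINT x|Q. (v x)\<^sup>2)"
    using assms by (intro Bochner_Integration.integral_cong) auto
  then show ?thesis using S1_cong[of u v] assms by (simp add: H1_norm_def)
qed

lemma H1Q_iff: "u \<in> H1Q \<longleftrightarrow> sqint Q u \<and> (\<exists>G. hwg u G)"
  by (simp add: H1_def square_integrable_eq)

lemma H1Q_cong: "(\<And>z. z \<in> unit_square \<Longrightarrow> u z = v z) \<Longrightarrow> u \<in> H1Q \<longleftrightarrow> v \<in> H1Q"
proof -
  assume a: "\<And>z. z \<in> unit_square \<Longrightarrow> u z = v z"
  have "hwg u = hwg v" using hwg_cong[of u v] a by (simp add: fun_eq_iff)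
  then show ?thesis unfolding H1Q_iff using sqint_cong[of Q u v] a by simp
qed

lemma H10_cong:
  assumes "\<And>z. z \<in> unit_square \<Longrightarrow> u z = v z" shows "u \<in> H10 \<longleftrightarrow> v \<in> H10"
proof -
  have "N1 (\<lambda>x. u x - \<phi> x) = N1 (\<lambda>x. v x - \<phi> x)" for \<phi> using assms by (intro N1_cong) auto
  then show ?thesis unfolding H1_0_def using H1Q_cong[of u v] assms by simp
qed

section \<open>Linear structure and norm properties of the Sobolev spaces\<close>

lemma H1Q_add: "u \<in> H1Q \<Longrightarrow> v \<in> H1Q \<Longrightarrow> (\<lambda>z. u z + v z) \<in> H1Q"
  unfolding H1Q_iff using sqint_add hwg_add by blast

lemma H1Q_cmult: "u \<in> H1Q \<Longrightarrow> (\<lambda>z. a * u z) \<in> H1Q"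
  unfolding H1Q_iff using sqint_cmult hwg_cmult by blast

lemma H1Q_diff: "u \<in> H1Q \<Longrightarrow> v \<in> H1Q \<Longrightarrow> (\<lambda>z. u z - v z) \<in> H1Q"
  using H1Q_add[of u "\<lambda>z. - 1 * v z"] H1Q_cmult[of v "- 1"] by simp

lemma N1_cmult:
  assumes "u \<in> H1Q" shows "N1 (\<lambda>z. a * u z) = \<bar>a\<bar> * N1 u"
proof -
  obtain G where u: "sqint Q u" "hwg u G" using assms H1Q_iff by blast
  have "N1 (\<lambda>z. a * u z) = l2 Q (\<lambda>z. a *\<^sub>R (u z, G z))"
    using N1_eq[OF sqint_cmult[OF u(1)] hwg_cmult[OF u(2)]] by simp
  then show ?thesis using N1_eq[OF u] by (simp only: l2_scaleR)
qed

lemma N1_triangle: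
  assumes "u \<in> H1Q" "v \<in> H1Q" shows "N1 (\<lambda>z. u z + v z) \<le> N1 u + N1 v"
proof -
  obtain G where u: "sqint Q u" "hwg u G" using assms H1Q_iff by blast
  obtain H where v: "sqint Q v" "hwg v H" using assms H1Q_iff by blast
  have "N1 (\<lambda>z. u z + v z) = l2 Q (\<lambda>z. (u z, G z) + (v z, H z))"
    using N1_eq[OF sqint_add[OF u(1) v(1)] hwg_add[OF u(1) v(1) u(2) v(2)]] by simp
  also have "\<dots> \<le> N1 u + N1 v"
    unfolding N1_eq[OF u] N1_eq[OF v] by (intro l2_triangle sqint_pair u v hwg_sqint[OF u(2)] hwg_sqint[OF v(2)])
  finally show ?thesis .
qed

lemma N1_diff_triangle:
  assumes "u \<in> H1Q" "v \<in> H1Q" "w \<in> H1Q"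
  shows "N1 (\<lambda>z. u z - w z) \<le> N1 (\<lambda>z. u z - v z) + N1 (\<lambda>z. v z - w z)"
  using N1_triangle[OF H1Q_diff[OF assms(1,2)] H1Q_diff[OF assms(2,3)]] by simp

lemma N1_minus_commute: "u \<in> H1Q \<Longrightarrow> v \<in> H1Q \<Longrightarrow> N1 (\<lambda>z. u z - v z) = N1 (\<lambda>z. v z - u z)"
  using N1_cmult[OF H1Q_diff[of v u], of "- 1"] by simp

lemma H10_H1Q: "u \<in> H10 \<Longrightarrow> u \<in> H1Q"
  by (simp add: H1_0_def)

lemma test_function_H1Q:
  assumes "\<phi> \<in> test_functions unit_square" shows "\<phi> \<in> H1Q"
proof -
  obtain D where D: "\<forall>z. GDERIV \<phi> z :> D z" using test_function_gradient_exists[OF assms] ..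
  note c = test_function_gradient[OF assms D[rule_format]]
  show ?thesis unfolding H1Q_iff
    by (intro conjI exI) (rule sqint_Q_continuous[OF c(2)], rule has_weak_gradient_C1[OF D[rule_format] c(1)])
qed

lemma zero_test_function: "(\<lambda>z. 0) \<in> test_functions unit_square"
  using test_functions_sum[of "{}" "\<lambda>_ _. 0"] by simp

lemma H10_approx:
  assumes "u \<in> H10" "e > 0"
  shows "\<exists>\<phi>. \<phi> \<in> test_functions unit_square \<and> N1 (\<lambda>z. u z - \<phi> z) < e"
proof -
  have "\<forall>e>0. \<exists>\<phi>\<in>test_functions unit_square. N1 (\<lambda>z. u z - \<phi> z) < e"
    using assms(1) by (simp add: H1_0_def)
  then show ?thesis using assms(2) by blast
qed

lemma test_function_H10:
  assumes "\<phi> \<in> test_functions unit_square" shows "\<phi> \<in> H10"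
proof -
  have "N1 (\<lambda>z. \<phi> z - \<phi> z) = 0" using N1_cmult[OF test_function_H1Q[OF assms], of 0] by simp
  then have "\<forall>e>0. \<exists>\<psi>\<in>test_functions unit_square. N1 (\<lambda>z. \<phi> z - \<psi> z) < e" using assms by metis
  then show ?thesis unfolding H1_0_def using test_function_H1Q[OF assms] by simp
qed

text \<open>An approximant in \<open>H10\<close> has itself a test function nearby. This is the
  common route to scalar multiples, sums, limits and splines.\<close>

lemma H10_closure:
  assumes u: "u \<in> H1Q" and a: "\<And>e. e > 0 \<Longrightarrow> \<exists>v\<in>H10. N1 (\<lambda>z. u z - v z) < e"
  shows "u \<in> H10"
  unfolding H1_0_def
proof (intro CollectI conjI allI impI u)
  fix e :: real assume e: "e > 0"
  then obtain v where v: "v \<in> H10" "N1 (\<lambda>z. u z - v z) < e / 2" using a[of "e / 2"] by auto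
  obtain \<phi> where \<phi>: "\<phi> \<in> test_functions unit_square" "N1 (\<lambda>z. v z - \<phi> z) < e / 2"
    using H10_approx[OF v(1), of "e / 2"] e by auto
  have "N1 (\<lambda>z. u z - \<phi> z) < e"
    using N1_diff_triangle[OF u H10_H1Q[OF v(1)] test_function_H1Q[OF \<phi>(1)]] v(2) \<phi>(2) by simp
  then show "\<exists>\<phi>\<in>test_functions unit_square. N1 (\<lambda>x. u x - \<phi> x) < e" using \<phi>(1) by blast
qed

lemma H10_cmult:
  assumes u: "u \<in> H10" shows "(\<lambda>z. a * u z) \<in> H10"
proof (rule H10_closure)
  show "(\<lambda>z. a * u z) \<in> H1Q" by (intro H1Q_cmult H10_H1Q u)
  fix e :: real assume e: "e > 0"
  have "e / (\<bar>a\<bar> + 1) > 0" using e by simp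
  then obtain \<phi> where \<phi>: "\<phi> \<in> test_functions unit_square" "N1 (\<lambda>z. u z - \<phi> z) < e / (\<bar>a\<bar> + 1)"
    using H10_approx[OF u] by blast
  have "N1 (\<lambda>z. a * u z - a * \<phi> z) = \<bar>a\<bar> * N1 (\<lambda>z. u z - \<phi> z)"
    using N1_cmult[OF H1Q_diff[OF H10_H1Q[OF u] test_function_H1Q[OF \<phi>(1)]], of a] by (simp add: right_diff_distrib)
  also have "\<dots> \<le> (\<bar>a\<bar> + 1) * N1 (\<lambda>z. u z - \<phi> z)" by (intro mult_right_mono) auto
  also have "\<dots> < e" using \<phi>(2) by (simp add: pos_less_divide_eq add_pos_nonneg mult.commute)
  finally show "\<exists>v\<in>H10. N1 (\<lambda>z. a * u z - v z) < e"
    using test_function_H10[OF test_functions_cmult[OF \<phi>(1), of a]] by (rule bexI)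
qed

lemma H10_add:
  assumes u: "u \<in> H10" and v: "v \<in> H10" shows "(\<lambda>z. u z + v z) \<in> H10"
proof (rule H10_closure)
  show "(\<lambda>z. u z + v z) \<in> H1Q" by (intro H1Q_add H10_H1Q u v)
  fix e :: real assume e: "e > 0"
  then have e2: "e / 2 > 0" by simp
  obtain \<phi> where \<phi>: "\<phi> \<in> test_functions unit_square" "N1 (\<lambda>z. u z - \<phi> z) < e / 2"
    using H10_approx[OF u e2] by blast
  obtain \<psi> where \<psi>: "\<psi> \<in> test_functions unit_square" "N1 (\<lambda>z. v z - \<psi> z) < e / 2"
    using H10_approx[OF v e2] by blast
  have "N1 (\<lambda>z. (u z - \<phi> z) + (v z - \<psi> z)) \<le> N1 (\<lambda>z. u z - \<phi> z) + N1 (\<lambda>z. v z - \<psi> z)"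
    by (intro N1_triangle H1Q_diff H10_H1Q u v test_function_H1Q \<phi> \<psi>)
  also have "(\<lambda>z. (u z - \<phi> z) + (v z - \<psi> z)) = (\<lambda>z. (u z + v z) - (\<phi> z - - 1 * \<psi> z))" by auto
  finally have 1: "N1 (\<lambda>z. (u z + v z) - (\<phi> z - - 1 * \<psi> z)) < e" using \<phi>(2) \<psi>(2) by simp
  have 2: "(\<lambda>z. \<phi> z - - 1 * \<psi> z) \<in> H10"
    by (intro test_function_H10 test_functions_diff test_functions_cmult \<phi> \<psi>)
  show "\<exists>w\<in>H10. N1 (\<lambda>z. (u z + v z) - w z) < e" by (rule bexI[OF _ 2]) (rule 1)
qed

lemma H10_sum: "finite I \<Longrightarrow> (\<And>i. i \<in> I \<Longrightarrow> f i \<in> H10) \<Longrightarrow> (\<lambda>z. \<Sum>i\<in>I. f i z) \<in> H10"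
  by (induction I rule: finite_induct) (auto intro: H10_add test_function_H10[OF zero_test_function])

section \<open>Completeness of the Sobolev space\<close>

lemma tendsto_integral_scaleR:
  fixes f :: "nat \<Rightarrow> 'a \<Rightarrow> real" and g :: "'a \<Rightarrow> 'b::euclidean_space"
  assumes "\<And>n. sqint M (f n)" "sqint M f'" "sqint M g" "(\<lambda>n. l2 M (\<lambda>x. f n x - f' x)) \<longlonglongrightarrow> 0"
  shows "(\<lambda>n. LINT x|M. f n x *\<^sub>R g x) \<longlonglongrightarrow> (LINT x|M. f' x *\<^sub>R g x)"
proof (rule LIM_zero_cancel, rule Lim_null_comparison)
  show "\<forall>\<^sub>F n in sequentially. norm ((LINT x|M. f n x *\<^sub>R g x) - (LINT x|M. f' x *\<^sub>R g x)) \<le> l2 M (\<lambda>x. f n x - f' x) * l2 M g"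
  proof (intro always_eventually allI)
    fix n
    have "(LINT x|M. f n x *\<^sub>R g x) - (LINT x|M. f' x *\<^sub>R g x) = (LINT x|M. (f n x - f' x) *\<^sub>R g x)"
      using assms by (simp add: scaleR_diff_left integrable_scaleR_sqint)
    also have "norm \<dots> \<le> (LINT x|M. norm (f n x - f' x) * norm (g x))"
      using integral_norm_bound[of M "\<lambda>x. (f n x - f' x) *\<^sub>R g x"] by simp
    also have "\<dots> \<le> l2 M (\<lambda>x. f n x - f' x) * l2 M g" by (intro l2_Cauchy_Schwarz sqint_diff assms)
    finally show "norm ((LINT x|M. f n x *\<^sub>R g x) - (LINT x|M. f' x *\<^sub>R g x)) \<le> l2 M (\<lambda>x. f n x - f' x) * l2 M g" .
  qed
  show "(\<lambda>n. l2 M (\<lambda>x. f n x - f' x) * l2 M g) \<longlonglongrightarrow> 0"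
    using tendsto_mult_right[OF assms(4), of "l2 M g"] by simp
qed

lemma tendsto_integral_scaleR_right:
  fixes f :: "'a \<Rightarrow> real" and g :: "nat \<Rightarrow> 'a \<Rightarrow> 'b::euclidean_space"
  assumes "sqint M f" "\<And>n. sqint M (g n)" "sqint M g'" "(\<lambda>n. l2 M (\<lambda>x. g n x - g' x)) \<longlonglongrightarrow> 0"
  shows "(\<lambda>n. LINT x|M. f x *\<^sub>R g n x) \<longlonglongrightarrow> (LINT x|M. f x *\<^sub>R g' x)"
proof (rule LIM_zero_cancel, rule Lim_null_comparison)
  show "\<forall>\<^sub>F n in sequentially. norm ((LINT x|M. f x *\<^sub>R g n x) - (LINT x|M. f x *\<^sub>R g' x)) \<le> l2 M f * l2 M (\<lambda>x. g n x - g' x)"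
  proof (intro always_eventually allI)
    fix n
    have "(LINT x|M. f x *\<^sub>R g n x) - (LINT x|M. f x *\<^sub>R g' x) = (LINT x|M. f x *\<^sub>R (g n x - g' x))"
      using assms by (simp add: scaleR_diff_right integrable_scaleR_sqint)
    also have "norm \<dots> \<le> (LINT x|M. norm (f x) * norm (g n x - g' x))"
      using integral_norm_bound[of M "\<lambda>x. f x *\<^sub>R (g n x - g' x)"] by simp
    also have "\<dots> \<le> l2 M f * l2 M (\<lambda>x. g n x - g' x)" by (intro l2_Cauchy_Schwarz sqint_diff assms)
    finally show "norm ((LINT x|M. f x *\<^sub>R g n x) - (LINT x|M. f x *\<^sub>R g' x)) \<le> l2 M f * l2 M (\<lambda>x. g n x - g' x)" .
  qed
  show "(\<lambda>n. l2 M f * l2 M (\<lambda>x. g n x - g' x)) \<longlonglongrightarrow> 0"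
    using tendsto_mult_left[OF assms(4), of "l2 M f"] by simp
qed

lemma l2_mono:
  assumes "sqint M f" "sqint M g" "\<And>x. x \<in> space M \<Longrightarrow> norm (f x) \<le> norm (g x)"
  shows "l2 M f \<le> l2 M g"
  unfolding l2_def using assms by (intro real_sqrt_le_mono integral_mono sqintD power_mono) auto

text \<open>Functions and weak gradients converge together as pairs. For a fixed test function both
  sides of the identity defining weak gradients are continuous in mean square, so the limit pair
  satisfies it as well.\<close>

theorem H10_complete:
  assumes u: "\<And>n. u n \<in> H10"
    and c: "\<And>e. e > 0 \<Longrightarrow> \<exists>M. \<forall>m\<ge>M. \<forall>n\<ge>M. N1 (\<lambda>z. u m z - u n z) < e"
  shows "\<exists>s\<in>H10. (\<lambda>n. N1 (\<lambda>z. s z - u n z)) \<longlonglongrightarrow> 0"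
proof -
  have "sqint Q (u n) \<and> (\<exists>G. hwg (u n) G)" for n using H10_H1Q[OF u[of n]] unfolding H1Q_iff .
  then obtain G where G: "\<And>n. sqint Q (u n)" "\<And>n. hwg (u n) (G n)" by metis
  note Gs = hwg_sqint[OF G(2)]
  let ?U = "\<lambda>n z. (u n z, G n z)"
  have Us: "sqint Q (?U n)" for n by (intro sqint_pair G Gs)
  have eq: "N1 (\<lambda>z. u m z - u n z) = l2 Q (\<lambda>z. ?U m z - ?U n z)" for m n
  proof -
    have "hwg (\<lambda>z. u m z + - 1 * u n z) (\<lambda>z. G m z + - 1 *\<^sub>R G n z)"
      by (intro hwg_add hwg_cmult G sqint_cmult)
    then have "hwg (\<lambda>z. u m z - u n z) (\<lambda>z. G m z - G n z)" by simp
    from N1_eq[OF sqint_diff[OF G(1) G(1)] this] show ?thesis by simp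
  qed
  have "\<exists>V. sqint Q V \<and> (\<lambda>n. l2 Q (\<lambda>z. ?U n z - V z)) \<longlonglongrightarrow> 0"
    by (rule l2_complete[OF finite_measure_Q Us]) (rule c[unfolded eq])
  then obtain V where "sqint Q V \<and> (\<lambda>n. l2 Q (\<lambda>z. ?U n z - V z)) \<longlonglongrightarrow> 0" ..
  then have V: "sqint Q V" "(\<lambda>n. l2 Q (\<lambda>z. ?U n z - V z)) \<longlonglongrightarrow> 0" by simp_all
  define s where "s z = fst (V z)" for z
  define H where "H z = snd (V z)" for z
  have s: "sqint Q s" and H: "sqint Q H"
    unfolding s_def[abs_def] H_def[abs_def] by (rule sqint_fst[OF V(1)], rule sqint_snd[OF V(1)])
  have d: "sqint Q (\<lambda>z. ?U n z - V z)" for n by (intro sqint_diff Us V)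
  have l1: "(\<lambda>n. l2 Q (\<lambda>z. u n z - s z)) \<longlonglongrightarrow> 0"
  proof (rule tendsto_sandwich[OF _ _ tendsto_const V(2)])
    show "\<forall>\<^sub>F n in sequentially. l2 Q (\<lambda>z. u n z - s z) \<le> l2 Q (\<lambda>z. ?U n z - V z)"
    proof (intro always_eventually allI l2_mono d sqint_diff G s)
      fix n z show "norm (u n z - s z) \<le> norm (?U n z - V z)"
        using norm_fst_le[of "u n z - fst (V z)" "G n z - snd (V z)"] by (cases "V z") (simp add: s_def)
    qed
  qed auto
  have l2: "(\<lambda>n. l2 Q (\<lambda>z. G n z - H z)) \<longlonglongrightarrow> 0"
  proof (rule tendsto_sandwich[OF _ _ tendsto_const V(2)])
    show "\<forall>\<^sub>F n in sequentially. l2 Q (\<lambda>z. G n z - H z) \<le> l2 Q (\<lambda>z. ?U n z - V z)"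
    proof (intro always_eventually allI l2_mono d sqint_diff Gs H)
      fix n z show "norm (G n z - H z) \<le> norm (?U n z - V z)"
        using norm_snd_le[of "G n z - snd (V z)" "u n z - fst (V z)"] by (cases "V z") (simp add: H_def)
    qed
  qed auto
  have hw: "hwg s H"
    unfolding has_weak_gradient_def square_integrable_eq
  proof (intro conjI ballI allI impI H)
    fix \<phi> D assume \<phi>: "\<phi> \<in> test_functions unit_square" and D: "\<forall>z. GDERIV \<phi> z :> D z"
    note cD = test_function_gradient[OF \<phi> D[rule_format]]
    have "(\<lambda>n. LINT x|Q. u n x *\<^sub>R D x) \<longlonglongrightarrow> (LINT x|Q. s x *\<^sub>R D x)"
      by (intro tendsto_integral_scaleR G s sqint_Q_continuous cD l1)
    moreover have "(\<lambda>n. - (LINT x|Q. \<phi> x *\<^sub>R G n x)) \<longlonglongrightarrow> - (LINT x|Q. \<phi> x *\<^sub>R H x)"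
      by (intro tendsto_minus tendsto_integral_scaleR_right Gs H sqint_Q_continuous cD l2)
    ultimately show "(LINT x|Q. s x *\<^sub>R D x) = - (LINT x|Q. \<phi> x *\<^sub>R H x)"
      unfolding hwgD[OF G(2) \<phi> D[rule_format]] by (rule LIMSEQ_unique)
  qed
  have eqs: "N1 (\<lambda>z. s z - u n z) = l2 Q (\<lambda>z. ?U n z - V z)" for n
  proof -
    have "hwg (\<lambda>z. s z + - 1 * u n z) (\<lambda>z. H z + - 1 *\<^sub>R G n z)"
      by (intro hwg_add hwg_cmult G sqint_cmult s hw)
    then have "hwg (\<lambda>z. s z - u n z) (\<lambda>z. H z - G n z)" by simp
    from N1_eq[OF sqint_diff[OF s G(1)] this]
    have "N1 (\<lambda>z. s z - u n z) = l2 Q (\<lambda>z. V z - ?U n z)"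
      by (simp add: s_def H_def minus_prod_def)
    then show ?thesis by (simp only: l2_minus_commute[of Q V])
  qed
  have lim: "(\<lambda>n. N1 (\<lambda>z. s z - u n z)) \<longlonglongrightarrow> 0" unfolding eqs by (rule V(2))
  have "s \<in> H10"
  proof (rule H10_closure)
    show "s \<in> H1Q" unfolding H1Q_iff by (intro conjI exI) (rule s, rule hw)
    fix e :: real assume "e > 0"
    then have "\<forall>\<^sub>F n in sequentially. N1 (\<lambda>z. s z - u n z) < e" by (rule order_tendstoD(2)[OF lim])
    then obtain n where "N1 (\<lambda>z. s z - u n z) < e" by (auto simp: eventually_sequentially)
    then show "\<exists>v\<in>H10. N1 (\<lambda>z. s z - v z) < e"
      by (intro bexI[where x = "u n"] u)
  qed
  show ?thesis by (intro bexI[where x = s] lim \<open>s \<in> H10\<close>)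
qed

section \<open>Quasi-interpolation\<close>

lemma l2_Q_dominated:
  fixes F :: "nat \<Rightarrow> real \<times> real \<Rightarrow> 'b::euclidean_space"
  assumes m: "\<And>n. F n \<in> borel_measurable Q"
    and b: "\<And>n z. z \<in> unit_square \<Longrightarrow> norm (F n z) \<le> B"
    and l: "\<And>z. z \<in> unit_square \<Longrightarrow> (\<lambda>n. F n z) \<longlonglongrightarrow> F' z"
  shows "sqint Q F'" "(\<lambda>n. l2 Q (\<lambda>z. F n z - F' z)) \<longlonglongrightarrow> 0"
proof -
  interpret finite_measure Q by (rule finite_measure_Q)
  have m': "F' \<in> borel_measurable Q" by (rule borel_measurable_LIMSEQ_metric[where f = F, OF m]) (simp add: l)
  have b': "norm (F' z) \<le> B" if "z \<in> unit_square" for z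
    by (rule LIMSEQ_le_const2[OF tendsto_norm[OF l[OF that]]]) (use b[OF that] in auto)
  show "sqint Q F'" by (rule sqint_Q_bounded[OF m' b'])
  have "(\<lambda>n. LINT z|Q. (norm (F n z - F' z))\<^sup>2) \<longlonglongrightarrow> (LINT z|Q. 0)"
  proof (rule integral_dominated_convergence[where w = "\<lambda>z. (2 * B)\<^sup>2"])
    show "AE z in Q. (\<lambda>n. (norm (F n z - F' z))\<^sup>2) \<longlonglongrightarrow> 0"
    proof (rule AE_I2)
      fix z assume "z \<in> space Q"
      then have "(\<lambda>n. F n z - F' z) \<longlonglongrightarrow> 0" using l[of z] by (simp add: LIM_zero)
      from tendsto_power[OF tendsto_norm[OF this], of 2] show "(\<lambda>n. (norm (F n z - F' z))\<^sup>2) \<longlonglongrightarrow> 0" by simp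
    qed
    show "AE z in Q. norm ((norm (F n z - F' z))\<^sup>2) \<le> (2 * B)\<^sup>2" for n
    proof (rule AE_I2)
      fix z assume "z \<in> space Q"
      then have "norm (F n z - F' z) \<le> 2 * B"
        using b[of z n] b'[of z] norm_triangle_ineq4[of "F n z" "F' z"] by simp
      then have "(norm (F n z - F' z))\<^sup>2 \<le> (2 * B)\<^sup>2" by (intro power_mono) auto
      then show "norm ((norm (F n z - F' z))\<^sup>2) \<le> (2 * B)\<^sup>2" by simp
    qed
  qed (use m m' in auto)
  then show "(\<lambda>n. l2 Q (\<lambda>z. F n z - F' z)) \<longlonglongrightarrow> 0"
    using tendsto_real_sqrt[of "\<lambda>n. LINT z|Q. (norm (F n z - F' z))\<^sup>2" 0] by (simp add: l2_def)
qed

text \<open>The choice of a ramp for \<open>s\<close> makes the kernel \<open>K\<close> below equal to \<^const>\<open>phi\<close>; a smooth \<open>s\<close> gives a smooth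
  kernel with the same support.\<close>

locale profile =
  fixes s X :: "real \<Rightarrow> real"
  assumes s_cont: "continuous_on UNIV s"
    and s_le: "\<And>x. x \<le> 0 \<Longrightarrow> s x = 0" and s_ge: "\<And>x. x \<ge> 1 \<Longrightarrow> s x = 1"
    and s_range: "\<And>x. 0 \<le> s x" "\<And>x. s x \<le> 1"
    and X_deriv: "\<And>x. (X has_real_derivative (s x - s (x - 1))) (at x)"
    and X_le: "\<And>x. x \<le> 0 \<Longrightarrow> X x = 0" and X_ge: "\<And>x. x \<ge> 2 \<Longrightarrow> X x = 1"
    and X_range: "\<And>x. 0 \<le> X x" "\<And>x. X x \<le> 1"
begin

definition K :: "real \<Rightarrow> real" where "K x = X x - X (x - 1)"
definition K' :: "real \<Rightarrow> real" where "K' x = s x - 2 * s (x - 1) + s (x - 2)"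

lemma K_deriv: "(K has_real_derivative K' x) (at x)"
proof -
  have "((\<lambda>x. X (1 * x + - 1)) has_real_derivative (s (1 * x + - 1) - s (1 * x + - 1 - 1)) * 1) (at x)"
    by (rule DERIV_chain2[OF X_deriv]) (auto intro!: derivative_eq_intros)
  from DERIV_diff[OF X_deriv this] show ?thesis by (simp add: K_def[abs_def] K'_def algebra_simps)
qed

lemma K_zero: "x \<le> 0 \<or> x \<ge> 3 \<Longrightarrow> K x = 0"
  using X_le[of x] X_le[of "x - 1"] X_ge[of x] X_ge[of "x - 1"] by (auto simp: K_def)

lemma K'_zero: "x \<le> 0 \<or> x \<ge> 3 \<Longrightarrow> K' x = 0"
  using s_le[of x] s_le[of "x - 1"] s_le[of "x - 2"] s_ge[of x] s_ge[of "x - 1"] s_ge[of "x - 2"] by (auto simp: K'_def)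

lemma K_abs: "\<bar>K x\<bar> \<le> 1"
  using X_range[of x] X_range[of "x - 1"] by (auto simp: K_def)

lemma K'_cont: "continuous_on UNIV K'"
  unfolding K'_def by (intro continuous_intros continuous_on_compose2[OF s_cont]) auto

text \<open>The three values telescope to \<open>X (f + 2) - X (f - 1)\<close>, which is 1 -
  0.\<close>

lemma K_partition:
  assumes "0 \<le> f" "f \<le> 1" shows "K f + K (f + 1) + K (f + 2) = 1"
  using assms X_le[of "f - 1"] X_ge[of "f + 2"] by (simp add: K_def add.commute)

text \<open>Only \<open>s f\<close> enters: three coefficients combined with these weights give two
  first differences combined with weights \<open>s f\<close> and \<open>1 - s f\<close>.\<close>

lemma K'_values:
  assumes "0 \<le> f" "f \<le> 1" shows "K' f = s f" "K' (f + 1) = 1 - 2 * s f" "K' (f + 2) = s f - 1"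
  using assms s_le[of "f - 1"] s_le[of "f - 2"] s_ge[of "f + 1"] s_ge[of "f + 2"] by (simp_all add: K'_def add.commute)

end

lemma GDERIV_cmult:
  assumes "GDERIV f z :> D" shows "GDERIV (\<lambda>z. c * f z) z :> c *\<^sub>R D"
  using has_derivative_mult_right[OF assms[unfolded gderiv_def], of c] by (simp add: gderiv_def)

text \<open>A kernel supported in an interval of length 3 meets a point with at most three integer
  translates. Coefficients outside \<open>A\<close> are set to zero in \<open>g\<close>, so that no
  case distinction arises near the ends.\<close>

lemma local_kernel_sum:
  fixes k :: "real \<Rightarrow> real" and h :: "int \<Rightarrow> real" and t :: real
  assumes k: "\<And>x. x \<le> 0 \<or> x \<ge> 3 \<Longrightarrow> k x = 0" and A: "finite A"
  defines "m \<equiv> \<lfloor>t\<rfloor>"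
  defines "g \<equiv> \<lambda>i. if i \<in> A then h i else 0"
  shows "(\<Sum>i\<in>A. h i * k (t - of_int i)) = g m * k (t - m) + g (m - 1) * k (t - m + 1) + g (m - 2) * k (t - m + 2)"
proof -
  let ?B = "{m, m - 1, m - 2}"
  have "(\<Sum>i\<in>A. h i * k (t - of_int i)) = (\<Sum>i\<in>A. g i * k (t - of_int i))"
    by (intro sum.cong refl) (simp add: g_def)
  also have "\<dots> = (\<Sum>i\<in>A \<union> ?B. g i * k (t - of_int i))"
    using A by (intro sum.mono_neutral_left) (auto simp: g_def)
  also have "\<dots> = (\<Sum>i\<in>?B. g i * k (t - of_int i))"
  proof (intro sum.mono_neutral_right ballI)
    fix i assume i: "i \<in> A \<union> ?B - ?B"
    then have "i > m \<or> i < m - 2" by auto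
    then have "t - of_int i \<le> 0 \<or> t - of_int i \<ge> 3" unfolding m_def by linarith
    then show "g i * k (t - of_int i) = 0" using k by simp
  qed (use A in auto)
  also have "\<dots> = g m * k (t - m) + g (m - 1) * k (t - m + 1) + g (m - 2) * k (t - m + 2)"
    by (simp add: algebra_simps)
  finally show ?thesis .
qed

context profile
begin

text \<open>The range of indices keeps the supports of the kernels in the interior of the square.\<close>

definition range_ix :: "nat \<Rightarrow> int set" where
  "range_ix N = {3..int N - 6}"

definition qi :: "(real \<times> real \<Rightarrow> real) \<Rightarrow> nat \<Rightarrow> real \<Rightarrow> real \<Rightarrow> real" where
  "qi f N x y = (\<Sum>i\<in>range_ix N. \<Sum>l\<in>range_ix N. f (of_int i / real N, of_int l / real N) * (K (real N * x - of_int i) * K (real N * y - of_int l)))"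

definition qx :: "(real \<times> real \<Rightarrow> real) \<Rightarrow> nat \<Rightarrow> real \<Rightarrow> real \<Rightarrow> real" where
  "qx f N x y = (\<Sum>i\<in>range_ix N. \<Sum>l\<in>range_ix N. f (of_int i / real N, of_int l / real N) * (real N * K' (real N * x - of_int i) * K (real N * y - of_int l)))"

definition qa :: "(real \<times> real \<Rightarrow> real) \<Rightarrow> nat \<Rightarrow> int \<Rightarrow> int \<Rightarrow> real" where
  "qa f N i l = (if i \<in> range_ix N \<and> l \<in> range_ix N then f (of_int i / real N, of_int l / real N) else 0)"

text \<open>Exchanging the variables turns the second partial derivative of the quasi-interpolant
  into \<open>qx\<close> of the swapped function.\<close>

definition swp :: "(real \<times> real \<Rightarrow> real) \<Rightarrow> real \<times> real \<Rightarrow> real" where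
  "swp f z = f (snd z, fst z)"

lemma range_ix_fin [simp]: "finite (range_ix N)"
  by (simp add: range_ix_def)

lemma qi_GDERIV: "GDERIV (\<lambda>z. qi f N (fst z) (snd z)) z :> (qx f N (fst z) (snd z), qx (swp f) N (snd z) (fst z))"
proof -
  let ?G = "\<lambda>i l. (f (of_int i / real N, of_int l / real N) * (real N * K' (real N * fst z - of_int i) * K (real N * snd z - of_int l)),
     f (of_int i / real N, of_int l / real N) * (K (real N * fst z - of_int i) * (real N * K' (real N * snd z - of_int l))))"
  have K: "((\<lambda>x. K (real N * x - of_int i)) has_real_derivative real N * K' (real N * x - of_int i)) (at x)" for i x
  proof -
    have "((\<lambda>x. real N * x - of_int i) has_real_derivative real N) (at x)" by (auto intro!: derivative_eq_intros)
    from DERIV_chain2[where f = K, OF K_deriv this] show ?thesis by (simp add: mult.commute)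
  qed
  have "GDERIV (\<lambda>z. f (of_int i / real N, of_int l / real N) * (K (real N * fst z - of_int i) * K (real N * snd z - of_int l))) z :> ?G i l" for i l
  proof -
    have "GDERIV (\<lambda>z. K (real N * fst z - of_int i) * K (real N * snd z - of_int l)) z :>
      (real N * K' (real N * fst z - of_int i) * K (real N * snd z - of_int l), K (real N * fst z - of_int i) * (real N * K' (real N * snd z - of_int l)))"
      by (rule GDERIV_tensor[OF K K])
    from GDERIV_cmult[OF this] show ?thesis by simp
  qed
  then have "GDERIV (\<lambda>z. qi f N (fst z) (snd z)) z :> (\<Sum>i\<in>range_ix N. \<Sum>l\<in>range_ix N. ?G i l)"
    unfolding qi_def gderiv_def inner_sum_right by (intro has_derivative_sum)
  also have "(\<Sum>i\<in>range_ix N. \<Sum>l\<in>range_ix N. ?G i l) = (qx f N (fst z) (snd z), qx (swp f) N (snd z) (fst z))"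
  proof (rule prod_eqI)
    show "fst (\<Sum>i\<in>range_ix N. \<Sum>l\<in>range_ix N. ?G i l) = fst (qx f N (fst z) (snd z), qx (swp f) N (snd z) (fst z))"
      by (simp add: fst_sum qx_def)
    have "qx (swp f) N (snd z) (fst z) = (\<Sum>l\<in>range_ix N. \<Sum>i\<in>range_ix N. snd (?G i l))"
      unfolding qx_def swp_def by (intro sum.cong refl) (simp add: algebra_simps)
    also have "\<dots> = (\<Sum>i\<in>range_ix N. \<Sum>l\<in>range_ix N. snd (?G i l))" by (rule sum.swap)
    finally show "snd (\<Sum>i\<in>range_ix N. \<Sum>l\<in>range_ix N. ?G i l) = snd (qx f N (fst z) (snd z), qx (swp f) N (snd z) (fst z))"
      by (simp add: snd_sum)
  qed
  finally show ?thesis .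
qed

lemma qx_cont: "continuous_on UNIV (\<lambda>z. qx f N (fst z) (snd z))"
proof -
  have Kc: "continuous_on UNIV K" using K_deriv DERIV_isCont continuous_at_imp_continuous_on by blast
  show ?thesis unfolding qx_def
    by (intro continuous_intros continuous_on_compose2[OF Kc] continuous_on_compose2[OF K'_cont]) auto
qed

lemma qi_local:
  fixes x y :: real and N :: nat and f :: "real \<times> real \<Rightarrow> real"
  defines "m \<equiv> \<lfloor>real N * x\<rfloor>" and "n \<equiv> \<lfloor>real N * y\<rfloor>"
  defines "u \<equiv> real N * x - m" and "v \<equiv> real N * y - n"
  defines "rw \<equiv> \<lambda>i. qa f N i n * K v + qa f N i (n - 1) * K (v + 1) + qa f N i (n - 2) * K (v + 2)"
  shows "qi f N x y = rw m * K u + rw (m - 1) * K (u + 1) + rw (m - 2) * K (u + 2)"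
    and "qx f N x y = real N * (rw m * K' u + rw (m - 1) * K' (u + 1) + rw (m - 2) * K' (u + 2))"
proof -
  let ?h = "\<lambda>i. \<Sum>l\<in>range_ix N. f (of_int i / real N, of_int l / real N) * K (real N * y - of_int l)"
  have rw: "(if i \<in> range_ix N then ?h i else 0) = rw i" for i
    unfolding rw_def v_def n_def using local_kernel_sum[where k = K and h = "\<lambda>l. f (of_int i / real N, of_int l / real N)" and t = "real N * y", OF K_zero range_ix_fin[of N]]
    by (cases "i \<in> range_ix N") (simp_all add: qa_def)
  have "qi f N x y = (\<Sum>i\<in>range_ix N. ?h i * K (real N * x - of_int i))"
    unfolding qi_def sum_distrib_right by (intro sum.cong refl) (simp add: algebra_simps)
  also have "\<dots> = rw m * K u + rw (m - 1) * K (u + 1) + rw (m - 2) * K (u + 2)"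
    using local_kernel_sum[where k = K and h = ?h and t = "real N * x", OF K_zero range_ix_fin[of N]] unfolding rw u_def m_def .
  finally show "qi f N x y = rw m * K u + rw (m - 1) * K (u + 1) + rw (m - 2) * K (u + 2)" .
  have "qx f N x y = real N * (\<Sum>i\<in>range_ix N. ?h i * K' (real N * x - of_int i))"
    unfolding qx_def sum_distrib_right sum_distrib_left by (intro sum.cong refl) (simp add: algebra_simps)
  also have "(\<Sum>i\<in>range_ix N. ?h i * K' (real N * x - of_int i)) = rw m * K' u + rw (m - 1) * K' (u + 1) + rw (m - 2) * K' (u + 2)"
    using local_kernel_sum[where k = K' and h = ?h and t = "real N * x", OF K'_zero range_ix_fin[of N]] unfolding rw u_def m_def .
  finally show "qx f N x y = real N * (rw m * K' u + rw (m - 1) * K' (u + 1) + rw (m - 2) * K' (u + 2))" .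
qed

text \<open>The derivative is an average of difference quotients of \<open>f\<close>: convex with
  weights \<open>s u\<close> and \<open>1 - s u\<close> in the first variable, with the partition of
  unity in the second. Bound and limit then follow for every profile alike.\<close>

lemma qx_local:
  fixes x y :: real and N :: nat and f :: "real \<times> real \<Rightarrow> real"
  defines "m \<equiv> \<lfloor>real N * x\<rfloor>" and "n \<equiv> \<lfloor>real N * y\<rfloor>"
  defines "u \<equiv> real N * x - m" and "v \<equiv> real N * y - n"
  defines "D \<equiv> \<lambda>i l. real N * (qa f N i l - qa f N (i - 1) l)"
  defines "W \<equiv> \<lambda>l. s u * D m l + (1 - s u) * D (m - 1) l"
  shows "qx f N x y = W n * K v + W (n - 1) * K (v + 1) + W (n - 2) * K (v + 2)"
proof -
  have u: "0 \<le> u" "u \<le> 1" unfolding u_def m_def by linarith+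
  show ?thesis
    unfolding qi_local(2)[of f N x y] unfolding m_def[symmetric] n_def[symmetric] unfolding u_def[symmetric] v_def[symmetric] K'_values[OF u]
    by (simp add: W_def D_def algebra_simps)
qed

lemma convex_abs_le:
  assumes "\<bar>a\<bar> \<le> B" "\<bar>b\<bar> \<le> B" "0 \<le> t" "t \<le> 1" shows "\<bar>t * a + (1 - t) * b\<bar> \<le> (B::real)"
proof -
  have "\<bar>t * a + (1 - t) * b\<bar> \<le> t * \<bar>a\<bar> + (1 - t) * \<bar>b\<bar>"
    using abs_triangle_ineq[of "t * a" "(1 - t) * b"] assms by (simp add: abs_mult)
  also have "\<dots> \<le> t * B + (1 - t) * B" using assms by (intro add_mono mult_left_mono) auto
  finally show ?thesis by (simp add: algebra_simps)
qed

lemma three_abs_le: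
  assumes "\<bar>a\<bar> \<le> B" "\<bar>b\<bar> \<le> B" "\<bar>c\<bar> \<le> B"
  shows "\<bar>a * K x + b * K y + c * K z\<bar> \<le> 3 * B"
proof -
  have k: "\<bar>a * K x\<bar> \<le> B" if "\<bar>a\<bar> \<le> B" for a x
    using that mult_left_mono[OF K_abs[of x] abs_ge_zero[of a]] by (simp add: abs_mult)
  show ?thesis using k[OF assms(1), of x] k[OF assms(2), of y] k[OF assms(3), of z] by linarith
qed

end

text \<open>Tailored to zero extensions of splines, whose gradient may jump across the boundary of
  the square: the Lipschitz bounds are global, the gradient is asked for inside.\<close>

definition admissible :: "(real \<times> real \<Rightarrow> real) \<Rightarrow> (real \<times> real \<Rightarrow> real \<times> real) \<Rightarrow> real \<Rightarrow> bool" where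
  "admissible f G L \<longleftrightarrow> L \<ge> 0 \<and> (\<forall>x x' y. \<bar>f (x, y) - f (x', y)\<bar> \<le> L * \<bar>x - x'\<bar>) \<and>
     (\<forall>x y y'. \<bar>f (x, y) - f (x, y')\<bar> \<le> L * \<bar>y - y'\<bar>) \<and> (\<forall>z. z \<notin> unit_square \<longrightarrow> f z = 0) \<and>
     (\<forall>z\<in>unit_square. GDERIV f z :> G z) \<and> continuous_on unit_square G"

context profile
begin

lemma qa_bound:
  assumes "admissible f G L" shows "\<bar>qa f N i l\<bar> \<le> L"
proof -
  have lip: "\<bar>f (x, y) - f (x', y)\<bar> \<le> L * \<bar>x - x'\<bar>" and z: "z \<notin> unit_square \<Longrightarrow> f z = 0" and L: "L \<ge> 0" for x x' y z
    using assms unfolding admissible_def by blast+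
  have "\<bar>f (x, y)\<bar> \<le> L" for x y
  proof (cases "(x, y) \<in> unit_square")
    case True
    then have "\<bar>f (x, y)\<bar> \<le> L * x" using lip[of x y 0] z[of "(0, y)"] by (simp add: unit_square_def)
    also have "\<dots> \<le> L * 1" using True L by (intro mult_left_mono) (auto simp: unit_square_def)
    finally show ?thesis by simp
  qed (use z L in auto)
  then show ?thesis using L by (simp add: qa_def)
qed

text \<open>Restricting the indices to \<open>range_ix\<close> replaces \<open>f\<close> by zero at
  distance at most 6 grid steps from the boundary. There \<open>f\<close> itself is at most
  \<open>L\<close> times that distance, whence \<open>6 * L\<close> instead of
  \<open>L\<close>.\<close>

lemma qa_diff_bound:
  assumes a: "admissible f G L" shows "\<bar>real N * (qa f N i l - qa f N (i - 1) l)\<bar> \<le> 6 * L"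
proof (cases "l \<in> range_ix N \<and> N > 0")
  case True
  then have N: "N > 0" and l: "l \<in> range_ix N" by auto
  have lip: "\<bar>f (x, y) - f (x', y)\<bar> \<le> L * \<bar>x - x'\<bar>" and z: "z \<notin> unit_square \<Longrightarrow> f z = 0" and L: "L \<ge> 0" for x x' y z
    using a unfolding admissible_def by blast+
  have *: "real N * \<bar>f (p / real N, y) - f (q / real N, y)\<bar> \<le> L * \<bar>p - q\<bar>" for p q y
  proof -
    have "real N * \<bar>f (p / real N, y) - f (q / real N, y)\<bar> \<le> real N * (L * \<bar>p / real N - q / real N\<bar>)"
      by (intro mult_left_mono lip) auto
    also have "\<dots> = L * \<bar>p - q\<bar>" using N by (simp add: diff_divide_distrib[symmetric] abs_divide)
    finally show ?thesis .
  qed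
  let ?y = "of_int l / real N"
  consider "i \<in> range_ix N \<and> i - 1 \<in> range_ix N" | "i = 3" "i - 1 \<notin> range_ix N" | "i = int N - 5" "i \<notin> range_ix N" 
    | "i \<notin> range_ix N \<and> i - 1 \<notin> range_ix N"
    unfolding range_ix_def by force
  then show ?thesis
  proof cases
    case 1
    have "\<bar>real N * (qa f N i l - qa f N (i - 1) l)\<bar> = real N * \<bar>f (of_int i / real N, ?y) - f (of_int (i - 1) / real N, ?y)\<bar>"
      using 1 l by (simp add: qa_def abs_mult)
    also have "\<dots> \<le> L * \<bar>of_int i - of_int (i - 1)\<bar>" by (rule *)
    finally show ?thesis using L by simp
  next
    case 2
    have "\<bar>real N * (qa f N i l - qa f N (i - 1) l)\<bar> \<le> real N * \<bar>f (of_int 3 / real N, ?y)\<bar>"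
      using 2 l by (simp add: qa_def abs_mult)
    also have "\<dots> = real N * \<bar>f (of_int 3 / real N, ?y) - f (of_int 0 / real N, ?y)\<bar>"
      using z[of "(0, ?y)"] by (simp add: unit_square_def)
    also have "\<dots> \<le> L * \<bar>of_int 3 - of_int 0\<bar>" by (rule *)
    finally show ?thesis using L by simp
  next
    case 3
    have i1: "real_of_int (i - 1) = real N - 6" using 3 by simp
    have "\<bar>real N * (qa f N i l - qa f N (i - 1) l)\<bar> \<le> real N * \<bar>f ((real N - 6) / real N, ?y)\<bar>"
      using 3 l unfolding i1[symmetric] by (simp add: qa_def abs_mult del: of_int_diff)
    also have "\<dots> = real N * \<bar>f ((real N - 6) / real N, ?y) - f (real N / real N, ?y)\<bar>"
      using z[of "(1, ?y)"] N by (simp add: unit_square_def)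
    also have "\<dots> \<le> L * \<bar>(real N - 6) - real N\<bar>" by (rule *)
    finally show ?thesis using L by simp
  next
    case 4 then show ?thesis using L by (simp add: qa_def)
  qed
next
  case False
  moreover have "L \<ge> 0" using a by (simp add: admissible_def)
  ultimately show ?thesis by (auto simp: qa_def)
qed

lemma qi_bound:
  assumes "admissible f G L" shows "\<bar>qi f N x y\<bar> \<le> 9 * L"
proof -
  have "\<bar>qi f N x y\<bar> \<le> 3 * (3 * L)"
    unfolding qi_local(1) by (intro three_abs_le qa_bound[OF assms])
  then show ?thesis by simp
qed

lemma qx_bound:
  assumes "admissible f G L" shows "\<bar>qx f N x y\<bar> \<le> 18 * L"
proof -
  have "\<bar>qx f N x y\<bar> \<le> 3 * (6 * L)"
    unfolding qx_local by (intro three_abs_le convex_abs_le qa_diff_bound[OF assms] s_range)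
  then show ?thesis by simp
qed

lemma in_range_ev:
  assumes "0 < x" "x < 1"
  shows "\<forall>\<^sub>F N in sequentially. \<lfloor>real N * x\<rfloor> \<in> range_ix N \<and> \<lfloor>real N * x\<rfloor> - 1 \<in> range_ix N \<and> \<lfloor>real N * x\<rfloor> - 2 \<in> range_ix N"
proof -
  obtain N0 :: nat where N0: "6 / x < N0" using reals_Archimedean2 by blast
  obtain N1 :: nat where N1: "6 / (1 - x) < N1" using reals_Archimedean2 by blast
  show ?thesis
  proof (rule eventually_sequentiallyI[of "max N0 N1"])
    fix N assume N: "N \<ge> max N0 N1"
    have "6 < real N0 * x" "6 < real N1 * (1 - x)" using N0 N1 assms by (auto simp: field_simps)
    moreover have "real N0 * x \<le> real N * x" "real N1 * (1 - x) \<le> real N * (1 - x)"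
      using N assms by (auto intro!: mult_right_mono)
    ultimately have "6 < real N * x" "real N * x < real N - 6" by (auto simp: algebra_simps)
    then have "6 \<le> \<lfloor>real N * x\<rfloor>" "\<lfloor>real N * x\<rfloor> \<le> int N - 6" by linarith+
    then show "\<lfloor>real N * x\<rfloor> \<in> range_ix N \<and> \<lfloor>real N * x\<rfloor> - 1 \<in> range_ix N \<and> \<lfloor>real N * x\<rfloor> - 2 \<in> range_ix N"
      by (simp add: range_ix_def)
  qed
qed

lemma ratio_close:
  assumes "N > 0" "\<lfloor>real N * x\<rfloor> - 2 \<le> i" "i \<le> \<lfloor>real N * x\<rfloor>"
  shows "\<bar>of_int i / real N - x\<bar> \<le> 3 / real N"
proof -
  have "\<bar>of_int i - real N * x\<bar> \<le> 3" using assms(2,3) by linarith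
  then have "\<bar>of_int i - real N * x\<bar> / real N \<le> 3 / real N" using assms(1) by (intro divide_right_mono) auto
  moreover have "of_int i / real N - x = (of_int i - real N * x) / real N"
    using assms(1) by (simp add: field_simps)
  then have "\<bar>of_int i / real N - x\<bar> = \<bar>of_int i - real N * x\<bar> / real N" by simp
  ultimately show ?thesis by simp
qed

lemma qi_tendsto:
  assumes a: "admissible f G L" and z: "(x, y) \<in> unit_square"
  shows "(\<lambda>N. qi f N x y) \<longlonglongrightarrow> f (x, y)"
proof (rule LIM_zero_cancel, rule Lim_null_comparison)
  have x: "0 < x" "x < 1" "0 < y" "y < 1" using z by (auto simp: unit_square_def)
  have L: "L \<ge> 0" using a by (simp add: admissible_def)
  show "\<forall>\<^sub>F N in sequentially. norm (qi f N x y - f (x, y)) \<le> 54 * L / real N"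
    using in_range_ev[OF x(1,2)] in_range_ev[OF x(3,4)] eventually_gt_at_top[of 0]
  proof eventually_elim
    case (elim N)
    define m where "m = \<lfloor>real N * x\<rfloor>"
    define n where "n = \<lfloor>real N * y\<rfloor>"
    define u where "u = real N * x - m"
    define v where "v = real N * y - n"
    have uv: "0 \<le> u" "u \<le> 1" "0 \<le> v" "v \<le> 1" unfolding u_def v_def m_def n_def by linarith+
    have q: "\<bar>qa f N i l - f (x, y)\<bar> \<le> 6 * L / real N" if i: "i \<in> {m, m - 1, m - 2}" and l: "l \<in> {n, n - 1, n - 2}" for i l
    proof -
      have ri: "i \<in> range_ix N" "l \<in> range_ix N" using elim i l by (auto simp: m_def n_def)
      have "\<bar>f (of_int i / real N, of_int l / real N) - f (x, of_int l / real N)\<bar> \<le> L * \<bar>of_int i / real N - x\<bar>"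
        using a by (simp add: admissible_def)
      also have "\<dots> \<le> L * (3 / real N)" using i elim by (intro mult_left_mono ratio_close L) (auto simp: m_def)
      finally have 1: "\<bar>f (of_int i / real N, of_int l / real N) - f (x, of_int l / real N)\<bar> \<le> 3 * L / real N" by (simp add: mult.commute)
      have "\<bar>f (x, of_int l / real N) - f (x, y)\<bar> \<le> L * \<bar>of_int l / real N - y\<bar>"
        using a by (simp add: admissible_def)
      also have "\<dots> \<le> L * (3 / real N)" using l elim by (intro mult_left_mono ratio_close L) (auto simp: n_def)
      finally have "\<bar>f (x, of_int l / real N) - f (x, y)\<bar> \<le> 3 * L / real N" by (simp add: mult.commute)
      with 1 have "\<bar>f (of_int i / real N, of_int l / real N) - f (x, y)\<bar> \<le> 3 * L / real N + 3 * L / real N" by linarith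
      then show ?thesis using ri by (simp add: qa_def)
    qed
    define rw where "rw i = (qa f N i n - f (x, y)) * K v + (qa f N i (n - 1) - f (x, y)) * K (v + 1) + (qa f N i (n - 2) - f (x, y)) * K (v + 2)" for i
    have rw: "\<bar>rw i\<bar> \<le> 3 * (6 * L / real N)" if "i \<in> {m, m - 1, m - 2}" for i
      unfolding rw_def by (intro three_abs_le q that) auto
    have r: "qa f N i n * K v + qa f N i (n - 1) * K (v + 1) + qa f N i (n - 2) * K (v + 2) = rw i + f (x, y)" for i
    proof -
      have "f (x, y) = f (x, y) * (K v + K (v + 1) + K (v + 2))" using K_partition[OF uv(3,4)] by simp
      then show ?thesis unfolding rw_def by (simp add: algebra_simps)
    qed
    have "qi f N x y = (rw m + f (x, y)) * K u + (rw (m - 1) + f (x, y)) * K (u + 1) + (rw (m - 2) + f (x, y)) * K (u + 2)"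
      unfolding qi_local(1)[of f N x y] unfolding m_def[symmetric] n_def[symmetric] unfolding u_def[symmetric] v_def[symmetric] r ..
    also have "\<dots> = rw m * K u + rw (m - 1) * K (u + 1) + rw (m - 2) * K (u + 2) + f (x, y) * (K u + K (u + 1) + K (u + 2))"
      by (simp add: algebra_simps)
    finally have "qi f N x y - f (x, y) = rw m * K u + rw (m - 1) * K (u + 1) + rw (m - 2) * K (u + 2)"
      using K_partition[OF uv(1,2)] by simp
    moreover have "\<bar>rw m * K u + rw (m - 1) * K (u + 1) + rw (m - 2) * K (u + 2)\<bar> \<le> 3 * (3 * (6 * L / real N))"
      by (intro three_abs_le rw) auto
    ultimately show ?case by simp
  qed
  show "(\<lambda>N. 54 * L / real N) \<longlonglongrightarrow> 0" by (rule lim_const_over_n)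
qed

lemma qx_tendsto:
  assumes a: "admissible f G L" and z: "(x, y) \<in> unit_square"
  shows "(\<lambda>N. qx f N x y) \<longlonglongrightarrow> fst (G (x, y))"
proof (rule LIMSEQ_I)
  have x: "0 < x" "x < 1" "0 < y" "y < 1" using z by (auto simp: unit_square_def)
  let ?g = "fst (G (x, y))"
  fix e :: real assume e: "e > 0"
  have os: "open unit_square" by (simp add: unit_square_box open_box)
  have Gc: "continuous_on unit_square G" and Gd: "\<And>z. z \<in> unit_square \<Longrightarrow> GDERIV f z :> G z" using a by (auto simp: admissible_def)
  have "isCont G (x, y)" using Gc os z by (simp add: continuous_on_eq_continuous_at)
  then obtain d1 where d1: "d1 > 0" "\<And>w. dist w (x, y) < d1 \<Longrightarrow> dist (G w) (G (x, y)) < e / 4"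
    using e unfolding continuous_at_eps_delta by (metis divide_pos_pos zero_less_numeral)
  obtain d2 where d2: "d2 > 0" "ball (x, y) d2 \<subseteq> unit_square" using os z open_contains_ball by blast
  define d where "d = min d1 d2"
  have d: "d > 0" "\<And>w. dist w (x, y) < d \<Longrightarrow> dist (G w) (G (x, y)) < e / 4 \<and> w \<in> unit_square"
    using d1 d2 by (auto simp: d_def dist_commute subset_eq)
  have near: "\<forall>\<^sub>F N in sequentially. 6 / real N < d"
    using order_tendstoD(2)[OF lim_const_over_n[of 6] d(1)] .
  have "\<forall>\<^sub>F N in sequentially. norm (qx f N x y - ?g) < e"
    using in_range_ev[OF x(1,2)] in_range_ev[OF x(3,4)] eventually_gt_at_top[of 0] near
  proof eventually_elim
    case (elim N)
    define m where "m = \<lfloor>real N * x\<rfloor>"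
    define n where "n = \<lfloor>real N * y\<rfloor>"
    define u where "u = real N * x - m"
    define v where "v = real N * y - n"
    have uv: "0 \<le> v" "v \<le> 1" unfolding v_def n_def by linarith+
    have N: "N > 0" using elim by simp
    \<comment> \<open>By the mean value theorem the quotient is a value of \<open>fst (G _)\<close>
      at a point of distance at most \<open>6 / real N\<close> from \<open>(x, y)\<close>. Three
      terms with weights bounded by 1 contribute at most 3/4 of \<open>e\<close>.\<close>
    have D: "\<bar>real N * (qa f N i l - qa f N (i - 1) l) - ?g\<bar> \<le> e / 4" if i: "i \<in> {m, m - 1}" and l: "l \<in> {n, n - 1, n - 2}" for i l
    proof -
      let ?y = "of_int l / real N"
      have ri: "i \<in> range_ix N" "i - 1 \<in> range_ix N" "l \<in> range_ix N" using elim i l by (auto simp: m_def n_def)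
      have c1: "\<bar>of_int i / real N - x\<bar> \<le> 3 / real N" "\<bar>of_int (i - 1) / real N - x\<bar> \<le> 3 / real N"
        using i N by (intro ratio_close; auto simp: m_def)+
      have c2: "\<bar>?y - y\<bar> \<le> 3 / real N" using l N by (intro ratio_close) (auto simp: n_def)
      have cl: "dist (t, ?y) (x, y) < d" if "of_int (i - 1) / real N \<le> t" "t \<le> of_int i / real N" for t
      proof -
        have "\<bar>t - x\<bar> \<le> 3 / real N" using c1 that by linarith
        have "dist (t, ?y) (x, y) \<le> \<bar>t - x\<bar> + \<bar>?y - y\<bar>"
          unfolding dist_prod_def by (simp add: dist_real_def sqrt_sum_squares_le_sum_abs)
        also have "\<dots> \<le> 3 / real N + 3 / real N" by (intro add_mono c2) fact
        also have "\<dots> < d" using elim by simp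
        finally show ?thesis .
      qed
      have lt: "of_int (i - 1) / real N < of_int i / real N" using N by (intro divide_strict_right_mono) auto
      have "\<exists>t. of_int (i - 1) / real N < t \<and> t < of_int i / real N \<and>
         f (of_int i / real N, ?y) - f (of_int (i - 1) / real N, ?y) = (of_int i / real N - of_int (i - 1) / real N) * fst (G (t, ?y))"
      proof (rule MVT2[OF lt])
        fix t assume t: "of_int (i - 1) / real N \<le> t" "t \<le> of_int i / real N"
        show "((\<lambda>t. f (t, ?y)) has_real_derivative fst (G (t, ?y))) (at t)"
          using GDERIV_partials(1)[OF Gd] d(2)[OF cl[OF t]] by blast
      qed
      then obtain t where t: "of_int (i - 1) / real N < t" "t < of_int i / real N"
        "f (of_int i / real N, ?y) - f (of_int (i - 1) / real N, ?y) = (of_int i / real N - of_int (i - 1) / real N) * fst (G (t, ?y))"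
        by blast
      have "real N * (qa f N i l - qa f N (i - 1) l) = real N * (f (of_int i / real N, ?y) - f (of_int (i - 1) / real N, ?y))"
        using ri by (simp add: qa_def)
      also have "\<dots> = fst (G (t, ?y))" unfolding t(3) using N by (simp add: diff_divide_distrib[symmetric])
      finally have "\<bar>real N * (qa f N i l - qa f N (i - 1) l) - ?g\<bar> = dist (fst (G (t, ?y))) ?g" by (simp add: dist_real_def)
      also have "\<dots> \<le> dist (G (t, ?y)) (G (x, y))" by (rule dist_fst_le)
      also have "\<dots> < e / 4" using d(2) cl[of t] t by simp
      finally show ?thesis by simp
    qed
    define W where "W l = s u * (real N * (qa f N m l - qa f N (m - 1) l) - ?g) + (1 - s u) * (real N * (qa f N (m - 1) l - qa f N (m - 1 - 1) l) - ?g)" for l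
    have W: "\<bar>W l\<bar> \<le> e / 4" if "l \<in> {n, n - 1, n - 2}" for l
      unfolding W_def by (intro convex_abs_le D that s_range) auto
    have r: "s u * (real N * (qa f N m l - qa f N (m - 1) l)) + (1 - s u) * (real N * (qa f N (m - 1) l - qa f N (m - 1 - 1) l)) = W l + ?g" for l
      unfolding W_def by (simp add: algebra_simps)
    have "qx f N x y = (W n + ?g) * K v + (W (n - 1) + ?g) * K (v + 1) + (W (n - 2) + ?g) * K (v + 2)"
      unfolding qx_local[of f N x y] unfolding m_def[symmetric] n_def[symmetric] unfolding u_def[symmetric] v_def[symmetric] r ..
    also have "\<dots> = W n * K v + W (n - 1) * K (v + 1) + W (n - 2) * K (v + 2) + ?g * (K v + K (v + 1) + K (v + 2))"
      by (simp add: algebra_simps)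
    finally have "qx f N x y - ?g = W n * K v + W (n - 1) * K (v + 1) + W (n - 2) * K (v + 2)"
      using K_partition[OF uv] by simp
    moreover have "\<bar>W n * K v + W (n - 1) * K (v + 1) + W (n - 2) * K (v + 2)\<bar> \<le> 3 * (e / 4)"
      by (intro three_abs_le W) auto
    ultimately show ?case using e by simp
  qed
  then show "\<exists>no. \<forall>n\<ge>no. norm (qx f n x y - ?g) < e" by (simp add: eventually_sequentially)
qed

lemma admissible_swp:
  assumes "admissible f G L" shows "admissible (swp f) (\<lambda>z. (snd (G (snd z, fst z)), fst (G (snd z, fst z)))) L"
  unfolding admissible_def
proof (intro conjI allI impI ballI)
  have sw: "(snd z, fst z) \<in> unit_square \<longleftrightarrow> z \<in> unit_square" for z by (cases z) (auto simp: unit_square_def)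
  show "GDERIV (swp f) z :> (snd (G (snd z, fst z)), fst (G (snd z, fst z)))" if "z \<in> unit_square" for z
  proof -
    have g: "(f has_derivative (\<lambda>h. h \<bullet> G (snd z, fst z))) (at (snd z, fst z))"
      using assms that sw by (simp add: admissible_def gderiv_def)
    have "((\<lambda>z. (snd z, fst z)) has_derivative (\<lambda>h. (snd h, fst h))) (at z)"
      by (auto intro!: derivative_eq_intros)
    from has_derivative_compose[OF this g] show ?thesis
      unfolding gderiv_def swp_def by (simp add: inner_prod_def add.commute)
  qed
  have "continuous_on unit_square (\<lambda>z. G (snd z, fst z))"
    by (rule continuous_on_compose2[of unit_square G]) (use assms sw in \<open>auto simp: admissible_def intro!: continuous_intros\<close>)
  then show "continuous_on unit_square (\<lambda>z. (snd (G (snd z, fst z)), fst (G (snd z, fst z))))"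
    by (intro continuous_intros)
  show "swp f z = 0" if "z \<notin> unit_square" for z
    using that sw[of z] assms by (simp add: admissible_def swp_def)
qed (use assms in \<open>auto simp: admissible_def swp_def\<close>)

text \<open>The values and both partial derivatives converge pointwise inside and are bounded by
  multiples of \<open>L\<close>, so dominated convergence applies to all three at once.\<close>

theorem qi_converges:
  assumes a: "admissible f G L" and h: "hwg f G" and s: "sqint Q f"
  shows "(\<lambda>N. N1 (\<lambda>z. f z - qi f N (fst z) (snd z))) \<longlonglongrightarrow> 0"
proof -
  let ?D = "\<lambda>N z. (qx f N (fst z) (snd z), qx (swp f) N (snd z) (fst z))"
  have Dc: "continuous_on UNIV (?D N)" for N
    by (intro continuous_intros qx_cont continuous_on_compose2[OF qx_cont[of "swp f" N], of UNIV "\<lambda>z. (snd z, fst z)", simplified])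
  have hq: "hwg (\<lambda>z. qi f N (fst z) (snd z)) (?D N)" for N
    by (rule has_weak_gradient_C1[OF qi_GDERIV Dc])
  have qc: "continuous_on UNIV (\<lambda>z. qi f N (fst z) (snd z))" for N
    by (rule GDERIV_continuous[OF qi_GDERIV])
  have sq: "sqint Q (\<lambda>z. qi f N (fst z) (snd z))" for N by (rule sqint_Q_continuous[OF qc])
  let ?F = "\<lambda>N z. (qi f N (fst z) (snd z), ?D N z)"
  have "(\<lambda>N. l2 Q (\<lambda>z. ?F N z - (f z, G z))) \<longlonglongrightarrow> 0"
  proof (rule l2_Q_dominated(2)[where B = "9 * L + (18 * L + 18 * L)"])
    show "?F N \<in> borel_measurable Q" for N
      by (intro borel_measurable_Q borel_measurable_continuous_onI continuous_intros qc Dc)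
    show "norm (?F N z) \<le> 9 * L + (18 * L + 18 * L)" for N z
    proof -
      have "norm (?F N z) \<le> norm (qi f N (fst z) (snd z)) + (norm (qx f N (fst z) (snd z)) + norm (qx (swp f) N (snd z) (fst z)))"
        by (intro order.trans[OF norm_Pair_le] add_left_mono norm_Pair_le)
      also have "\<dots> \<le> 9 * L + (18 * L + 18 * L)"
        using qi_bound[OF a] qx_bound[OF a] qx_bound[OF admissible_swp[OF a]] by (intro add_mono) auto
      finally show ?thesis .
    qed
    show "(\<lambda>N. ?F N z) \<longlonglongrightarrow> (f z, G z)" if z: "z \<in> unit_square" for z
    proof -
      have z': "(snd z, fst z) \<in> unit_square" "(fst z, snd z) \<in> unit_square" using z by (auto simp: unit_square_def)
      have "(\<lambda>N. ?F N z) \<longlonglongrightarrow> (f (fst z, snd z), (fst (G (fst z, snd z)), snd (G (fst z, snd z))))"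
        using qx_tendsto[OF admissible_swp[OF a] z'(1)]
        by (intro tendsto_Pair qi_tendsto[OF a z'(2)] qx_tendsto[OF a z'(2)]) simp
      then show ?thesis by simp
    qed
  qed
  moreover have "N1 (\<lambda>z. f z - qi f N (fst z) (snd z)) = l2 Q (\<lambda>z. ?F N z - (f z, G z))" for N
  proof -
    have "hwg (\<lambda>z. f z + - 1 * qi f N (fst z) (snd z)) (\<lambda>z. G z + - 1 *\<^sub>R ?D N z)"
      by (intro hwg_add hwg_cmult h hq sqint_cmult s sq)
    then have "hwg (\<lambda>z. f z - qi f N (fst z) (snd z)) (\<lambda>z. G z - ?D N z)"
      by (simp only: scaleR_minus1_left mult_minus1 add_uminus_conv_diff)
    from N1_eq[OF sqint_diff[OF s sq] this] show ?thesis
      by (subst l2_minus_commute) simp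
  qed
  ultimately show ?thesis by simp
qed

end

section \<open>Splines in one variable\<close>

lemma max_square_deriv: "((\<lambda>x. (max 0 x)\<^sup>2 / 2) has_real_derivative max 0 x) (at (x::real))"
proof -
  consider "x > 0" | "x < 0" | "x = 0" by linarith
  then show ?thesis
  proof cases
    case 1
    have "((\<lambda>x. x\<^sup>2 / 2) has_real_derivative x) (at x)" by (auto intro!: derivative_eq_intros)
    then have "((\<lambda>x. (max 0 x)\<^sup>2 / 2) has_real_derivative x) (at x)"
      by (rule has_field_derivative_transform_within_open[of _ _ _ "{0<..}"]) (use 1 in auto)
    then show ?thesis using 1 by simp
  next
    case 2
    have "((\<lambda>x. 0) has_real_derivative 0) (at x)" by simp
    then have "((\<lambda>x. (max 0 x)\<^sup>2 / 2) has_real_derivative 0) (at x)"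
      by (rule has_field_derivative_transform_within_open[of _ _ _ "{..<0}"]) (use 2 in auto)
    then show ?thesis using 2 by simp
  next
    case 3
    have "((\<lambda>h. ((max 0 (0 + h))\<^sup>2 / 2 - (max 0 (0::real))\<^sup>2 / 2) / h) \<longlongrightarrow> 0) (at 0)"
    proof (rule Lim_null_comparison)
      show "\<forall>\<^sub>F h in at 0. norm (((max 0 (0 + h))\<^sup>2 / 2 - (max 0 (0::real))\<^sup>2 / 2) / h) \<le> \<bar>h\<bar>"
        by (intro always_eventually allI) (auto simp: max_def power2_eq_square)
      show "((\<lambda>h::real. \<bar>h\<bar>) \<longlongrightarrow> 0) (at 0)" by (intro tendsto_rabs_zero tendsto_ident_at)
    qed
    then show ?thesis using 3 by (simp add: DERIV_def)
  qed
qed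

definition ramp :: "real \<Rightarrow> real" where "ramp x = max 0 x - max 0 (x - 1)"
definition ramp_X :: "real \<Rightarrow> real" where
  "ramp_X x = (max 0 x)\<^sup>2 / 2 - 2 * ((max 0 (x - 1))\<^sup>2 / 2) + (max 0 (x - 2))\<^sup>2 / 2"

interpretation ramp: profile ramp ramp_X
proof
  show "continuous_on UNIV ramp" unfolding ramp_def by (intro continuous_intros)
  show "(ramp_X has_real_derivative ramp x - ramp (x - 1)) (at x)" for x
  proof -
    have sh: "((\<lambda>x. (max 0 (x - c))\<^sup>2 / 2) has_real_derivative max 0 (x - c)) (at x)" for c
    proof -
      have "((\<lambda>x. x - c) has_real_derivative 1) (at x)" by (auto intro!: derivative_eq_intros)
      from DERIV_chain2[where f = "\<lambda>x. (max 0 x)\<^sup>2 / 2", OF max_square_deriv this] show ?thesis by simp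
    qed
    have "((\<lambda>x. (max 0 x)\<^sup>2 / 2 - 2 * ((max 0 (x - 1))\<^sup>2 / 2) + (max 0 (x - 2))\<^sup>2 / 2) has_real_derivative
       max 0 x - 2 * max 0 (x - 1) + max 0 (x - 2)) (at x)"
      by (intro DERIV_add DERIV_diff DERIV_cmult sh max_square_deriv)
    then show ?thesis unfolding ramp_X_def[abs_def] ramp_def by (simp add: algebra_simps)
  qed
  show "ramp_X x = 1" if "x \<ge> 2" for x
    using that by (simp add: ramp_X_def max_def power2_eq_square field_simps)
  have r: "0 \<le> ramp_X x \<and> ramp_X x \<le> 1" for x
  proof -
    consider "x \<le> 0" | "0 \<le> x" "x \<le> 1" | "1 \<le> x" "x \<le> 2" | "2 \<le> x" by linarith
    then show ?thesis
    proof cases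
      case 2
      then have "x\<^sup>2 \<le> 1" by (simp add: power_le_one)
      then show ?thesis using 2 by (simp add: ramp_X_def max_def)
    next
      case 3
      then have "ramp_X x = 1 - (2 - x)\<^sup>2 / 2" by (simp add: ramp_X_def max_def power2_eq_square field_simps)
      moreover have "(2 - x)\<^sup>2 \<le> 1" using 3 by (simp add: power_le_one)
      ultimately show ?thesis by simp
    next
      case 4 then show ?thesis by (simp add: ramp_X_def max_def power2_eq_square field_simps)
    qed (simp add: ramp_X_def max_def)
  qed
  show "0 \<le> ramp_X x" "ramp_X x \<le> 1" for x using r by auto
qed (auto simp: ramp_def ramp_X_def)

text \<open>The quadratic B-spline is the third difference of the truncated square
  \<open>(max 0 x)^2 / 2\<close>, checked on each of its pieces.\<close>

lemma ramp_K: "ramp.K = phi"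
proof
  fix x :: real
  consider "x < 0" | "0 \<le> x" "x \<le> 1" | "1 < x" "x \<le> 2" | "2 < x" "x \<le> 3" | "3 < x" by linarith
  then show "ramp.K x = phi x"
    by cases (simp_all add: ramp.K_def ramp_X_def phi_def max_def power2_eq_square field_simps)
qed

lemma phi_values:
  assumes "0 \<le> f" "f \<le> 1"
  shows "phi f = f\<^sup>2 / 2" "phi (f + 1) = - f\<^sup>2 + f + 1 / 2" "phi (f + 2) = (1 - f)\<^sup>2 / 2"
proof -
  show "phi f = f\<^sup>2 / 2" using assms by (simp add: phi_def)
  show "phi (f + 1) = - f\<^sup>2 + f + 1 / 2"
    using assms by (cases "f = 0") (simp_all add: phi_def power2_eq_square field_simps)
  show "phi (f + 2) = (1 - f)\<^sup>2 / 2"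
    using assms by (cases "f = 0") (simp_all add: phi_def power2_eq_square field_simps)
qed

lemma phi_zero: "x \<le> 0 \<or> x \<ge> 3 \<Longrightarrow> phi x = 0"
  using ramp.K_zero by (simp add: ramp_K)

text \<open>The translates with index \<open>0\<close> and \<open>N + 1\<close> straddle the end
  points. With them, all translates that do not vanish on the open unit interval are
  present.\<close>

definition spline1 :: "int \<Rightarrow> (int \<Rightarrow> real) \<Rightarrow> real \<Rightarrow> real" where
  "spline1 N g x = (\<Sum>k\<in>{0..N + 1}. g k * phi (of_int N * x - of_int k + 2))"

definition spline1_deriv :: "int \<Rightarrow> (int \<Rightarrow> real) \<Rightarrow> real \<Rightarrow> real" where
  "spline1_deriv N g x = (\<Sum>k\<in>{0..N + 1}. g k * (of_int N * ramp.K' (of_int N * x - of_int k + 2)))"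

definition quad :: "real \<Rightarrow> real \<Rightarrow> real \<Rightarrow> real \<Rightarrow> real" where
  "quad a b c t = a * ((1 - t)\<^sup>2 / 2) + b * (- t\<^sup>2 + t + 1 / 2) + c * (t\<^sup>2 / 2)"

lemma shifted_kernel_sum:
  fixes k :: "real \<Rightarrow> real" and g :: "int \<Rightarrow> real"
  assumes k: "\<And>x. x \<le> 0 \<or> x \<ge> 3 \<Longrightarrow> k x = 0" and m: "m = \<lfloor>t\<rfloor>" "0 \<le> m" "m < N"
  shows "(\<Sum>i\<in>{0..N + 1}. g i * k (t - of_int i + 2)) = g m * k (t - m + 2) + g (m + 1) * k (t - m + 1) + g (m + 2) * k (t - m)"
proof -
  have "(\<Sum>i\<in>{0..N + 1}. g i * k (t - of_int i + 2)) = (\<Sum>i\<in>{-2..N - 1}. g (i + 2) * k (t - of_int i))"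
    by (rule sum.reindex_bij_witness[of _ "\<lambda>i. i + 2" "\<lambda>i. i - 2"]) (auto simp: algebra_simps)
  also have "\<dots> = g m * k (t - m + 2) + g (m + 1) * k (t - m + 1) + g (m + 2) * k (t - m)"
    using local_kernel_sum[where k = k and h = "\<lambda>i. g (i + 2)" and t = t and A = "{-2..N - 1}", OF k] m
    by (simp add: add.commute)
  finally show ?thesis .
qed

lemma spline1_cell:
  assumes "0 \<le> m" "m < N" "m = \<lfloor>of_int N * x\<rfloor>"
  shows "spline1 N g x = quad (g m) (g (m + 1)) (g (m + 2)) (of_int N * x - of_int m)"
proof -
  have f: "0 \<le> of_int N * x - of_int m" "of_int N * x - of_int m \<le> 1" using assms(3) by linarith+
  show ?thesis using shifted_kernel_sum[where k = phi and g = g, OF phi_zero assms(3,1,2)]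
    unfolding spline1_def phi_values[OF f] quad_def by simp
qed

lemma spline1_deriv_cell:
  assumes "0 \<le> m" "m < N" "m = \<lfloor>of_int N * x\<rfloor>"
  shows "spline1_deriv N g x = of_int N * ((1 - (of_int N * x - of_int m)) * (g (m + 1) - g m) + (of_int N * x - of_int m) * (g (m + 2) - g (m + 1)))"
proof -
  have f: "0 \<le> of_int N * x - of_int m" "of_int N * x - of_int m \<le> 1" using assms(3) by linarith+
  have r: "ramp (of_int N * x - of_int m) = of_int N * x - of_int m" using f by (simp add: ramp_def max_def)
  have "spline1_deriv N g x = of_int N * (\<Sum>k\<in>{0..N + 1}. g k * ramp.K' (of_int N * x - of_int k + 2))"
    unfolding spline1_deriv_def sum_distrib_left by (intro sum.cong refl) simp
  also have "\<dots> = of_int N * ((1 - (of_int N * x - of_int m)) * (g (m + 1) - g m) + (of_int N * x - of_int m) * (g (m + 2) - g (m + 1)))"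
    using shifted_kernel_sum[where k = ramp.K' and g = g, OF ramp.K'_zero assms(3,1,2)]
    unfolding ramp.K'_values[OF f] r by (simp only:) (simp add: algebra_simps)
  finally show ?thesis .
qed

lemma phi_deriv: "(phi has_real_derivative ramp.K' x) (at x)"
  using ramp.K_deriv by (simp add: ramp_K)

lemma phi_scaled_deriv:
  "((\<lambda>x. phi (of_int N * x - of_int k + 2)) has_real_derivative of_int N * ramp.K' (of_int N * x - of_int k + 2)) (at x)"
proof -
  have "((\<lambda>x. of_int N * x - of_int k + 2) has_real_derivative of_int N) (at x)" by (auto intro!: derivative_eq_intros)
  from DERIV_chain2[where f = phi, OF phi_deriv this] show ?thesis by (simp add: mult.commute)
qed

lemma spline1_deriv: "(spline1 N g has_real_derivative spline1_deriv N g x) (at x)"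
  unfolding spline1_def[abs_def] spline1_deriv_def by (intro DERIV_sum DERIV_cmult phi_scaled_deriv)

lemma spline1_cont: "continuous_on A (spline1 N g)" and spline1_deriv_cont: "continuous_on A (spline1_deriv N g)"
proof -
  show "continuous_on A (spline1 N g)" by (meson spline1_deriv DERIV_isCont continuous_at_imp_continuous_on)
  show "continuous_on A (spline1_deriv N g)" unfolding spline1_deriv_def
    by (intro continuous_intros continuous_on_compose2[OF ramp.K'_cont]) auto
qed

lemma spline1_diff: "spline1 N (\<lambda>k. g k - h k) x = spline1 N g x - spline1 N h x"
  by (simp add: spline1_def left_diff_distrib sum_subtractf)

definition I1 :: "(real \<Rightarrow> real) \<Rightarrow> real" where
  "I1 g = (\<integral>x. indicator {0<..<1} x * g x \<partial>lborel)"

lemma I1_integrable: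
  fixes g :: "real \<Rightarrow> real"
  assumes g: "continuous_on UNIV g" shows "integrable lborel (\<lambda>x. indicator {0<..<1} x * g x)"
proof -
  have "integrable lborel (\<lambda>x. indicator {0..1} x *\<^sub>R g x)"
    by (rule borel_integrable_compact) (auto intro: continuous_on_subset[OF g])
  then show ?thesis
  proof (rule Bochner_Integration.integrable_bound)
    show "(\<lambda>x. indicator {0<..<1} x * g x) \<in> borel_measurable lborel"
      using borel_measurable_continuous_onI[OF g] by simp
  qed (auto simp: indicator_def)
qed

lemma I1_sum:
  assumes "\<And>i. i \<in> I \<Longrightarrow> continuous_on UNIV (g i)"
  shows "I1 (\<lambda>x. \<Sum>i\<in>I. g i x) = (\<Sum>i\<in>I. I1 (g i))"
  unfolding I1_def sum_distrib_left using assms by (intro Bochner_Integration.integral_sum I1_integrable)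

lemma I1_cmult: "I1 (\<lambda>x. c * g x) = c * I1 g"
  unfolding I1_def by (subst integral_mult_right_zero[symmetric]) (simp add: algebra_simps)

text \<open>On cell \<open>m\<close> the integrand is \<open>q m\<close> in the local coordinate,
  with antiderivative \<open>R m\<close>. The grid points, where the closed cells overlap, form a
  null set.\<close>

lemma I1_cells:
  assumes N: "N > 0" and R: "\<And>m t. (R m has_real_derivative q m t) (at t)" and qc: "\<And>m. continuous_on UNIV (q m)"
    and gc: "continuous_on UNIV g"
    and g: "\<And>m x. 0 \<le> m \<Longrightarrow> m < N \<Longrightarrow> m = \<lfloor>of_int N * x\<rfloor> \<Longrightarrow> g x = q m (of_int N * x - of_int m)"
  shows "I1 g = (\<Sum>m\<in>{0..N - 1}. (R m 1 - R m 0) / of_int N)"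
proof -
  let ?h = "\<lambda>m x. q m (of_int N * x - of_int m) * indicator {of_int m / of_int N..of_int (m + 1) / of_int N} x"
  let ?P = "\<Union>m\<in>{0..N}. {of_int m / of_int N :: real}"
  have cell: "has_bochner_integral lborel (?h m) ((R m 1 - R m 0) / of_int N)" for m
  proof -
    have "has_bochner_integral lborel (?h m) (R m (of_int N * (of_int (m + 1) / of_int N) - of_int m) / of_int N - R m (of_int N * (of_int m / of_int N) - of_int m) / of_int N)"
    proof (rule has_bochner_integral_FTC_Icc_real)
      show "of_int m / of_int N \<le> (of_int (m + 1) / of_int N :: real)" using N by (intro divide_right_mono) auto
      show "((\<lambda>x. R m (of_int N * x - of_int m) / of_int N) has_real_derivative q m (of_int N * x - of_int m)) (at x)" for x
      proof -
        have "((\<lambda>x. of_int N * x - of_int m) has_real_derivative of_int N) (at x)" by (auto intro!: derivative_eq_intros)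
        from DERIV_cdivide[OF DERIV_chain2[where f = "R m", OF R this], of "of_int N"] show ?thesis using N by simp
      qed
      have "continuous_on UNIV (\<lambda>x. q m (of_int N * x - of_int m))"
        by (intro continuous_on_compose2[OF qc] continuous_intros) auto
      then show "isCont (\<lambda>x. q m (of_int N * x - of_int m)) x" for x by (simp add: continuous_on_eq_continuous_at)
    qed
    then show ?thesis using N by (simp add: diff_divide_distrib)
  qed
  have pw: "indicator {0<..<1} x * g x = (\<Sum>m\<in>{0..N - 1}. ?h m x)" if x: "x \<notin> ?P" for x
  proof (cases "x \<in> {0<..<1}")
    case True
    define m0 where "m0 = \<lfloor>of_int N * x\<rfloor>"
    have m0: "0 \<le> m0" "m0 < N"
    proof -
      have "0 \<le> of_int N * x" "of_int N * x < of_int N * 1" using True N by (auto intro!: mult_strict_left_mono)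
      then show "0 \<le> m0" "m0 < N" unfolding m0_def by linarith+
    qed
    have ind: "(indicator {of_int m / of_int N..of_int (m + 1) / of_int N} x :: real) = (if m = m0 then 1 else 0)" if m: "m \<in> {0..N - 1}" for m
    proof -
      have n1: "x \<noteq> of_int m / of_int N" using x m by auto
      have "m + 1 \<in> {0..N}" using m by simp
      then have n2: "x \<noteq> of_int (m + 1) / of_int N" using x by blast
      have Nr: "(0::real) < of_int N" using N by simp
      have "x \<in> {of_int m / of_int N..of_int (m + 1) / of_int N} \<longleftrightarrow> of_int m / of_int N < x \<and> x < of_int (m + 1) / of_int N"
        using n1 n2 by auto
      also have "\<dots> \<longleftrightarrow> of_int m < of_int N * x \<and> of_int N * x < of_int m + 1"
        using Nr by (simp add: pos_divide_less_eq pos_less_divide_eq mult.commute)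
      also have "\<dots> \<longleftrightarrow> m = m0"
      proof
        assume e: "m = m0"
        have "of_int m \<noteq> of_int N * x" using n1 Nr by (auto simp: field_simps)
        then show "of_int m < of_int N * x \<and> of_int N * x < of_int m + 1"
          using floor_correct[of "of_int N * x"] unfolding e m0_def by linarith
      qed (use m0_def in linarith)
      finally show ?thesis by (simp add: indicator_def)
    qed
    have "(\<Sum>m\<in>{0..N - 1}. ?h m x) = (\<Sum>m\<in>{0..N - 1}. if m = m0 then q m (of_int N * x - of_int m) else 0)"
      by (intro sum.cong refl) (simp add: ind del: of_int_add)
    also have "\<dots> = q m0 (of_int N * x - of_int m0)" using m0 by simp
    finally show ?thesis using g[OF m0 m0_def] True by simp
  next
    case False
    have "?h m x = 0" if m: "m \<in> {0..N - 1}" for m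
    proof -
      have n1: "x \<noteq> of_int m / of_int N" using x m by auto
      have "m + 1 \<in> {0..N}" using m by simp
      then have n2: "x \<noteq> of_int (m + 1) / of_int N" using x by blast
      have "real_of_int (m + 1) \<le> of_int N" using m by simp
      then have "(0::real) \<le> of_int m / of_int N" "of_int (m + 1) / of_int N \<le> (1::real)"
        using m N by (simp_all add: divide_le_eq)
      then have "x \<notin> {of_int m / of_int N..of_int (m + 1) / of_int N}" using False n1 n2 by auto
      then show ?thesis by simp
    qed
    then have "(\<Sum>m\<in>{0..N - 1}. ?h m x) = 0" by (intro sum.neutral ballI)
    then show ?thesis using False by simp
  qed
  have "I1 g = (\<integral>x. (\<Sum>m\<in>{0..N - 1}. ?h m x) \<partial>lborel)"
    unfolding I1_def
  proof (rule integral_cong_AE)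
    have "countable ?P" by (intro countable_finite) auto
    then have "?P \<in> null_sets lborel" by (rule countable_imp_null_set_lborel)
    then have "AE x in lborel. x \<notin> ?P" by (rule AE_not_in)
    then show "AE x in lborel. indicator {0<..<1} x * g x = (\<Sum>m\<in>{0..N - 1}. ?h m x)"
      by eventually_elim (rule pw)
    show "(\<lambda>x. \<Sum>m\<in>{0..N - 1}. ?h m x) \<in> borel_measurable lborel"
      by (intro borel_measurable_sum borel_measurable_integrable integrable.intros[OF cell])
    show "(\<lambda>x. indicator {0<..<1} x * g x) \<in> borel_measurable lborel"
      using I1_integrable[OF gc] by (rule borel_measurable_integrable)
  qed
  also have "\<dots> = (\<Sum>m\<in>{0..N - 1}. \<integral>x. ?h m x \<partial>lborel)"
    using cell by (intro Bochner_Integration.integral_sum) (auto simp: has_bochner_integral_iff)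
  also have "\<dots> = (\<Sum>m\<in>{0..N - 1}. (R m 1 - R m 0) / of_int N)"
    using cell by (intro sum.cong refl has_bochner_integral_integral_eq)
  finally show ?thesis .
qed

lemma sum_shift_cells: "(\<Sum>m\<in>{0..N - 1}. f m) = (\<Sum>i\<in>{1..N}. f (i - 1))" for f :: "int \<Rightarrow> real"
  by (rule sum.reindex_bij_witness[of _ "\<lambda>i. i - 1" "\<lambda>i. i + 1"]) auto

lemma spline1_square_bounds:
  assumes N: "N > 0"
  shows "1 / (25 * of_int N) * sq N g \<le> I1 (\<lambda>x. (spline1 N g x)\<^sup>2)"
    and "I1 (\<lambda>x. (spline1 N g x)\<^sup>2) \<le> 1 / of_int N * (\<Sum>i\<in>{1..N}. (g (i - 1))\<^sup>2 + (g i)\<^sup>2 + (g (i + 1))\<^sup>2)"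
proof -
  define A where "A m = (g m + g (m + 1)) / 2" for m
  define B where "B m = g (m + 1) - g m" for m
  define C where "C m = (g m - 2 * g (m + 1) + g (m + 2)) / 2" for m
  define R where "R m t = (A m)\<^sup>2 * t + A m * B m * t ^ 2 + ((B m)\<^sup>2 + 2 * A m * C m) / 3 * t ^ 3 + B m * C m / 2 * t ^ 4 + (C m)\<^sup>2 / 5 * t ^ 5" for m t
  have e: "I1 (\<lambda>x. (spline1 N g x)\<^sup>2) = (\<Sum>m\<in>{0..N - 1}. (R m 1 - R m 0) / of_int N)"
  proof (rule I1_cells[OF N, where q = "\<lambda>m t. (A m + B m * t + C m * t\<^sup>2)\<^sup>2"])
    show "(R m has_real_derivative (A m + B m * t + C m * t\<^sup>2)\<^sup>2) (at t)" for m t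
      unfolding R_def by (auto intro!: derivative_eq_intros simp: power2_eq_square power3_eq_cube power4_eq_xxxx algebra_simps)
    show "continuous_on UNIV (\<lambda>t. (A m + B m * t + C m * t\<^sup>2)\<^sup>2)" for m by (intro continuous_intros)
    show "continuous_on UNIV (\<lambda>x. (spline1 N g x)\<^sup>2)" by (intro continuous_intros spline1_cont)
    show "(spline1 N g x)\<^sup>2 = (A m + B m * (of_int N * x - of_int m) + C m * (of_int N * x - of_int m)\<^sup>2)\<^sup>2"
      if "0 \<le> m" "m < N" "m = \<lfloor>of_int N * x\<rfloor>" for m x
    proof -
      have "quad a b c t = (a + b) / 2 + (b - a) * t + (a - 2 * b + c) / 2 * t\<^sup>2" for a b c t
        by (simp add: quad_def power2_eq_square field_simps)
      then show ?thesis unfolding spline1_cell[OF that] A_def B_def C_def by simp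
    qed
  qed
  have R1: "R m 1 - R m 0 = (6 * (g m)\<^sup>2 + 6 * (g (m + 2))\<^sup>2 + 2 * g m * g (m + 2) + 26 * g (m + 1) * (g m + g (m + 2)) + 54 * (g (m + 1))\<^sup>2) / 120" for m
    unfolding R_def A_def B_def C_def by (simp add: power2_eq_square field_simps)
  \<comment> \<open>Only the middle coefficient of each cell is kept, so that each of
    \<open>1..N\<close> is counted once. Minimizing the form over the outer two leaves 40/7 of its
    square; 24/5 = 120/25 suffices.\<close>
  have lo: "1 / 25 * (g (m + 1))\<^sup>2 \<le> R m 1 - R m 0" for m
  proof -
    have "24 / 5 * b\<^sup>2 \<le> 6 * a\<^sup>2 + 6 * c\<^sup>2 + 2 * a * c + 26 * b * (a + c) + 54 * b\<^sup>2" for a b c :: real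
    proof -
      have "6 * a\<^sup>2 + 6 * c\<^sup>2 + 2 * a * c + 26 * b * (a + c) + 54 * b\<^sup>2 - 24 / 5 * b\<^sup>2
        = 7 / 2 * (a + c + 26 / 7 * b)\<^sup>2 + 5 / 2 * (a - c)\<^sup>2 + 32 / 35 * b\<^sup>2"
        by (simp add: power2_eq_square field_simps)
      moreover have "0 \<le> 7 / 2 * (a + c + 26 / 7 * b)\<^sup>2 + 5 / 2 * (a - c)\<^sup>2 + 32 / 35 * b\<^sup>2" by simp
      ultimately show ?thesis by (metis diff_ge_0_iff_ge)
    qed
    from this[of "g (m + 1)" "g m" "g (m + 2)"] show ?thesis unfolding R1 by simp
  qed
  have hi: "R m 1 - R m 0 \<le> (g m)\<^sup>2 + (g (m + 1))\<^sup>2 + (g (m + 2))\<^sup>2" for m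
  proof -
    have
      "6 * (g m)\<^sup>2 + 6 * (g (m + 2))\<^sup>2 + 2 * g m * g (m + 2) + 26 * g (m + 1) * (g m + g (m + 2)) + 54 * (g (m + 1))\<^sup>2
       \<le> 120 * ((g m)\<^sup>2 + (g (m + 1))\<^sup>2 + (g (m + 2))\<^sup>2)"
      using zero_le_power2[of "g m"] zero_le_power2[of "g (m + 1)"] zero_le_power2[of "g (m + 2)"]
        sum_squares_bound[of "g m" "g (m + 2)"] sum_squares_bound[of "g (m + 1)" "g m"] sum_squares_bound[of "g (m + 1)" "g (m + 2)"]
      by (simp only: distrib_left mult.assoc)
    then show ?thesis unfolding R1 by simp
  qed
  have Nr: "(0::real) < of_int N" using N by simp
  have "1 / (25 * of_int N) * sq N g = (\<Sum>m\<in>{0..N - 1}. 1 / 25 * (g (m + 1))\<^sup>2 / of_int N)"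
    unfolding sum_shift_cells sq_def sum_distrib_left by simp
  also have "\<dots> \<le> I1 (\<lambda>x. (spline1 N g x)\<^sup>2)"
    unfolding e using Nr by (intro sum_mono divide_right_mono lo) auto
  finally show "1 / (25 * of_int N) * sq N g \<le> I1 (\<lambda>x. (spline1 N g x)\<^sup>2)" .
  have "I1 (\<lambda>x. (spline1 N g x)\<^sup>2) \<le> (\<Sum>m\<in>{0..N - 1}. ((g m)\<^sup>2 + (g (m + 1))\<^sup>2 + (g (m + 2))\<^sup>2) / of_int N)"
    unfolding e using Nr by (intro sum_mono divide_right_mono hi) auto
  also have "\<dots> = 1 / of_int N * (\<Sum>i\<in>{1..N}. (g (i - 1))\<^sup>2 + (g i)\<^sup>2 + (g (i + 1))\<^sup>2)"
    unfolding sum_shift_cells sum_distrib_left by (intro sum.cong refl) (simp add: add.commute)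
  finally show "I1 (\<lambda>x. (spline1 N g x)\<^sup>2) \<le> 1 / of_int N * (\<Sum>i\<in>{1..N}. (g (i - 1))\<^sup>2 + (g i)\<^sup>2 + (g (i + 1))\<^sup>2)" .
qed

text \<open>On a cell the derivative interpolates linearly between \<open>of_int N * dif g m\<close>
  and \<open>of_int N * dif g (m + 1)\<close>, so the exact integral is a form in two neighbouring
  differences.\<close>

lemma spline1_deriv_square_bounds:
  assumes N: "N > 0"
  shows "of_int N / 6 * (\<Sum>i\<in>{1..N}. (dif g (i - 1))\<^sup>2 + (dif g i)\<^sup>2) \<le> I1 (\<lambda>x. (spline1_deriv N g x)\<^sup>2)"
    and "I1 (\<lambda>x. (spline1_deriv N g x)\<^sup>2) \<le> of_int N / 2 * (\<Sum>i\<in>{1..N}. (dif g (i - 1))\<^sup>2 + (dif g i)\<^sup>2)"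
proof -
  define A where "A m = of_int N * dif g m" for m
  define B where "B m = of_int N * (dif g (m + 1) - dif g m)" for m
  define R where "R m t = (A m)\<^sup>2 * t + A m * B m * t ^ 2 + (B m)\<^sup>2 / 3 * t ^ 3" for m t
  have Nr: "(0::real) < of_int N" using N by simp
  have e: "I1 (\<lambda>x. (spline1_deriv N g x)\<^sup>2) = (\<Sum>m\<in>{0..N - 1}. (R m 1 - R m 0) / of_int N)"
  proof (rule I1_cells[OF N, where q = "\<lambda>m t. (A m + B m * t)\<^sup>2"])
    show "(R m has_real_derivative (A m + B m * t)\<^sup>2) (at t)" for m t
      unfolding R_def by (auto intro!: derivative_eq_intros simp: power2_eq_square power3_eq_cube algebra_simps)
    show "continuous_on UNIV (\<lambda>t. (A m + B m * t)\<^sup>2)" for m by (intro continuous_intros)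
    show "continuous_on UNIV (\<lambda>x. (spline1_deriv N g x)\<^sup>2)" by (intro continuous_intros spline1_deriv_cont)
    show "(spline1_deriv N g x)\<^sup>2 = (A m + B m * (of_int N * x - of_int m))\<^sup>2"
      if "0 \<le> m" "m < N" "m = \<lfloor>of_int N * x\<rfloor>" for m x
      unfolding spline1_deriv_cell[OF that] A_def B_def dif_def by (simp add: algebra_simps)
  qed
  have R1: "(R m 1 - R m 0) / of_int N = of_int N * (((dif g m)\<^sup>2 + dif g m * dif g (m + 1) + (dif g (m + 1))\<^sup>2) / 3)" for m
    unfolding R_def A_def B_def using Nr by (simp add: power2_eq_square field_simps)
  have q: "(a\<^sup>2 + b\<^sup>2) / 6 \<le> (a\<^sup>2 + a * b + b\<^sup>2) / 3" "(a\<^sup>2 + a * b + b\<^sup>2) / 3 \<le> (a\<^sup>2 + b\<^sup>2) / 2" for a b :: real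
    using zero_le_power2[of "a + b"] zero_le_power2[of "a - b"] by (simp_all add: power2_eq_square field_simps)
  have "of_int N / 6 * (\<Sum>i\<in>{1..N}. (dif g (i - 1))\<^sup>2 + (dif g i)\<^sup>2) = (\<Sum>m\<in>{0..N - 1}. of_int N * (((dif g m)\<^sup>2 + (dif g (m + 1))\<^sup>2) / 6))"
    unfolding sum_shift_cells sum_distrib_left by simp
  also have "\<dots> \<le> I1 (\<lambda>x. (spline1_deriv N g x)\<^sup>2)"
    unfolding e R1 using Nr by (intro sum_mono mult_left_mono q) auto
  finally show "of_int N / 6 * (\<Sum>i\<in>{1..N}. (dif g (i - 1))\<^sup>2 + (dif g i)\<^sup>2) \<le> I1 (\<lambda>x. (spline1_deriv N g x)\<^sup>2)" .
  have "I1 (\<lambda>x. (spline1_deriv N g x)\<^sup>2) \<le> (\<Sum>m\<in>{0..N - 1}. of_int N * (((dif g m)\<^sup>2 + (dif g (m + 1))\<^sup>2) / 2))"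
    unfolding e R1 using Nr by (intro sum_mono mult_left_mono q) auto
  also have "\<dots> = of_int N / 2 * (\<Sum>i\<in>{1..N}. (dif g (i - 1))\<^sup>2 + (dif g i)\<^sup>2)"
    unfolding sum_shift_cells sum_distrib_left by simp
  finally show "I1 (\<lambda>x. (spline1_deriv N g x)\<^sup>2) \<le> of_int N / 2 * (\<Sum>i\<in>{1..N}. (dif g (i - 1))\<^sup>2 + (dif g i)\<^sup>2)" .
qed

section \<open>Tensor product splines\<close>

lemma Q_fubini:
  fixes f :: "real \<times> real \<Rightarrow> real"
  assumes f: "continuous_on UNIV f"
  shows "integral\<^sup>L Q f = I1 (\<lambda>y. I1 (\<lambda>x. f (x, y)))" "integrable lborel (\<lambda>y. indicator {0<..<1} y * I1 (\<lambda>x. f (x, y)))"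
proof -
  let ?g = "\<lambda>z. indicator unit_square z * f z"
  have fm: "f \<in> borel_measurable borel" by (rule borel_measurable_continuous_onI[OF f])
  have "integrable lborel (\<lambda>z. indicator (cbox (0, 0) (1, 1)) z *\<^sub>R f z)"
    by (intro borel_integrable_compact compact_cbox continuous_on_subset[OF f]) auto
  then have gi: "integrable lborel ?g"
  proof (rule Bochner_Integration.integrable_bound)
    show "?g \<in> borel_measurable lborel" using fm by (auto intro!: borel_measurable_times borel_measurable_indicator)
    have "unit_square \<subseteq> cbox (0, 0) (1, 1)" unfolding unit_square_box by (rule box_subset_cbox)
    then show "AE z in lborel. norm (?g z) \<le> norm (indicator (cbox (0, 0) (1, 1)) z *\<^sub>R f z)"
      by (intro AE_I2) (auto simp: indicator_def)
  qed
  then have gp: "integrable (lborel \<Otimes>\<^sub>M lborel) (case_prod (\<lambda>x y. ?g (x, y)))" by (simp add: lborel_prod case_prod_beta')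
  have i: "(\<integral>x. ?g (x, y) \<partial>lborel) = indicator {0<..<1} y * I1 (\<lambda>x. f (x, y))" for y
  proof -
    have e: "(\<lambda>x. ?g (x, y)) = (\<lambda>x. indicator {0<..<1} y * (indicator {0<..<1} x * f (x, y)))"
      by (auto simp: indicator_def unit_square_def fun_eq_iff)
    show ?thesis unfolding I1_def e by (rule integral_mult_right_zero)
  qed
  have "integral\<^sup>L Q f = integral\<^sup>L lborel ?g" using integral_Q_lborel[OF fm] by simp
  also have "\<dots> = (\<integral>y. (\<integral>x. ?g (x, y) \<partial>lborel) \<partial>lborel)"
    unfolding lborel_pair.integral_snd[OF gp] by (simp add: lborel_prod case_prod_beta')
  finally show "integral\<^sup>L Q f = I1 (\<lambda>y. I1 (\<lambda>x. f (x, y)))" unfolding i I1_def[of "\<lambda>y. I1 (\<lambda>x. f (x, y))"] .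
  show "integrable lborel (\<lambda>y. indicator {0<..<1} y * I1 (\<lambda>x. f (x, y)))"
    using lborel_pair.integrable_snd[OF gp] unfolding i .
qed

lemma Q_swap:
  fixes f :: "real \<times> real \<Rightarrow> real"
  assumes f: "continuous_on UNIV f"
  shows "integral\<^sup>L Q f = integral\<^sup>L Q (\<lambda>z. f (snd z, fst z))"
proof -
  let ?g = "\<lambda>z. indicator unit_square z * f z"
  have fm: "f \<in> borel_measurable borel" by (rule borel_measurable_continuous_onI[OF f])
  have fs: "continuous_on UNIV (\<lambda>z. f (snd z, fst z))"
    by (rule continuous_on_compose2[OF f]) (auto intro!: continuous_intros)
  have gm: "?g \<in> borel_measurable (lborel \<Otimes>\<^sub>M lborel)"
    using fm by (auto simp: lborel_prod intro!: borel_measurable_times borel_measurable_indicator)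
  have "integral\<^sup>L Q f = integral\<^sup>L (lborel \<Otimes>\<^sub>M lborel) ?g" using integral_Q_lborel[OF fm] by (simp add: lborel_prod)
  also have "\<dots> = integral\<^sup>L (lborel \<Otimes>\<^sub>M lborel) (\<lambda>(x, y). ?g (y, x))"
    using lborel_pair.integral_product_swap[OF gm] by simp
  also have "(\<lambda>(x, y). ?g (y, x)) = (\<lambda>z. indicator unit_square z *\<^sub>R f (snd z, fst z))"
    by (auto simp: fun_eq_iff indicator_def unit_square_def)
  also have "integral\<^sup>L (lborel \<Otimes>\<^sub>M lborel) \<dots> = integral\<^sup>L Q (\<lambda>z. f (snd z, fst z))"
    using integral_Q_lborel[OF borel_measurable_continuous_onI[OF fs]] by (simp add: lborel_prod)
  finally show ?thesis .
qed

lemma I1_mono: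
  assumes "integrable lborel (\<lambda>x. indicator {0<..<1} x * g x)" "integrable lborel (\<lambda>x. indicator {0<..<1} x * h x)"
    "\<And>x. 0 < x \<Longrightarrow> x < 1 \<Longrightarrow> g x \<le> h x"
  shows "I1 g \<le> I1 h"
  unfolding I1_def using assms by (intro integral_mono) (auto simp: indicator_def)

definition spline2 :: "int \<Rightarrow> (int \<Rightarrow> int \<Rightarrow> real) \<Rightarrow> real \<times> real \<Rightarrow> real" where
  "spline2 N X z = (\<Sum>k\<in>{0..N + 1}. \<Sum>l\<in>{0..N + 1}. X k l * (phi (of_int N * fst z - of_int k + 2) * phi (of_int N * snd z - of_int l + 2)))"

definition spline2_dx :: "int \<Rightarrow> (int \<Rightarrow> int \<Rightarrow> real) \<Rightarrow> real \<times> real \<Rightarrow> real" where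
  "spline2_dx N X z = spline1_deriv N (\<lambda>k. spline1 N (X k) (snd z)) (fst z)"

lemma spline2_spline1: "spline2 N X z = spline1 N (\<lambda>k. spline1 N (X k) (snd z)) (fst z)"
  unfolding spline2_def spline1_def sum_distrib_right by (intro sum.cong refl) (simp add: algebra_simps)

lemma spline2_transpose: "spline2 N X (x, y) = spline2 N (\<lambda>k l. X l k) (y, x)"
  unfolding spline2_def by (subst sum.swap) (intro sum.cong refl, simp add: algebra_simps)

lemma spline2_GDERIV: "GDERIV (spline2 N X) z :> (spline2_dx N X z, spline2_dx N (\<lambda>k l. X l k) (snd z, fst z))"
proof -
  let ?A = "\<lambda>k x. phi (of_int N * x - of_int k + 2)" and ?B = "\<lambda>k x. of_int N * ramp.K' (of_int N * x - of_int k + 2)"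
  let ?G = "\<lambda>k l. X k l *\<^sub>R (?B k (fst z) * ?A l (snd z), ?A k (fst z) * ?B l (snd z))"
  have "GDERIV (\<lambda>z. X k l * (?A k (fst z) * ?A l (snd z))) z :> ?G k l" for k l
    by (intro GDERIV_cmult GDERIV_tensor phi_scaled_deriv)
  then have "GDERIV (spline2 N X) z :> (\<Sum>k\<in>{0..N + 1}. \<Sum>l\<in>{0..N + 1}. ?G k l)"
    unfolding spline2_def[abs_def] gderiv_def inner_sum_right by (intro has_derivative_sum)
  also have "(\<Sum>k\<in>{0..N + 1}. \<Sum>l\<in>{0..N + 1}. ?G k l) = (spline2_dx N X z, spline2_dx N (\<lambda>k l. X l k) (snd z, fst z))"
  proof (rule prod_eqI)
    show "fst (\<Sum>k\<in>{0..N + 1}. \<Sum>l\<in>{0..N + 1}. ?G k l) = fst (spline2_dx N X z, spline2_dx N (\<lambda>k l. X l k) (snd z, fst z))"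
      unfolding spline2_dx_def spline1_deriv_def spline1_def fst_sum sum_distrib_right by (simp add: algebra_simps)
    have "snd (\<Sum>k\<in>{0..N + 1}. \<Sum>l\<in>{0..N + 1}. ?G k l) = (\<Sum>l\<in>{0..N + 1}. \<Sum>k\<in>{0..N + 1}. snd (?G k l))"
      unfolding snd_sum by (rule sum.swap)
    also have "\<dots> = spline2_dx N (\<lambda>k l. X l k) (snd z, fst z)"
      unfolding spline2_dx_def spline1_deriv_def spline1_def sum_distrib_right by (simp add: algebra_simps)
    finally show "snd (\<Sum>k\<in>{0..N + 1}. \<Sum>l\<in>{0..N + 1}. ?G k l) = snd (spline2_dx N X z, spline2_dx N (\<lambda>k l. X l k) (snd z, fst z))" by simp
  qed
  finally show ?thesis .
qed

lemma spline2_dx_cont: "continuous_on UNIV (spline2_dx N X)"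
  unfolding spline2_dx_def[abs_def] spline1_deriv_def
  by (intro continuous_intros continuous_on_compose2[OF ramp.K'_cont] continuous_on_compose2[OF spline1_cont, of UNIV]) auto

lemma spline2_cont: "continuous_on UNIV (spline2 N X)"
  by (rule GDERIV_continuous[OF spline2_GDERIV])

lemma spline2_dx_swap_cont: "continuous_on UNIV (\<lambda>z. spline2_dx N X (snd z, fst z))"
  by (rule continuous_on_compose2[OF spline2_dx_cont]) (auto intro!: continuous_intros)

lemma spline2_hwg: "hwg (spline2 N X) (\<lambda>z. (spline2_dx N X z, spline2_dx N (\<lambda>k l. X l k) (snd z, fst z)))"
  by (rule has_weak_gradient_C1[OF spline2_GDERIV]) (intro continuous_intros spline2_dx_cont spline2_dx_swap_cont)

lemma spline2_sqint: "sqint Q (spline2 N X)"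
  by (rule sqint_Q_continuous[OF spline2_cont])

lemma spline2_H1Q: "spline2 N X \<in> H1Q"
  unfolding H1Q_iff by (intro conjI exI) (rule spline2_sqint, rule spline2_hwg)

lemma dif_sym:
  assumes "oddper N c" shows "dif c (2 * N - k) = dif c k"
  using oddperD(5)[OF assms, of k] oddperD(5)[OF assms, of "k + 1"] by (simp add: dif_def algebra_simps)

text \<open>The values at \<open>0\<close> and \<open>N\<close> are their own mirror images and
  occur once in a period, all others twice; a sum over the cells of the unit interval counts in the
  same way.\<close>

lemma sum_dif_period:
  fixes F :: "int \<Rightarrow> real"
  assumes N: "N \<ge> 0" and s: "\<And>k. F (2 * N - k) = F k" and p: "\<And>k. F (k + 2 * N) = F k"
  shows "(\<Sum>k\<in>{1..2 * N}. F k) = (\<Sum>i\<in>{1..N}. F (i - 1) + F i)"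
proof -
  have "(\<Sum>k\<in>{1..2 * N}. F (k - 1) + F k) = 2 * (\<Sum>i\<in>{1..N}. F (i - 1) + F i)"
  proof (rule sum_reflect[OF N])
    fix k show "F (2 * N + 1 - k - 1) + F (2 * N + 1 - k) = F (k - 1) + F k"
      using s[of k] s[of "k - 1"] by (simp add: algebra_simps)
  qed
  moreover have "(\<Sum>k\<in>{1..2 * N}. F (k - 1)) = (\<Sum>k\<in>{1..2 * N}. F k)"
    using N p by (intro sum_periodic_shift') auto
  ultimately show ?thesis by (simp add: sum.distrib)
qed

lemma sum_three_oddper:
  assumes N: "N \<ge> 0" and c: "oddper N c"
  shows "(\<Sum>i\<in>{1..N}. (c (i - 1))\<^sup>2 + (c i)\<^sup>2 + (c (i + 1))\<^sup>2) = 3 * sq N c"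
proof -
  have "(\<Sum>i\<in>{1..N}. (c (i + 1))\<^sup>2 - (c i)\<^sup>2) + (\<Sum>i\<in>{1..N}. (c (i - 1))\<^sup>2 - (c i)\<^sup>2) = 0"
    using sum_telescope_int[OF N, of "\<lambda>k. (c k)\<^sup>2"] sum_telescope_int[OF N, of "\<lambda>k. (c (k - 1))\<^sup>2"] oddperD(3,4)[OF c]
    by (simp add: sum_subtractf)
  then show ?thesis by (simp add: sq_def sum.distrib sum_subtractf)
qed

lemma oddper_op1_dif: "oddper2 N N X \<Longrightarrow> oddper N (op1 dif X k)"
  using oddper_diff[OF oddper2D(2) oddper2D(2)] unfolding op1_def[abs_def] dif_def by blast

text \<open>For fixed \<open>y\<close> this is a one-dimensional spline in \<open>x\<close> whose
  coefficients, and their differences, are splines in \<open>y\<close>; the bounds for the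
  derivative in \<open>x\<close> and for the function in \<open>y\<close> are applied in succession.
  Their factors \<open>of_int N\<close> and \<open>1 / of_int N\<close> cancel. The constants are
  1/2 * 1/6 * 1/25 and 1/2 * 1/2 * 3, where 1/2 stems from summing over a full period.\<close>

lemma spline2_dx_energy:
  assumes N: "N > 0" and X: "oddper2 N N X"
  shows "1 / 300 * sq2 (2 * N) (2 * N) (op1 dif X) \<le> (LINT z|Q. (spline2_dx N X z)\<^sup>2)"
    and "(LINT z|Q. (spline2_dx N X z)\<^sup>2) \<le> 3 / 4 * sq2 (2 * N) (2 * N) (op1 dif X)"
proof -
  have Nr: "(0::real) < of_int N" and N0: "N \<ge> 0" using N by simp_all
  let ?Y = "\<lambda>y k. spline1 N (X k) y"
  let ?D = "op1 dif X"
  let ?S = "\<Sum>i\<in>{1..N}. sq N (?D (i - 1)) + sq N (?D i)"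
  have dY: "dif (?Y y) i = spline1 N (?D i) y" for y i
    by (simp add: dif_def op1_def[abs_def] spline1_diff)
  have SD: "sq2 (2 * N) (2 * N) ?D = 2 * ?S"
  proof -
    have "sq2 (2 * N) (2 * N) ?D = (\<Sum>k\<in>{1..2 * N}. 2 * sq N (?D k))"
      unfolding sq2_def by (intro sum.cong refl sq_oddper N0 oddper_op1_dif X)
    also have "\<dots> = 2 * (\<Sum>k\<in>{1..2 * N}. sq N (?D k))" by (simp add: sum_distrib_left)
    also have "(\<Sum>k\<in>{1..2 * N}. sq N (?D k)) = ?S"
    proof (rule sum_dif_period[OF N0])
      show "sq N (?D (2 * N - k)) = sq N (?D k)" for k
        using dif_sym[OF oddper2D(1)[OF X]] by (simp add: op1_def[abs_def])
      show "sq N (?D (k + 2 * N)) = sq N (?D k)" for k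
        using oddperD(1)[OF oddper2D(1)[OF X], of k] oddperD(1)[OF oddper2D(1)[OF X], of "k + 1"]
        by (simp add: op1_def[abs_def] dif_def algebra_simps)
    qed
    finally show ?thesis .
  qed
  have c2: "continuous_on UNIV (\<lambda>z. (spline2_dx N X z)\<^sup>2)" by (intro continuous_intros spline2_dx_cont)
  have e: "(LINT z|Q. (spline2_dx N X z)\<^sup>2) = I1 (\<lambda>y. I1 (\<lambda>x. (spline1_deriv N (?Y y) x)\<^sup>2))"
    using Q_fubini(1)[OF c2] by (simp add: spline2_dx_def)
  have i: "integrable lborel (\<lambda>y. indicator {0<..<1} y * I1 (\<lambda>x. (spline1_deriv N (?Y y) x)\<^sup>2))"
    using Q_fubini(2)[OF c2] by (simp add: spline2_dx_def)
  let ?h = "\<lambda>y. \<Sum>i\<in>{1..N}. (spline1 N (?D (i - 1)) y)\<^sup>2 + (spline1 N (?D i) y)\<^sup>2"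
  have hc: "continuous_on UNIV ?h" by (intro continuous_intros spline1_cont)
  have hi: "I1 ?h = (\<Sum>i\<in>{1..N}. I1 (\<lambda>y. (spline1 N (?D (i - 1)) y)\<^sup>2) + I1 (\<lambda>y. (spline1 N (?D i) y)\<^sup>2))"
  proof -
    have "I1 (\<lambda>y. (spline1 N (?D (i - 1)) y)\<^sup>2 + (spline1 N (?D i) y)\<^sup>2) = I1 (\<lambda>y. (spline1 N (?D (i - 1)) y)\<^sup>2) + I1 (\<lambda>y. (spline1 N (?D i) y)\<^sup>2)" for i
      using I1_integrable[of "\<lambda>y. (spline1 N (?D (i - 1)) y)\<^sup>2"] I1_integrable[of "\<lambda>y. (spline1 N (?D i) y)\<^sup>2"]
      unfolding I1_def distrib_left by (intro Bochner_Integration.integral_add) (auto intro!: continuous_intros spline1_cont)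
    then show ?thesis by (subst I1_sum) (auto intro!: continuous_intros spline1_cont)
  qed
  have "1 / 300 * sq2 (2 * N) (2 * N) ?D = of_int N / 6 * (\<Sum>i\<in>{1..N}. 1 / (25 * of_int N) * sq N (?D (i - 1)) + 1 / (25 * of_int N) * sq N (?D i))"
    unfolding SD distrib_left[symmetric] sum_distrib_left[symmetric] using Nr by simp
  also have "\<dots> \<le> of_int N / 6 * I1 ?h"
    unfolding hi using Nr by (intro mult_left_mono sum_mono add_mono spline1_square_bounds N) auto
  also have "\<dots> = I1 (\<lambda>y. of_int N / 6 * ?h y)" by (rule I1_cmult[symmetric])
  also have "\<dots> \<le> I1 (\<lambda>y. I1 (\<lambda>x. (spline1_deriv N (?Y y) x)\<^sup>2))"
  proof (rule I1_mono[OF I1_integrable i])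
    show "of_int N / 6 * ?h y \<le> I1 (\<lambda>x. (spline1_deriv N (?Y y) x)\<^sup>2)" for y
      using spline1_deriv_square_bounds(1)[OF N, of "?Y y"] unfolding dY .
  qed (intro continuous_intros hc)
  finally show "1 / 300 * sq2 (2 * N) (2 * N) ?D \<le> (LINT z|Q. (spline2_dx N X z)\<^sup>2)" unfolding e .
  have "I1 (\<lambda>y. I1 (\<lambda>x. (spline1_deriv N (?Y y) x)\<^sup>2)) \<le> I1 (\<lambda>y. of_int N / 2 * ?h y)"
  proof (rule I1_mono[OF i I1_integrable])
    show "I1 (\<lambda>x. (spline1_deriv N (?Y y) x)\<^sup>2) \<le> of_int N / 2 * ?h y" for y
      using spline1_deriv_square_bounds(2)[OF N, of "?Y y"] unfolding dY .
  qed (intro continuous_intros hc)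
  also have "\<dots> = of_int N / 2 * I1 ?h" by (rule I1_cmult)
  also have "\<dots> \<le> of_int N / 2 * (\<Sum>i\<in>{1..N}. 1 / of_int N * (3 * sq N (?D (i - 1))) + 1 / of_int N * (3 * sq N (?D i)))"
  proof -
    have "I1 (\<lambda>y. (spline1 N (?D i) y)\<^sup>2) \<le> 1 / of_int N * (3 * sq N (?D i))" for i
      using spline1_square_bounds(2)[OF N, of "?D i"] unfolding sum_three_oddper[OF N0 oddper_op1_dif[OF X]] .
    then show ?thesis unfolding hi using Nr by (intro mult_left_mono sum_mono add_mono) auto
  qed
  also have "\<dots> = 3 / 4 * sq2 (2 * N) (2 * N) ?D"
    unfolding SD distrib_left[symmetric] sum_distrib_left[symmetric] using Nr by simp
  finally show "(LINT z|Q. (spline2_dx N X z)\<^sup>2) \<le> 3 / 4 * sq2 (2 * N) (2 * N) ?D" unfolding e .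
qed

lemma S1_spline2:
  assumes N: "N > 0" and X: "oddper2 N N X"
  shows "1 / 300 * energy (2 * N) X \<le> (S1 (spline2 N X))\<^sup>2" "(S1 (spline2 N X))\<^sup>2 \<le> 3 / 4 * energy (2 * N) X"
proof -
  let ?T = "\<lambda>k l. X l k"
  have T: "oddper2 N N ?T" using X by (simp add: oddper2_def)
  have st: "sq2 (2 * N) (2 * N) (op1 dif ?T) = sq2 (2 * N) (2 * N) (op2 dif X)"
    unfolding sq2_swap[of _ _ "op2 dif X"] unfolding sq2_def op1_def[abs_def] op2_def[abs_def] by simp
  have c: "continuous_on UNIV (\<lambda>z. (spline2_dx N ?T z)\<^sup>2)" "continuous_on UNIV (\<lambda>z. (spline2_dx N X z)\<^sup>2)" "continuous_on UNIV (\<lambda>z. (spline2_dx N ?T (snd z, fst z))\<^sup>2)"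
    by (intro continuous_intros spline2_dx_cont spline2_dx_swap_cont)+
  have "(S1 (spline2 N X))\<^sup>2 = (LINT z|Q. (spline2_dx N X z)\<^sup>2 + (spline2_dx N ?T (snd z, fst z))\<^sup>2)"
    unfolding S1_eq[OF spline2_hwg] l2_power2 norm_pair_power2 by simp
  also have "\<dots> = (LINT z|Q. (spline2_dx N X z)\<^sup>2) + (LINT z|Q. (spline2_dx N ?T (snd z, fst z))\<^sup>2)"
    using c by (intro Bochner_Integration.integral_add integrable_sqint_Q sqint_Q_continuous)
  also have "(LINT z|Q. (spline2_dx N ?T (snd z, fst z))\<^sup>2) = (LINT z|Q. (spline2_dx N ?T z)\<^sup>2)"
    using Q_swap[OF c(1)] by simp
  finally have "(S1 (spline2 N X))\<^sup>2 = (LINT z|Q. (spline2_dx N X z)\<^sup>2) + (LINT z|Q. (spline2_dx N ?T z)\<^sup>2)" .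
  then show "1 / 300 * energy (2 * N) X \<le> (S1 (spline2 N X))\<^sup>2" "(S1 (spline2 N X))\<^sup>2 \<le> 3 / 4 * energy (2 * N) X"
    using spline2_dx_energy[OF N X] spline2_dx_energy[OF N T] unfolding energy_def st by (simp_all only: distrib_left)
qed

lemma discrete_poincare:
  assumes N: "N > 0" and c: "oddper N c"
  shows "sq N c \<le> (of_int N)\<^sup>2 * sq (2 * N) (dif c)"
proof -
  have N0: "N \<ge> 0" using N by simp
  let ?b = "sq (2 * N) (dif c)"
  have d0: "dif c 0 = dif c (2 * N)" using dif_sym[OF c, of 0] by simp
  have tel: "(\<Sum>i\<in>{0..k}. dif c i) = c (k + 1) - c 0" if "k \<ge> 0" for k
    using that
  proof (induction k rule: int_ge_induct)
    case (step i)
    have "{0..i + 1} = insert (i + 1) {0..i}" using step(1) by auto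
    then show ?case using step by (simp add: dif_def)
  qed (simp add: dif_def)
  have one: "(c k)\<^sup>2 \<le> of_int N * ?b" if k: "k \<in> {1..N}" for k
  proof -
    \<comment> \<open>The difference across the boundary is \<open>2 * c 1\<close>, so half of it
      leads from the boundary value zero to \<open>c 1\<close>.\<close>
    define e where "e i = (if i = 0 then dif c 0 / 2 else dif c i)" for i
    have "(\<Sum>i\<in>{0..k - 1}. e i) = (\<Sum>i\<in>{0..k - 1}. dif c i) - dif c 0 / 2"
    proof -
      have "{0..k - 1} = insert 0 {1..k - 1}" using k by auto
      then show ?thesis by (simp add: e_def)
    qed
    also have "\<dots> = c k" using tel[of "k - 1"] k oddperD(3)[OF c] by (simp add: dif_def)
    finally have "(c k)\<^sup>2 = (\<Sum>i\<in>{0..k - 1}. e i)\<^sup>2" by simp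
    also have "\<dots> \<le> (\<Sum>i\<in>{0..k - 1}. (e i)\<^sup>2) * card {0..k - 1}"
      by (rule sum_squared_le_sum_of_squares)
    also have "\<dots> \<le> ?b * of_int N"
    proof (intro mult_mono)
      have "(\<Sum>i\<in>{0..k - 1}. (e i)\<^sup>2) \<le> (\<Sum>i\<in>{0..k - 1}. (dif c i)\<^sup>2)"
        by (intro sum_mono) (auto simp: e_def power_divide)
      \<comment> \<open>Index 0 is moved to \<open>2 * N\<close>, since \<open>sq (2 * N)\<close>
        sums over \<open>1..2 * N\<close>.\<close>
      also have "\<dots> = (\<Sum>i\<in>insert (2 * N) {1..k - 1}. (dif c i)\<^sup>2)"
      proof -
        have "{0..k - 1} = insert 0 {1..k - 1}" using k by auto
        then show ?thesis using k d0 by simp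
      qed
      also have "\<dots> \<le> ?b" unfolding sq_def using k N by (intro sum_mono2) auto
      finally show "(\<Sum>i\<in>{0..k - 1}. (e i)\<^sup>2) \<le> ?b" .
      show "real (card {0..k - 1}) \<le> of_int N" using k by simp
    qed auto
    finally show ?thesis by (simp add: mult.commute)
  qed
  have "sq N c \<le> (\<Sum>k\<in>{1..N}. of_int N * ?b)" unfolding sq_def[of N] by (intro sum_mono one)
  also have "\<dots> = (of_int N)\<^sup>2 * ?b" using N by (simp add: power2_eq_square)
  finally show ?thesis .
qed

lemma oddper_spline1: "oddper2 N N X \<Longrightarrow> oddper N (\<lambda>k. spline1 N (X k) y)"
proof -
  assume X: "oddper2 N N X"
  have "X (k + 2 * N) = X k" "X (1 - k) = (\<lambda>l. - X k l)" for k
    using oddperD(1,2)[OF oddper2D(1)[OF X]] by auto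
  then show ?thesis by (simp add: oddper_def spline1_def sum_negf)
qed

text \<open>Integration in two variables gives the inverse square of the grid number, which
  compensates the square in the discrete Poincare inequality; 9 = 3 * 3.\<close>

lemma spline2_L2:
  assumes N: "N > 0" and X: "oddper2 N N X"
  shows "(LINT z|Q. (spline2 N X z)\<^sup>2) \<le> 9 * energy (2 * N) X"
proof -
  have Nr: "(0::real) < of_int N" and N0: "N \<ge> 0" using N by simp_all
  let ?Y = "\<lambda>y k. spline1 N (X k) y"
  have c2: "continuous_on UNIV (\<lambda>z. (spline2 N X z)\<^sup>2)" by (intro continuous_intros spline2_cont)
  have "(LINT z|Q. (spline2 N X z)\<^sup>2) = I1 (\<lambda>y. I1 (\<lambda>x. (spline1 N (?Y y) x)\<^sup>2))"
    using Q_fubini(1)[OF c2] by (simp add: spline2_spline1)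
  also have "\<dots> \<le> I1 (\<lambda>y. 3 / of_int N * sq N (?Y y))"
  proof (rule I1_mono[OF _ I1_integrable])
    show "integrable lborel (\<lambda>y. indicator {0<..<1} y * I1 (\<lambda>x. (spline1 N (?Y y) x)\<^sup>2))"
      using Q_fubini(2)[OF c2] by (simp add: spline2_spline1)
    show "continuous_on UNIV (\<lambda>y. 3 / of_int N * sq N (?Y y))" unfolding sq_def by (intro continuous_intros spline1_cont)
    show "I1 (\<lambda>x. (spline1 N (?Y y) x)\<^sup>2) \<le> 3 / of_int N * sq N (?Y y)" for y
      using spline1_square_bounds(2)[OF N, of "?Y y"] unfolding sum_three_oddper[OF N0 oddper_spline1[OF X]] by simp
  qed
  also have "\<dots> = 3 / of_int N * I1 (\<lambda>y. \<Sum>k\<in>{1..N}. (spline1 N (X k) y)\<^sup>2)" unfolding I1_cmult sq_def ..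
  also have "\<dots> = 3 / of_int N * (\<Sum>k\<in>{1..N}. I1 (\<lambda>y. (spline1 N (X k) y)\<^sup>2))"
    by (subst I1_sum) (auto intro!: continuous_intros spline1_cont)
  also have "\<dots> \<le> 3 / of_int N * (\<Sum>k\<in>{1..N}. 1 / of_int N * (3 * sq N (X k)))"
  proof -
    have "I1 (\<lambda>y. (spline1 N (X k) y)\<^sup>2) \<le> 1 / of_int N * (3 * sq N (X k))" for k
      using spline1_square_bounds(2)[OF N, of "X k"] unfolding sum_three_oddper[OF N0 oddper2D(2)[OF X]] .
    then show ?thesis using Nr by (intro mult_left_mono sum_mono) auto
  qed
  also have "\<dots> = 9 / (of_int N)\<^sup>2 * sq2 N N X"
    unfolding sq2_def by (simp add: sum_distrib_left power2_eq_square)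
  also have "sq2 N N X \<le> (of_int N)\<^sup>2 * sq2 (2 * N) (2 * N) (op1 dif X)"
  proof -
    have "sq2 N N X \<le> (\<Sum>l\<in>{1..N}. (of_int N)\<^sup>2 * sq (2 * N) (dif (\<lambda>k. X k l)))"
      unfolding sq2_swap by (intro sum_mono discrete_poincare N oddper2D(1)[OF X])
    also have "\<dots> \<le> (\<Sum>l\<in>{1..2 * N}. (of_int N)\<^sup>2 * sq (2 * N) (dif (\<lambda>k. X k l)))"
      using N by (intro sum_mono2) auto
    also have "\<dots> = (of_int N)\<^sup>2 * sq2 (2 * N) (2 * N) (op1 dif X)"
      unfolding sq2_swap by (simp add: sum_distrib_left op1_def[abs_def])
    finally show ?thesis .
  qed
  then have "9 / (of_int N)\<^sup>2 * sq2 N N X \<le> 9 * sq2 (2 * N) (2 * N) (op1 dif X)"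
    using Nr by (simp add: field_simps)
  finally show ?thesis unfolding energy_def using sq2_nonneg[of "2 * N" "2 * N" "op2 dif X"] by argo
qed

lemma N1_spline2:
  assumes N: "N > 0" and X: "oddper2 N N X"
  shows "(N1 (spline2 N X))\<^sup>2 \<le> 10 * energy (2 * N) X"
proof -
  have "(N1 (spline2 N X))\<^sup>2 = (LINT z|Q. (spline2 N X z)\<^sup>2) + (S1 (spline2 N X))\<^sup>2"
    by (simp add: H1_norm_def)
  moreover have "energy (2 * N) X \<ge> 0" by (simp add: energy_def)
  ultimately show ?thesis using spline2_L2[OF N X] S1_spline2(2)[OF N X] by argo
qed

section \<open>Wavelets in spline coordinates\<close>

definition unit_phi :: "int \<Rightarrow> int \<Rightarrow> real \<Rightarrow> real" where
  "unit_phi n k x = (if k = 1 then phi_b (of_int n * x) else if k = n then phi_b (of_int n * (1 - x))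
     else phi (of_int n * x - of_int k + 2))"

text \<open>Twice the wavelet without its power of two. Since the even index has the plus sign, the
  boundary function is subtracted at the left end and added at the right end, as the sign of the
  last wavelet demands.\<close>

definition unit_psi :: "int \<Rightarrow> int \<Rightarrow> real \<Rightarrow> real" where
  "unit_psi n k x = unit_phi (2 * n) (2 * k) x - unit_phi (2 * n) (2 * k - 1) x"

lemma spline1_cmult: "spline1 N (\<lambda>k. a * g k) x = a * spline1 N g x"
  by (simp add: spline1_def sum_distrib_left mult.assoc)

lemma spline1_add: "spline1 N (\<lambda>k. g k + h k) x = spline1 N g x + spline1 N h x"
  by (simp add: spline1_def distrib_right sum.distrib)

lemma spline1_minus: "spline1 N (\<lambda>k. - g k) x = - spline1 N g x"
  by (simp add: spline1_def sum_negf)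

lemma spline1_sum: "spline1 N (\<lambda>k. \<Sum>i\<in>I. g i k) x = (\<Sum>i\<in>I. spline1 N (g i) x)"
  unfolding spline1_def sum_distrib_right by (rule sum.swap)

lemma phi_sym: "phi (3 - x) = phi x"
proof -
  consider "x < 0" | "0 \<le> x" "x \<le> 1" | "1 < x" "x < 2" | "2 \<le> x" "x \<le> 3" | "3 < x" by linarith
  then show ?thesis by cases (auto simp: phi_def power2_eq_square field_simps)
qed

lemma floor_range:
  fixes x :: real and N :: int
  assumes "0 < x" "x < 1" "N > 0" shows "0 \<le> \<lfloor>of_int N * x\<rfloor>" "\<lfloor>of_int N * x\<rfloor> < N"
proof -
  have "0 \<le> of_int N * x" "of_int N * x < of_int N * 1" using assms by (auto intro!: mult_strict_left_mono)
  then show "0 \<le> \<lfloor>of_int N * x\<rfloor>" "\<lfloor>of_int N * x\<rfloor> < N" by linarith+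
qed

text \<open>For \<open>k = 1\<close> the odd extension adds the coefficient \<open>- 3 / 2\<close>
  at index 0, and 3/2 times the difference of the two B-splines is \<open>phi_b\<close> on the
  interval; the other end is its mirror image. The verification runs over the cells.\<close>

lemma spline1_unit:
  assumes n: "n \<ge> 4" and k: "k \<in> {1..n}" and x: "0 < x" "x < 1"
  shows "spline1 n (bdry n (\<lambda>m. if m = k then 1 else 0)) x = unit_phi n k x"
proof -
  define e where "e = bdry n (\<lambda>m. if m = k then 1 else 0)"
  define m where "m = \<lfloor>of_int n * x\<rfloor>"
  define t where "t = of_int n * x - of_int m"
  have m: "0 \<le> m" "m < n" using floor_range[OF x, of n] n by (auto simp: m_def)
  have t: "0 \<le> t" "t \<le> 1" "t < 1" unfolding t_def m_def by linarith+
  have y: "of_int n * x = of_int m + t" by (simp add: t_def)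
  have y': "of_int n * (1 - x) = of_int n - of_int m - t" by (simp add: t_def algebra_simps)
  have eo: "oddper n e" unfolding e_def using n by (intro oddper_bdry) simp
  have ev: "e i = (if i = k then if k = 1 \<or> k = n then 3 / 2 else 1 else 0)" if "i \<in> {1..n}" for i
    unfolding e_def bdry_def oddext_eq[OF that] by simp
  have e0: "e 0 = (if k = 1 then - 3 / 2 else 0)" and en: "e (n + 1) = (if k = n then - 3 / 2 else 0)"
    using oddperD(3,4)[OF eo] ev[of 1] ev[of n] n by auto
  have spline1: "spline1 n e x = quad (e m) (e (m + 1)) (e (m + 2)) t"
    unfolding t_def by (rule spline1_cell[OF m m_def])
  have pz: "phi s = 0" if "s \<le> 0 \<or> s \<ge> 3" for s using phi_zero[OF that] .
  show ?thesis
  proof (cases "k = 1")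
    case True
    consider "m = 0" | "m = 1" | "m \<ge> 2" using m by linarith
    then have "quad (e m) (e (m + 1)) (e (m + 2)) t = phi_b (of_int m + t)"
    proof cases
      case 1
      have E: "e 0 = - 3 / 2" "e 1 = 3 / 2" "e 2 = 0" using True e0 ev[of 1] ev[of 2] n by auto
      show ?thesis unfolding 1 quad_def phi_b_def using t by (simp add: E power2_eq_square field_simps)
    next
      case 2
      have E: "e 1 = 3 / 2" "e 2 = 0" "e 3 = 0" using True ev[of 1] ev[of 2] ev[of 3] n by auto
      show ?thesis unfolding 2 quad_def phi_b_def using t
        by (cases "t = 0") (simp_all add: E power2_eq_square field_simps)
    next
      case 3
      then have "e m = 0" "e (m + 1) = 0" using True ev[of m] ev[of "m + 1"] m by auto
      moreover have "e (m + 2) = 0"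
      proof (cases "m + 2 = n + 1")
        case r: True
        show ?thesis unfolding r using True en n by simp
      next
        case False
        then show ?thesis using True ev[of "m + 2"] m 3 by simp
      qed
      moreover have "phi_b (of_int m + t) = 0" 
      proof -
        have "of_int m + t \<ge> 2" using 3 t by simp
        then consider "of_int m + t = 2" | "of_int m + t > 2" by linarith
        then show ?thesis by cases (auto simp: phi_b_def power2_eq_square)
      qed
      ultimately show ?thesis by (simp add: quad_def)
    qed
    then show ?thesis using spline1 True unfolding e_def[symmetric] by (simp add: unit_phi_def y)
  next
    case False
    show ?thesis
    proof (cases "k = n")
      case True
      consider "m = n - 1" | "m = n - 2" | "m \<le> n - 3" using m by linarith
      then have "quad (e m) (e (m + 1)) (e (m + 2)) t = phi_b (of_int n - of_int m - t)"
      proof cases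
        case 1
        have i: "m + 1 = n" "m + 2 = n + 1" using 1 by simp_all
        have "e m = 0" using 1 True ev[of m] n by simp
        then have E: "e m = 0" "e (m + 1) = 3 / 2" "e (m + 2) = - 3 / 2"
          unfolding i using True False en ev[of n] n by simp_all
        have D: "of_int n - of_int m - t = 1 - t" using 1 by simp
        show ?thesis unfolding D quad_def phi_b_def E using t by (simp add: power2_eq_square field_simps)
      next
        case 2
        have i: "m + 1 = n - 1" "m + 2 = n" using 2 by simp_all
        have "e m = 0" using 2 True ev[of m] n by simp
        then have E: "e m = 0" "e (m + 1) = 0" "e (m + 2) = 3 / 2"
          unfolding i using True False ev[of n] ev[of "n - 1"] n by simp_all
        have D: "of_int n - of_int m - t = 2 - t" using 2 by simp
        show ?thesis unfolding D quad_def phi_b_def E using t by (simp add: power2_eq_square field_simps)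
      next
        case 3
        then have "e m = 0" using True False ev[of m] e0 m by (cases "m = 0") auto
        moreover have "e (m + 1) = 0" "e (m + 2) = 0" using True False ev[of "m + 1"] ev[of "m + 2"] m 3 by auto
        moreover have "phi_b (of_int n - of_int m - t) = 0"
        proof -
          have "real_of_int m \<le> of_int n - 3" using 3 by linarith
          then have "of_int n - of_int m - t > 2" using t by linarith
          then show ?thesis by (simp add: phi_b_def)
        qed
        ultimately show ?thesis by (simp add: quad_def)
      qed
      then show ?thesis using spline1 True False unfolding e_def[symmetric] by (simp add: unit_phi_def y')
    next
      case kn: False
      have ev': "e i = (if i = k then 1 else 0)" if i: "0 \<le> i" "i \<le> n + 1" for i
      proof -
        consider "i = 0" | "i = n + 1" | "i \<in> {1..n}" using i by force
        then show ?thesis using False kn e0 en ev[of i] k by cases auto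
      qed
      have e3: "e m = (if m = k then 1 else 0)" "e (m + 1) = (if m + 1 = k then 1 else 0)" "e (m + 2) = (if m + 2 = k then 1 else 0)"
        using m by (auto simp: ev')
      consider "k = m" | "k = m + 1" | "k = m + 2" | "k < m \<or> k > m + 2" by linarith
      then have "quad (e m) (e (m + 1)) (e (m + 2)) t = phi (of_int m + t - of_int k + 2)"
      proof cases
        case 1 then show ?thesis using e3 phi_values(3)[OF t(1,2)] by (simp add: quad_def)
      next
        case 2 then show ?thesis using e3 phi_values(2)[OF t(1,2)] by (simp add: quad_def algebra_simps)
      next
        case 3 then show ?thesis using e3 phi_values(1)[OF t(1,2)] by (simp add: quad_def)
      next
        case 4
        then have "real_of_int k \<le> of_int m - 1 \<or> of_int k \<ge> real_of_int m + 3" by linarith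
        then have "phi (of_int m + t - of_int k + 2) = 0" using t by (intro pz) linarith
        then show ?thesis using e3 4 by (auto simp: quad_def)
      qed
      then show ?thesis using spline1 False kn unfolding e_def[symmetric] by (simp add: unit_phi_def y)
    qed
  qed
qed

lemma spline1_bdry:
  assumes n: "n \<ge> 4" and x: "0 < x" "x < 1"
  shows "spline1 n (bdry n d) x = (\<Sum>k\<in>{1..n}. d k * unit_phi n k x)"
proof -
  let ?e = "\<lambda>k. bdry n (\<lambda>m. if m = k then 1 else 0)"
  have n0: "n > 0" using n by simp
  have "bdry n d m = (\<Sum>k\<in>{1..n}. d k * ?e k m)" for m
  proof (rule oddper_eqI[OF oddper_bdry oddper_sum n0])
    show "oddper n (\<lambda>m. d k * ?e k m)" for k by (intro oddper_cmult oddper_bdry n0)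
    fix m assume m: "m \<in> {1..n}"
    have "(\<Sum>k\<in>{1..n}. d k * ?e k m) = (\<Sum>k\<in>{1..n}. if k = m then (if m = 1 \<or> m = n then 3 / 2 else 1) * d m else 0)"
      unfolding bdry_def oddext_eq[OF m] by (intro sum.cong refl) auto
    then show "bdry n d m = (\<Sum>k\<in>{1..n}. d k * ?e k m)" using m by (simp add: bdry_def oddext_eq[OF m])
  qed (use n0 in auto)
  then have "bdry n d = (\<lambda>m. \<Sum>k\<in>{1..n}. d k * ?e k m)" by auto
  then have "spline1 n (bdry n d) x = (\<Sum>k\<in>{1..n}. d k * spline1 n (?e k) x)" by (simp only: spline1_sum spline1_cmult)
  also have "\<dots> = (\<Sum>k\<in>{1..n}. d k * unit_phi n k x)" using spline1_unit[OF n _ x] by (intro sum.cong refl) simp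
  finally show ?thesis .
qed

lemma spline1_detail:
  assumes n: "n \<ge> 4" and x: "0 < x" "x < 1"
  shows "spline1 (2 * n) (detail n d) x = (\<Sum>k\<in>{1..n}. d k * unit_psi n k x)"
proof -
  have "spline1 (2 * n) (detail n d) x = (\<Sum>m\<in>{1..2 * n}. (if even m then d (m div 2) else - d ((m + 1) div 2)) * unit_phi (2 * n) m x)"
    unfolding detail_def using n by (intro spline1_bdry x) simp
  also have "\<dots> = (\<Sum>k\<in>{1..n}. d k * unit_psi n k x)"
    using n by (subst sum_pairs) (auto simp: unit_psi_def algebra_simps intro!: sum.cong)
  finally show ?thesis .
qed

text \<open>The two-scale relation of quadratic B-splines (Chaikin's corner cutting), verified on
  the two halves of each coarse cell.\<close>

lemma spline1_refine:
  assumes N: "N > 0" and x: "0 < x" "x < 1"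
  shows "spline1 (2 * N) (refine c) x = spline1 N c x"
proof -
  define m where "m = \<lfloor>of_int N * x\<rfloor>"
  define t where "t = of_int N * x - of_int m"
  have m: "0 \<le> m" "m < N" using floor_range[OF x N] by (auto simp: m_def)
  have t: "0 \<le> t" "t < 1" unfolding t_def m_def by linarith+
  have y: "of_int (2 * N) * x = of_int (2 * m) + 2 * t" by (simp add: t_def algebra_simps)
  have i: "2 * m + 2 = 2 * (m + 1)" "2 * m + 3 = 2 * (m + 1) + 1" by simp_all
  have rN: "spline1 N c x = quad (c m) (c (m + 1)) (c (m + 2)) t"
    unfolding t_def by (rule spline1_cell[OF m m_def])
  show ?thesis
  proof (cases "t < 1 / 2")
    case True
    have f: "2 * m = \<lfloor>of_int (2 * N) * x\<rfloor>" unfolding y using t True by linarith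
    have "spline1 (2 * N) (refine c) x = quad (refine c (2 * m)) (refine c (2 * m + 1)) (refine c (2 * m + 2)) (2 * t)"
      using spline1_cell[OF _ _ f, of "refine c"] m unfolding y by simp
    also have "\<dots> = quad (c m) (c (m + 1)) (c (m + 2)) t"
      unfolding i refine_even refine_odd' quad_def by (simp add: power2_eq_square field_simps)
    finally show ?thesis using rN by simp
  next
    case False
    have f: "2 * m + 1 = \<lfloor>of_int (2 * N) * x\<rfloor>" unfolding y using t False by linarith
    have "spline1 (2 * N) (refine c) x = quad (refine c (2 * m + 1)) (refine c (2 * m + 2)) (refine c (2 * m + 3)) (2 * t - 1)"
      using spline1_cell[OF _ _ f, of "refine c"] m unfolding y by (simp add: algebra_simps)
    also have "\<dots> = quad (c m) (c (m + 1)) (c (m + 2)) t"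
      unfolding i refine_even refine_odd' quad_def by (simp add: power2_eq_square field_simps)
    finally show ?thesis using rN by simp
  qed
qed

text \<open>Evaluation in one variable is linear in the coefficients and so commutes with the linear
  operations on the other index. This and the next two lemmas reduce two-dimensional identities to
  one-dimensional ones.\<close>

lemma spline1_bdry_commute: "spline1 M (\<lambda>l. bdry n (\<lambda>i. Y i l) k) y = bdry n (\<lambda>i. spline1 M (Y i) y) k"
  by (simp add: bdry_def oddext_def Let_def spline1_cmult spline1_minus)

lemma spline1_detail_commute: "spline1 M (\<lambda>l. detail n (\<lambda>i. Y i l) k) y = detail n (\<lambda>i. spline1 M (Y i) y) k"
proof -
  have "(\<lambda>m. spline1 M (\<lambda>l. if even m then Y (m div 2) l else - Y ((m + 1) div 2) l) y) =
      (\<lambda>m. if even m then spline1 M (Y (m div 2)) y else - spline1 M (Y ((m + 1) div 2)) y)"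
    by (auto simp: fun_eq_iff spline1_minus)
  then show ?thesis unfolding detail_def spline1_bdry_commute by simp
qed

lemma spline1_refine_commute: "spline1 M (\<lambda>l. refine (\<lambda>i. Y i l) k) y = refine (\<lambda>i. spline1 M (Y i) y) k"
proof -
  have "refine f k = 3 / 4 * f (if even k then k div 2 else (k + 1) div 2) + 1 / 4 * f (if even k then k div 2 + 1 else (k - 1) div 2)" for f :: "int \<Rightarrow> real"
    by (simp add: refine_def field_simps)
  then show ?thesis by (simp only: spline1_add spline1_cmult)
qed

lemma spline2_synth:
  assumes n: "n \<ge> 4" and z: "z \<in> unit_square"
  shows "spline2 (2 * n) (synth n X a b c) z = spline2 n X z
    + (\<Sum>k\<in>{1..n}. \<Sum>l\<in>{1..n}. a k l * (unit_phi n k (fst z) * unit_psi n l (snd z)))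
    + (\<Sum>k\<in>{1..n}. \<Sum>l\<in>{1..n}. b k l * (unit_psi n k (fst z) * unit_phi n l (snd z)))
    + (\<Sum>k\<in>{1..n}. \<Sum>l\<in>{1..n}. c k l * (unit_psi n k (fst z) * unit_psi n l (snd z)))"
proof -
  let ?x = "fst z" and ?y = "snd z"
  have x: "0 < ?x" "?x < 1" and y: "0 < ?y" "?y < 1" using z by (auto simp: unit_square_def)
  have n0: "n > 0" using n by simp
  define U where "U k l = op2 refine X k l + op2 (detail n) (op1 (bdry n) a) k l" for k l
  define V where "V k l = op2 refine (op2 (bdry n) b) k l + op2 (detail n) c k l" for k l
  have S: "synth n X a b c k = (\<lambda>l. refine (\<lambda>i. U i l) k + detail n (\<lambda>i. V i l) k)" for k
    by (simp add: synth_def U_def V_def op1_def fun_eq_iff)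
  have U: "spline1 (2 * n) (U i) ?y = spline1 n (X i) ?y + bdry n (\<lambda>i. \<Sum>l\<in>{1..n}. a i l * unit_psi n l ?y) i" for i
  proof -
    have "spline1 (2 * n) (U i) ?y = spline1 (2 * n) (refine (X i)) ?y + spline1 (2 * n) (detail n (op1 (bdry n) a i)) ?y"
      unfolding U_def[abs_def] op2_def by (rule spline1_add)
    also have "spline1 (2 * n) (refine (X i)) ?y = spline1 n (X i) ?y" by (rule spline1_refine[OF n0 y])
    also have "spline1 (2 * n) (detail n (op1 (bdry n) a i)) ?y = (\<Sum>l\<in>{1..n}. op1 (bdry n) a i l * unit_psi n l ?y)"
      by (rule spline1_detail[OF n y])
    also have "\<dots> = bdry n (\<lambda>i. \<Sum>l\<in>{1..n}. a i l * unit_psi n l ?y) i"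
      by (simp add: op1_def bdry_def oddext_def Let_def sum_distrib_left mult.assoc sum_negf)
    finally show ?thesis .
  qed
  have V: "spline1 (2 * n) (V i) ?y = (\<Sum>l\<in>{1..n}. b i l * unit_phi n l ?y) + (\<Sum>l\<in>{1..n}. c i l * unit_psi n l ?y)" for i
  proof -
    have "spline1 (2 * n) (V i) ?y = spline1 (2 * n) (refine (bdry n (b i))) ?y + spline1 (2 * n) (detail n (c i)) ?y"
      unfolding V_def[abs_def] op2_def by (rule spline1_add)
    then show ?thesis by (simp only: spline1_refine[OF n0 y] spline1_bdry[OF n y] spline1_detail[OF n y])
  qed
  have "spline2 (2 * n) (synth n X a b c) z = spline1 (2 * n) (\<lambda>k. refine (\<lambda>i. spline1 (2 * n) (U i) ?y) k + detail n (\<lambda>i. spline1 (2 * n) (V i) ?y) k) ?x"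
    unfolding spline2_spline1 S spline1_add spline1_refine_commute spline1_detail_commute ..
  also have "\<dots> = spline1 n (\<lambda>i. spline1 (2 * n) (U i) ?y) ?x + (\<Sum>k\<in>{1..n}. spline1 (2 * n) (V k) ?y * unit_psi n k ?x)"
    unfolding spline1_add by (simp only: spline1_refine[OF n0 x] spline1_detail[OF n x])
  also have "spline1 n (\<lambda>i. spline1 (2 * n) (U i) ?y) ?x = spline2 n X z + (\<Sum>k\<in>{1..n}. (\<Sum>l\<in>{1..n}. a k l * unit_psi n l ?y) * unit_phi n k ?x)"
    unfolding U spline1_add spline2_spline1 by (simp only: spline1_bdry[OF n x])
  finally show ?thesis unfolding V distrib_right sum.distrib sum_distrib_right
    by (simp add: algebra_simps)
qed

lemma spline2_bdry:
  assumes n: "n \<ge> 4" and z: "z \<in> unit_square"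
  shows "spline2 n (op1 (bdry n) (op2 (bdry n) a)) z = (\<Sum>k\<in>{1..n}. \<Sum>l\<in>{1..n}. a k l * (unit_phi n k (fst z) * unit_phi n l (snd z)))"
proof -
  let ?x = "fst z" and ?y = "snd z"
  have x: "0 < ?x" "?x < 1" and y: "0 < ?y" "?y < 1" using z by (auto simp: unit_square_def)
  have "spline2 n (op1 (bdry n) (op2 (bdry n) a)) z = spline1 n (bdry n (\<lambda>i. spline1 n (bdry n (a i)) ?y)) ?x"
    unfolding spline2_spline1 op1_def[abs_def] op2_def spline1_bdry_commute ..
  also have "\<dots> = (\<Sum>k\<in>{1..n}. (\<Sum>l\<in>{1..n}. a k l * unit_phi n l ?y) * unit_phi n k ?x)"
    by (simp only: spline1_bdry[OF n x] spline1_bdry[OF n y])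
  finally show ?thesis unfolding sum_distrib_right by (simp add: algebra_simps)
qed

lemma two_power_ge4: "2 \<le> j \<Longrightarrow> (4::int) \<le> 2 ^ j"
  using power_increasing[of 2 j "2::int"] by simp

lemma phi1_unit_phi: "phi1 j k x = 2 powr (real j / 2) * unit_phi (2 ^ j) k x"
  by (simp add: phi1_def unit_phi_def)

lemma psi1_unit_psi:
  assumes j: "2 \<le> j" shows "psi1 j k x = 2 powr (real j / 2) / 2 * unit_psi (2 ^ j) k x"
proof -
  have p: "(4::int) \<le> 2 ^ j" using j by (rule two_power_ge4)
  have e: "(2 * (2::int) ^ j = 2 * k) \<longleftrightarrow> k = 2 ^ j" "2 * k \<noteq> 1" "2 * k - 1 \<noteq> 2 * 2 ^ j" "2 * k - 1 = 1 \<longleftrightarrow> k = 1"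
    "2 * k = 2 * (2::int) ^ j \<longleftrightarrow> k = 2 ^ j" by presburger+
  \<comment> \<open>The last wavelet contains a reflected scaling function; symmetry of
    \<open>phi\<close> about 3/2 makes it a translate.\<close>
  have s: "phi (2 * (2 ^ j * (1 - x))) = phi (2 * 2 ^ j * x - (2 * 2 ^ j - 1) + 2)"
    using phi_sym[of "2 * (2 ^ j * (1 - x))"] by (simp add: algebra_simps)
  consider "k = 1" | "k = 2 ^ j" "k \<noteq> 1" | "k \<noteq> 1" "k \<noteq> 2 ^ j" by blast
  then show ?thesis
  proof cases
    case 1
    have "(2::int) ^ j \<noteq> 1" "2 \<noteq> 2 * (2::int) ^ j" "1 \<noteq> (2::int) ^ j" using p by linarith+
    then show ?thesis unfolding psi1_def unit_psi_def unit_phi_def 1 by (simp add: psi_b_def algebra_simps)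
  next
    case 2
    then show ?thesis using p s unfolding psi1_def unit_psi_def unit_phi_def e by (simp add: psi_b_def field_simps)
  next
    case 3
    then show ?thesis using p unfolding psi1_def unit_psi_def unit_phi_def e by (simp add: psi_def algebra_simps)
  qed
qed

definition unit_type :: "nat \<Rightarrow> int \<Rightarrow> int \<Rightarrow> real \<Rightarrow> real" where
  "unit_type e n = (if e = 1 then unit_psi n else unit_phi n)"

definition level_weight :: "nat \<Rightarrow> nat \<times> nat \<Rightarrow> real" where
  "level_weight j e = 2 ^ j * ((if fst e = 1 then 1 / 2 else 1) * (if snd e = 1 then 1 / 2 else 1))"

lemma psi2_unit_type:
  assumes j: "2 \<le> j"
  shows "psi2 j e k z = level_weight j e * (unit_type (fst e) (2 ^ j) (fst k) (fst z) * unit_type (snd e) (2 ^ j) (snd k) (snd z))"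
proof -
  have t: "psi1_type j i m x = 2 powr (real j / 2) * (if i = 1 then 1 / 2 else 1) * unit_type i (2 ^ j) m x" for i m x
    by (simp add: psi1_type_def phi1_unit_phi psi1_unit_psi[OF j] unit_type_def)
  have p: "2 powr (real j / 2) * 2 powr (real j / 2) = (2::real) ^ j"
    by (simp add: powr_add[symmetric] powr_realpow)
  show ?thesis unfolding psi2_def t level_weight_def p[symmetric] by (simp add: algebra_simps)
qed

lemma level_weight_pos: "level_weight j e > 0"
  by (simp add: level_weight_def)

section \<open>Decomposition of splines into wavelets\<close>

text \<open>Gaussian elimination: the bound on \<open>q\<close> keeps the pivots \<open>6 - q\<close> away from zero.\<close>

lemma tridiagonal_sweep:
  fixes y :: "int \<Rightarrow> real"
  shows "\<exists>p q. 0 \<le> q \<and> q \<le> 1 / 3 \<and> (\<forall>v. \<exists>c. 13 / 3 * c 1 + c 2 = y 1 \<and>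
    (\<forall>k. 2 \<le> k \<and> k \<le> int m + 1 \<longrightarrow> c (k - 1) + 6 * c k + c (k + 1) = y k) \<and> c (int m + 1) = p - q * v \<and> c (int m + 2) = v)"
proof (induction m)
  case 0
  have c: "\<exists>c. 13 / 3 * c 1 + c 2 = y 1 \<and> (\<forall>k. 2 \<le> k \<and> k \<le> int 0 + 1 \<longrightarrow> c (k - 1) + 6 * c k + c (k + 1) = y k) \<and>
      c (int 0 + 1) = 3 / 13 * y 1 - 3 / 13 * v \<and> c (int 0 + 2) = v" for v
    by (rule exI[of _ "\<lambda>k. if k = 1 then 3 / 13 * y 1 - 3 / 13 * v else v"]) (simp add: field_simps)
  show ?case
    apply (rule exI[of _ "3 / 13 * y 1"], rule exI[of _ "3 / 13"], intro conjI allI)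
    apply simp
    apply simp
    apply (rule c)
    done
next
  case (Suc m)
  then obtain p q where q: "0 \<le> q" "q \<le> 1 / 3" and c: "\<forall>v. \<exists>c. 13 / 3 * c 1 + c 2 = y 1 \<and>
    (\<forall>k. 2 \<le> k \<and> k \<le> int m + 1 \<longrightarrow> c (k - 1) + 6 * c k + c (k + 1) = y k) \<and> c (int m + 1) = p - q * v \<and> c (int m + 2) = v"
    by (elim exE conjE) (rule that)
  let ?p = "(y (int m + 2) - p) / (6 - q)" and ?q = "1 / (6 - q)"
  have "0 \<le> ?q \<and> ?q \<le> 1 / 3" using q by (simp add: field_simps)
  moreover have "\<exists>c. 13 / 3 * c 1 + c 2 = y 1 \<and>
    (\<forall>k. 2 \<le> k \<and> k \<le> int (Suc m) + 1 \<longrightarrow> c (k - 1) + 6 * c k + c (k + 1) = y k) \<and>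
    c (int (Suc m) + 1) = ?p - ?q * v \<and> c (int (Suc m) + 2) = v" for v
  proof -
    define w where "w = ?p - ?q * v"
    obtain c where c: "13 / 3 * c 1 + c 2 = y 1"
      "\<And>k. 2 \<le> k \<and> k \<le> int m + 1 \<Longrightarrow> c (k - 1) + 6 * c k + c (k + 1) = y k" "c (int m + 1) = p - q * w" "c (int m + 2) = w"
      using c[rule_format, of w] by metis
    have "w = (y (int m + 2) - p - v) / (6 - q)" by (simp add: w_def diff_divide_distrib)
    then have "w * (6 - q) = y (int m + 2) - p - v" using q by simp
    then have w: "(p - q * w) + 6 * w + v = y (int m + 2)" by (simp add: algebra_simps)
    have "(c(int m + 3 := v)) (k - 1) + 6 * (c(int m + 3 := v)) k + (c(int m + 3 := v)) (k + 1) = y k"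
      if k: "2 \<le> k \<and> k \<le> int (Suc m) + 1" for k
    proof (cases "k = int m + 2")
      case True
      then show ?thesis using w c(3,4) by (simp add: add.commute)
    next
      case False
      then show ?thesis using k c(2)[of k] by simp
    qed
    then show ?thesis using c(1,4)
      by (intro exI[of _ "c(int m + 3 := v)"] conjI allI impI) (simp_all add: w_def add.commute)
  qed
  ultimately show ?case by (intro exI[of _ ?p] exI[of _ ?q]) (intro conjI allI; simp)
qed

lemma tri_solvable:
  assumes n: "n \<ge> 2"
  shows "\<exists>c. oddper n c \<and> (\<forall>k\<in>{1..n}. tri n c k = y k)"
proof -
  define m where "m = nat (n - 2)"
  have m: "int m = n - 2" using n by (simp add: m_def)
  obtain p q where q: "0 \<le> q" "q \<le> 1 / 3" and c: "\<forall>v. \<exists>c. 13 / 3 * c 1 + c 2 = y 1 \<and>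
    (\<forall>k. 2 \<le> k \<and> k \<le> int m + 1 \<longrightarrow> c (k - 1) + 6 * c k + c (k + 1) = y k) \<and> c (int m + 1) = p - q * v \<and> c (int m + 2) = v"
    using tridiagonal_sweep[of y m] by (elim exE conjE) (rule that)
  \<comment> \<open>The value left free by the elimination is fixed by the last row, whose pivot
    \<open>13 / 3 - q\<close> is at least 4.\<close>
  define v where "v = (y n - p) / (13 / 3 - q)"
  obtain c where c: "13 / 3 * c 1 + c 2 = y 1"
      "\<And>k. 2 \<le> k \<and> k \<le> int m + 1 \<Longrightarrow> c (k - 1) + 6 * c k + c (k + 1) = y k" "c (int m + 1) = p - q * v" "c (int m + 2) = v"
    using c[rule_format, of v] by metis
  have "v * (13 / 3 - q) = y n - p" using q by (simp add: v_def)
  then have v: "(p - q * v) + 13 / 3 * v = y n" by (simp add: algebra_simps)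
  define e where "e = oddext n c"
  have eo: "oddper n e" using n by (simp add: e_def oddper_oddext)
  have e: "e k = c k" if "k \<in> {1..n}" for k using oddext_eq[OF that] by (simp add: e_def)
  have e0: "e 0 = - c 1" "e (n + 1) = - c n" using oddperD(3,4)[OF eo] e[of 1] e[of n] n by auto
  have "tri n e k = y k" if k: "k \<in> {1..n}" for k
  proof -
    consider "k = 1" | "k = n" "k \<noteq> 1" | "2 \<le> k" "k \<le> n - 1" using k by force
    then show ?thesis
    proof cases
      case 1
      then show ?thesis using c(1) e0 e[of 1] e[of 2] n by (simp add: tri_def)
    next
      case 2
      have "c (n - 1) = p - q * v" "c n = v" using c(3,4) m by (simp_all add: algebra_simps)
      then show ?thesis using 2 v e0 e[of n] e[of "n - 1"] n by (simp add: tri_def)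
    next
      case 3
      then show ?thesis using c(2)[of k] m e[of k] e[of "k - 1"] e[of "k + 1"] by (simp add: tri_def)
    qed
  qed
  then show ?thesis using eo by blast
qed

text \<open>The coarse part is dictated by biorthogonality: \<open>tri n c = dual_avg n x\<close>.
  The remainder is annihilated by \<open>dual_avg\<close>, and that one relation between the entries
  at \<open>2 * k - 1\<close> and \<open>2 * k\<close> makes it a \<open>detail\<close>.\<close>

lemma refine_detail_decomposition:
  assumes n: "n \<ge> 2" and x: "oddper (2 * n) x"
  shows "\<exists>c d. oddper n c \<and> x = (\<lambda>m. refine c m + detail n d m)"
proof -
  obtain c where c: "oddper n c" "\<And>k. k \<in> {1..n} \<Longrightarrow> tri n c k = dual_avg n x k"
    using tri_solvable[OF n, of "dual_avg n x"] by metis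
  define w where "w m = x m - refine c m" for m
  have wo: "oddper (2 * n) w" unfolding w_def[abs_def] by (intro oddper_diff x oddper_refine c(1))
  define d where "d k = w (2 * k) / (if k = n then 3 / 2 else 1)" for k
  have n0: "2 * n > 0" using n by simp
  have z: "detail n (\<lambda>_. 0) m = 0" for m by (simp add: detail_def bdry_def oddext_def Let_def)
  have "w m = detail n d m" for m
  proof (rule oddper_eqI[OF wo oddper_detail n0])
    show "n > 0" using n by simp
    fix m assume m: "m \<in> {1..2 * n}"
    obtain k where k: "k \<in> {1..n}" "m = 2 * k - 1 \<or> m = 2 * k"
    proof (rule that[of "(m + 1) div 2"])
      show "(m + 1) div 2 \<in> {1..n}" using m by auto
      show "m = 2 * ((m + 1) div 2) - 1 \<or> m = 2 * ((m + 1) div 2)" by presburger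
    qed
    have "dual_avg n (\<lambda>m. refine c m + detail n (\<lambda>_. 0) m) k = dual_avg n x k"
      using dual_avg_refine_detail[OF n c(1) k(1)] c(2)[OF k(1)] by simp
    then have "(if k = 1 then 2 / 3 else 1) * w (2 * k - 1) + (if k = n then 2 / 3 else 1) * w (2 * k) = 0"
      unfolding z dual_avg_def w_def by (cases "k = 1"; cases "k = n") (simp_all add: field_simps)
    then have "w (2 * k - 1) = - ((if k = 1 then 3 / 2 else 1) * d k)"
      unfolding d_def by (cases "k = 1"; cases "k = n") (simp_all add: field_simps)
    moreover have "w (2 * k) = (if k = n then 3 / 2 else 1) * d k" by (simp add: d_def)
    ultimately show "w m = detail n d m" using k detail_values[OF k(1), of d] by auto
  qed
  then have "x = (\<lambda>m. refine c m + detail n d m)" by (simp add: w_def fun_eq_iff algebra_simps)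
  then show ?thesis using c(1) by metis
qed

lemma bdry_surj:
  assumes n: "n > 0" and c: "oddper n c" shows "\<exists>b. bdry n b = c"
proof -
  define b where "b m = c m / (if m = 1 \<or> m = n then 3 / 2 else 1)" for m
  have "bdry n b m = c m" for m
    by (rule oddper_eqI[OF oddper_bdry[OF n] c n]) (simp add: bdry_def oddext_eq b_def)
  then show ?thesis by (intro exI[of _ b]) auto
qed

lemma oddext_ext:
  assumes "oddper n (\<lambda>k. Z k l)" "\<And>r. oddper n (\<lambda>k. Z k r)" shows "oddper n (\<lambda>k. oddext m (Z k) l)"
  using assms(2) by (auto simp: oddper_def oddext_def Let_def)

lemma oddper2_cols_eqI:
  assumes "oddper2 m n X" "oddper2 m n Y" "n > 0" "\<And>k l. l \<in> {1..n} \<Longrightarrow> X k l = Y k l"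
  shows "X = Y"
proof (intro ext)
  fix k l show "X k l = Y k l"
    by (rule oddper_eqI[OF oddper2D(2)[OF assms(1)] oddper2D(2)[OF assms(2)] assms(3)]) (rule assms(4))
qed

text \<open>The one-dimensional decomposition is applied to every column, and then to every row of
  the two resulting arrays.\<close>

lemma synth_surj:
  assumes n: "n \<ge> 2" and Y: "oddper2 (2 * n) (2 * n) Y"
  shows "\<exists>X a b c. oddper2 n n X \<and> Y = synth n X a b c"
proof -
  have n0: "n > 0" "2 * n > 0" using n by auto
  have "\<exists>c d. oddper n c \<and> (\<lambda>k. Y k l) = (\<lambda>m. refine c m + detail n d m)" for l
    by (rule refine_detail_decomposition[OF n oddper2D(1)[OF Y]])
  then obtain U0 V0 where UV0: "\<And>l. oddper n (U0 l)" "\<And>l. (\<lambda>k. Y k l) = (\<lambda>m. refine (U0 l) m + detail n (V0 l) m)"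
    by metis
  \<comment> \<open>\<open>U0\<close> and \<open>V0\<close> were chosen column by column, with no
    relation between the columns. Keeping the columns \<open>1..2 * n\<close> and extending them
    oddly restores the symmetry in the second index; \<open>X\<close> below repairs
    \<open>X0\<close> in the same way.\<close>
  define U where "U k = oddext (2 * n) (\<lambda>l. U0 l k)" for k
  define V where "V k = oddext (2 * n) (\<lambda>l. V0 l k)" for k
  have Uo: "oddper2 n (2 * n) U" unfolding oddper2_def
  proof (intro conjI allI)
    show "oddper n (\<lambda>k. U k l)" for l unfolding U_def by (rule oddext_ext) (rule UV0(1))+
    show "oddper (2 * n) (U k)" for k unfolding U_def by (rule oddper_oddext[OF n0(2)])
  qed
  have Vo: "oddper (2 * n) (V k)" for k unfolding V_def using n0 by (intro oddper_oddext)
  have YUV: "Y = (\<lambda>k l. op1 refine U k l + op1 (detail n) V k l)"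
  proof (rule oddper2_cols_eqI[OF Y _ n0(2)])
    have "oddper2 (2 * n) (2 * n) (op1 (detail n) V)"
      unfolding oddper2_def op1_def[abs_def] using oddper_detail[OF n0(1)] detail_ext[OF n0(1), of "2 * n" V, OF Vo] by blast
    then show "oddper2 (2 * n) (2 * n) (\<lambda>k l. op1 refine U k l + op1 (detail n) V k l)"
      by (intro oddper2_add oddper2_op1_refine Uo)
    fix k l assume l: "l \<in> {1..2 * n}"
    have "(\<lambda>i. U i l) = U0 l" "(\<lambda>i. V i l) = V0 l" using oddext_eq[OF l] by (auto simp: U_def V_def)
    then show "Y k l = op1 refine U k l + op1 (detail n) V k l" using fun_cong[OF UV0(2)[of l], of k] by (simp add: op1_def)
  qed
  have "\<exists>c d. oddper n c \<and> V k = (\<lambda>m. refine c m + detail n d m)" for k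
    by (rule refine_detail_decomposition[OF n Vo])
  then obtain B c where B: "\<And>k. oddper n (B k)" "\<And>k. V k = (\<lambda>m. refine (B k) m + detail n (c k) m)" by metis
  obtain b where b: "\<And>k. bdry n (b k) = B k" using bdry_surj[OF n0(1) B(1)] by metis
  have "\<exists>c d. oddper n c \<and> U k = (\<lambda>m. refine c m + detail n d m)" for k
    by (rule refine_detail_decomposition[OF n oddper2D(2)[OF Uo]])
  then obtain X0 A0 where XA: "\<And>k. oddper n (X0 k)" "\<And>k. U k = (\<lambda>m. refine (X0 k) m + detail n (A0 k) m)" by metis
  define X where "X k l = oddext n (\<lambda>k. X0 k l) k" for k l
  define a where "a k l = A0 k l / (if k = 1 \<or> k = n then 3 / 2 else 1)" for k l
  have Xo: "oddper2 n n X" unfolding oddper2_def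
  proof (intro conjI allI)
    show "oddper n (X k)" for k unfolding X_def using oddext_ext[of n "\<lambda>l k. X0 k l" k n] XA(1) by auto
    show "oddper n (\<lambda>k. X k l)" for l unfolding X_def using n0 by (intro oddper_oddext)
  qed
  have U: "U = (\<lambda>k l. op2 refine X k l + op2 (detail n) (op1 (bdry n) a) k l)"
  proof (intro ext, rule oddper_eqI[OF oddper2D(1)[OF Uo] _ n0(1)])
    fix l
    have "oddper n (\<lambda>k. detail n (op1 (bdry n) a k) l)" 
      by (rule detail_ext2[OF n0(1)]) (simp add: op1_def oddper_bdry[OF n0(1)])
    moreover have "oddper n (\<lambda>k. op2 refine X k l)" by (rule oddper2D(1)[OF oddper2_op2_refine[OF Xo]])
    ultimately show "oddper n (\<lambda>k. op2 refine X k l + op2 (detail n) (op1 (bdry n) a) k l)"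
      unfolding op2_def by (intro oddper_add)
    fix k assume k: "k \<in> {1..n}"
    have "X k = X0 k" unfolding X_def using oddext_eq[OF k] by auto
    moreover have "op1 (bdry n) a k = A0 k" unfolding op1_def bdry_def oddext_eq[OF k] by (auto simp: a_def)
    ultimately show "U k l = op2 refine X k l + op2 (detail n) (op1 (bdry n) a) k l"
      using fun_cong[OF XA(2)[of k], of l] by (simp add: op2_def)
  qed
  have V: "V = (\<lambda>k l. op2 refine (op2 (bdry n) b) k l + op2 (detail n) c k l)"
  proof (intro ext)
    fix k l
    have "op2 (bdry n) b = B" by (intro ext) (simp add: op2_def b)
    then show "V k l = op2 refine (op2 (bdry n) b) k l + op2 (detail n) c k l"
      using fun_cong[OF B(2)[of k], of l] by (simp add: op2_def)
  qed
  have "Y = synth n X a b c" unfolding synth_def U[symmetric] V[symmetric] by (rule YUV)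
  then show ?thesis using Xo by blast
qed

lemma chain_exists:
  assumes "2 \<le> J" "oddper2 (2 ^ J) (2 ^ J) Y"
  shows "\<exists>X a b c. chain J X a b c \<and> X J = Y"
  using assms
proof (induction J arbitrary: Y rule: nat_induct_at_least)
  case base
  then show ?case by (intro exI[of _ "\<lambda>_. Y"]) (auto simp: chain_def)
next
  case (Suc J)
  have "oddper2 (2 * 2 ^ J) (2 * 2 ^ J) Y" using Suc.prems by simp
  moreover have "(2::int) \<le> 2 ^ J" using two_power_ge4[OF Suc.hyps] by linarith
  ultimately obtain Z a0 b0 c0 where Z: "oddper2 (2 ^ J) (2 ^ J) Z" "Y = synth (2 ^ J) Z a0 b0 c0"
    using synth_surj by blast
  obtain X a b c where X: "chain J X a b c" "X J = Z" using Suc.IH[OF Z(1)] by (elim exE conjE) 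
  have "chain (Suc J) (X(Suc J := Y)) (a(J := a0)) (b(J := b0)) (c(J := c0))"
    using X Z(2) Suc.hyps unfolding chain_def by (auto simp: less_Suc_eq)
  then show ?case by (metis fun_upd_same)
qed

lemma oddper2_bdry_surj:
  assumes n: "n > 0" and X: "oddper2 n n X"
  shows "\<exists>a. X = op1 (bdry n) (op2 (bdry n) a)"
proof -
  obtain b where b: "\<And>l. bdry n (b l) = (\<lambda>k. X k l)" using bdry_surj[OF n oddper2D(1)[OF X]] by metis
  obtain a where a: "\<And>k. bdry n (a k) = X k" using bdry_surj[OF n oddper2D(2)[OF X]] by metis
  define w where "w k = (if k = 1 \<or> k = n then 3 / 2 else 1 :: real)" for k
  have "X k l = op1 (bdry n) (op2 (bdry n) (\<lambda>k l. a k l / w k)) k l" for k l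
  proof (rule oddper_eqI[OF oddper2D(1)[OF X, of l] _ n])
    show "oddper n (\<lambda>k. op1 (bdry n) (op2 (bdry n) (\<lambda>k l. a k l / w k)) k l)"
      unfolding op1_def using n by (rule oddper_bdry)
    fix k assume k: "k \<in> {1..n}"
    have "bdry n (\<lambda>l. a i l / w i) l = bdry n (a i) l / w i" for i
      by (simp add: bdry_def oddext_def Let_def)
    then show "X k l = op1 (bdry n) (op2 (bdry n) (\<lambda>k l. a k l / w k)) k l"
      unfolding op1_def op2_def a by (simp add: bdry_def oddext_eq[OF k] w_def)
  qed
  then show ?thesis by (intro exI[of _ "\<lambda>k l. a k l / w k"]) auto
qed

section \<open>Membership in the Sobolev space and density\<close>

lemma smooth_profile:
  obtains s X where "profile s X" "smooth X"
proof -
  obtain s :: "real \<Rightarrow> real" where s: "smooth s" "\<And>x. x \<le> 0 \<Longrightarrow> s x = 0" "\<And>x. x \<ge> 1 \<Longrightarrow> s x = 1" "\<And>x. 0 \<le> s x \<and> s x \<le> 1"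
    using smooth_step_exists by blast
  obtain S where S: "\<And>x. (S has_real_derivative s x) (at x)"
    using antiderivative_exists[OF smooth_continuous[OF s(1)]] by blast
  define X where "X x = S x - S (x - 1)" for x
  \<comment> \<open>The mean value theorem makes each value of \<open>X\<close> a value of
    \<open>s\<close>, which yields its range and its constant ends.\<close>
  have X: "\<exists>z. x - 1 < z \<and> z < x \<and> X x = s z" for x
    using MVT2[of "x - 1" x S s] S by (auto simp: X_def)
  have sh: "((\<lambda>x. S (x - 1)) has_real_derivative s (x - 1)) (at x)" for x
  proof -
    have "((\<lambda>x. x - 1) has_real_derivative 1) (at x)" by (auto intro!: derivative_eq_intros)
    from DERIV_chain2[where f = S, OF S this] show ?thesis by simp
  qed
  have sm: "smooth S" by (rule smooth_antideriv[OF S s(1)])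
  have "smooth X" using smooth_diff[OF sm smooth_affine[OF sm, of 1 "- 1"]] by (simp add: X_def[abs_def])
  moreover have "profile s X"
  proof
    show "continuous_on UNIV s" by (rule smooth_continuous[OF s(1)])
    show "(X has_real_derivative s x - s (x - 1)) (at x)" for x
      unfolding X_def[abs_def] by (intro DERIV_diff S sh)
    show "X x = 0" if "x \<le> 0" for x using X[of x] s(2) that by force
    show "X x = 1" if "x \<ge> 2" for x using X[of x] s(3) that by force
    show "0 \<le> X x" "X x \<le> 1" for x using X[of x] s(4) by auto
  qed (use s in auto)
  ultimately show thesis using that by blast
qed

lemma (in profile) qi_test_function:
  assumes X: "smooth X"
  shows "(\<lambda>z. qi f N (fst z) (snd z)) \<in> test_functions unit_square"
proof (cases "range_ix N = {}")
  case True
  then show ?thesis using zero_test_function by (simp add: qi_def)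
next
  case False
  then have N: "N > 0" by (auto simp: range_ix_def)
  have K: "smooth K" using smooth_diff[OF X smooth_affine[OF X, of 1 "- 1"]] by (simp add: K_def[abs_def])
  have Ks: "smooth (\<lambda>x. K (real N * x - of_int i))" for i
    using smooth_affine[OF K, of "real N" "- of_int i"] by simp
  have Kz: "K (real N * x - of_int i) = 0" if i: "i \<in> range_ix N" and x: "x \<notin> {3 / real N..(real N - 3) / real N}" for x i
  proof -
    have ii: "3 \<le> real_of_int i" "real_of_int i \<le> real N - 6" using i by (auto simp: range_ix_def)
    have "x < 3 / real N \<or> x > (real N - 3) / real N" using x by auto
    then have "real N * x < 3 \<or> real N * x > real N - 3" using N by (auto simp: field_simps)
    then show ?thesis using ii by (intro K_zero) linarith
  qed
  show ?thesis unfolding qi_def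
  proof (intro test_functions_sum range_ix_fin test_functions_cmult)
    fix i l assume il: "i \<in> range_ix N" "l \<in> range_ix N"
    show "(\<lambda>z. K (real N * fst z - of_int i) * K (real N * snd z - of_int l)) \<in> test_functions unit_square"
      by (rule test_functions_tensor[of _ _ "3 / real N" "(real N - 3) / real N"]) (use N Ks Kz il in auto)
  qed
qed

lemma lipschitz_of_derivative:
  fixes h :: "real \<Rightarrow> real"
  assumes "\<And>x. (h has_real_derivative h' x) (at x)" "\<And>x. x \<in> {0..1} \<Longrightarrow> \<bar>h' x\<bar> \<le> L" "u \<in> {0..1}" "v \<in> {0..1}"
  shows "\<bar>h u - h v\<bar> \<le> L * \<bar>u - v\<bar>"
proof -
  have *: "\<bar>h u - h v\<bar> \<le> L * \<bar>u - v\<bar>" if uv: "u < v" "u \<in> {0..1}" "v \<in> {0..1}" for u v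
  proof -
    obtain z where z: "u < z" "z < v" "h v - h u = (v - u) * h' z" using MVT2[of u v h h'] uv assms(1) by blast
    have "\<bar>h v - h u\<bar> = \<bar>v - u\<bar> * \<bar>h' z\<bar>" by (simp add: z(3) abs_mult)
    also have "\<dots> \<le> \<bar>v - u\<bar> * L" using z uv by (intro mult_left_mono assms(2)) auto
    finally show ?thesis by (simp add: abs_minus_commute mult.commute)
  qed
  consider "u < v" | "u = v" | "v < u" by linarith
  then show ?thesis using *[of u v] *[of v u] assms(3,4) by cases (auto simp: abs_minus_commute)
qed

lemma lipschitz_zero_extension:
  fixes h :: "real \<Rightarrow> real"
  assumes d: "\<And>x. (h has_real_derivative h' x) (at x)" "\<And>x. x \<in> {0..1} \<Longrightarrow> \<bar>h' x\<bar> \<le> L"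
    and z: "h 0 = 0" "h 1 = 0"
  shows "\<bar>(if 0 < u \<and> u < 1 then h u else 0) - (if 0 < v \<and> v < 1 then h v else 0)\<bar> \<le> L * \<bar>u - v\<bar>"
proof -
  \<comment> \<open>As \<open>h\<close> vanishes at both ends, its zero extension is
    \<open>h\<close> after clamping to the unit interval, and clamping does not increase
    distances.\<close>
  define cl where "cl u = max 0 (min 1 u)" for u :: real
  have e: "(if 0 < u \<and> u < 1 then h u else 0) = h (cl u)" for u
    using z by (auto simp: cl_def max_def min_def)
  have L: "L \<ge> 0" using d(2)[of 0] by auto
  have "\<bar>h (cl u) - h (cl v)\<bar> \<le> L * \<bar>cl u - cl v\<bar>"
    by (rule lipschitz_of_derivative[OF d]) (auto simp: cl_def)
  also have "\<dots> \<le> L * \<bar>u - v\<bar>" using L by (intro mult_left_mono) (auto simp: cl_def)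
  finally show ?thesis unfolding e .
qed

lemma admissible_zero_extension:
  assumes D: "\<And>z. GDERIV h z :> D z" "continuous_on UNIV D"
    and z: "\<And>y. h (0, y) = 0" "\<And>y. h (1, y) = 0" "\<And>x. h (x, 0) = 0" "\<And>x. h (x, 1) = 0"
  shows "\<exists>L. admissible (\<lambda>z. if z \<in> unit_square then h z else 0) D L"
proof -
  have "compact ({0..1::real} \<times> {0..1::real})" by (intro compact_Times compact_Icc)
  then have "bounded (D ` ({0..1} \<times> {0..1}))"
    by (intro compact_imp_bounded compact_continuous_image continuous_on_subset[OF D(2)]) auto
  then obtain L where L: "L > 0" "\<And>x y. x \<in> {0..1} \<Longrightarrow> y \<in> {0..1} \<Longrightarrow> norm (D (x, y)) \<le> L"
    unfolding bounded_pos by auto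
  have L1: "\<bar>fst (D (x, y))\<bar> \<le> L" "\<bar>snd (D (x, y))\<bar> \<le> L" if "x \<in> {0..1}" "y \<in> {0..1}" for x y
    using L(2)[OF that] norm_fst_le[of "fst (D (x, y))" "snd (D (x, y))"] norm_snd_le[of "snd (D (x, y))" "fst (D (x, y))"] by auto
  have "\<bar>(if (x, y) \<in> unit_square then h (x, y) else 0) - (if (x', y) \<in> unit_square then h (x', y) else 0)\<bar> \<le> L * \<bar>x - x'\<bar>" for x x' y
  proof (cases "0 < y \<and> y < 1")
    case True
    have "\<bar>(if 0 < x \<and> x < 1 then h (x, y) else 0) - (if 0 < x' \<and> x' < 1 then h (x', y) else 0)\<bar> \<le> L * \<bar>x - x'\<bar>"
      by (rule lipschitz_zero_extension[OF GDERIV_partials(1)[OF D(1)]]) (use True L1 z in auto)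
    then show ?thesis using True by (simp add: unit_square_def)
  next
    case False
    then show ?thesis using L by (auto simp: unit_square_def)
  qed
  moreover have "\<bar>(if (x, y) \<in> unit_square then h (x, y) else 0) - (if (x, y') \<in> unit_square then h (x, y') else 0)\<bar> \<le> L * \<bar>y - y'\<bar>" for x y y'
  proof (cases "0 < x \<and> x < 1")
    case True
    have "\<bar>(if 0 < y \<and> y < 1 then h (x, y) else 0) - (if 0 < y' \<and> y' < 1 then h (x, y') else 0)\<bar> \<le> L * \<bar>y - y'\<bar>"
      by (rule lipschitz_zero_extension[OF GDERIV_partials(2)[OF D(1)]]) (use True L1 z in auto)
    then show ?thesis using True by (simp add: unit_square_def)
  next
    case False
    then show ?thesis using L by (auto simp: unit_square_def)
  qed
  moreover have "GDERIV (\<lambda>z. if z \<in> unit_square then h z else 0) z :> D z" if "z \<in> unit_square" for z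
  proof -
    have "open unit_square" by (simp add: unit_square_def open_Times)
    then show ?thesis using D(1)[of z] that unfolding gderiv_def
      by (elim has_derivative_transform_within_open) auto
  qed
  ultimately show ?thesis using L(1) continuous_on_subset[OF D(2)] unfolding admissible_def
    by (intro exI[of _ L]) auto
qed

text \<open>At a grid point just two translates are active, each with value 1/2. Hence odd
  reflection of the coefficients is the same as a zero boundary value.\<close>

lemma spline1_node:
  assumes m: "0 \<le> m" "m \<le> N" "N > 0" and x: "of_int N * x = of_int m"
  shows "spline1 N c x = (c m + c (m + 1)) / 2"
proof -
  have p: "phi 1 = 1 / 2" "phi 2 = 1 / 2" by (simp_all add: phi_def)
  have "spline1 N c x = (\<Sum>k\<in>{m, m + 1}. c k * phi (of_int N * x - of_int k + 2))"
    unfolding spline1_def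
  proof (intro sum.mono_neutral_right ballI)
    fix k assume "k \<in> {0..N + 1} - {m, m + 1}"
    then have "k \<le> m - 1 \<or> k \<ge> m + 2" by auto
    then have "real_of_int k \<le> of_int m - 1 \<or> real_of_int k \<ge> of_int m + 2" by linarith
    then have "phi (of_int N * x - of_int k + 2) = 0" unfolding x by (intro phi_zero) linarith
    then show "c k * phi (of_int N * x - of_int k + 2) = 0" by simp
  qed (use m in auto)
  then show ?thesis by (simp add: x p)
qed

lemma spline2_boundary:
  assumes "N > 0" "oddper2 N N X"
  shows "spline2 N X (0, y) = 0" "spline2 N X (1, y) = 0" "spline2 N X (y, 0) = 0" "spline2 N X (y, 1) = 0"
proof -
  have *: "spline2 N X (0, y) = 0" "spline2 N X (1, y) = 0" if X: "oddper2 N N X" for X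
  proof -
    note o = oddper_spline1[OF X, of y]
    show "spline2 N X (0, y) = 0" "spline2 N X (1, y) = 0"
      using spline1_node[of 0 N 0 "\<lambda>k. spline1 N (X k) y"] spline1_node[of N N 1 "\<lambda>k. spline1 N (X k) y"] assms(1) oddperD(3,4)[OF o]
      unfolding spline2_spline1 by auto
  qed
  have "oddper2 N N (\<lambda>k l. X l k)" using assms(2) by (auto simp: oddper2_def)
  from *[OF this] *[OF assms(2)]
  show "spline2 N X (0, y) = 0" "spline2 N X (1, y) = 0" "spline2 N X (y, 0) = 0" "spline2 N X (y, 1) = 0"
    using spline2_transpose[of N X] by auto
qed

lemma spline2_H10:
  assumes N: "N > 0" and X: "oddper2 N N X" shows "spline2 N X \<in> H10"
proof -
  \<comment> \<open>Only values inside the square matter, so the spline may be replaced by its zero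
    extension, which is \<open>admissible\<close> because the spline vanishes on the
    boundary.\<close>
  define f where "f z = (if z \<in> unit_square then spline2 N X z else 0)" for z
  define D where "D z = (spline2_dx N X z, spline2_dx N (\<lambda>k l. X l k) (snd z, fst z))" for z
  have Dc: "continuous_on UNIV D" unfolding D_def by (intro continuous_intros spline2_dx_cont spline2_dx_swap_cont)
  obtain L where a: "admissible f D L"
    unfolding f_def using admissible_zero_extension[of "spline2 N X" D, OF _ Dc] spline2_GDERIV spline2_boundary[OF N X]
    by (auto simp: D_def)
  have e: "f z = spline2 N X z" if "z \<in> unit_square" for z using that by (simp add: f_def)
  have "hwg (spline2 N X) D" unfolding D_def[abs_def] by (rule spline2_hwg)
  moreover have "hwg f D \<longleftrightarrow> hwg (spline2 N X) D" by (rule hwg_cong) (rule e)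
  ultimately have h: "hwg f D" by simp
  have s: "sqint Q f" using sqint_cong[of Q f "spline2 N X"] e spline2_sqint by auto
  obtain p P where "profile p P" and P: "smooth P" by (rule smooth_profile)
  then interpret profile p P by simp
  note lim = qi_converges[OF a h s]
  have "f \<in> H10"
  proof (rule H10_closure)
    show "f \<in> H1Q" unfolding H1Q_iff using h s by blast
    fix e :: real assume "e > 0"
    then obtain n where "norm (N1 (\<lambda>z. f z - qi f n (fst z) (snd z)) - 0) < e" using LIMSEQ_D[OF lim] by blast
    then show "\<exists>v\<in>H10. N1 (\<lambda>z. f z - v z) < e"
      by (intro bexI[where x = "\<lambda>z. qi f n (fst z) (snd z)"] test_function_H10 qi_test_function[OF P]) auto
  qed
  then show ?thesis using H10_cong[of f "spline2 N X", OF e] by simp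
qed

text \<open>With the ramp profile the quasi-interpolant is itself a spline, node \<open>i\<close>
  becoming coefficient \<open>i + 2\<close>. The coefficients at 0, 1, \<open>N\<close> and
  \<open>N + 1\<close> vanish, so the odd extension agrees with the given values on all of
  \<open>0..N + 1\<close>.\<close>

lemma ramp_qi_spline2:
  "\<exists>Y. oddper2 (int (Suc n)) (int (Suc n)) Y \<and> (\<forall>z. ramp.qi f (Suc n) (fst z) (snd z) = spline2 (int (Suc n)) Y z)"
proof -
  define N where "N = int (Suc n)"
  have N: "N > 0" by (simp add: N_def)
  define A where "A k l = (if k - 2 \<in> ramp.range_ix (Suc n) then if l - 2 \<in> ramp.range_ix (Suc n)
     then f (of_int (k - 2) / real (Suc n), of_int (l - 2) / real (Suc n)) else 0 else 0)" for k l
  define Y where "Y = op1 (oddext N) (op2 (oddext N) A)"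
  have oo: "oddper N (oddext N g)" for g by (rule oddper_oddext[OF N])
  have Yo: "oddper2 N N Y" unfolding oddper2_def
  proof (intro conjI allI)
    show "oddper N (\<lambda>k. Y k l)" for l unfolding Y_def op1_def by (rule oo)
    show "oddper N (Y k)" for k unfolding Y_def op1_def[abs_def] op2_def
      using oo oddext_ext[of N "\<lambda>l k. oddext N (A k) l" k N] by auto
  qed
  have ev: "oddext N g k = g k" if k: "k \<in> {0..N + 1}" and g: "g 0 = 0" "g 1 = 0" "g N = 0" "g (N + 1) = 0" for g k
  proof -
    consider "k = 0" | "k = N + 1" | "k \<in> {1..N}" using k by force
    then show ?thesis
      using oddperD(3,4)[OF oo[of g]] oddext_eq[of 1 N g] oddext_eq[of N N g] oddext_eq[of k N g] N g by cases auto
  qed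
  have r: "k - 2 \<notin> ramp.range_ix (Suc n)" if "k = 0 \<or> k = 1 \<or> k = N \<or> k = N + 1" for k
    using that by (auto simp: ramp.range_ix_def N_def)
  have Y: "Y k l = A k l" if k: "k \<in> {0..N + 1}" and l: "l \<in> {0..N + 1}" for k l
  proof -
    have 1: "oddext N (A i) l = A i l" for i by (rule ev[OF l]) (use r[of 0] r[of 1] r[of N] r[of "N + 1"] in \<open>auto simp: A_def\<close>)
    show ?thesis unfolding Y_def op1_def op2_def 1 by (rule ev[OF k]) (use r[of 0] r[of 1] r[of N] r[of "N + 1"] in \<open>auto simp: A_def\<close>)
  qed
  have sh: "(\<Sum>k\<in>{0..N + 1}. if k - 2 \<in> ramp.range_ix (Suc n) then h (k - 2) else 0) = (\<Sum>i\<in>ramp.range_ix (Suc n). h i)" for h :: "int \<Rightarrow> real"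
  proof -
    have "(\<Sum>k\<in>{0..N + 1}. if k - 2 \<in> ramp.range_ix (Suc n) then h (k - 2) else 0) = (\<Sum>k\<in>{k \<in> {0..N + 1}. k - 2 \<in> ramp.range_ix (Suc n)}. h (k - 2))"
      by (rule sum.inter_filter[symmetric]) simp
    also have "\<dots> = (\<Sum>i\<in>ramp.range_ix (Suc n). h i)"
      by (rule sum.reindex_bij_witness[of _ "\<lambda>i. i + 2" "\<lambda>k. k - 2"]) (auto simp: ramp.range_ix_def N_def)
    finally show ?thesis .
  qed
  have "spline2 N Y z = ramp.qi f (Suc n) (fst z) (snd z)" for z
  proof -
    let ?p = "\<lambda>i x. phi (real (Suc n) * x - of_int i)"
    let ?f = "\<lambda>i l. f (of_int i / real (Suc n), of_int l / real (Suc n))"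
    have p: "?p (k - 2) x = phi (of_int N * x - of_int k + 2)" for k x by (simp add: N_def algebra_simps)
    have "spline2 N Y z = (\<Sum>k\<in>{0..N + 1}. if k - 2 \<in> ramp.range_ix (Suc n) then (\<Sum>l\<in>{0..N + 1}. if l - 2 \<in> ramp.range_ix (Suc n)
        then ?f (k - 2) (l - 2) * (?p (k - 2) (fst z) * ?p (l - 2) (snd z)) else 0) else 0)"
      unfolding spline2_def p by (intro sum.cong refl) (auto simp: Y A_def intro!: sum.cong)
    also have "\<dots> = (\<Sum>i\<in>ramp.range_ix (Suc n). \<Sum>l\<in>ramp.range_ix (Suc n). ?f i l * (?p i (fst z) * ?p l (snd z)))"
      using sh[of "\<lambda>k. \<Sum>l\<in>{0..N + 1}. if l - 2 \<in> ramp.range_ix (Suc n)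
        then ?f k (l - 2) * (?p k (fst z) * ?p (l - 2) (snd z)) else 0"]
      unfolding sh[where h = "\<lambda>l. ?f _ l * (?p _ (fst z) * ?p l (snd z))"] .
    finally show ?thesis by (simp add: ramp.qi_def ramp_K)
  qed
  then show ?thesis using Yo unfolding N_def by (intro exI[of _ Y]) auto
qed

theorem spline2_dense:
  assumes u: "u \<in> H10" and e: "e > 0"
  shows "\<exists>J Y. 2 \<le> J \<and> oddper2 (2 ^ J) (2 ^ J) Y \<and> N1 (\<lambda>z. u z - spline2 (2 ^ J) Y z) < e"
proof -
  obtain f where f: "f \<in> test_functions unit_square" "N1 (\<lambda>z. u z - f z) < e / 2"
    using H10_approx[OF u, of "e / 2"] e by auto
  obtain D where D: "\<And>z. GDERIV f z :> D z" using test_function_gradient_exists[OF f(1)] by blast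
  note c = test_function_gradient[OF f(1) D]
  have z: "f z = 0" if "z \<notin> unit_square" for z
    using zero_outside_support[of z f] test_functionsD(3)[OF f(1)] that by blast
  have "(\<lambda>z. if z \<in> unit_square then f z else 0) = f" using z by auto
  then obtain L where a: "admissible f D L"
    using admissible_zero_extension[OF D c(1)] z by (auto simp: unit_square_def)
  have lim: "(\<lambda>N. N1 (\<lambda>z. f z - ramp.qi f N (fst z) (snd z))) \<longlonglongrightarrow> 0"
    by (rule ramp.qi_converges[OF a has_weak_gradient_C1[OF D c(1)] sqint_Q_continuous[OF c(2)]])
  obtain N0 where N0: "\<And>n. n \<ge> N0 \<Longrightarrow> norm (N1 (\<lambda>z. f z - ramp.qi f n (fst z) (snd z)) - 0) < e / 2"
    using LIMSEQ_D[OF lim, of "e / 2"] e by auto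
  define J where "J = N0 + 2"
  have J: "2 \<le> J" "N0 \<le> 2 ^ J" using less_exp[of J] by (auto simp: J_def)
  have p: "(2::nat) ^ J > 0" by simp
  obtain n where n: "(2::nat) ^ J = Suc n" using gr0_implies_Suc[OF p] by blast
  have N: "int (Suc n) = 2 ^ J" unfolding n[symmetric] by simp
  obtain Y where Y: "oddper2 (2 ^ J) (2 ^ J) Y" "\<And>z. ramp.qi f (Suc n) (fst z) (snd z) = spline2 (2 ^ J) Y z"
    using ramp_qi_spline2[of n f] unfolding N by blast
  have "N1 (\<lambda>z. f z - spline2 (2 ^ J) Y z) < e / 2" using N0[of "Suc n"] J(2) n unfolding Y(2) by simp
  then have "N1 (\<lambda>z. u z - spline2 (2 ^ J) Y z) < e"
    using N1_diff_triangle[OF H10_H1Q[OF u] test_function_H1Q[OF f(1)] spline2_H1Q[of "2 ^ J" Y]] f(2) by linarith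
  then show ?thesis using J(1) Y(1) by blast
qed

section \<open>The Riesz basis\<close>

text \<open>The index \<open>((j, e), k)\<close> stands for \<open>psi2 j e k\<close>; the scaling functions are those with
  \<open>j = 2\<close> and \<open>e = (0, 0)\<close>.\<close>

type_synonym wavelet_index = "(nat \<times> (nat \<times> nat)) \<times> (int \<times> int)"

definition index_set :: "wavelet_index set" where
  "index_set = Sigma (insert (2, (0, 0)) ({2..} \<times> E2)) (\<lambda>p. I_set (fst p) \<times> I_set (fst p))"

definition index_below :: "nat \<Rightarrow> wavelet_index set" where
  "index_below J = Sigma (insert (2, (0, 0)) ({2..<J} \<times> E2)) (\<lambda>p. I_set (fst p) \<times> I_set (fst p))"

definition wavelet :: "wavelet_index \<Rightarrow> real \<times> real \<Rightarrow> real" where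
  "wavelet t = psi2 (fst (fst t)) (snd (fst t)) (snd t)"

text \<open>The wavelet without the scalar \<open>weight\<close>. In two dimensions these functions
  have seminorms bounded above and below uniformly in the level, so they are normalized up to
  constants.\<close>

definition uwavelet :: "wavelet_index \<Rightarrow> real \<times> real \<Rightarrow> real" where
  "uwavelet t z = unit_type (fst (snd (fst t))) (2 ^ fst (fst t)) (fst (snd t)) (fst z) *
     unit_type (snd (snd (fst t))) (2 ^ fst (fst t)) (snd (snd t)) (snd z)"

definition weight :: "wavelet_index \<Rightarrow> real" where
  "weight t = level_weight (fst (fst t)) (snd (fst t))"

lemma index_below_subset: "index_below J \<subseteq> index_set"
  by (auto simp: index_below_def index_set_def)

lemma E2_eq: "E2 = {(0, 1), (1, 0), (1, 1)}"
  by (auto simp: E2_def)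

lemma finite_index_below [simp]: "finite (index_below J)"
  by (simp add: index_below_def E2_eq I_set_def)

lemma wavelet_uwavelet: "t \<in> index_set \<Longrightarrow> wavelet t = (\<lambda>z. weight t * uwavelet t z)"
  using psi2_unit_type[of "fst (fst t)" "snd (fst t)" "snd t"]
  by (auto simp: index_set_def wavelet_def uwavelet_def weight_def fun_eq_iff)

lemma Psi_2D_image: "Psi_2D = wavelet ` index_set"
proof -
  have p: "phi2 2 k = psi2 2 (0, 0) k" for k
    by (simp add: fun_eq_iff phi2_def psi2_def psi1_type_def)
  have "Psi_2D = {psi2 j e k |j e k. (j, e) \<in> insert (2, (0, 0)) ({2..} \<times> E2) \<and> k \<in> I_set j \<times> I_set j}"
    unfolding Psi_2D_def p by blast
  also have "\<dots> = wavelet ` index_set"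
  proof (intro equalityI subsetI)
    fix g assume "g \<in> {psi2 j e k |j e k. (j, e) \<in> insert (2, (0, 0)) ({2..} \<times> E2) \<and> k \<in> I_set j \<times> I_set j}"
    then obtain j e k where "g = psi2 j e k" "(j, e) \<in> insert (2, (0, 0)) ({2..} \<times> E2)" "k \<in> I_set j \<times> I_set j" by blast
    then show "g \<in> wavelet ` index_set"
      by (intro image_eqI[of _ _ "((j, e), k)"]) (auto simp: wavelet_def index_set_def)
  next
    fix g assume "g \<in> wavelet ` index_set"
    then obtain t where t: "t \<in> index_set" "g = wavelet t" by blast
    then show "g \<in> {psi2 j e k |j e k. (j, e) \<in> insert (2, (0, 0)) ({2..} \<times> E2) \<and> k \<in> I_set j \<times> I_set j}"
      by (intro CollectI exI[of _ "fst (fst t)"] exI[of _ "snd (fst t)"] exI[of _ "snd t"]) (auto simp: wavelet_def index_set_def)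
  qed
  finally show ?thesis .
qed

lemma index_below_exhausts:
  assumes "finite F" "F \<subseteq> index_set" shows "\<exists>J\<ge>2. F \<subseteq> index_below J"
proof -
  define J where "J = Max (insert 2 ((\<lambda>t. Suc (fst (fst t))) ` F))"
  have "Suc (fst (fst t)) \<le> J" if "t \<in> F" for t using assms(1) that by (simp add: J_def)
  moreover have "2 \<le> J" using assms(1) by (simp add: J_def)
  ultimately show ?thesis using assms(2)
    by (intro exI[of _ J]) (force simp: index_below_def index_set_def)
qed

lemma sum_index_below:
  fixes g :: "wavelet_index \<Rightarrow> real"
  shows "(\<Sum>t\<in>index_below J. g t) = (\<Sum>k\<in>{1..4}. \<Sum>l\<in>{1..4}. g ((2, (0, 0)), (k, l))) +
    (\<Sum>j=2..<J. (\<Sum>k\<in>{1..2 ^ j}. \<Sum>l\<in>{1..2 ^ j}. g ((j, (0, 1)), (k, l))) +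
       (\<Sum>k\<in>{1..2 ^ j}. \<Sum>l\<in>{1..2 ^ j}. g ((j, (1, 0)), (k, l))) + (\<Sum>k\<in>{1..2 ^ j}. \<Sum>l\<in>{1..2 ^ j}. g ((j, (1, 1)), (k, l))))"
proof -
  define h where "h p = (\<Sum>k\<in>{1..2 ^ fst p}. \<Sum>l\<in>{1..2 ^ fst p}. g (p, (k, l)))" for p
  have "(\<Sum>t\<in>index_below J. g t) = (\<Sum>p\<in>insert (2, (0, 0)) ({2..<J} \<times> E2). \<Sum>k\<in>I_set (fst p) \<times> I_set (fst p). g (p, k))"
    unfolding index_below_def by (subst sum.Sigma) (auto simp: E2_eq I_set_def)
  also have "\<dots> = (\<Sum>p\<in>insert (2, (0, 0)) ({2..<J} \<times> E2). h p)"
    unfolding h_def by (simp add: sum.cartesian_product I_set_def split_def)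
  also have "\<dots> = h (2, (0, 0)) + (\<Sum>p\<in>{2..<J} \<times> E2. h p)"
    by (rule sum.insert) (auto simp: E2_eq)
  also have "(\<Sum>p\<in>{2..<J} \<times> E2. h p) = (\<Sum>j=2..<J. \<Sum>e\<in>E2. h (j, e))"
    by (simp add: sum.cartesian_product)
  finally show ?thesis by (simp add: E2_eq h_def add.assoc)
qed

section \<open>Transfer of the discrete inequalities to finite wavelet sums\<close>

lemma spline2_chain:
  assumes X: "chain J X a b c" "X 2 = op1 (bdry 4) (op2 (bdry 4) x0)" and J: "2 \<le> J" and z: "z \<in> unit_square"
  shows "spline2 (2 ^ J) (X J) z = (\<Sum>k\<in>{1..4}. \<Sum>l\<in>{1..4}. x0 k l * uwavelet ((2, (0, 0)), (k, l)) z) +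
    (\<Sum>j=2..<J. (\<Sum>k\<in>{1..2 ^ j}. \<Sum>l\<in>{1..2 ^ j}. a j k l * uwavelet ((j, (0, 1)), (k, l)) z) +
       (\<Sum>k\<in>{1..2 ^ j}. \<Sum>l\<in>{1..2 ^ j}. b j k l * uwavelet ((j, (1, 0)), (k, l)) z) +
       (\<Sum>k\<in>{1..2 ^ j}. \<Sum>l\<in>{1..2 ^ j}. c j k l * uwavelet ((j, (1, 1)), (k, l)) z))"
  using J X(1)
proof (induction J rule: dec_induct)
  case base
  show ?case using spline2_bdry[of 4 z x0, OF _ z] X(2) by (simp add: uwavelet_def unit_type_def)
next
  case (step J)
  have "chain J X a b c" "X (Suc J) = synth (2 ^ J) (X J) (a J) (b J) (c J)"
    using step.prems step.hyps by (auto simp: chain_def)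
  then show ?case using step.IH spline2_synth[OF two_power_ge4[OF step.hyps(1)] z, of "X J" "a J" "b J" "c J"] step.hyps
    by (simp add: uwavelet_def unit_type_def)
qed

lemma chain_construct: "\<exists>X. X 2 = x \<and> (\<forall>j\<ge>2. X (Suc j) = synth (2 ^ j) (X j) (a j) (b j) (c j))"
proof -
  define W where "W = rec_nat x (\<lambda>m W. synth (2 ^ (m + 2)) W (a (m + 2)) (b (m + 2)) (c (m + 2)))"
  have "W (Suc j - 2) = synth (2 ^ j) (W (j - 2)) (a j) (b j) (c j)" if "2 \<le> j" for j
  proof -
    obtain m where "j = m + 2" using \<open>2 \<le> j\<close> by (metis le_add_diff_inverse2)
    then show ?thesis by (simp add: W_def)
  qed
  then show ?thesis by (intro exI[of _ "\<lambda>j. W (j - 2)"]) (simp add: W_def)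
qed

lemma sq2_bdry_bounds:
  assumes "n > 0"
  shows "sq2 n n x \<le> sq2 n n (op1 (bdry n) (op2 (bdry n) x))" "sq2 n n (op1 (bdry n) (op2 (bdry n) x)) \<le> 6 * sq2 n n x"
proof -
  have 1: "sq2 n n y \<le> sq2 n n (op1 (bdry n) y)" "sq2 n n (op1 (bdry n) y) \<le> 9 / 4 * sq2 n n y" for y
    unfolding sq2_swap[of n n] sum_distrib_left op1_def by (intro sum_mono sq_bdry_ge sq_bdry_le)+
  have 2: "sq2 n n y \<le> sq2 n n (op2 (bdry n) y)" "sq2 n n (op2 (bdry n) y) \<le> 9 / 4 * sq2 n n y" for y
    unfolding sq2_def sum_distrib_left op2_def by (intro sum_mono sq_bdry_ge sq_bdry_le)+
  show "sq2 n n x \<le> sq2 n n (op1 (bdry n) (op2 (bdry n) x))" "sq2 n n (op1 (bdry n) (op2 (bdry n) x)) \<le> 6 * sq2 n n x"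
    using 1[of "op2 (bdry n) x"] 2[of x] sq2_nonneg[of n n x] by argo+
qed

text \<open>The chain is built upward from the given coefficients. On the coarsest level they are
  multiplied by the boundary factors in both variables, which costs (9/4)^2, rounded up to
  6.\<close>

lemma wavelet_sum_spline:
  assumes J: "2 \<le> J"
  shows "\<exists>X. oddper2 (2 ^ J) (2 ^ J) X \<and> (\<forall>z\<in>unit_square. spline2 (2 ^ J) X z = (\<Sum>t\<in>index_below J. g t * uwavelet t z)) \<and>
    (\<Sum>t\<in>index_below J. (g t)\<^sup>2) \<le> 10 ^ 9 * energy (2 * 2 ^ J) X \<and>
    energy (2 * 2 ^ J) X \<le> 6 * 10 ^ 6 * (\<Sum>t\<in>index_below J. (g t)\<^sup>2)"
proof -
  define x where "x k l = g ((2, (0, 0)), (k, l))" for k l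
  define a where "a j k l = g ((j, (0, 1)), (k, l))" for j k l
  define b where "b j k l = g ((j, (1, 0)), (k, l))" for j k l
  define c where "c j k l = g ((j, (1, 1)), (k, l))" for j k l
  obtain X where X2: "X 2 = op1 (bdry 4) (op2 (bdry 4) x)" and Xs: "\<forall>j\<ge>2. X (Suc j) = synth (2 ^ j) (X j) (a j) (b j) (c j)"
    using chain_construct[of "op1 (bdry 4) (op2 (bdry 4) x)" a b c] by (elim exE conjE) (rule that)
  have "oddper2 4 4 (X 2)" unfolding oddper2_def X2
  proof (intro conjI allI)
    show "oddper 4 (\<lambda>k. op1 (bdry 4) (op2 (bdry 4) x) k l)" for l unfolding op1_def by (simp add: oddper_bdry)
    show "oddper 4 (op1 (bdry 4) (op2 (bdry 4) x) k)" for k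
      unfolding op1_def[abs_def] by (rule bdry_ext) (simp_all add: op2_def[abs_def] oddper_bdry)
  qed
  then have ch: "chain J X a b c" using Xs by (simp add: chain_def)
  have s: "(\<Sum>t\<in>index_below J. (g t)\<^sup>2) = sq2 4 4 x + (\<Sum>j=2..<J. coef_norm (2 ^ j) (a j) (b j) (c j))"
    unfolding sum_index_below coef_norm_def sq2_def sq_def x_def a_def b_def c_def by (simp only: add.commute add.left_commute)
  have cn: "0 \<le> (\<Sum>j=2..<J. coef_norm (2 ^ j) (a j) (b j) (c j))" by (intro sum_nonneg) (simp add: coef_norm_def)
  have t: "(\<Sum>t\<in>index_below J. (g t)\<^sup>2) \<le> total_norm J X a b c" "total_norm J X a b c \<le> 6 * (\<Sum>t\<in>index_below J. (g t)\<^sup>2)"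
    unfolding s total_norm_def X2 using sq2_bdry_bounds[of 4 x] cn by auto
  have "(\<Sum>t\<in>index_below J. (g t)\<^sup>2) \<le> 10 ^ 9 * energy (2 * 2 ^ J) (X J)"
    using t(1) discrete_lower[OF ch J] by (rule order_trans)
  moreover have "energy (2 * 2 ^ J) (X J) \<le> 6 * 10 ^ 6 * (\<Sum>t\<in>index_below J. (g t)\<^sup>2)"
    using discrete_upper[OF ch J] mult_left_mono[OF t(2), of "10 ^ 6"] by simp
  moreover have "\<forall>z\<in>unit_square. spline2 (2 ^ J) (X J) z = (\<Sum>t\<in>index_below J. g t * uwavelet t z)"
    unfolding sum_index_below using spline2_chain[OF ch X2 J] by (simp add: x_def a_def b_def c_def)
  ultimately show ?thesis using chain_oddper2[OF ch J order_refl] by (intro exI[of _ "X J"] conjI)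
qed

lemma spline_wavelet_sum:
  assumes J: "2 \<le> J" and Y: "oddper2 (2 ^ J) (2 ^ J) Y"
  shows "\<exists>g. \<forall>z\<in>unit_square. spline2 (2 ^ J) Y z = (\<Sum>t\<in>index_below J. g t * uwavelet t z)"
proof -
  obtain X a b c where X: "chain J X a b c" "X J = Y" using chain_exists[OF J Y] by (elim exE conjE) (rule that)
  obtain x where x: "X 2 = op1 (bdry 4) (op2 (bdry 4) x)"
    using oddper2_bdry_surj[of 4 "X 2"] X(1) by (auto simp: chain_def)
  define g :: "wavelet_index \<Rightarrow> real" where "g = (\<lambda>((j, e), (k, l)). if e = (0, 0) then x k l else if e = (0, 1) then a j k l
     else if e = (1, 0) then b j k l else c j k l)"
  have "spline2 (2 ^ J) Y z = (\<Sum>t\<in>index_below J. g t * uwavelet t z)" if "z \<in> unit_square" for z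
    unfolding sum_index_below using spline2_chain[OF X(1) x J that] by (simp add: g_def X(2))
  then show ?thesis by (intro exI[of _ g]) simp
qed

text \<open>The lower bound is stated for the seminorm: for a single wavelet it is what makes the
  normalization by \<open>S1\<close> possible and controls it.\<close>

lemma uwavelet_sum_bounds:
  fixes g :: "wavelet_index \<Rightarrow> real"
  assumes F: "finite F" "F \<subseteq> index_set"
  defines "u \<equiv> \<lambda>z. \<Sum>t\<in>F. g t * uwavelet t z"
  shows "u \<in> H10" "(\<Sum>t\<in>F. (g t)\<^sup>2) \<le> 300 * 10 ^ 9 * (S1 u)\<^sup>2" "(N1 u)\<^sup>2 \<le> 60 * 10 ^ 6 * (\<Sum>t\<in>F. (g t)\<^sup>2)"
proof -
  obtain J where J: "J \<ge> 2" "F \<subseteq> index_below J" using index_below_exhausts[OF F] by (elim exE conjE) (rule that)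
  define h where "h t = (if t \<in> F then g t else 0)" for t
  obtain X where X: "oddper2 (2 ^ J) (2 ^ J) X" "\<forall>z\<in>unit_square. spline2 (2 ^ J) X z = (\<Sum>t\<in>index_below J. h t * uwavelet t z)"
    "(\<Sum>t\<in>index_below J. (h t)\<^sup>2) \<le> 10 ^ 9 * energy (2 * 2 ^ J) X"
    "energy (2 * 2 ^ J) X \<le> 6 * 10 ^ 6 * (\<Sum>t\<in>index_below J. (h t)\<^sup>2)"
    using wavelet_sum_spline[OF J(1), of h] by (elim exE conjE) (rule that)
  have s: "(\<Sum>t\<in>index_below J. (h t)\<^sup>2) = (\<Sum>t\<in>F. (g t)\<^sup>2)"
    using J(2) by (intro sum.mono_neutral_cong_right) (auto simp: h_def)
  have "(\<Sum>t\<in>index_below J. h t * uwavelet t z) = u z" for z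
    unfolding u_def using J(2) by (intro sum.mono_neutral_cong_right) (auto simp: h_def)
  then have e: "u z = spline2 (2 ^ J) X z" if "z \<in> unit_square" for z using X(2) that by simp
  have p: "(2::int) ^ J > 0" by simp
  show "u \<in> H10" using spline2_H10[OF p X(1)] H10_cong[of u "spline2 (2 ^ J) X", OF e] by simp
  show "(\<Sum>t\<in>F. (g t)\<^sup>2) \<le> 300 * 10 ^ 9 * (S1 u)\<^sup>2"
  proof -
    have "S1 u = S1 (spline2 (2 ^ J) X)" by (rule S1_cong) (rule e)
    then show ?thesis using S1_spline2(1)[OF p X(1)] X(3) unfolding s by simp
  qed
  show "(N1 u)\<^sup>2 \<le> 60 * 10 ^ 6 * (\<Sum>t\<in>F. (g t)\<^sup>2)"
  proof -
    have "N1 u = N1 (spline2 (2 ^ J) X)" by (rule N1_cong) (rule e)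
    then show ?thesis using N1_spline2[OF p X(1)] X(4) unfolding s by simp
  qed
qed

text \<open>Two-sided bounds for finite sums suffice. The upper bound makes partial sums over the
  exhausting sets \<open>F n\<close> Cauchy; as it holds for every finite set containing
  \<open>F n\<close>, the limit of that sequence is also the limit along the net. Both bounds then
  pass to the limit.\<close>

lemma riesz_basisI:
  fixes J :: "(real \<times> real \<Rightarrow> real) set"
  assumes J: "countable J" "J \<subseteq> H10"
    and dense: "\<And>h e. h \<in> H10 \<Longrightarrow> e > 0 \<Longrightarrow> \<exists>F a. finite F \<and> F \<subseteq> J \<and> N1 (\<lambda>z. h z - (\<Sum>f\<in>F. a f * f z)) < e"
    and AB: "A > 0" "B > 0"
    and lower: "\<And>F b. finite F \<Longrightarrow> F \<subseteq> J \<Longrightarrow> A * (\<Sum>f\<in>F. (b f)\<^sup>2) \<le> (N1 (\<lambda>z. \<Sum>f\<in>F. b f * f z))\<^sup>2"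
    and upper: "\<And>F b. finite F \<Longrightarrow> F \<subseteq> J \<Longrightarrow> (N1 (\<lambda>z. \<Sum>f\<in>F. b f * f z))\<^sup>2 \<le> B * (\<Sum>f\<in>F. (b f)\<^sup>2)"
  shows "riesz_basis H10 N1 J (\<lambda>f. f)"
proof -
  have main: "\<exists>s\<in>H10. ((\<lambda>F. N1 (\<lambda>x. s x - (\<Sum>l\<in>F. b l * l x))) \<longlongrightarrow> 0) (finite_subsets_at_top J) \<and>
        sqrt A * sqrt (\<Sum>\<^sub>\<infinity>l\<in>J. (b l)\<^sup>2) \<le> N1 s \<and> N1 s \<le> sqrt B * sqrt (\<Sum>\<^sub>\<infinity>l\<in>J. (b l)\<^sup>2)"
    if b: "(\<lambda>l. (b l)\<^sup>2) summable_on J" for b :: "(real \<times> real \<Rightarrow> real) \<Rightarrow> real"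
  proof -
    define T where "T = (\<Sum>\<^sub>\<infinity>l\<in>J. (b l)\<^sup>2)"
    define U where "U F = (\<lambda>z. \<Sum>f\<in>F. b f * f z)" for F
    define S where "S F = (\<Sum>f\<in>F. (b f)\<^sup>2)" for F
    have UH: "U F \<in> H10" if "finite F" "F \<subseteq> J" for F
      unfolding U_def using that J(2) by (intro H10_sum H10_cmult) auto
    have lim: "(S \<longlongrightarrow> T) (finite_subsets_at_top J)"
      using has_sum_infsum[OF b] unfolding has_sum_def T_def S_def .
    have ST: "S F \<le> T" if "finite F" "F \<subseteq> J" for F
      unfolding S_def T_def using b that by (intro finite_sum_le_infsum) auto
    have "\<exists>F. finite F \<and> F \<subseteq> J \<and> T - 1 / real (Suc n) < S F" for n
    proof -
      have "eventually (\<lambda>F. T - 1 / real (Suc n) < S F) (finite_subsets_at_top J)"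
        by (rule order_tendstoD(1)[OF lim]) simp
      then show ?thesis unfolding eventually_finite_subsets_at_top by (metis order_refl)
    qed
    then obtain F0 where F0: "\<And>n. finite (F0 n)" "\<And>n. F0 n \<subseteq> J" "\<And>n. T - 1 / real (Suc n) < S (F0 n)" by metis
    \<comment> \<open>Unions make the sets increasing, and all but \<open>1 / real (Suc n)\<close>
      of the total square sum is still captured.\<close>
    define F where "F n = (\<Union>i\<le>n. F0 i)" for n
    have F: "finite (F n)" "F n \<subseteq> J" for n using F0 by (auto simp: F_def)
    have Fmono: "F n \<subseteq> F m" if "n \<le> m" for n m using that unfolding F_def by force
    have SF: "T - 1 / real (Suc n) < S (F n)" for n
    proof -
      have "S (F0 n) \<le> S (F n)" unfolding S_def using F(1) by (intro sum_mono2) (auto simp: F_def)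
      then show ?thesis using F0(3)[of n] by linarith
    qed
    define r where "r n = sqrt (B / real (Suc n))" for n
    have diff: "N1 (\<lambda>z. U G z - U (F n) z) \<le> r n" if G: "finite G" "G \<subseteq> J" "F n \<subseteq> G" for G n
    proof -
      have "(\<lambda>z. U G z - U (F n) z) = (\<lambda>z. \<Sum>f\<in>G - F n. b f * f z)"
        unfolding U_def sum.subset_diff[OF G(3,1)] by simp
      then have "(N1 (\<lambda>z. U G z - U (F n) z))\<^sup>2 \<le> B * (\<Sum>f\<in>G - F n. (b f)\<^sup>2)" using upper[of "G - F n" b] G by auto
      also have "(\<Sum>f\<in>G - F n. (b f)\<^sup>2) = S G - S (F n)"
        unfolding S_def using sum.subset_diff[OF G(3,1), of "\<lambda>f. (b f)\<^sup>2"] by simp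
      also have "B * (S G - S (F n)) \<le> B * (1 / real (Suc n))"
        using ST[OF G(1,2)] SF[of n] AB by (intro mult_left_mono) auto
      finally show ?thesis unfolding r_def by (intro real_le_rsqrt) simp
    qed
    have r0: "r \<longlonglongrightarrow> 0"
    proof -
      have "(\<lambda>n. B * (1 / real (Suc n))) \<longlonglongrightarrow> B * 0"
        by (intro tendsto_mult tendsto_const) (use LIMSEQ_inverse_real_of_nat in \<open>simp add: inverse_eq_divide\<close>)
      from tendsto_real_sqrt[OF this] show ?thesis by (simp add: r_def[abs_def])
    qed
    have "\<exists>s\<in>H10. (\<lambda>n. N1 (\<lambda>z. s z - U (F n) z)) \<longlonglongrightarrow> 0"
    proof (rule H10_complete)
      show "U (F n) \<in> H10" for n by (rule UH[OF F])
      fix e :: real assume "e > 0"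
      then obtain M where M: "r n < e" if "n \<ge> M" for n
        using order_tendstoD(2)[OF r0] unfolding eventually_sequentially by blast
      have 1: "N1 (\<lambda>z. U (F m) z - U (F n) z) < e" if "n \<ge> M" "n \<le> m" for m n
        using diff[OF F Fmono[OF that(2)]] M[OF that(1)] by linarith
      have "N1 (\<lambda>z. U (F m) z - U (F n) z) < e" if mn: "m \<ge> M" "n \<ge> M" for m n
      proof (cases "n \<le> m")
        case True then show ?thesis using 1 mn by blast
      next
        case False
        then show ?thesis using 1[of m n] mn N1_minus_commute[OF H10_H1Q[OF UH[OF F]] H10_H1Q[OF UH[OF F]], of m n] by simp
      qed
      then show "\<exists>M. \<forall>m\<ge>M. \<forall>n\<ge>M. N1 (\<lambda>z. U (F m) z - U (F n) z) < e" by blast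
    qed
    then obtain s where s: "s \<in> H10" "(\<lambda>n. N1 (\<lambda>z. s z - U (F n) z)) \<longlonglongrightarrow> 0" ..
    note H = H10_H1Q[OF s(1)] H10_H1Q[OF UH]
    have net: "((\<lambda>F. N1 (\<lambda>x. s x - U F x)) \<longlongrightarrow> 0) (finite_subsets_at_top J)"
    proof (rule tendstoI)
      fix e :: real assume e: "e > 0"
      have "(\<lambda>n. N1 (\<lambda>z. s z - U (F n) z) + r n) \<longlonglongrightarrow> 0" using tendsto_add[OF s(2) r0] by simp
      from order_tendstoD(2)[OF this e] obtain n where n: "N1 (\<lambda>z. s z - U (F n) z) + r n < e"
        by (auto simp: eventually_sequentially)
      have "dist (N1 (\<lambda>x. s x - U G x)) 0 < e" if G: "finite G" "F n \<subseteq> G" "G \<subseteq> J" for G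
      proof -
        have "N1 (\<lambda>z. U (F n) z - U G z) \<le> r n"
          using diff[OF G(1,3,2)] N1_minus_commute[OF H(2)[OF F] H(2)[OF G(1,3)]] by simp
        then show ?thesis using n N1_diff_triangle[OF H(1) H(2)[OF F] H(2)[OF G(1,3)], of n] by (simp add: dist_real_def)
      qed
      then show "\<forall>\<^sub>F G in finite_subsets_at_top J. dist (N1 (\<lambda>x. s x - U G x)) 0 < e"
        unfolding eventually_finite_subsets_at_top using F by (intro exI[of _ "F n"]) auto
    qed
    have Ns: "(\<lambda>n. N1 (U (F n))) \<longlonglongrightarrow> N1 s"
    proof (rule LIM_zero_cancel, rule Lim_null_comparison[OF _ s(2)], intro always_eventually allI)
      fix n
      have "N1 s \<le> N1 (\<lambda>z. s z - U (F n) z) + N1 (U (F n))"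
        using N1_triangle[OF H1Q_diff[OF H(1) H(2)[OF F]] H(2)[OF F], of n n] by simp
      moreover have "N1 (U (F n)) \<le> N1 (\<lambda>z. U (F n) z - s z) + N1 s"
        using N1_triangle[OF H1Q_diff[OF H(2)[OF F] H(1)] H(1), of n] by simp
      ultimately show "norm (N1 (U (F n)) - N1 s) \<le> N1 (\<lambda>z. s z - U (F n) z)"
        using N1_minus_commute[OF H(1) H(2)[OF F], of n] by simp
    qed
    have Ts: "(\<lambda>n. S (F n)) \<longlonglongrightarrow> T"
    proof (rule tendsto_sandwich[where f = "\<lambda>n. T - 1 / real (Suc n)" and h = "\<lambda>_. T"])
      have "(\<lambda>n. T - inverse (real (Suc n))) \<longlonglongrightarrow> T - 0" by (intro tendsto_diff tendsto_const LIMSEQ_inverse_real_of_nat)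
      then show "(\<lambda>n. T - 1 / real (Suc n)) \<longlonglongrightarrow> T" by (simp add: inverse_eq_divide)
      show "\<forall>\<^sub>F n in sequentially. T - 1 / real (Suc n) \<le> S (F n)" "\<forall>\<^sub>F n in sequentially. S (F n) \<le> T"
        by (intro always_eventually allI less_imp_le[OF SF], intro always_eventually allI ST[OF F])
    qed simp
    have "A * T \<le> (N1 s)\<^sup>2"
      by (rule LIMSEQ_le[OF tendsto_mult[OF tendsto_const Ts] tendsto_power[OF Ns]]) (use lower[OF F] in \<open>auto simp: S_def U_def\<close>)
    moreover have "(N1 s)\<^sup>2 \<le> B * T"
      by (rule LIMSEQ_le[OF tendsto_power[OF Ns] tendsto_mult[OF tendsto_const Ts]]) (use upper[OF F] in \<open>auto simp: S_def U_def\<close>)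
    ultimately have "sqrt A * sqrt T \<le> N1 s" "N1 s \<le> sqrt B * sqrt T"
      unfolding real_sqrt_mult[symmetric] by (auto intro: real_le_lsqrt real_le_rsqrt)
    then show ?thesis using s(1) net unfolding U_def T_def by blast
  qed
  show ?thesis unfolding riesz_basis_def
  proof (intro conjI)
    show "\<exists>c>0. \<exists>C>0. \<forall>b. (\<lambda>l. (b l)\<^sup>2) summable_on J \<longrightarrow>
        (\<exists>s\<in>H10. ((\<lambda>F. N1 (\<lambda>x. s x - (\<Sum>l\<in>F. b l * l x))) \<longlongrightarrow> 0) (finite_subsets_at_top J) \<and>
               c * sqrt (\<Sum>\<^sub>\<infinity>l\<in>J. (b l)\<^sup>2) \<le> N1 s \<and> N1 s \<le> C * sqrt (\<Sum>\<^sub>\<infinity>l\<in>J. (b l)\<^sup>2))"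
    proof (intro exI conjI allI impI)
      show "sqrt A > 0" "sqrt B > 0" using AB by auto
    qed (rule main)
  qed (use J dense in auto)
qed

section \<open>Normalization in the seminorm\<close>

definition normalized :: "wavelet_index \<Rightarrow> real \<times> real \<Rightarrow> real" where
  "normalized t = (\<lambda>z. wavelet t z / S1 (wavelet t))"

definition scale :: "wavelet_index \<Rightarrow> real" where
  "scale t = weight t / S1 (wavelet t)"

lemma weight_pos: "weight t > 0"
  by (simp add: weight_def level_weight_pos)

lemma wavelet_S1_bounds:
  assumes t: "t \<in> index_set"
  shows "S1 (wavelet t) > 0" "(weight t)\<^sup>2 \<le> 300 * 10 ^ 9 * (S1 (wavelet t))\<^sup>2" "(S1 (wavelet t))\<^sup>2 \<le> 60 * 10 ^ 6 * (weight t)\<^sup>2"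
proof -
  have b: "(weight t)\<^sup>2 \<le> 300 * 10 ^ 9 * (S1 (wavelet t))\<^sup>2" "(N1 (wavelet t))\<^sup>2 \<le> 60 * 10 ^ 6 * (weight t)\<^sup>2"
    using uwavelet_sum_bounds(2,3)[of "{t}" weight] t by (simp_all add: wavelet_uwavelet)
  have s0: "S1 (wavelet t) \<ge> 0" by (simp add: H1_seminorm_def)
  have "(weight t)\<^sup>2 > 0" using weight_pos[of t] by simp
  then have "S1 (wavelet t) \<noteq> 0" using b(1) by auto
  then show "S1 (wavelet t) > 0" using s0 by simp
  show "(weight t)\<^sup>2 \<le> 300 * 10 ^ 9 * (S1 (wavelet t))\<^sup>2" by (rule b(1))
  have "(S1 (wavelet t))\<^sup>2 \<le> (N1 (wavelet t))\<^sup>2" using S1_le_N1 s0 by (intro power_mono)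
  then show "(S1 (wavelet t))\<^sup>2 \<le> 60 * 10 ^ 6 * (weight t)\<^sup>2" using b(2) by (rule order_trans)
qed

lemma scale_bounds:
  assumes t: "t \<in> index_set"
  shows "scale t > 0" "(scale t)\<^sup>2 \<le> 300 * 10 ^ 9" "1 \<le> 60 * 10 ^ 6 * (scale t)\<^sup>2"
proof -
  note b = wavelet_S1_bounds[OF t]
  have p: "(S1 (wavelet t))\<^sup>2 > 0" using b(1) by simp
  show "scale t > 0" using weight_pos b(1) by (simp add: scale_def)
  show "(scale t)\<^sup>2 \<le> 300 * 10 ^ 9" using b(2) p by (simp add: scale_def power_divide divide_le_eq)
  show "1 \<le> 60 * 10 ^ 6 * (scale t)\<^sup>2" using b(3) p by (simp add: scale_def power_divide le_divide_eq)
qed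

lemma normalized_scale: "t \<in> index_set \<Longrightarrow> normalized t = (\<lambda>z. scale t * uwavelet t z)"
  by (simp add: normalized_def scale_def wavelet_uwavelet)

lemma normalized_sum_bounds:
  fixes b :: "wavelet_index \<Rightarrow> real"
  assumes F: "finite F" "F \<subseteq> index_set"
  defines "u \<equiv> \<lambda>z. \<Sum>t\<in>F. b t * normalized t z"
  shows "u \<in> H10" "(\<Sum>t\<in>F. (b t)\<^sup>2) \<le> 60 * 10 ^ 6 * (300 * 10 ^ 9) * (N1 u)\<^sup>2"
    "(N1 u)\<^sup>2 \<le> 60 * 10 ^ 6 * (300 * 10 ^ 9) * (\<Sum>t\<in>F. (b t)\<^sup>2)"
proof -
  have u: "u = (\<lambda>z. \<Sum>t\<in>F. (b t * scale t) * uwavelet t z)"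
    unfolding u_def using F(2) by (intro ext sum.cong refl) (auto simp: normalized_scale)
  note B = uwavelet_sum_bounds[OF F, of "\<lambda>t. b t * scale t", folded u]
  show "u \<in> H10" by (rule B(1))
  have "(\<Sum>t\<in>F. (b t)\<^sup>2) \<le> 60 * 10 ^ 6 * (\<Sum>t\<in>F. (b t * scale t)\<^sup>2)"
    unfolding sum_distrib_left
  proof (intro sum_mono)
    fix t assume "t \<in> F"
    then show "(b t)\<^sup>2 \<le> 60 * 10 ^ 6 * (b t * scale t)\<^sup>2"
      using mult_left_mono[OF scale_bounds(3), of t "(b t)\<^sup>2"] F(2) by (auto simp: power_mult_distrib algebra_simps)
  qed
  also have "\<dots> \<le> 60 * 10 ^ 6 * (300 * 10 ^ 9 * (S1 u)\<^sup>2)" using B(2) by (intro mult_left_mono) auto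
  also have "\<dots> \<le> 60 * 10 ^ 6 * (300 * 10 ^ 9 * (N1 u)\<^sup>2)"
    using S1_le_N1[of u] by (intro mult_left_mono power_mono) (auto simp: H1_seminorm_def)
  finally show "(\<Sum>t\<in>F. (b t)\<^sup>2) \<le> 60 * 10 ^ 6 * (300 * 10 ^ 9) * (N1 u)\<^sup>2" by (simp only: mult.assoc)
  have "(\<Sum>t\<in>F. (b t * scale t)\<^sup>2) \<le> 300 * 10 ^ 9 * (\<Sum>t\<in>F. (b t)\<^sup>2)"
    unfolding sum_distrib_left
  proof (intro sum_mono)
    fix t assume "t \<in> F"
    then show "(b t * scale t)\<^sup>2 \<le> 300 * 10 ^ 9 * (b t)\<^sup>2"
      using mult_left_mono[OF scale_bounds(2), of t "(b t)\<^sup>2"] F(2) by (auto simp: power_mult_distrib algebra_simps)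
  qed
  then have "60 * 10 ^ 6 * (\<Sum>t\<in>F. (b t * scale t)\<^sup>2) \<le> 60 * 10 ^ 6 * (300 * 10 ^ 9 * (\<Sum>t\<in>F. (b t)\<^sup>2))"
    by (intro mult_left_mono) auto
  then show "(N1 u)\<^sup>2 \<le> 60 * 10 ^ 6 * (300 * 10 ^ 9) * (\<Sum>t\<in>F. (b t)\<^sup>2)"
    using B(3) by (simp only: mult.assoc)
qed

text \<open>The family of the theorem is a set of functions indexed by itself, so sums over
  \<open>index_set\<close> can be transported to it only if no function occurs twice. Two equal
  functions with coefficients 1 and -1 would contradict the lower bound.\<close>

lemma normalized_inj: "inj_on normalized index_set"
proof (rule inj_onI, rule ccontr)
  fix t t' assume t: "t \<in> index_set" "t' \<in> index_set" "normalized t = normalized t'" "t \<noteq> t'"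
  define b where "b i = (if i = t then 1 else - 1 :: real)" for i
  have "(\<lambda>z. \<Sum>i\<in>{t, t'}. b i * normalized i z) = (\<lambda>z. 0)" using t(3,4) by (simp add: b_def)
  then have "(\<Sum>i\<in>{t, t'}. (b i)\<^sup>2) \<le> 60 * 10 ^ 6 * (300 * 10 ^ 9) * (N1 (\<lambda>z. 0))\<^sup>2"
    using normalized_sum_bounds(2)[of "{t, t'}" b] t(1,2) by simp
  moreover have "N1 (\<lambda>z. 0) = 0" using N1_cmult[OF test_function_H1Q[OF zero_test_function], of 0] by simp
  ultimately show False using t(4) by (simp add: b_def)
qed

theorem theorem13:
  shows "riesz_basis (H1_0 unit_square) (H1_norm unit_square)
           {\<lambda>x. g x / H1_seminorm unit_square g |g. g \<in> Psi_2D} (\<lambda>f. f)"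
proof -
  have eq: "{\<lambda>x. g x / S1 g |g. g \<in> Psi_2D} = normalized ` index_set"
    unfolding Psi_2D_image normalized_def by auto
  let ?C = "60 * 10 ^ 6 * (300 * 10 ^ 9) :: real"
  have sub: "\<exists>G. finite G \<and> G \<subseteq> index_set \<and> F = normalized ` G" if "finite F" "F \<subseteq> normalized ` index_set" for F
    using that by (metis finite_subset_image)
  have reindex: "(\<Sum>f\<in>normalized ` G. h f) = (\<Sum>t\<in>G. h (normalized t))" if "G \<subseteq> index_set" for G and h :: "_ \<Rightarrow> real"
    using inj_on_subset[OF normalized_inj that] by (simp add: sum.reindex)
  show ?thesis unfolding eq
  proof (rule riesz_basisI)
    show "countable (normalized ` index_set)" by simp
    show "normalized ` index_set \<subseteq> H10"
    proof
      fix f assume "f \<in> normalized ` index_set"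
      then obtain t where "t \<in> index_set" "f = normalized t" by blast
      then show "f \<in> H10" using normalized_sum_bounds(1)[of "{t}" "\<lambda>_. 1"] by simp
    qed
    show "1 / ?C > 0" "?C > 0" by simp_all
  next
    fix h and e :: real assume "h \<in> H10" "e > 0"
    then obtain J Y where Y: "2 \<le> J" "oddper2 (2 ^ J) (2 ^ J) Y" "N1 (\<lambda>z. h z - spline2 (2 ^ J) Y z) < e"
      using spline2_dense by blast
    obtain g where g: "\<forall>z\<in>unit_square. spline2 (2 ^ J) Y z = (\<Sum>t\<in>index_below J. g t * uwavelet t z)"
      using spline_wavelet_sum[OF Y(1,2)] ..
    \<comment> \<open>The coefficient of a normalized function is that of its index, freed from the
      factor by which it differs from \<open>uwavelet\<close>.\<close>
    define a where "a f = (let t = inv_into index_set normalized f in g t / scale t)" for f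
    have "spline2 (2 ^ J) Y z = (\<Sum>f\<in>normalized ` index_below J. a f * f z)" if "z \<in> unit_square" for z
    proof -
      have "a (normalized t) * normalized t z = g t * uwavelet t z" if "t \<in> index_below J" for t
      proof -
        have t: "t \<in> index_set" using that index_below_subset by blast
        have "a (normalized t) = g t / scale t"
          unfolding a_def inv_into_f_f[OF normalized_inj t] Let_def ..
        then show ?thesis using scale_bounds(1)[OF t] by (simp add: normalized_scale[OF t])
      qed
      then show ?thesis unfolding reindex[OF index_below_subset] using g that by simp
    qed
    then have "N1 (\<lambda>z. h z - (\<Sum>f\<in>normalized ` index_below J. a f * f z)) = N1 (\<lambda>z. h z - spline2 (2 ^ J) Y z)"
      by (intro N1_cong) simp
    then show "\<exists>F a. finite F \<and> F \<subseteq> normalized ` index_set \<and> N1 (\<lambda>z. h z - (\<Sum>f\<in>F. a f * f z)) < e"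
      using Y(3) index_below_subset
      by (intro exI[of _ "normalized ` index_below J"] exI[of _ a]) (simp add: image_mono)
  next
    fix F and b :: "(real \<times> real \<Rightarrow> real) \<Rightarrow> real"
    assume "finite F" "F \<subseteq> normalized ` index_set"
    then obtain G where G: "finite G" "G \<subseteq> index_set" "F = normalized ` G" using sub by blast
    show "1 / ?C * (\<Sum>f\<in>F. (b f)\<^sup>2) \<le> (N1 (\<lambda>z. \<Sum>f\<in>F. b f * f z))\<^sup>2"
      using normalized_sum_bounds(2)[OF G(1,2), of "\<lambda>t. b (normalized t)"] unfolding G(3) reindex[OF G(2)]
      by (simp add: field_simps)
    show "(N1 (\<lambda>z. \<Sum>f\<in>F. b f * f z))\<^sup>2 \<le> ?C * (\<Sum>f\<in>F. (b f)\<^sup>2)"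
      using normalized_sum_bounds(3)[OF G(1,2), of "\<lambda>t. b (normalized t)"] unfolding G(3) reindex[OF G(2)] .
  qed
qed

end
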